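(* For every $k\ge 1$ and every $\lambda\in\mathrm{Par}^k$, the $k$-Schur Katalan function equals the $K$-$k$-Schur function: $\mathfrak{g}_\lambda^{(k)}=g_\lambda^{(k)}$. In particular the $\mathfrak{g}_\lambda^{(k)}$ represent the Schubert basis of the $K$-homology of the affine Grassmannian of $SL_{k+1}$.
   Context: Let $\Lambda=\mathbb Z[h_1,h_2,\dots]$ be the ring of symmetric functions, with $h_d$ the complete homogeneous symmetric functions, $h_0=1$, $h_d=0$ for $d<0$. For $m,r\in\mathbb Z$ set $k_m^{(r)}=\sum_{i=0}^m\binom{r+i-1}{i}h_{m-i}$, where $\binom{n}{0}=1$ and $\binom{n}{i}=n(n-1)\cdots(n-i+1)/i!$ for $n\in\mathbb Z,i\ge 1$ (so $k^{(r)}_m=0$ for $m<0$). For $\gamma\in\mathbb Z^\ell$ let $g_\gamma=\det(k^{(i-1)}_{\gamma_i+j-i})_{1\le i,j\le \ell}$ (for $\gamma$ a partition, the dual stable Grothendieck polynomial). Let $\Delta^+_\ell=\{(i,j):1\le i<j\le \ell\}$ with order $(a,b)\le(c,d)$ iff $a\ge c$ and $b\le d$; a root ideal is an upper order ideal of $\Delta^+_\ell$. Let $\mathbb A=\mathbb Z[[z_1/z_2,\dots,z_{\ell-1}/z_\ell]][z_1^{\pm1},\dots,z_\ell^{\pm1}]$ and let $g:\mathbb A\to\Lambda$ be the additive map $\sum_\gamma c_\gamma \mathbf z^\gamma\mapsto\sum_\gamma c_\gamma g_\gamma$ (the sums arising below have finitely many nonzero terms). For a root ideal $\Psi\subset\Delta^+_\ell$,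 a multiset $M$ with support in $[\ell]$ and $\gamma\in\mathbb Z^\ell$, the Katalan function is $K(\Psi;M;\gamma)=g\big(\prod_{(i,j)\in\Psi}(1-z_i/z_j)^{-1}\prod_{j\in M}(1-1/z_j)\,\mathbf z^\gamma\big)$ (product over $M$ with multiplicity). For a root ideal $\mathcal L$ let $L(\mathcal L)$ be the multiset $\bigsqcup_{(i,j)\in\mathcal L}\{j\}$ and write $K(\Psi;\mathcal L;\gamma)=K(\Psi;L(\mathcal L);\gamma)$. Fix $k\ge1$. Let $\mathrm{Par}^k_\ell=\{\mu\in\mathbb Z^\ell: k\ge\mu_1\ge\cdots\ge\mu_\ell\ge0\}$, $\mathrm{Par}^k$ the partitions with first part $\le k$, and $\Lambda_{(k)}=\mathbb Z[h_1,\dots,h_k]$. For $\mu\in\mathrm{Par}^k_\ell$ (and any $m$) set $\Delta^m(\mu)=\{(i,j)\in\Delta^+_\ell: m-\mu_i+i<j\}$. The $k$-Schur Katalan function is $\mathfrak g^{(k)}_\lambda=K(\Delta^k(\lambda);\Delta^{k+1}(\lambda);\lambda)$ for $\lambda\in\mathrm{Par}^k_\ell$. The affine symmetric group $\tilde S_{k+1}$ is generated by $s_0,\dots,s_k$ (indices mod $k+1$) with relations $s_i^2=1$, $s_is_{i+1}s_i=s_{i+1}s_is_{i+1}$, $s_is_j=s_js_i$ for $i-j\not\equiv0,\pm1$; $\ell(w)$ denotes length. $\tilde S^0_{k+1}$ is the set of minimal length representatives of the cosets $wS_{k+1}$, $S_{k+1}=\langle s_1,\dots,s_k\rangle$. For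 $\lambda\in\mathrm{Par}^k$ with $\ell$ nonzero parts, $w_\lambda=(s_{\lambda_\ell-\ell}\cdots s_{-\ell+1})\cdots(s_{\lambda_2-2}\cdots s_{-1})(s_{\lambda_1-1}\cdots s_0)$, the $r$-th factor being $s_{\lambda_r-r}s_{\lambda_r-r-1}\cdots s_{-r+1}$ (indices mod $k+1$); $\lambda\mapsto w_\lambda$ is a bijection $\mathrm{Par}^k\to\tilde S^0_{k+1}$, with inverse denoted $\mathfrak w^{-1}$. The 0-Hecke algebra $H_{k+1}$ is the $\mathbb Z$-algebra generated by $T_0,\dots,T_k$ with the braid and commutation relations of $\tilde S_{k+1}$ and $T_i^2=-T_i$; it has basis $T_w=T_{i_1}\cdots T_{i_m}$ for reduced words $w=s_{i_1}\cdots s_{i_m}$. An element $w$ is cyclically increasing if $w=s_{i_1}\cdots s_{i_m}$ with distinct indices such that no index $i$ occurs to the right of $i+1$ (mod $k+1$). The $K$-$k$-Schur functions $\{g^{(k)}_\lambda\}_{\lambda\in\mathrm{Par}^k}$ (Lam–Schilling–Shimozono; the images of the $K$-homology Schubert basis of the affine Grassmannian of $SL_{k+1}$ under a Hopf algebra isomorphism onto $\Lambda_{(k)}$) are the unique elements of $\Lambda_{(k)}$ such that for all $r\in[k]$ and $\lambda\in\mathrm{Par}^k$: $g_{1^r}g^{(k)}_\lambda=\sum (-1)^{\ell(w_\lambda)+r-\ell(w)}g^{(k)}_{\mathfrak w^{-1}(w)}$, summed over cyclically increasing $u\in\tilde S_{k+1}$ with $\ell(u)=r$ and $T_uT_{w_\lambda}=\pm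 T_w$ for some $w\in\tilde S^0_{k+1}$.
   Formalization: The K-k-Schur functions are fixed by the Pieri rule plus the value 1 at the empty partition (0 also solves the rule); for k=1 the braid relation is dropped (infinite dihedral group); the Schubert-basis sentence is given algebraically, as the Pieri rule and a Z-basis of Λ_(k). *)

theory Defs
  imports
    "HOL-Library.Poly_Mapping"
    "HOL-Library.Multiset"
    "HOL-Library.FuncSet"
    "Jordan_Normal_Form.Determinant"
begin

section \<open>Symmetric functions and dual stable Grothendieck polynomials\<close>

text \<open>The polynomial ring in countably many variables; the variable with index \<open>n\<close> is
  \<open>h\<close> with subscript \<open>n + 1\<close>.\<close>

type_synonym symf = "(nat \<Rightarrow>\<^sub>0 nat) \<Rightarrow>\<^sub>0 int"

definition h :: "int \<Rightarrow> symf" where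
  "h d = (if d < 0 then 0 else if d = 0 then 1
          else Poly_Mapping.single (Poly_Mapping.single (nat d - 1) 1) 1)"

text \<open>The subring of polynomials in \<open>h 1, \<dots>, h k\<close>.\<close>

definition Lambda_sub :: "nat \<Rightarrow> symf set" where
  "Lambda_sub k = {f. \<forall>m \<in> Poly_Mapping.keys f. Poly_Mapping.keys m \<subseteq> {..<k}}"

text \<open>The division is exact.\<close>

definition ibinom :: "int \<Rightarrow> nat \<Rightarrow> int" where
  "ibinom n i = (\<Prod>t<i. n - int t) div fact i"

definition kh :: "int \<Rightarrow> int \<Rightarrow> symf" where
  "kh r m = (if m < 0 then 0
             else \<Sum>i\<le>nat m. of_int (ibinom (r + int i - 1) i) * h (m - int i))"

text \<open>Vectors in \<open>\<int>\<close> to the power \<open>\<ell>\<close> are finitely supported functions whose support lies in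
  \<open>{1..\<ell>}\<close>; a partition is thereby identified with all its extensions by zeros.\<close>

type_synonym zvec = "nat \<Rightarrow>\<^sub>0 int"

definition zvecs :: "nat \<Rightarrow> zvec set" where
  "zvecs l = {\<gamma>. Poly_Mapping.keys \<gamma> \<subseteq> {1..l}}"

text \<open>The library matrices are indexed from 0, so entry \<open>(i, j)\<close> below is the
  usual entry \<open>(i + 1, j + 1)\<close>.\<close>

definition g_fun :: "nat \<Rightarrow> zvec \<Rightarrow> symf" where
  "g_fun l \<gamma> = det (mat l l (\<lambda>(i, j).
     kh (int i) (Poly_Mapping.lookup \<gamma> (Suc i) + int j - int i)))"

definition ones :: "nat \<Rightarrow> zvec" where
  "ones r = (\<Sum>i = 1..r. Poly_Mapping.single i 1)"

section \<open>The ring of Laurent-type series\<close>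

text \<open>Nonnegative combinations of the simple roots \<open>\<epsilon> i - \<epsilon> (i + 1)\<close>, \<open>1 \<le> i < \<ell>\<close>, i.e. the
  exponents of the monomials occurring in power series in \<open>z 1 / z 2, \<dots>, z (\<ell> - 1) / z \<ell>\<close>.\<close>

definition root_comb :: "nat \<Rightarrow> (nat \<Rightarrow> nat) \<Rightarrow> zvec" where
  "root_comb l n = (\<Sum>i = 1..<l. Poly_Mapping.single i (int (n i)) -
                              Poly_Mapping.single (Suc i) (int (n i)))"

definition Qplus :: "nat \<Rightarrow> zvec set" where
  "Qplus l = range (root_comb l)"

lemma lookup_root_comb:
  "Poly_Mapping.lookup (root_comb l n) m =
     (if 1 \<le> m \<and> m < l then int (n m) else 0) - (if 2 \<le> m \<and> m \<le> l then int (n (m - 1)) else 0)"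
proof -
  have "Poly_Mapping.lookup (root_comb l n) m =
      (\<Sum>i = 1..<l. (if i = m then int (n i) else 0)) -
      (\<Sum>i = 1..<l. (if Suc i = m then int (n i) else 0))"
    by (simp add: root_comb_def lookup_sum lookup_minus lookup_single sum_subtractf when_def)
  also have "(\<Sum>i = 1..<l. (if i = m then int (n i) else 0)) =
      (if 1 \<le> m \<and> m < l then int (n m) else 0)"
    by simp
  also have "(\<Sum>i = 1..<l. (if Suc i = m then int (n i) else 0)) =
      (if 2 \<le> m \<and> m \<le> l then int (n (m - 1)) else 0)"
  proof (cases m)
    case (Suc m')
    have "(\<Sum>i = 1..<l. (if Suc i = m then int (n i) else 0)) =
        (\<Sum>i = 1..<l. (if i = m' then int (n i) else 0))"
      by (simp add: Suc)
    then show ?thesis by (auto simp: Suc)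
  qed auto
  finally show ?thesis .
qed

lemma root_comb_add: "root_comb l n + root_comb l n' = root_comb l (\<lambda>i. n i + n' i)"
  by (rule poly_mapping_eqI) (auto simp: lookup_add lookup_root_comb)

lemma Qplus_add: "p \<in> Qplus l \<Longrightarrow> q \<in> Qplus l \<Longrightarrow> p + q \<in> Qplus l"
  by (auto simp: Qplus_def root_comb_add)

lemma Qplus_0: "0 \<in> Qplus l"
proof -
  have "root_comb l (\<lambda>_. 0) = 0"
    by (simp add: root_comb_def)
  then show ?thesis unfolding Qplus_def by (metis rangeI)
qed

lemma Qplus_mono:
  assumes "l \<le> l'" shows "Qplus l \<subseteq> Qplus l'"
proof
  fix q assume "q \<in> Qplus l"
  then obtain n where q: "q = root_comb l n" by (auto simp: Qplus_def)
  have "q = root_comb l' (\<lambda>i. if i < l then n i else 0)"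
    unfolding q using assms by (intro poly_mapping_eqI) (auto simp: lookup_root_comb)
  then show "q \<in> Qplus l'" by (auto simp: Qplus_def)
qed

lemma psum_root_comb:
  "1 \<le> m \<Longrightarrow> m < l \<Longrightarrow> (\<Sum>i = 1..m. Poly_Mapping.lookup (root_comb l n) i) = int (n m)"
proof (induction m)
  case (Suc m)
  then show ?case by (cases "m = 0") (auto simp: lookup_root_comb)
qed simp

lemma root_comb_restrict: "root_comb l n = root_comb l (restrict n {1..<l})"
  by (simp add: root_comb_def)

lemma finite_Qplus_bounded:
  "finite {q \<in> Qplus l. \<exists>n. q = root_comb l n \<and> (\<forall>m \<in> {1..<l}. n m \<le> (b m :: nat))}" (is "finite ?X")
proof (rule finite_subset)
  show "?X \<subseteq> root_comb l ` (\<Pi>\<^sub>E m \<in> {1..<l}. {..b m})"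
  proof safe
    fix n assume "\<forall>m \<in> {1..<l}. n m \<le> b m"
    then show "root_comb l n \<in> root_comb l ` (\<Pi>\<^sub>E m \<in> {1..<l}. {..b m})"
      by (subst root_comb_restrict) (rule imageI, auto)
  qed
  show "finite (root_comb l ` (\<Pi>\<^sub>E m \<in> {1..<l}. {..b m}))"
    by (intro finite_imageI finite_PiE) auto
qed

lemma finite_Qplus_split: "finite {q \<in> Qplus l. \<beta> - q \<in> Qplus l}"
proof (rule finite_subset[OF _ finite_Qplus_bounded])
  show "{q \<in> Qplus l. \<beta> - q \<in> Qplus l} \<subseteq> {q \<in> Qplus l. \<exists>n. q = root_comb l n \<and>
      (\<forall>m \<in> {1..<l}. n m \<le> nat (\<Sum>i = 1..m. Poly_Mapping.lookup \<beta> i))}"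
  proof safe
    fix q assume "q \<in> Qplus l" "\<beta> - q \<in> Qplus l"
    then obtain n n' where n: "q = root_comb l n" "\<beta> - q = root_comb l n'"
      by (auto simp: Qplus_def)
    then have \<beta>: "\<beta> = root_comb l (\<lambda>i. n i + n' i)"
      by (metis add.commute diff_add_cancel root_comb_add)
    show "\<exists>n. q = root_comb l n \<and>
        (\<forall>m \<in> {1..<l}. n m \<le> nat (\<Sum>i = 1..m. Poly_Mapping.lookup \<beta> i))"
    proof (intro exI[of _ n] conjI ballI)
      fix m assume "m \<in> {1..<l}"
      then have "(\<Sum>i = 1..m. Poly_Mapping.lookup \<beta> i) = int (n m + n' m)"
        unfolding \<beta> by (intro psum_root_comb) auto
      then show "n m \<le> nat (\<Sum>i = 1..m. Poly_Mapping.lookup \<beta> i)" by simp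
    qed (rule n(1))
  qed
qed

definition cone_supported :: "nat \<Rightarrow> (zvec \<Rightarrow> int) \<Rightarrow> bool" where
  "cone_supported l f \<longleftrightarrow> (\<exists>S. finite S \<and>
     (\<forall>\<beta>. f \<beta> \<noteq> 0 \<longrightarrow> (\<exists>\<gamma> \<in> S. \<beta> - \<gamma> \<in> Qplus l)))"

lemma cone_supported_mono: "cone_supported l f \<Longrightarrow> l \<le> l' \<Longrightarrow> cone_supported l' f"
  unfolding cone_supported_def by (meson Qplus_mono subset_iff)

lemma cone_supported_pair:
  assumes "\<exists>l. cone_supported l f" "\<exists>l. cone_supported l f'"
  obtains l where "cone_supported l f" "cone_supported l f'"
  using assms cone_supported_mono by (metis nat_le_linear)

lemma cone_supported_zero: "cone_supported l (\<lambda>_. 0)"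
  by (auto simp: cone_supported_def)

lemma cone_supported_combine:
  assumes "cone_supported l f" "cone_supported l f'"
    and "\<And>\<beta>. F \<beta> \<noteq> 0 \<Longrightarrow> f \<beta> \<noteq> 0 \<or> f' \<beta> \<noteq> 0"
  shows "cone_supported l F"
proof -
  obtain S S' where S: "finite S" "\<And>\<beta>. f \<beta> \<noteq> 0 \<Longrightarrow> \<exists>\<gamma> \<in> S. \<beta> - \<gamma> \<in> Qplus l"
    "finite S'" "\<And>\<beta>. f' \<beta> \<noteq> 0 \<Longrightarrow> \<exists>\<gamma> \<in> S'. \<beta> - \<gamma> \<in> Qplus l"
    using assms(1,2) unfolding cone_supported_def by meson
  then show ?thesis unfolding cone_supported_def
    by (intro exI[of _ "S \<union> S'"]) (use assms(3) in \<open>auto; blast\<close>)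
qed

definition conv :: "(zvec \<Rightarrow> int) \<Rightarrow> (zvec \<Rightarrow> int) \<Rightarrow> zvec \<Rightarrow> int" where
  "conv f f' \<beta> = (\<Sum>\<alpha> \<in> {\<alpha>. f \<alpha> \<noteq> 0 \<and> f' (\<beta> - \<alpha>) \<noteq> 0}. f \<alpha> * f' (\<beta> - \<alpha>))"

lemma finite_conv:
  assumes "cone_supported l f" "cone_supported l f'"
  shows "finite {\<alpha>. f \<alpha> \<noteq> 0 \<and> f' (\<beta> - \<alpha>) \<noteq> 0}"
proof -
  obtain S S' where S: "finite S" "\<And>\<beta>. f \<beta> \<noteq> 0 \<Longrightarrow> \<exists>\<gamma> \<in> S. \<beta> - \<gamma> \<in> Qplus l"
    "finite S'" "\<And>\<beta>. f' \<beta> \<noteq> 0 \<Longrightarrow> \<exists>\<gamma> \<in> S'. \<beta> - \<gamma> \<in> Qplus l"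
    using assms unfolding cone_supported_def by meson
  have "{\<alpha>. f \<alpha> \<noteq> 0 \<and> f' (\<beta> - \<alpha>) \<noteq> 0} \<subseteq>
      (\<Union>\<gamma> \<in> S. \<Union>\<gamma>' \<in> S'. (+) \<gamma> ` {q \<in> Qplus l. \<beta> - \<gamma> - \<gamma>' - q \<in> Qplus l})"
  proof safe
    fix \<alpha> assume "f \<alpha> \<noteq> 0" "f' (\<beta> - \<alpha>) \<noteq> 0"
    then obtain \<gamma> \<gamma>' where *: "\<gamma> \<in> S" "\<gamma>' \<in> S'" "\<alpha> - \<gamma> \<in> Qplus l" "\<beta> - \<alpha> - \<gamma>' \<in> Qplus l"
      using S by blast
    have "\<alpha> = \<gamma> + (\<alpha> - \<gamma>)" "\<beta> - \<gamma> - \<gamma>' - (\<alpha> - \<gamma>) = \<beta> - \<alpha> - \<gamma>'" by (auto simp: algebra_simps)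
    then have "\<alpha> \<in> (+) \<gamma> ` {q \<in> Qplus l. \<beta> - \<gamma> - \<gamma>' - q \<in> Qplus l}"
      using * by (metis (mono_tags, lifting) image_eqI mem_Collect_eq)
    with * show "\<alpha> \<in> (\<Union>\<gamma> \<in> S. \<Union>\<gamma>' \<in> S'. (+) \<gamma> ` {q \<in> Qplus l. \<beta> - \<gamma> - \<gamma>' - q \<in> Qplus l})"
      by blast
  qed
  then show ?thesis
    by (rule finite_subset) (use S in \<open>auto intro!: finite_imageI finite_Qplus_split\<close>)
qed

lemma conv_nonzero:
  assumes "conv f f' \<beta> \<noteq> 0" obtains \<alpha> where "f \<alpha> \<noteq> 0" "f' (\<beta> - \<alpha>) \<noteq> 0"
proof -
  have "{\<alpha>. f \<alpha> \<noteq> 0 \<and> f' (\<beta> - \<alpha>) \<noteq> 0} \<noteq> {}"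
    using assms unfolding conv_def by (metis sum.empty)
  then show ?thesis using that by blast
qed

lemma cone_supported_conv:
  assumes "cone_supported l f" "cone_supported l f'"
  shows "cone_supported l (conv f f')"
proof -
  obtain S S' where S: "finite S" "\<And>\<beta>. f \<beta> \<noteq> 0 \<Longrightarrow> \<exists>\<gamma> \<in> S. \<beta> - \<gamma> \<in> Qplus l"
    "finite S'" "\<And>\<beta>. f' \<beta> \<noteq> 0 \<Longrightarrow> \<exists>\<gamma> \<in> S'. \<beta> - \<gamma> \<in> Qplus l"
    using assms(1,2) unfolding cone_supported_def by meson
  let ?S = "(\<lambda>(a, b). a + b) ` (S \<times> S')"
  have "finite ?S" using S by auto
  moreover have "\<exists>\<gamma> \<in> ?S. \<beta> - \<gamma> \<in> Qplus l" if nz: "conv f f' \<beta> \<noteq> 0" for \<beta>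
  proof -
    obtain \<alpha> where "f \<alpha> \<noteq> 0" "f' (\<beta> - \<alpha>) \<noteq> 0" using nz by (rule conv_nonzero)
    then obtain \<gamma> \<gamma>' where *: "\<gamma> \<in> S" "\<gamma>' \<in> S'" "\<alpha> - \<gamma> \<in> Qplus l" "\<beta> - \<alpha> - \<gamma>' \<in> Qplus l"
      using S by blast
    have "\<beta> - (\<gamma> + \<gamma>') = (\<alpha> - \<gamma>) + (\<beta> - \<alpha> - \<gamma>')" by (simp add: algebra_simps)
    then have "\<beta> - (\<gamma> + \<gamma>') \<in> Qplus l" using * Qplus_add by presburger
    with * show ?thesis by (intro bexI[of _ "\<gamma> + \<gamma>'"]) auto
  qed
  ultimately show ?thesis unfolding cone_supported_def by blast
qed

lemma conv_superset:
  assumes "finite X" "{\<alpha>. f \<alpha> \<noteq> 0 \<and> f' (\<beta> - \<alpha>) \<noteq> 0} \<subseteq> X"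
  shows "conv f f' \<beta> = (\<Sum>\<alpha> \<in> X. f \<alpha> * f' (\<beta> - \<alpha>))"
  unfolding conv_def using assms by (intro sum.mono_neutral_left) auto

lemma conv_commute: "conv f f' \<beta> = conv f' f \<beta>"
  unfolding conv_def
  by (rule sum.reindex_bij_witness[of _ "\<lambda>\<alpha>. \<beta> - \<alpha>" "\<lambda>\<alpha>. \<beta> - \<alpha>"]) auto

lemma conv_assoc:
  assumes "cone_supported l a" "cone_supported l b" "cone_supported l c"
  shows "conv (conv a b) c \<beta> = conv a (conv b c) \<beta>"
proof -
  define F where "F = {(x, y). a x \<noteq> 0 \<and> b y \<noteq> 0 \<and> c (\<beta> - x - y) \<noteq> 0}"
  note ab = cone_supported_conv[of l "\<lambda>x. \<bar>a x\<bar>" "\<lambda>x. \<bar>b x\<bar>"]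
  have absc: "cone_supported l (\<lambda>x. \<bar>f x\<bar>)" if "cone_supported l f" for f
    using that by (auto simp: cone_supported_def)
  let ?A = "\<lambda>x. \<bar>a x\<bar>" and ?B = "\<lambda>x. \<bar>b x\<bar>"
  have pos: "conv ?A ?B (x + y) \<noteq> 0" if "a x \<noteq> 0" "b y \<noteq> 0" for x y
  proof -
    have fin: "finite {\<alpha>. ?A \<alpha> \<noteq> 0 \<and> ?B (x + y - \<alpha>) \<noteq> 0}"
      by (rule finite_conv[OF absc absc]) (use assms in auto)
    have "0 < \<bar>a x\<bar> * \<bar>b (x + y - x)\<bar>" using that by simp
    also have "\<dots> \<le> conv ?A ?B (x + y)" unfolding conv_def
      by (rule member_le_sum[OF _ _ fin]) (use that in auto)
    finally show ?thesis by simp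
  qed
  have finE: "finite {\<epsilon>. conv ?A ?B \<epsilon> \<noteq> 0 \<and> c (\<beta> - \<epsilon>) \<noteq> 0}" (is "finite ?E")
    by (rule finite_conv[OF cone_supported_conv[OF absc absc]]) (use assms in auto)
  have finX: "finite {x. a x \<noteq> 0 \<and> b (\<epsilon> - x) \<noteq> 0}" for \<epsilon>
    by (rule finite_conv[OF assms(1,2)])
  have finF: "finite F"
  proof (rule finite_subset)
    show "F \<subseteq> (\<lambda>(\<epsilon>, x). (x, \<epsilon> - x)) ` (SIGMA \<epsilon> : ?E. {x. a x \<noteq> 0 \<and> b (\<epsilon> - x) \<noteq> 0})"
    proof
      fix p assume "p \<in> F"
      then obtain x y where p: "p = (x, y)" "a x \<noteq> 0" "b y \<noteq> 0" "c (\<beta> - x - y) \<noteq> 0"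
        by (auto simp: F_def)
      have "\<beta> - x - y = \<beta> - (x + y)" by (simp add: algebra_simps)
      with p pos[OF p(2,3)]
      show "p \<in> (\<lambda>(\<epsilon>, x). (x, \<epsilon> - x)) ` (SIGMA \<epsilon> : ?E. {x. a x \<noteq> 0 \<and> b (\<epsilon> - x) \<noteq> 0})"
        by (intro image_eqI[of _ _ "(x + y, x)"]) auto
    qed
  qed (use finE finX in auto)
  have L: "conv (conv a b) c \<beta> = (\<Sum>(x, y) \<in> F. a x * b y * c (\<beta> - x - y))"
  proof -
    have "conv (conv a b) c \<beta> = (\<Sum>\<epsilon> \<in> ?E. conv a b \<epsilon> * c (\<beta> - \<epsilon>))"
    proof (rule conv_superset[OF finE], safe)
      fix \<epsilon> assume "conv a b \<epsilon> \<noteq> 0" "conv ?A ?B \<epsilon> = 0"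
      from \<open>conv a b \<epsilon> \<noteq> 0\<close> obtain x where "a x \<noteq> 0" "b (\<epsilon> - x) \<noteq> 0" by (rule conv_nonzero)
      with pos[of x "\<epsilon> - x"] \<open>conv ?A ?B \<epsilon> = 0\<close> show False by simp
    qed
    also have "\<dots> = (\<Sum>\<epsilon> \<in> ?E. \<Sum>x \<in> {x. a x \<noteq> 0 \<and> b (\<epsilon> - x) \<noteq> 0}.
        a x * b (\<epsilon> - x) * c (\<beta> - \<epsilon>))"
      by (simp add: conv_def sum_distrib_right)
    also have "\<dots> = (\<Sum>(\<epsilon>, x) \<in> (SIGMA \<epsilon> : ?E. {x. a x \<noteq> 0 \<and> b (\<epsilon> - x) \<noteq> 0}).
        a x * b (\<epsilon> - x) * c (\<beta> - \<epsilon>))"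
      by (rule sum.Sigma) (use finE finX in auto)
    also have "\<dots> = (\<Sum>(x, y) \<in> F. a x * b y * c (\<beta> - x - y))"
      by (rule sum.reindex_bij_witness[of _ "\<lambda>(x, y). (x + y, x)" "\<lambda>(\<epsilon>, x). (x, \<epsilon> - x)"])
        (auto simp: F_def pos diff_diff_eq)
    finally show ?thesis .
  qed
  have R: "conv a (conv b c) \<beta> = (\<Sum>(x, y) \<in> F. a x * b y * c (\<beta> - x - y))"
  proof -
    have finY: "finite {y. b y \<noteq> 0 \<and> c (\<beta> - x - y) \<noteq> 0}" for x
      by (rule finite_conv[OF assms(2,3)])
    have "conv a (conv b c) \<beta> = (\<Sum>x \<in> fst ` F. a x * conv b c (\<beta> - x))"
    proof (rule conv_superset, safe)
      fix x assume "a x \<noteq> 0" "conv b c (\<beta> - x) \<noteq> 0"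
      from \<open>conv b c (\<beta> - x) \<noteq> 0\<close> obtain y where "b y \<noteq> 0" "c (\<beta> - x - y) \<noteq> 0"
        by (rule conv_nonzero)
      with \<open>a x \<noteq> 0\<close> show "x \<in> fst ` F" by (auto simp: F_def image_iff)
    qed (use finF in auto)
    also have "\<dots> = (\<Sum>x \<in> fst ` F. \<Sum>y \<in> {y. b y \<noteq> 0 \<and> c (\<beta> - x - y) \<noteq> 0}.
        a x * b y * c (\<beta> - x - y))"
      by (simp add: conv_def sum_distrib_left mult.assoc)
    also have "\<dots> = (\<Sum>(x, y) \<in> (SIGMA x : fst ` F. {y. b y \<noteq> 0 \<and> c (\<beta> - x - y) \<noteq> 0}).
        a x * b y * c (\<beta> - x - y))"
      by (rule sum.Sigma) (use finF finY in auto)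
    also have "(SIGMA x : fst ` F. {y. b y \<noteq> 0 \<and> c (\<beta> - x - y) \<noteq> 0}) = F"
      by (force simp: F_def)
    finally show ?thesis .
  qed
  show ?thesis using L R by simp
qed

lemma conv_one: "conv (\<lambda>\<beta>. if \<beta> = 0 then 1 else 0) f \<beta> = f \<beta>"
  by (subst conv_superset[of "{0}"]) auto

text \<open>An ambient ring for all \<open>\<ell>\<close> at once. \<open>A_ring \<ell>\<close> below is the ring
  \<open>\<int>[[z 1 / z 2, \<dots>, z (\<ell> - 1) / z \<ell>]]\<close> with \<open>z 1, \<dots>, z \<ell>\<close> and their inverses adjoined: a finite
  sum of Laurent monomials times power series is a coefficient function supported in finitely
  many translates of \<open>Qplus \<ell>\<close>.\<close>

typedef zseries = "{f. \<exists>l. cone_supported l f}"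
  morphisms zcoeff Abs_zseries
  using cone_supported_zero by blast

setup_lifting type_definition_zseries

definition A_ring :: "nat \<Rightarrow> zseries set" where
  "A_ring l = {f. cone_supported l (zcoeff f) \<and> (\<forall>\<beta>. zcoeff f \<beta> \<noteq> 0 \<longrightarrow> \<beta> \<in> zvecs l)}"

instantiation zseries :: comm_ring_1
begin

lift_definition zero_zseries :: zseries is "\<lambda>_. 0"
  using cone_supported_zero by blast

lift_definition one_zseries :: zseries is "\<lambda>\<beta>. if \<beta> = 0 then 1 else 0"
proof -
  have "cone_supported 0 (\<lambda>\<beta>. if \<beta> = 0 then 1 else 0)"
    unfolding cone_supported_def by (intro exI[of _ "{0}"]) (auto simp: Qplus_0)
  then show "\<exists>l. cone_supported l (\<lambda>\<beta>. if \<beta> = 0 then 1 else 0)" by blast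
qed

lift_definition plus_zseries :: "zseries \<Rightarrow> zseries \<Rightarrow> zseries" is "\<lambda>f f' \<beta>. f \<beta> + f' \<beta>"
  by (erule (1) cone_supported_pair) (rule exI, erule (1) cone_supported_combine, auto)

lift_definition minus_zseries :: "zseries \<Rightarrow> zseries \<Rightarrow> zseries" is "\<lambda>f f' \<beta>. f \<beta> - f' \<beta>"
  by (erule (1) cone_supported_pair) (rule exI, erule (1) cone_supported_combine, auto)

lift_definition uminus_zseries :: "zseries \<Rightarrow> zseries" is "\<lambda>f \<beta>. - f \<beta>"
  by (auto simp: cone_supported_def)

lift_definition times_zseries :: "zseries \<Rightarrow> zseries \<Rightarrow> zseries" is conv
  by (erule (1) cone_supported_pair) (rule exI, erule (1) cone_supported_conv)

instance
proof
  fix a b c :: zseries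
  show "a + b + c = a + (b + c)" "a + b = b + a" "0 + a = a" "- a + a = 0" "a - b = a + - b"
    by (transfer, simp add: fun_eq_iff)+
  show "(0 :: zseries) \<noteq> 1"
    by transfer (auto simp: fun_eq_iff)
  show "1 * a = a"
    by transfer (simp add: conv_one fun_eq_iff)
  show "a * b = b * a"
    by transfer (simp add: conv_commute fun_eq_iff)
  show "a * b * c = a * (b * c)"
  proof transfer
    fix a b c :: "zvec \<Rightarrow> int"
    assume "\<exists>l. cone_supported l a" "\<exists>l. cone_supported l b" "\<exists>l. cone_supported l c"
    then obtain l1 l2 l3 where "cone_supported l1 a" "cone_supported l2 b" "cone_supported l3 c"
      by blast
    then have "cone_supported (max l1 (max l2 l3)) a" "cone_supported (max l1 (max l2 l3)) b"
      "cone_supported (max l1 (max l2 l3)) c"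
      by (auto elim: cone_supported_mono)
    then show "conv (conv a b) c = conv a (conv b c)"
      by (intro ext conv_assoc)
  qed
  show "(a + b) * c = a * c + b * c"
  proof transfer
    fix a b c :: "zvec \<Rightarrow> int"
    assume "\<exists>l. cone_supported l a" "\<exists>l. cone_supported l b" "\<exists>l. cone_supported l c"
    then obtain l1 l2 l3 where "cone_supported l1 a" "cone_supported l2 b" "cone_supported l3 c"
      by blast
    then have *: "cone_supported (max l1 (max l2 l3)) a" "cone_supported (max l1 (max l2 l3)) b"
      "cone_supported (max l1 (max l2 l3)) c"
      by (auto elim: cone_supported_mono)
    show "conv (\<lambda>\<beta>. a \<beta> + b \<beta>) c = (\<lambda>\<beta>. conv a c \<beta> + conv b c \<beta>)"
    proof
      fix \<beta>
      let ?X = "{\<alpha>. a \<alpha> \<noteq> 0 \<and> c (\<beta> - \<alpha>) \<noteq> 0} \<union> {\<alpha>. b \<alpha> \<noteq> 0 \<and> c (\<beta> - \<alpha>) \<noteq> 0}"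
      have fin: "finite ?X" using finite_conv[OF *(1,3)] finite_conv[OF *(2,3)] by blast
      show "conv (\<lambda>\<beta>. a \<beta> + b \<beta>) c \<beta> = conv a c \<beta> + conv b c \<beta>"
        by (subst (1 2 3) conv_superset[OF fin]) (auto simp: algebra_simps sum.distrib)
    qed
  qed
qed

end

lemma cone_supported_zmono: "cone_supported l (\<lambda>\<beta>. if \<beta> = \<gamma> then 1 else 0)"
  unfolding cone_supported_def by (intro exI[of _ "{\<gamma>}"]) (auto simp: Qplus_0)

definition zmono :: "zvec \<Rightarrow> zseries" where
  "zmono \<gamma> = Abs_zseries (\<lambda>\<beta>. if \<beta> = \<gamma> then 1 else 0)"

lemma zcoeff_zmono: "zcoeff (zmono \<gamma>) = (\<lambda>\<beta>. if \<beta> = \<gamma> then 1 else 0)"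
  unfolding zmono_def using cone_supported_zmono by (subst Abs_zseries_inverse) auto

lemma zcoeff_zmono_mult: "zcoeff (zmono \<gamma> * f) \<beta> = zcoeff f (\<beta> - \<gamma>)"
  by (simp add: times_zseries.rep_eq zcoeff_zmono, subst conv_superset[of "{\<gamma>}"]) auto

lemma zmono_mult: "zmono \<gamma> * zmono \<gamma>' = zmono (\<gamma> + \<gamma>')"
  by (rule zcoeff_inject[THEN iffD1])
    (auto simp: fun_eq_iff zcoeff_zmono_mult zcoeff_zmono diff_eq_eq add.commute)

lemma zmono_0: "zmono 0 = 1"
  by (rule zcoeff_inject[THEN iffD1]) (auto simp: zcoeff_zmono one_zseries.rep_eq)

text \<open>The multiplicative inverse in the ring; it is unique when it exists.\<close>

definition zinv :: "zseries \<Rightarrow> zseries" where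
  "zinv x = (THE y. x * y = 1)"

lemma zinv_eqI:
  assumes "x * y = 1" shows "zinv x = y"
  unfolding zinv_def
proof (rule the_equality)
  show "x * y = 1" by (rule assms)
  fix y' assume "x * y' = 1"
  then show "y' = y" using assms by (metis mult.assoc mult.commute mult_1)
qed

definition eroot :: "nat \<Rightarrow> nat \<Rightarrow> zvec" where
  "eroot i j = Poly_Mapping.single i 1 - Poly_Mapping.single j 1"

lemma root_multiple_in_Qplus:
  assumes "1 \<le> i" "i < j" "j \<le> l"
  shows "Poly_Mapping.single i (int n) - Poly_Mapping.single j (int n) \<in> Qplus l"
proof -
  have "Poly_Mapping.single i (int n) - Poly_Mapping.single j (int n) =
      root_comb l (\<lambda>a. if i \<le> a \<and> a < j then n else 0)"
    using assms
    by (intro poly_mapping_eqI) (auto simp: lookup_root_comb lookup_minus lookup_single when_def)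
  then show ?thesis by (auto simp: Qplus_def)
qed

definition geo_fun :: "nat \<Rightarrow> nat \<Rightarrow> zvec \<Rightarrow> int" where
  "geo_fun i j \<beta> = (if \<exists>n::nat. \<beta> = Poly_Mapping.single i (int n) - Poly_Mapping.single j (int n)
                   then 1 else 0)"

lemma geo_fun_eq:
  "\<exists>n. \<beta> = Poly_Mapping.single i (int n) - Poly_Mapping.single j (int n) \<Longrightarrow> geo_fun i j \<beta> = 1"
  "\<nexists>n. \<beta> = Poly_Mapping.single i (int n) - Poly_Mapping.single j (int n) \<Longrightarrow> geo_fun i j \<beta> = 0"
  unfolding geo_fun_def by (rule if_P, assumption) (rule if_not_P)

lemma zinv_root:
  assumes "1 \<le> i" "i < j" "j \<le> l"
  shows "zcoeff (zinv (1 - zmono (eroot i j))) = geo_fun i j \<and>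
    (1 - zmono (eroot i j)) * zinv (1 - zmono (eroot i j)) = 1 \<and>
    zinv (1 - zmono (eroot i j)) \<in> A_ring l"
proof -
  have cs: "cone_supported l (geo_fun i j)"
    unfolding cone_supported_def
  proof (intro exI[of _ "{0}"] conjI allI impI)
    fix \<beta> assume "geo_fun i j \<beta> \<noteq> 0"
    then obtain n where "\<beta> = Poly_Mapping.single i (int n) - Poly_Mapping.single j (int n)"
      using geo_fun_eq(2) by blast
    then have "\<beta> - 0 \<in> Qplus l" using assms root_multiple_in_Qplus by simp
    then show "\<exists>\<gamma> \<in> {0}. \<beta> - \<gamma> \<in> Qplus l" by blast
  qed simp
  define y where "y = Abs_zseries (geo_fun i j)"
  have y: "zcoeff y = (geo_fun i j)" unfolding y_def using cs by (subst Abs_zseries_inverse) auto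
  have geo_shift: "geo_fun i j \<beta> - geo_fun i j (\<beta> - eroot i j) = (if \<beta> = 0 then 1 else 0)" for \<beta>
  proof (cases "\<exists>n. \<beta> = Poly_Mapping.single i (int n) - Poly_Mapping.single j (int n)")
    case True
    then obtain n where n: "\<beta> = Poly_Mapping.single i (int n) - Poly_Mapping.single j (int n)" ..
    show ?thesis
    proof (cases n)
      case 0
      then have b: "\<beta> = 0" using n by simp
      have "geo_fun i j (\<beta> - eroot i j) = 0"
      proof -
        have "- eroot i j \<noteq> Poly_Mapping.single i (int m) - Poly_Mapping.single j (int m)" for m
        proof
          assume "- eroot i j = Poly_Mapping.single i (int m) - Poly_Mapping.single j (int m)"
          then have "Poly_Mapping.lookup (- eroot i j) i =
              Poly_Mapping.lookup (Poly_Mapping.single i (int m) - Poly_Mapping.single j (int m)) i"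
            by simp
          then show False using assms by (simp add: eroot_def lookup_minus lookup_single when_def)
        qed
        then show ?thesis unfolding b diff_0 by (intro geo_fun_eq(2)) blast
      qed
      moreover have "geo_fun i j \<beta> = 1" using True by (rule geo_fun_eq(1))
      ultimately show ?thesis using b by simp
    next
      case (Suc m)
      have "\<beta> - eroot i j = Poly_Mapping.single i (int m) - Poly_Mapping.single j (int m)"
        unfolding n eroot_def
        by (rule poly_mapping_eqI) (auto simp: lookup_minus lookup_single when_def Suc)
      then have "geo_fun i j (\<beta> - eroot i j) = 1" by (intro geo_fun_eq(1) exI)
      moreover have "geo_fun i j \<beta> = 1" using True by (rule geo_fun_eq(1))
      moreover have "Poly_Mapping.lookup \<beta> i \<noteq> 0"
        using assms n Suc by (simp add: lookup_minus lookup_single when_def)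
      then have "\<beta> \<noteq> 0" by (metis lookup_zero)
      ultimately show ?thesis by simp
    qed
  next
    case False
    have ne: "\<beta> - eroot i j \<noteq> Poly_Mapping.single i (int m) - Poly_Mapping.single j (int m)" for m
    proof
      assume "\<beta> - eroot i j = Poly_Mapping.single i (int m) - Poly_Mapping.single j (int m)"
      then have "\<beta> = Poly_Mapping.single i (int m) - Poly_Mapping.single j (int m) + eroot i j"
        by (metis diff_add_cancel)
      also have "\<dots> = Poly_Mapping.single i (int (Suc m)) - Poly_Mapping.single j (int (Suc m))"
        unfolding eroot_def
        by (rule poly_mapping_eqI) (auto simp: lookup_add lookup_minus lookup_single when_def)
      finally show False using False by blast
    qed
    have "\<beta> \<noteq> 0"
    proof
      assume "\<beta> = 0"
      then have "\<beta> = Poly_Mapping.single i (int 0) - Poly_Mapping.single j (int 0)" by simp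
      then show False using False by blast
    qed
    moreover have "geo_fun i j \<beta> = 0" using False by (rule geo_fun_eq(2))
    moreover have "geo_fun i j (\<beta> - eroot i j) = 0" using ne by (intro geo_fun_eq(2)) blast
    ultimately show ?thesis by simp
  qed
  have "(1 - zmono (eroot i j)) * y = y - zmono (eroot i j) * y"
    by (simp add: left_diff_distrib)
  also have "\<dots> = 1"
    by (rule zcoeff_inject[THEN iffD1])
      (auto simp: fun_eq_iff minus_zseries.rep_eq one_zseries.rep_eq zcoeff_zmono_mult y geo_shift)
  finally have inv: "(1 - zmono (eroot i j)) * y = 1" .
  have zy: "zinv (1 - zmono (eroot i j)) = y" by (rule zinv_eqI[OF inv])
  have zv: "\<beta> \<in> zvecs l" if nz: "geo_fun i j \<beta> \<noteq> 0" for \<beta>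
  proof -
    obtain n where "\<beta> = Poly_Mapping.single i (int n) - Poly_Mapping.single j (int n)"
      using nz geo_fun_eq(2) by blast
    then show ?thesis using assms(1-3) unfolding zvecs_def
      by (auto simp: in_keys_iff lookup_minus lookup_single when_def split: if_splits)
  qed
  show "zcoeff (zinv (1 - zmono (eroot i j))) = geo_fun i j \<and>
      (1 - zmono (eroot i j)) * zinv (1 - zmono (eroot i j)) = 1 \<and>
      zinv (1 - zmono (eroot i j)) \<in> A_ring l"
    unfolding zy A_ring_def mem_Collect_eq y by (intro conjI allI impI inv cs zv refl)
qed

lemma zvecs_add: "\<alpha> \<in> zvecs l \<Longrightarrow> \<beta> \<in> zvecs l \<Longrightarrow> \<alpha> + \<beta> \<in> zvecs l"
  unfolding zvecs_def using Poly_Mapping.keys_add[of \<alpha> \<beta>] by blast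

lemma A_ring_mult:
  assumes "f \<in> A_ring l" "f' \<in> A_ring l" shows "f * f' \<in> A_ring l"
proof -
  have "\<beta> \<in> zvecs l" if "conv (zcoeff f) (zcoeff f') \<beta> \<noteq> 0" for \<beta>
  proof -
    obtain \<alpha> where "zcoeff f \<alpha> \<noteq> 0" "zcoeff f' (\<beta> - \<alpha>) \<noteq> 0" using \<open>conv _ _ \<beta> \<noteq> 0\<close> by (rule conv_nonzero)
    then have "\<alpha> + (\<beta> - \<alpha>) \<in> zvecs l" using assms by (intro zvecs_add) (auto simp: A_ring_def)
    then show ?thesis by simp
  qed
  then show ?thesis using assms
    by (auto simp: A_ring_def times_zseries.rep_eq cone_supported_conv)
qed

lemma A_ring_diff:
  assumes "f \<in> A_ring l" "f' \<in> A_ring l" shows "f - f' \<in> A_ring l"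
proof -
  have nz: "zcoeff f \<beta> \<noteq> 0 \<or> zcoeff f' \<beta> \<noteq> 0" if "zcoeff (f - f') \<beta> \<noteq> 0" for \<beta>
    using that by (auto simp: minus_zseries.rep_eq)
  have "cone_supported l (zcoeff (f - f'))"
    by (rule cone_supported_combine[OF _ _ nz]) (use assms in \<open>auto simp: A_ring_def\<close>)
  moreover have "\<beta> \<in> zvecs l" if "zcoeff (f - f') \<beta> \<noteq> 0" for \<beta>
    using nz[OF that] assms by (auto simp: A_ring_def)
  ultimately show ?thesis unfolding A_ring_def mem_Collect_eq by (intro conjI allI impI)
qed

lemma A_ring_zmono: "\<gamma> \<in> zvecs l \<Longrightarrow> zmono \<gamma> \<in> A_ring l"
  unfolding A_ring_def by (auto simp: zcoeff_zmono cone_supported_zmono)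

lemma A_ring_one: "1 \<in> A_ring l"
  using A_ring_zmono[of 0 l] by (simp add: zvecs_def zmono_0)

section \<open>Katalan functions\<close>

text \<open>The additive extension of \<open>z\<close> to the power \<open>\<gamma>\<close> \<open>\<mapsto>\<close> \<open>g_fun \<ell> \<gamma>\<close>; on \<open>A_ring \<ell>\<close> only finitely
  many terms are nonzero.\<close>

definition g_map :: "nat \<Rightarrow> zseries \<Rightarrow> symf" where
  "g_map l f = Sum_any (\<lambda>\<gamma>. of_int (zcoeff f \<gamma>) * g_fun l \<gamma>)"

lemma g_fun_nonzero_bound:
  assumes "g_fun l \<gamma> \<noteq> 0" "1 \<le> i" "i \<le> l"
  shows "Poly_Mapping.lookup \<gamma> i \<ge> int i - int l"
proof (rule ccontr)
  assume neg: "\<not> ?thesis"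
  let ?A = "mat l l (\<lambda>(i, j). kh (int i) (Poly_Mapping.lookup \<gamma> (Suc i) + int j - int i))"
  have row: "?A $$ (i - 1, j) = 0" if "j < l" for j
    using neg assms that by (auto simp: kh_def of_nat_diff)
  have "det ?A = 0"
  proof (subst det_def'[of _ l], simp, intro sum.neutral ballI)
    fix p assume "p \<in> {p. p permutes {0..<l}}"
    then have p: "p permutes {0..<l}" by simp
    then have "p (i - 1) < l" using assms permutes_in_image[OF p, of "i - 1"] by auto
    then have "(\<Prod>a = 0..<l. ?A $$ (a, p a)) = 0"
      using assms row by (intro prod_zero) (auto intro!: bexI[of _ "i - 1"])
    then show "signof p * (\<Prod>a = 0..<l. ?A $$ (a, p a)) = 0" by simp
  qed
  then show False using assms(1) by (simp add: g_fun_def)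
qed

lemma g_map_finite:
  assumes "f \<in> A_ring l"
  shows "finite {\<gamma>. of_int (zcoeff f \<gamma>) * g_fun l \<gamma> \<noteq> 0}"
proof -
  obtain S where S: "finite S" "\<And>\<beta>. zcoeff f \<beta> \<noteq> 0 \<Longrightarrow> \<exists>\<gamma> \<in> S. \<beta> - \<gamma> \<in> Qplus l"
    using assms unfolding A_ring_def cone_supported_def by blast
  define b where "b \<gamma> m = nat (\<Sum>i = Suc m..l. Poly_Mapping.lookup \<gamma> i + int l - int i)" for \<gamma> :: zvec and m
  let ?X = "\<lambda>\<gamma>. {q \<in> Qplus l. \<exists>n. q = root_comb l n \<and> (\<forall>m \<in> {1..<l}. n m \<le> b \<gamma> m)}"
  have tail: "(\<Sum>i = Suc m..l. Poly_Mapping.lookup (root_comb l n) i) = - int (n m)"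
    if "1 \<le> m" "m < l" for m n
    using that
  proof (induction "l - m" arbitrary: m)
    case (Suc d)
    show ?case
    proof (cases "Suc m = l")
      case True
      then show ?thesis using Suc by (auto simp: lookup_root_comb)
    next
      case False
      have "(\<Sum>i = Suc m..l. Poly_Mapping.lookup (root_comb l n) i) =
          Poly_Mapping.lookup (root_comb l n) (Suc m) +
          (\<Sum>i = Suc (Suc m)..l. Poly_Mapping.lookup (root_comb l n) i)"
        using Suc by (subst sum.atLeast_Suc_atMost) auto
      also have "(\<Sum>i = Suc (Suc m)..l. Poly_Mapping.lookup (root_comb l n) i) = - int (n (Suc m))"
        using Suc False by (intro Suc.hyps) auto
      finally show ?thesis using Suc False by (auto simp: lookup_root_comb)
    qed
  qed simp
  have "{\<gamma>. of_int (zcoeff f \<gamma>) * g_fun l \<gamma> \<noteq> 0} \<subseteq> (\<Union>\<gamma> \<in> S. (+) \<gamma> ` ?X \<gamma>)"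
  proof
    fix \<beta> assume "\<beta> \<in> {\<gamma>. of_int (zcoeff f \<gamma>) * g_fun l \<gamma> \<noteq> 0}"
    then have nz: "zcoeff f \<beta> \<noteq> 0" "g_fun l \<beta> \<noteq> 0" by auto
    then obtain \<gamma> n where \<gamma>: "\<gamma> \<in> S" "\<beta> - \<gamma> = root_comb l n" using S unfolding Qplus_def by blast
    have \<beta>: "\<beta> = \<gamma> + root_comb l n" using \<gamma>(2) by (metis add.commute diff_add_cancel)
    have "n m \<le> b \<gamma> m" if m: "m \<in> {1..<l}" for m
    proof -
      have "int (n m) = - (\<Sum>i = Suc m..l. Poly_Mapping.lookup (root_comb l n) i)"
        using tail m by simp
      also have "\<dots> = (\<Sum>i = Suc m..l. - Poly_Mapping.lookup (root_comb l n) i)"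
        by (simp add: sum_negf)
      also have "\<dots> \<le> (\<Sum>i = Suc m..l. Poly_Mapping.lookup \<gamma> i + int l - int i)"
      proof (rule sum_mono)
        fix i assume "i \<in> {Suc m..l}"
        then show "- Poly_Mapping.lookup (root_comb l n) i \<le> Poly_Mapping.lookup \<gamma> i + int l - int i"
          using g_fun_nonzero_bound[OF nz(2), of i] by (auto simp: \<beta> lookup_add)
      qed
      finally show ?thesis by (simp add: b_def)
    qed
    then have "root_comb l n \<in> ?X \<gamma>" by (auto simp: Qplus_def)
    then show "\<beta> \<in> (\<Union>\<gamma> \<in> S. (+) \<gamma> ` ?X \<gamma>)" using \<gamma>(1) \<beta> by blast
  qed
  then show ?thesis
    by (rule finite_subset) (intro finite_UN_I[OF S(1)] finite_imageI finite_Qplus_bounded)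
qed

definition pos_roots :: "nat \<Rightarrow> (nat \<times> nat) set" where
  "pos_roots l = {(i, j). 1 \<le> i \<and> i < j \<and> j \<le> l}"

definition root_ideal :: "nat \<Rightarrow> (nat \<times> nat) set \<Rightarrow> bool" where
  "root_ideal l \<Psi> \<longleftrightarrow> \<Psi> \<subseteq> pos_roots l \<and>
     (\<forall>(a, b) \<in> \<Psi>. \<forall>(c, d) \<in> pos_roots l. a \<ge> c \<and> b \<le> d \<longrightarrow> (c, d) \<in> \<Psi>)"

definition Katalan_series :: "(nat \<times> nat) set \<Rightarrow> nat multiset \<Rightarrow> zvec \<Rightarrow> zseries" where
  "Katalan_series \<Psi> M \<gamma> = (\<Prod>(i, j) \<in> \<Psi>. zinv (1 - zmono (eroot i j))) *
     (\<Prod>j \<in># M. 1 - zmono (- Poly_Mapping.single j 1)) * zmono \<gamma>"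

definition Katalan :: "nat \<Rightarrow> (nat \<times> nat) set \<Rightarrow> nat multiset \<Rightarrow> zvec \<Rightarrow> symf" where
  "Katalan l \<Psi> M \<gamma> = g_map l (Katalan_series \<Psi> M \<gamma>)"

lemma Katalan_series_in_A_ring:
  assumes "\<Psi> \<subseteq> pos_roots l" "set_mset M \<subseteq> {1..l}" "\<gamma> \<in> zvecs l"
  shows "Katalan_series \<Psi> M \<gamma> \<in> A_ring l"
proof -
  have "(\<Prod>(i, j) \<in> \<Psi>. zinv (1 - zmono (eroot i j))) \<in> A_ring l"
    using assms(1)
  proof (induction \<Psi> rule: infinite_finite_induct)
    case (insert x F)
    then show ?case by (auto simp: pos_roots_def intro!: A_ring_mult zinv_root[THEN conjunct2, THEN conjunct2])
  qed (auto simp: A_ring_one)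
  moreover have "(\<Prod>j \<in># M. 1 - zmono (- Poly_Mapping.single j 1)) \<in> A_ring l"
    using assms(2)
    by (induction M) (auto simp: A_ring_one zvecs_def intro!: A_ring_mult A_ring_diff A_ring_zmono)
  ultimately show ?thesis
    unfolding Katalan_series_def using assms(3) by (intro A_ring_mult A_ring_zmono)
qed

definition L_multiset :: "(nat \<times> nat) set \<Rightarrow> nat multiset" where
  "L_multiset \<L> = image_mset snd (mset_set \<L>)"

definition Par_len :: "nat \<Rightarrow> nat \<Rightarrow> zvec set" where
  "Par_len k l = {\<mu> \<in> zvecs l.
     (\<forall>i \<in> {1..l}. 0 \<le> Poly_Mapping.lookup \<mu> i \<and> Poly_Mapping.lookup \<mu> i \<le> int k) \<and>
     (\<forall>i \<in> {1..l}. \<forall>j \<in> {1..l}. i \<le> j \<longrightarrow> Poly_Mapping.lookup \<mu> j \<le> Poly_Mapping.lookup \<mu> i)}"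

definition Par :: "nat \<Rightarrow> zvec set" where
  "Par k = (\<Union>l. Par_len k l)"

text \<open>The number of nonzero parts of a partition.\<close>

definition nparts :: "zvec \<Rightarrow> nat" where
  "nparts \<mu> = card (Poly_Mapping.keys \<mu>)"

definition Delta :: "nat \<Rightarrow> int \<Rightarrow> zvec \<Rightarrow> (nat \<times> nat) set" where
  "Delta l m \<mu> = {(i, j) \<in> pos_roots l. m - Poly_Mapping.lookup \<mu> i + int i < int j}"

lemma root_ideal_Delta:
  assumes "\<mu> \<in> Par_len k l" shows "root_ideal l (Delta l m \<mu>)"
  unfolding root_ideal_def
proof (intro conjI ballI, goal_cases)
  case 1
  show ?case by (auto simp: Delta_def)
next
  case (2 p)
  obtain a b where p: "p = (a, b)" by (cases p)
  have ab: "(a, b) \<in> pos_roots l" "m - Poly_Mapping.lookup \<mu> a + int a < int b"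
    using 2 by (auto simp: Delta_def p)
  have "(c, d) \<in> Delta l m \<mu>" if cd: "(c, d) \<in> pos_roots l" "a \<ge> c" "b \<le> d" for c d
  proof -
    have "c \<in> {1..l}" "a \<in> {1..l}" using cd ab by (auto simp: pos_roots_def)
    then have "Poly_Mapping.lookup \<mu> a \<le> Poly_Mapping.lookup \<mu> c"
      using assms cd(2) unfolding Par_len_def by blast
    then show ?thesis using ab(2) cd by (simp add: Delta_def)
  qed
  then show ?case by (auto simp: p)
qed

definition kSchur_Katalan :: "nat \<Rightarrow> nat \<Rightarrow> zvec \<Rightarrow> symf" where
  "kSchur_Katalan k l \<mu> =
     Katalan l (Delta l (int k) \<mu>) (L_multiset (Delta l (int k + 1) \<mu>)) \<mu>"

section \<open>The affine symmetric group\<close>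

text \<open>Elements of the group on generators \<open>s 0, \<dots>, s k\<close> are classes of words in \<open>{0..k}\<close>;
  the generators are involutions, so no formal inverses are needed. For \<open>k = 1\<close> the group is
  the infinite dihedral group and there is no braid relation.\<close>

inductive cox_step :: "nat \<Rightarrow> nat list \<Rightarrow> nat list \<Rightarrow> bool" for k where
  square: "i \<le> k \<Longrightarrow> cox_step k (u @ [i, i] @ v) (u @ v)"
| braid: "2 \<le> k \<Longrightarrow> i \<le> k \<Longrightarrow> j = (i + 1) mod (k + 1) \<Longrightarrow>
    cox_step k (u @ [i, j, i] @ v) (u @ [j, i, j] @ v)"
| commute: "i \<le> k \<Longrightarrow> j \<le> k \<Longrightarrow> i \<noteq> j \<Longrightarrow> j \<noteq> (i + 1) mod (k + 1) \<Longrightarrow> i \<noteq> (j + 1) mod (k + 1) \<Longrightarrow>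
    cox_step k (u @ [i, j] @ v) (u @ [j, i] @ v)"

definition word_class :: "nat \<Rightarrow> nat list \<Rightarrow> nat list set" where
  "word_class k a = {b. equivclp (cox_step k) a b}"

definition aff_sym :: "nat \<Rightarrow> nat list set set" where
  "aff_sym k = word_class k ` lists {..k}"

definition aff_length :: "nat list set \<Rightarrow> nat" where
  "aff_length w = (LEAST n. \<exists>a \<in> w. length a = n)"

text \<open>The coset of \<open>w\<close> modulo the subgroup generated by \<open>s 1, \<dots>, s k\<close>.\<close>

definition fin_coset :: "nat \<Rightarrow> nat list set \<Rightarrow> nat list set set" where
  "fin_coset k w = {word_class k (a @ b) | a b. a \<in> w \<and> b \<in> lists {1..k}}"

definition aff_grass :: "nat \<Rightarrow> nat list set set" where
  "aff_grass k = {w \<in> aff_sym k. \<forall>v \<in> fin_coset k w. aff_length w \<le> aff_length v}"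

text \<open>Factors run from \<open>r = nparts \<mu>\<close> on the left down to \<open>r = 1\<close> on the right; the \<open>r\<close>-th one has
  the indices \<open>c - r\<close> for \<open>c = \<mu> r, \<dots>, 1\<close>.\<close>

definition par_word :: "nat \<Rightarrow> zvec \<Rightarrow> nat list" where
  "par_word k \<mu> = concat (map
     (\<lambda>r. map (\<lambda>c. nat ((c - int r) mod (int k + 1))) (rev [1..Poly_Mapping.lookup \<mu> r]))
     (rev [1..<nparts \<mu> + 1]))"

definition par_elt :: "nat \<Rightarrow> zvec \<Rightarrow> nat list set" where
  "par_elt k \<mu> = word_class k (par_word k \<mu>)"

definition cyc_increasing :: "nat \<Rightarrow> nat list set \<Rightarrow> bool" where
  "cyc_increasing k w \<longleftrightarrow> (\<exists>a \<in> w. distinct a \<and>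
     (\<forall>p q. p < q \<and> q < length a \<longrightarrow> a ! p \<noteq> (a ! q + 1) mod (k + 1)))"

section \<open>The 0-Hecke algebra\<close>

text \<open>Words form a free monoid, written additively, so \<open>word \<Rightarrow>\<^sub>0 int\<close> is the free associative
  algebra on generators \<open>T i\<close>. The 0-Hecke algebra is the quotient, of its subalgebra generated by
  \<open>T 0, \<dots>, T k\<close>, by the two-sided ideal \<open>hecke_ideal k\<close>.\<close>

datatype word = Word (letters: "nat list")

instantiation word :: monoid_add
begin

definition zero_word :: word where "zero_word = Word []"

definition plus_word :: "word \<Rightarrow> word \<Rightarrow> word" where
  "plus_word a b = Word (letters a @ letters b)"

instance by standard (simp_all add: zero_word_def plus_word_def)

end

definition T_gen :: "nat \<Rightarrow> (word \<Rightarrow>\<^sub>0 int)" where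
  "T_gen i = Poly_Mapping.single (Word [i]) 1"

definition hecke_rels :: "nat \<Rightarrow> (word \<Rightarrow>\<^sub>0 int) set" where
  "hecke_rels k =
     {T_gen i * T_gen i + T_gen i | i. i \<le> k} \<union>
     {T_gen i * T_gen j * T_gen i - T_gen j * T_gen i * T_gen j | i j.
        2 \<le> k \<and> i \<le> k \<and> j = (i + 1) mod (k + 1)} \<union>
     {T_gen i * T_gen j - T_gen j * T_gen i | i j.
        i \<le> k \<and> j \<le> k \<and> i \<noteq> j \<and> j \<noteq> (i + 1) mod (k + 1) \<and> i \<noteq> (j + 1) mod (k + 1)}"

inductive_set hecke_ideal :: "nat \<Rightarrow> (word \<Rightarrow>\<^sub>0 int) set" for k where
  zero: "0 \<in> hecke_ideal k"
| gen: "x \<in> hecke_rels k \<Longrightarrow> a * x * b \<in> hecke_ideal k"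
| add: "x \<in> hecke_ideal k \<Longrightarrow> y \<in> hecke_ideal k \<Longrightarrow> x + y \<in> hecke_ideal k"

definition hecke_eq :: "nat \<Rightarrow> (word \<Rightarrow>\<^sub>0 int) \<Rightarrow> (word \<Rightarrow>\<^sub>0 int) \<Rightarrow> bool" where
  "hecke_eq k x y \<longleftrightarrow> x - y \<in> hecke_ideal k"

text \<open>A representative of the basis element \<open>T w\<close>; modulo \<open>hecke_ideal k\<close> it does not depend on
  the chosen reduced word.\<close>

definition T_elt :: "nat list set \<Rightarrow> (word \<Rightarrow>\<^sub>0 int)" where
  "T_elt w = prod_list (map T_gen (SOME a. a \<in> w \<and> length a = aff_length w))"

section \<open>K-k-Schur functions\<close>

text \<open>The pairs \<open>(u, w)\<close> indexing the terms of the Pieri rule; \<open>w\<close> is determined by \<open>u\<close>.\<close>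

definition pieri_pairs :: "nat \<Rightarrow> nat \<Rightarrow> zvec \<Rightarrow> (nat list set \<times> nat list set) set" where
  "pieri_pairs k r \<mu> = {(u, w). u \<in> aff_sym k \<and> cyc_increasing k u \<and> aff_length u = r \<and>
     w \<in> aff_grass k \<and>
     (hecke_eq k (T_elt u * T_elt (par_elt k \<mu>)) (T_elt w) \<or>
      hecke_eq k (T_elt u * T_elt (par_elt k \<mu>)) (- T_elt w))}"

text \<open>The Pieri rule is homogeneous in the family, so it characterises the K-k-Schur functions
  only together with the normalisation that the empty partition (the Schubert class of the
  identity) gives 1. In the exponent, \<open>aff_length w \<le> aff_length (par_elt k \<mu>) + r\<close>.\<close>

definition K_k_Schur_family :: "nat \<Rightarrow> (zvec \<Rightarrow> symf) \<Rightarrow> bool" where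
  "K_k_Schur_family k G \<longleftrightarrow> G \<in> Par k \<rightarrow>\<^sub>E Lambda_sub k \<and> G 0 = 1 \<and>
     (\<forall>r \<in> {1..k}. \<forall>\<mu> \<in> Par k.
        g_fun r (ones r) * G \<mu> =
          (\<Sum>(u, w) \<in> pieri_pairs k r \<mu>.
             (- 1) ^ (aff_length (par_elt k \<mu>) + r - aff_length w) *
             G (inv_into (Par k) (par_elt k) w)))"

definition K_k_Schur :: "nat \<Rightarrow> zvec \<Rightarrow> symf" where
  "K_k_Schur k = (THE G. K_k_Schur_family k G)"

definition Z_basis :: "'i set \<Rightarrow> ('i \<Rightarrow> symf) \<Rightarrow> symf set \<Rightarrow> bool" where
  "Z_basis I b V \<longleftrightarrow> b ` I \<subseteq> V \<and>
     (\<forall>f \<in> V. \<exists>!c :: 'i \<Rightarrow>\<^sub>0 int. Poly_Mapping.keys c \<subseteq> I \<and>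
        f = (\<Sum>i \<in> Poly_Mapping.keys c. of_int (Poly_Mapping.lookup c i) * b i))"

end

theory Submission
  imports Defs "HOL-Combinatorics.Transposition"
begin

text \<open>
  Expanding the determinants \<open>g\<close> along their rows cancels the root ideal: the Katalan function becomes the
  value at \<open>\<Prod> (1 - z i / z j) z^\<mu>\<close>, the product over the pairs \<^emph>\<open>outside\<close> the ideal, of a linear
  functional \<open>kap\<close> sending \<open>z^\<gamma>\<close> to a product of row functions \<open>kh\<close>. It is symmetric in rows of
  equal rank, which gives straightening relations for such rows.

  Appending a window of \<open>k + 1\<close> zero rows turns multiplication by \<open>g (1^r)\<close> into the sum over the
  \<open>r\<close>-element subsets of the window of the products of the factors \<open>z w - 1\<close>. Straightening carries a single
  such factor upwards through the partition, row by row; it ends by adding a box of the residue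
  determined by \<open>w\<close>, by giving 0, or by giving a factor \<open>-1\<close>. These are the three cases of the action of a
  0-Hecke generator on a Grassmannian element, so the Katalan functions satisfy the Pieri rule.

  Finally, the functions \<open>g (1^r)\<close>, \<open>r \<le> k\<close>, generate \<open>\<int>[h 1, \<dots>, h k]\<close>, and the leading monomial of the Katalan
  function of \<open>\<mu>\<close> for a suitable concave weight is \<open>h \<mu>\<close>. Hence the Katalan functions form a basis, and the
  Pieri rule determines a family with value 1 at the empty partition.
\<close>

section \<open>Linear functionals on monoid algebras\<close>

text \<open>Say that row x ends at q if b x = q. Two equal adjacent rows q and q + 1 are not quite
  interchangeable: row q + 1 has the surplus pair (q + 1, b q) outside the ideal, and a row i ending
  at q + 1 has column q outside the ideal but not column q + 1. If row i - 1 ends at q, the relation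
  that moves the factor from row q + 1 to row i also deletes (i, q), the surplus pair of row i over
  row i - 1. So the argument reproduces itself, and the trace follows preimages of b. Chain lengths
  of b, regularised along the zero rows, give a function H on the integers with H (x + K) = H x - 1.
  Adding a box of residue a composes H with the reflection exchanging a - 1 and a modulo K, and the
  sign of H a - H (a - 1) separates the three cases. Since H determines the partition, box moves
  replace general Coxeter theory, and matrix coefficients of the action on H replace linear
  independence of the T_w. The window has K rows so that every residue has exactly one row.
  Straightening a factor requires the others to avoid its row and the cyclically preceding one;
  cyclically increasing words guarantee this.\<close>

lemma pm_sum_singles: "(\<Sum>a\<in>Poly_Mapping.keys f. Poly_Mapping.single a (Poly_Mapping.lookup f a)) = f"
  by (rule poly_mapping_eqI)
    (auto simp: lookup_sum lookup_single when_def in_keys_iff sum.delta' if_distrib cong: if_cong)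

lemma pm_induct [case_names zero single add]:
  fixes f :: "'a \<Rightarrow>\<^sub>0 'b::comm_monoid_add"
  assumes "P 0" "\<And>a c. P (Poly_Mapping.single a c)" "\<And>f g. P f \<Longrightarrow> P g \<Longrightarrow> P (f + g)"
  shows "P f"
proof -
  have "P (\<Sum>a\<in>A. Poly_Mapping.single a (Poly_Mapping.lookup f a))" for A
    using assms by (induction A rule: infinite_finite_induct) auto
  then show ?thesis by (metis pm_sum_singles)
qed

definition lin :: "('a \<Rightarrow> 'b::comm_ring_1) \<Rightarrow> ('a \<Rightarrow>\<^sub>0 int) \<Rightarrow> 'b" where
  "lin \<phi> f = (\<Sum>a\<in>Poly_Mapping.keys f. of_int (Poly_Mapping.lookup f a) * \<phi> a)"

lemma lin_superset:
  "finite A \<Longrightarrow> Poly_Mapping.keys f \<subseteq> A \<Longrightarrow>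
    lin \<phi> f = (\<Sum>a\<in>A. of_int (Poly_Mapping.lookup f a) * \<phi> a)"
  unfolding lin_def by (rule sum.mono_neutral_left) (auto simp: in_keys_iff)

lemma lin_0 [simp]: "lin \<phi> 0 = 0"
  by (simp add: lin_def)

lemma lin_single: "lin \<phi> (Poly_Mapping.single a c) = of_int c * \<phi> a"
  by (subst lin_superset[of "{a}"]) auto

lemma lin_add: "lin \<phi> (f + g) = lin \<phi> f + lin \<phi> g"
proof -
  let ?A = "Poly_Mapping.keys f \<union> Poly_Mapping.keys g"
  have "Poly_Mapping.keys (f + g) \<subseteq> ?A" by (rule Poly_Mapping.keys_add)
  then show ?thesis
    by (simp add: lin_superset[of ?A] lookup_add distrib_right sum.distrib)
qed

lemma lin_uminus: "lin \<phi> (- f) = - lin \<phi> f"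
  using lin_add[of \<phi> f "- f"] by (simp add: eq_neg_iff_add_eq_0 add.commute)

lemma lin_diff: "lin \<phi> (f - g) = lin \<phi> f - lin \<phi> g"
  using lin_add[of \<phi> f "- g"] by (simp add: lin_uminus)

lemma lin_sum: "lin \<phi> (sum f A) = (\<Sum>x\<in>A. lin \<phi> (f x))"
  by (induction A rule: infinite_finite_induct) (auto simp: lin_add)

lemma lin_mult:
  fixes f g :: "'a::monoid_add \<Rightarrow>\<^sub>0 int"
  assumes "\<And>a b. \<phi> (a + b) = \<phi> a * \<phi> b"
  shows "lin \<phi> (f * g) = lin \<phi> f * lin \<phi> g"
proof (induction f rule: pm_induct)
  case (single a c)
  show ?case
  proof (induction g rule: pm_induct)
    case (single b d)
    show ?case by (simp add: mult_single lin_single assms)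
  qed (simp_all add: lin_add distrib_left)
qed (simp_all add: lin_add distrib_right)

lemma lin_1: "lin \<phi> 1 = \<phi> (0 :: 'a::monoid_add)"
  using lin_single[of \<phi> 0 1] by simp

section \<open>Laurent polynomials and the row functional\<close>

type_synonym laurent = "zvec \<Rightarrow>\<^sub>0 int"

definition zp :: "nat \<Rightarrow> int \<Rightarrow> laurent" where
  "zp i n = Poly_Mapping.single (Poly_Mapping.single i n) 1"

lemma zp_add: "zp i n * zp i m = zp i (n + m)"
  by (simp add: zp_def mult_single single_add)

lemma zp_0 [simp]: "zp i 0 = 1"
  by (simp add: zp_def)

lemma zp_cancel [simp]: "zp i 1 * zp i (-1) = 1" "zp i (-1) * zp i 1 = 1"
  by (simp_all add: zp_add)

text \<open>Coordinates outside \<open>I\<close> are ignored. With the ranks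
  \<open>c i = i - 1\<close> each row contributes an entry of the determinant \<open>g_fun\<close>;
  the determinant itself appears after multiplication by a Vandermonde product, see
  \<open>g_fun_eq_kap\<close>.\<close>

definition kap :: "nat set \<Rightarrow> (nat \<Rightarrow> int) \<Rightarrow> laurent \<Rightarrow> symf" where
  "kap I c = lin (\<lambda>\<gamma>. \<Prod>i\<in>I. kh (c i) (Poly_Mapping.lookup \<gamma> i))"

lemma kap_add: "kap I c (f + g) = kap I c f + kap I c g"
  and kap_diff: "kap I c (f - g) = kap I c f - kap I c g"
  and kap_uminus: "kap I c (- f) = - kap I c f"
  and kap_0 [simp]: "kap I c 0 = 0"
  and kap_sum: "kap I c (sum F A) = (\<Sum>x\<in>A. kap I c (F x))"
  by (simp_all add: kap_def lin_add lin_diff lin_uminus lin_sum)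

lemma kap_cong: "(\<And>i. i \<in> I \<Longrightarrow> c i = c' i) \<Longrightarrow> kap I c f = kap I c' f"
  by (simp add: kap_def cong: prod.cong)

section \<open>Transposition of two rows\<close>

definition psw :: "nat \<Rightarrow> nat \<Rightarrow> laurent \<Rightarrow> laurent" where
  "psw j q = lin (\<lambda>\<gamma>. Poly_Mapping.single (Poly_Mapping.map_key (transpose j q) \<gamma>) 1)"

lemma inj_transpose: "inj (transpose a b)"
  by (metis injI transpose_involutory)

lemma psw_add: "psw j q (f + g) = psw j q f + psw j q g"
  and psw_diff: "psw j q (f - g) = psw j q f - psw j q g"
  by (simp_all add: psw_def lin_add lin_diff)

lemma map_key_transpose_single:
  "Poly_Mapping.map_key (transpose j q) (Poly_Mapping.single i n) =
     Poly_Mapping.single (transpose j q i) n"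
proof -
  have "Poly_Mapping.map_key (transpose j q) (Poly_Mapping.single (transpose j q (transpose j q i)) n) =
     Poly_Mapping.single (transpose j q i) n"
    by (rule map_key_single) (rule inj_transpose)
  then show ?thesis by simp
qed

lemma psw_mult: "psw j q (f * g) = psw j q f * psw j q g"
  unfolding psw_def
  by (rule lin_mult) (simp add: map_key_plus inj_transpose mult_single)

lemma psw_1 [simp]: "psw j q 1 = 1"
  by (simp add: psw_def lin_1 inj_transpose)

lemma psw_prod: "psw j q (prod F A) = (\<Prod>x\<in>A. psw j q (F x))"
  by (induction A rule: infinite_finite_induct) (auto simp: psw_mult)

lemma psw_sum: "psw j q (sum F A) = (\<Sum>x\<in>A. psw j q (F x))"
  by (simp add: psw_def lin_sum)

lemma psw_zp [simp]: "psw j q (zp i n) = zp (transpose j q i) n"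
  by (simp add: psw_def zp_def lin_single map_key_transpose_single)

lemma kap_psw:
  assumes "finite I" "j \<in> I" "q \<in> I" "c j = c q"
  shows "kap I c (psw j q f) = kap I c f"
proof (induction f rule: pm_induct)
  case (single \<gamma> d)
  have c: "c (transpose j q i) = c i" for i
    using assms(4) by (auto simp: transpose_def)
  have I: "transpose j q i \<in> I \<longleftrightarrow> i \<in> I" for i
    using assms by (auto simp: transpose_def)
  have "(\<Prod>i\<in>I. kh (c i) (Poly_Mapping.lookup (Poly_Mapping.map_key (transpose j q) \<gamma>) i)) =
      (\<Prod>i\<in>I. kh (c i) (Poly_Mapping.lookup \<gamma> (transpose j q i)))"
    by (simp add: map_key.rep_eq inj_transpose)
  also have "\<dots> = (\<Prod>i\<in>I. kh (c i) (Poly_Mapping.lookup \<gamma> i))"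
    by (rule prod.reindex_bij_witness[of _ "transpose j q" "transpose j q"]) (auto simp: c I)
  finally have *: "(\<Prod>i\<in>I. kh (c i) (Poly_Mapping.lookup (Poly_Mapping.map_key (transpose j q) \<gamma>) i)) =
      (\<Prod>i\<in>I. kh (c i) (Poly_Mapping.lookup \<gamma> i))" .
  have "psw j q (Poly_Mapping.single \<gamma> d) =
      of_int d * Poly_Mapping.single (Poly_Mapping.map_key (transpose j q) \<gamma>) 1"
    by (simp add: psw_def lin_single)
  also have "\<dots> = Poly_Mapping.single (Poly_Mapping.map_key (transpose j q) \<gamma>) d"
    by (simp add: single_of_int[symmetric] mult_single del: single_of_int)
  finally show ?case by (simp add: kap_def lin_single *)
next
  case zero
  show ?case by (simp add: psw_def)
next
  case (add f g)
  then show ?case by (simp add: psw_add kap_add)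
qed

text \<open>There is no 2-torsion in the coefficients; this turns antisymmetry into
  vanishing.\<close>

lemma symf_double_zero:
  assumes "x = - (x :: symf)" shows "x = 0"
proof (rule poly_mapping_eqI)
  fix a
  have "Poly_Mapping.lookup x a = - Poly_Mapping.lookup x a"
    using arg_cong[OF assms, of "\<lambda>f. Poly_Mapping.lookup f a"] by simp
  then show "Poly_Mapping.lookup x a = Poly_Mapping.lookup 0 a" by simp
qed

lemma kap_antisym:
  assumes "finite I" "j \<in> I" "q \<in> I" "c j = c q" "psw j q f = - f"
  shows "kap I c f = 0"
  using kap_psw[OF assms(1-4), of f] assms(5) by (intro symf_double_zero) (simp add: kap_uminus)

section \<open>Row functions of varying rank\<close>

lemma ibinom_pascal: "ibinom (n + 1) (Suc i) = ibinom n i + ibinom n (Suc i)"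
proof -
  \<comment> \<open>Multiplying by the factorial removes the truncating division; its exactness is
    the integrality of the generalised binomial coefficients.\<close>
  have fact_ibinom: "fact i * ibinom n i = (\<Prod>t<i. n - int t)" for n i
    using gbinomial_int_mult_fact[of i n] by (simp add: ibinom_def gbinomial_prod_rev atLeast0LessThan)
  have "fact (Suc i) * (ibinom (n + 1) (Suc i)) =
      fact (Suc i) * (ibinom n i + ibinom n (Suc i) :: int)"
  proof -
    have 1: "(\<Prod>t<Suc i. n + 1 - int t) = (n + 1) * (\<Prod>t<i. n - int t)"
      by (subst prod.lessThan_Suc_shift) (simp add: algebra_simps)
    have 2: "(\<Prod>t<Suc i. n - int t) = (\<Prod>t<i. n - int t) * (n - int i)"
      by simp
    have "fact (Suc i) * ibinom n i = int (Suc i) * (\<Prod>t<i. n - int t)"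
      using fact_ibinom[of i n] by (simp add: algebra_simps)
    then show ?thesis
      unfolding distrib_left fact_ibinom 1 2 by (simp add: algebra_simps)
  qed
  then show ?thesis by (metis fact_nonzero mult_cancel_left)
qed

lemma ibinom_0 [simp]: "ibinom n 0 = 1"
  by (simp add: ibinom_def)

lemma kh_0 [simp]: "kh r 0 = 1"
  by (simp add: kh_def h_def)

lemma kh_neg: "m < 0 \<Longrightarrow> kh r m = 0"
  by (simp add: kh_def)

lemma kh_nat: "kh r (int m) = (\<Sum>i\<le>m. of_int (ibinom (r + int i - 1) i) * h (int m - int i))"
  by (simp add: kh_def)

lemma kh_Suc: "kh r (int (Suc n)) =
    h (int (Suc n)) + (\<Sum>i\<le>n. of_int (ibinom (r + int i) (Suc i)) * h (int n - int i))"
  unfolding kh_nat sum.atMost_Suc_shift by (simp add: algebra_simps)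

text \<open>The functions of rank r have the generating function (1 - t)^(-r) \<Sum> h_m t^m, so
  multiplication by 1 - t lowers the rank by one; on coefficients this is Pascal's rule.\<close>

lemma kh_diff: "kh r m - kh r (m - 1) = kh (r - 1) m"
proof (cases "m \<le> 0")
  case True
  then show ?thesis by (cases "m = 0") (auto simp: kh_neg)
next
  case False
  then obtain n where m: "m = int (Suc n)" by (metis not_le pos_int_cases Suc_pred)
  have "kh r (m - 1) = (\<Sum>i\<le>n. of_int (ibinom (r + int i - 1) i) * h (int n - int i))"
    using kh_nat[of r n] by (simp add: m)
  moreover have "ibinom (r + int i) (Suc i) = ibinom (r + int i - 1) i + ibinom (r - 1 + int i) (Suc i)" for i
    using ibinom_pascal[of "r + int i - 1" i] by (simp add: algebra_simps)
  ultimately show ?thesis unfolding m kh_Suc by (simp add: distrib_right sum.distrib)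
qed

lemma kap_single: "kap I c (Poly_Mapping.single \<gamma> d) =
    of_int d * (\<Prod>i\<in>I. kh (c i) (Poly_Mapping.lookup \<gamma> i))"
  by (simp add: kap_def lin_single)

text \<open>\<open>kh_diff\<close> applied in one row. In this way the factors 1 - 1/z_j of a
  Katalan function turn into a shift of the ranks.\<close>

lemma kap_v:
  assumes "finite I" "j \<in> I"
  shows "kap I c ((1 - zp j (-1)) * f) = kap I (c(j := c j - 1)) f"
proof (induction f rule: pm_induct)
  case (single \<gamma> d)
  let ?r = "\<Prod>i\<in>I - {j}. kh (c i) (Poly_Mapping.lookup \<gamma> i)"
  have sp: "(\<Prod>i\<in>I. F i) = F j * (\<Prod>i\<in>I - {j}. F i)" for F :: "nat \<Rightarrow> symf"
    using assms by (rule prod.remove)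
  have "(1 - zp j (-1)) * Poly_Mapping.single \<gamma> d =
      Poly_Mapping.single \<gamma> d - Poly_Mapping.single (Poly_Mapping.single j (-1) + \<gamma>) d"
    by (simp add: left_diff_distrib zp_def mult_single)
  then have "kap I c ((1 - zp j (-1)) * Poly_Mapping.single \<gamma> d) =
      of_int d * (kh (c j) (Poly_Mapping.lookup \<gamma> j) * ?r) -
      of_int d * (kh (c j) (Poly_Mapping.lookup \<gamma> j - 1) *
        (\<Prod>i\<in>I - {j}. kh (c i) (Poly_Mapping.lookup (Poly_Mapping.single j (-1) + \<gamma>) i)))"
    by (simp add: kap_diff kap_single sp lookup_add)
  also have "(\<Prod>i\<in>I - {j}. kh (c i) (Poly_Mapping.lookup (Poly_Mapping.single j (-1) + \<gamma>) i)) = ?r"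
    by (rule prod.cong) (auto simp: lookup_add lookup_single)
  also have "of_int d * (kh (c j) (Poly_Mapping.lookup \<gamma> j) * ?r) -
      of_int d * (kh (c j) (Poly_Mapping.lookup \<gamma> j - 1) * ?r) =
      of_int d * ((kh (c j) (Poly_Mapping.lookup \<gamma> j) - kh (c j) (Poly_Mapping.lookup \<gamma> j - 1)) * ?r)"
    by (simp add: algebra_simps)
  also have "\<dots> = kap I (c(j := c j - 1)) (Poly_Mapping.single \<gamma> d)"
    by (simp add: kh_diff kap_single sp)
  finally show ?case .
qed (simp_all add: kap_add distrib_left)

section \<open>Degree in one row, and separation of variables\<close>

definition low :: "nat \<Rightarrow> laurent \<Rightarrow> bool" where
  "low j f \<longleftrightarrow> (\<forall>\<gamma>\<in>Poly_Mapping.keys f. Poly_Mapping.lookup \<gamma> j \<le> 0)"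

lemma low_add: "low j f \<Longrightarrow> low j g \<Longrightarrow> low j (f + g)"
  unfolding low_def using Poly_Mapping.keys_add[of f g] by blast

lemma low_uminus: "low j f \<Longrightarrow> low j (- f)"
  by (simp add: low_def)

lemma low_diff: "low j f \<Longrightarrow> low j g \<Longrightarrow> low j (f - g)"
  using low_add[of j f "- g"] low_uminus by simp

lemma low_mult: "low j f \<Longrightarrow> low j g \<Longrightarrow> low j (f * g)"
  unfolding low_def using Poly_Mapping.keys_mult[of f g] by (fastforce simp: lookup_add)

lemma low_1: "low j 1"
  by (simp add: low_def)

lemma low_zp: "i \<noteq> j \<or> n \<le> 0 \<Longrightarrow> low j (zp i n)"
  by (auto simp: low_def zp_def lookup_single when_def)

lemma low_prod: "(\<And>x. x \<in> A \<Longrightarrow> low j (F x)) \<Longrightarrow> low j (prod F A)"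
  by (induction A rule: infinite_finite_induct) (auto intro: low_mult low_1)

text \<open>Row functions vanish in negative degree. This is what makes pairs disappear whose second
  row is a zero row at the bottom.\<close>

lemma kap_low:
  assumes "finite I" "j \<in> I" "low j f"
  shows "kap I c (zp j (-1) * f) = 0"
  unfolding kap_def lin_def
proof (intro sum.neutral ballI)
  fix \<gamma> assume "\<gamma> \<in> Poly_Mapping.keys (zp j (-1) * f)"
  then obtain \<delta> where "\<delta> \<in> Poly_Mapping.keys f" "\<gamma> = Poly_Mapping.single j (-1) + \<delta>"
    using Poly_Mapping.keys_mult[of "zp j (-1)" f] by (auto simp: zp_def)
  then have "Poly_Mapping.lookup \<gamma> j < 0"
    using assms(3) by (auto simp: low_def lookup_add)
  then have "(\<Prod>i\<in>I. kh (c i) (Poly_Mapping.lookup \<gamma> i)) = 0"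
    using assms by (intro prod_zero bexI[of _ j]) (auto simp: kh_neg)
  then show "of_int (Poly_Mapping.lookup (zp j (- 1) * f) \<gamma>) *
      (\<Prod>i\<in>I. kh (c i) (Poly_Mapping.lookup \<gamma> i)) = 0" by simp
qed

definition only :: "nat set \<Rightarrow> laurent \<Rightarrow> bool" where
  "only I f \<longleftrightarrow> (\<forall>\<gamma>\<in>Poly_Mapping.keys f. Poly_Mapping.keys \<gamma> \<subseteq> I)"

lemma only_add: "only I f \<Longrightarrow> only I g \<Longrightarrow> only I (f + g)"
  unfolding only_def using Poly_Mapping.keys_add[of f g] by blast

lemma only_diff: "only I f \<Longrightarrow> only I g \<Longrightarrow> only I (f - g)"
  using only_add[of I f "- g"] by (simp add: only_def)

lemma only_mult: "only I f \<Longrightarrow> only I g \<Longrightarrow> only I (f * g)"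
proof (unfold only_def, intro ballI subsetI)
  fix \<gamma> i assume *: "\<forall>\<gamma>\<in>Poly_Mapping.keys f. Poly_Mapping.keys \<gamma> \<subseteq> I"
    "\<forall>\<gamma>\<in>Poly_Mapping.keys g. Poly_Mapping.keys \<gamma> \<subseteq> I"
    "\<gamma> \<in> Poly_Mapping.keys (f * g)" "i \<in> Poly_Mapping.keys \<gamma>"
  then obtain a b where "a \<in> Poly_Mapping.keys f" "b \<in> Poly_Mapping.keys g" "\<gamma> = a + b"
    using Poly_Mapping.keys_mult[of f g] by auto
  then show "i \<in> I" using * Poly_Mapping.keys_add[of a b] by blast
qed

lemma only_1: "only I 1"
  by (simp add: only_def)

lemma only_zp: "i \<in> I \<Longrightarrow> only I (zp i n)"
  by (auto simp: only_def zp_def)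

lemma only_prod: "(\<And>x. x \<in> A \<Longrightarrow> only I (F x)) \<Longrightarrow> only I (prod F A)"
  by (induction A rule: infinite_finite_induct) (auto intro: only_mult only_1)

lemma only_sum: "(\<And>x. x \<in> A \<Longrightarrow> only I (F x)) \<Longrightarrow> only I (sum F A)"
proof (induction A rule: infinite_finite_induct)
  case (insert x A)
  then show ?case by (auto intro: only_add)
qed (auto simp: only_def)

lemma kap_union:
  assumes "finite I" "finite J" "I \<inter> J = {}" "only I f" "only J g"
  shows "kap (I \<union> J) c (f * g) = kap I c f * kap J c g"
proof -
  let ?p = "\<lambda>A (\<gamma>::zvec). \<Prod>i\<in>A. kh (c i) (Poly_Mapping.lookup \<gamma> i)"
  have "f * g = (\<Sum>a\<in>Poly_Mapping.keys f. \<Sum>b\<in>Poly_Mapping.keys g.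
      Poly_Mapping.single (a + b) (Poly_Mapping.lookup f a * Poly_Mapping.lookup g b))"
    by (subst pm_sum_singles[of f, symmetric], subst pm_sum_singles[of g, symmetric])
      (simp only: sum_product mult_single)
  then have "kap (I \<union> J) c (f * g) = (\<Sum>a\<in>Poly_Mapping.keys f. \<Sum>b\<in>Poly_Mapping.keys g.
      of_int (Poly_Mapping.lookup f a * Poly_Mapping.lookup g b) * ?p (I \<union> J) (a + b))"
    by (simp only: kap_sum kap_single)
  also have "\<dots> = (\<Sum>a\<in>Poly_Mapping.keys f. \<Sum>b\<in>Poly_Mapping.keys g.
      (of_int (Poly_Mapping.lookup f a) * ?p I a) * (of_int (Poly_Mapping.lookup g b) * ?p J b))"
  proof (intro sum.cong refl)
    fix a b assume ab: "a \<in> Poly_Mapping.keys f" "b \<in> Poly_Mapping.keys g"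
    have 1: "Poly_Mapping.lookup b i = 0" if "i \<in> I" for i
      using ab assms(3,5) that unfolding only_def by (metis IntI empty_iff in_keys_iff subsetD)
    have 2: "Poly_Mapping.lookup a i = 0" if "i \<in> J" for i
      using ab assms(3,4) that unfolding only_def by (metis IntI empty_iff in_keys_iff subsetD)
    have "?p (I \<union> J) (a + b) = ?p I (a + b) * ?p J (a + b)"
      using assms by (intro prod.union_disjoint)
    also have "?p I (a + b) = ?p I a" by (rule prod.cong) (auto simp: lookup_add 1)
    also have "?p J (a + b) = ?p J b" by (rule prod.cong) (auto simp: lookup_add 2)
    finally show "of_int (Poly_Mapping.lookup f a * Poly_Mapping.lookup g b) * ?p (I \<union> J) (a + b) =
      (of_int (Poly_Mapping.lookup f a) * ?p I a) * (of_int (Poly_Mapping.lookup g b) * ?p J b)"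
      by (simp add: algebra_simps)
  qed
  also have "\<dots> = kap I c f * kap J c g"
    by (simp add: kap_def lin_def sum_product)
  finally show ?thesis .
qed

text \<open>The factor of a pair \<open>(i, j)\<close> outside the root ideal; see \<open>Katalan_eq_kap\<close>.\<close>

definition nrt :: "nat \<times> nat \<Rightarrow> laurent" where
  "nrt = (\<lambda>(i, j). 1 - zp i 1 * zp j (-1))"

section \<open>Straightening relations for two rows of equal rank\<close>

lemma psw_nrt: "psw j q (nrt (x, y)) = nrt (transpose j q x, transpose j q y)"
  by (simp add: nrt_def psw_diff psw_mult)

lemma psw_nrt_prod:
  assumes "\<And>x y. (x, y) \<in> N \<Longrightarrow> (transpose j q x, transpose j q y) \<in> N"
  shows "psw j q (prod nrt N) = prod nrt N"
  unfolding psw_prod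
  by (rule prod.reindex_bij_witness[of _ "map_prod (transpose j q) (transpose j q)"
        "map_prod (transpose j q) (transpose j q)"]) (auto simp: psw_nrt assms)

text \<open>Because (1 - z_j/z_q) z_q = z_q - z_j is antisymmetric in the two rows. The relations
  below use the same mechanism with other multipliers.\<close>

lemma kap_pair_Z:
  assumes "finite I" "j \<in> I" "q \<in> I" "c j = c q" "j \<noteq> q" "psw j q S = S"
  shows "kap I c (nrt (j, q) * zp q 1 * S) = 0"
proof (rule kap_antisym[OF assms(1-4)])
  have "nrt (j, q) * zp q 1 = zp q 1 - zp j 1"
    by (simp add: nrt_def left_diff_distrib mult.assoc)
  then show "psw j q (nrt (j, q) * zp q 1 * S) = - (nrt (j, q) * zp q 1 * S)"
    by (simp only:) (simp add: psw_mult psw_diff assms(6) algebra_simps)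
qed

lemma kap_pair_inv:
  assumes "finite I" "j \<in> I" "q \<in> I" "c j = c q" "j \<noteq> q" "psw j q S = S"
  shows "kap I c (nrt (j, q) * zp j (-1) * S) = 0"
proof (rule kap_antisym[OF assms(1-4)])
  have "nrt (j, q) * zp j (-1) = zp j (-1) - zp q (-1) * (zp j 1 * zp j (-1))"
    by (simp add: nrt_def algebra_simps del: zp_cancel)
  then have "nrt (j, q) * zp j (-1) = zp j (-1) - zp q (-1)" by simp
  then show "psw j q (nrt (j, q) * zp j (-1) * S) = - (nrt (j, q) * zp j (-1) * S)"
    by (simp only:) (simp add: psw_mult psw_diff assms(6) algebra_simps)
qed

text \<open>Because (1 - z_j/z_q) (z_q/z_j + 1) = z_q/z_j - z_j/z_q is antisymmetric, the ratio
  z_q/z_j acts as -1.\<close>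

lemma kap_pair_ratio:
  assumes "finite I" "j \<in> I" "q \<in> I" "c j = c q" "j \<noteq> q" "psw j q S = S"
  shows "kap I c (nrt (j, q) * (zp q 1 * zp j (-1)) * S) = - kap I c (nrt (j, q) * S)"
proof -
  have "nrt (j, q) * (zp q 1 * zp j (-1) + 1) =
      zp q 1 * zp j (-1) + 1 - (zp j 1 * zp j (-1)) * (zp q 1 * zp q (-1)) - zp j 1 * zp q (-1)"
    by (simp add: nrt_def algebra_simps del: zp_cancel)
  then have *: "nrt (j, q) * (zp q 1 * zp j (-1) + 1) = zp q 1 * zp j (-1) - zp j 1 * zp q (-1)"
    by simp
  have "kap I c (nrt (j, q) * (zp q 1 * zp j (-1) + 1) * S) = 0"
  proof (rule kap_antisym[OF assms(1-4)])
    show "psw j q (nrt (j, q) * (zp q 1 * zp j (-1) + 1) * S) =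
        - (nrt (j, q) * (zp q 1 * zp j (-1) + 1) * S)"
      unfolding * by (simp add: psw_mult psw_diff assms(6) algebra_simps)
  qed
  then have "kap I c (nrt (j, q) * (zp q 1 * zp j (-1)) * S) + kap I c (nrt (j, q) * S) = 0"
    by (simp add: kap_add[symmetric] algebra_simps)
  then show ?thesis by (simp add: eq_neg_iff_add_eq_0)
qed

text \<open>The part with X/z_j vanishes by \<open>kap_pair_inv\<close>. With X = z_i the lemma
  deletes the pair (i, j), that is, moves it into the ideal.\<close>

lemma kap_drop:
  assumes "finite I" "j \<in> I" "q \<in> I" "c j = c q" "j \<noteq> q" "psw j q S = S" "psw j q X = X"
  shows "kap I c (nrt (j, q) * (1 - X * zp j (-1)) * S) = kap I c (nrt (j, q) * S)"
proof -
  have "nrt (j, q) * (1 - X * zp j (-1)) * S = nrt (j, q) * S - nrt (j, q) * zp j (-1) * (X * S)"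
    by (simp add: algebra_simps)
  moreover have "kap I c (nrt (j, q) * zp j (-1) * (X * S)) = 0"
    by (rule kap_pair_inv[OF assms(1-5)]) (simp add: psw_mult assms)
  ultimately show ?thesis by (simp add: kap_diff)
qed

text \<open>Expanding, z_q and X/z_j die, -X z_q/z_j becomes X, and -1 stays. With X = z_i this
  carries the factor z_q - 1 to row i and deletes the pair (i, j) on the way.\<close>

lemma kap_slide:
  assumes "finite I" "j \<in> I" "q \<in> I" "c j = c q" "j \<noteq> q" "psw j q S = S" "psw j q X = X"
  shows "kap I c (nrt (j, q) * (1 - X * zp j (-1)) * ((zp q 1 - 1) * S)) =
    kap I c (nrt (j, q) * ((X - 1) * S))"
proof -
  have "nrt (j, q) * (1 - X * zp j (-1)) * ((zp q 1 - 1) * S) =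
      nrt (j, q) * zp q 1 * S - nrt (j, q) * (zp q 1 * zp j (-1)) * (X * S)
      - nrt (j, q) * S + nrt (j, q) * zp j (-1) * (X * S)"
    by (simp add: algebra_simps)
  moreover have XS: "psw j q (X * S) = X * S" by (simp add: psw_mult assms)
  ultimately have "kap I c (nrt (j, q) * (1 - X * zp j (-1)) * ((zp q 1 - 1) * S)) =
      kap I c (nrt (j, q) * (X * S)) - kap I c (nrt (j, q) * S)"
    using kap_pair_Z[OF assms(1-6)] kap_pair_ratio[OF assms(1-5) XS] kap_pair_inv[OF assms(1-5) XS]
    by (simp add: kap_add kap_diff)
  then show ?thesis by (simp add: kap_diff[symmetric] algebra_simps)
qed

section \<open>Row data of a bounded partition\<close>

text \<open>A partition \<open>\<mu>\<close> with parts at most \<open>k = K - 1\<close> is encoded by \<open>b i = i + K - \<mu> i\<close>, the first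
  column of a root of \<open>\<Delta>\<close> in row \<open>i\<close>; rows beyond \<open>n\<close> are zero.\<close>

definition rowfun :: "nat \<Rightarrow> nat \<Rightarrow> (nat \<Rightarrow> nat) \<Rightarrow> bool" where
  "rowfun K n b \<longleftrightarrow> 2 \<le> K \<and> (\<forall>i\<ge>1. i < b i \<and> b i \<le> i + K) \<and> (\<forall>i\<ge>1. \<forall>j>i. b i < b j) \<and>
     (\<forall>i>n. b i = i + K)"

lemma rowfunD:
  assumes "rowfun K n b"
  shows "2 \<le> K" "1 \<le> i \<Longrightarrow> i < b i" "1 \<le> i \<Longrightarrow> b i \<le> i + K" "1 \<le> i \<Longrightarrow> i < j \<Longrightarrow> b i < b j"
    "n < i \<Longrightarrow> b i = i + K"
  using assms by (auto simp: rowfun_def)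

lemma rowfun_inj:
  assumes "rowfun K n b" "1 \<le> i" "1 \<le> j" "b i = b j" shows "i = j"
  using rowfunD(4)[OF assms(1)] assms(2-) by (metis less_irrefl nat_neq_iff)

lemma rowfun_less:
  assumes "rowfun K n b" "1 \<le> i" "1 \<le> j" "b i < b j" shows "i < j"
  using rowfunD(4)[OF assms(1)] assms(2-) by (metis less_asym less_irrefl nat_neq_iff)

lemma rowfun_mono: "rowfun K n b \<Longrightarrow> n \<le> m \<Longrightarrow> rowfun K m b"
  by (auto simp: rowfun_def)

section \<open>Pairs outside the ideal, and ranks\<close>

definition NR :: "nat \<Rightarrow> (nat \<Rightarrow> nat) \<Rightarrow> (nat \<times> nat) set" where
  "NR l b = {(i, j). 1 \<le> i \<and> i < j \<and> j \<le> l \<and> j < b i}"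

lemma finite_NR [simp]: "finite (NR l b)"
  by (rule finite_subset[of _ "{..l} \<times> {..l}"]) (auto simp: NR_def)

text \<open>The rank of row j, that is j - 1 minus the multiplicity of j in the multiset of the
  Katalan function, counted through the complementary pairs; see
  \<open>kSchur_eq_GG\<close>.\<close>

definition cc :: "(nat \<Rightarrow> nat) \<Rightarrow> nat \<Rightarrow> int" where
  "cc b j = int (card {i. 1 \<le> i \<and> i < j \<and> j \<le> b i})"

definition ZM :: "nat \<Rightarrow> nat \<Rightarrow> (nat \<Rightarrow> nat) \<Rightarrow> laurent" where
  "ZM K l b = (\<Prod>i\<in>{1..l}. zp i (int i + int K - int (b i)))"

text \<open>\<open>R\<close> collects the pairs that straightening has deleted, \<open>P\<close> the
  factors not yet processed. The Katalan function itself is the case of empty \<open>R\<close> and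
  \<open>P = 1\<close>.\<close>

definition GG :: "nat \<Rightarrow> nat \<Rightarrow> (nat \<Rightarrow> nat) \<Rightarrow> (nat \<times> nat) set \<Rightarrow> laurent \<Rightarrow> symf" where
  "GG K l b R P = kap {1..l} (cc b) (prod nrt (NR l b - R) * ZM K l b * P)"

text \<open>Passing from q to q + 1 gains row q and loses the row that ends at q, if there is one.
  So the ranks of rows q and q + 1 agree exactly when some row ends at q.\<close>

lemma cc_Suc:
  assumes "rowfun K n b" "1 \<le> q"
  shows "cc b (Suc q) = cc b q + (if \<exists>x\<ge>1. b x = q then 0 else 1)"
proof -
  let ?A = "\<lambda>j. {i. 1 \<le> i \<and> i < j \<and> j \<le> b i}"
  have fin: "finite (?A j)" for j by (rule finite_subset[of _ "{..j}"]) auto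
  have q: "q < b q" using rowfunD(2)[OF assms(1)] assms(2) by auto
  show ?thesis
  proof (cases "\<exists>x\<ge>1. b x = q")
    case True
    then obtain x where x: "1 \<le> x" "b x = q" by auto
    then have xq: "x < q" using rowfunD(2)[OF assms(1)] by auto
    have bi: "b i = q \<longleftrightarrow> i = x" if "1 \<le> i" for i
      using rowfun_inj[OF assms(1) x(1) that] x by metis
    have "i \<in> ?A (Suc q) \<longleftrightarrow> i \<in> insert q (?A q - {x})" for i
    proof (cases "i = q")
      case False
      have "Suc q \<le> b i \<longleftrightarrow> q \<le> b i \<and> b i \<noteq> q" by linarith
      then show ?thesis using False bi[of i] by auto
    qed (use q assms(2) in simp)
    then have "?A (Suc q) = insert q (?A q - {x})" by blast
    moreover have "card (?A q) = Suc (card (?A q - {x}))"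
      by (rule card.remove[OF fin]) (use x xq in auto)
    moreover have "card (insert q (?A q - {x})) = Suc (card (?A q - {x}))"
      by (rule card_insert_disjoint) (use fin[of q] in auto)
    ultimately have "card (?A (Suc q)) = card (?A q)" by metis
    then show ?thesis using True by (simp add: cc_def)
  next
    case False
    have "i \<in> ?A (Suc q) \<longleftrightarrow> i \<in> insert q (?A q)" for i
    proof (cases "i = q")
      case f: False
      have "Suc q \<le> b i \<longleftrightarrow> q \<le> b i \<and> b i \<noteq> q" by linarith
      then show ?thesis using False f by auto
    qed (use q assms(2) in simp)
    then have "?A (Suc q) = insert q (?A q)" by blast
    then have "card (?A (Suc q)) = Suc (card (?A q))" using fin[of q] by simp
    then show ?thesis using False by (simp add: cc_def)
  qed
qed

section \<open>Symmetry of two equal adjacent rows\<close>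

lemma prod_nrt_remove: "finite N \<Longrightarrow> p \<in> N \<Longrightarrow> prod nrt N = nrt p * prod nrt (N - {p})"
  by (rule prod.remove)

text \<open>Rows q and q + 1 have equal parts, and the pair (q, q + 1) lies outside the
  ideal.\<close>

definition good :: "(nat \<Rightarrow> nat) \<Rightarrow> nat \<Rightarrow> bool" where
  "good b q \<longleftrightarrow> 1 \<le> q \<and> b (Suc q) = Suc (b q) \<and> Suc q < b q"

text \<open>Row q + 1 has one column more outside the ideal than row q needs for symmetry, namely
  \<open>b q\<close>; it must have been deleted. All other deleted pairs stay away from the rows and
  columns q and q + 1.\<close>

definition clean :: "nat \<Rightarrow> (nat \<Rightarrow> nat) \<Rightarrow> nat \<Rightarrow> (nat \<times> nat) set \<Rightarrow> bool" where
  "clean l b q R \<longleftrightarrow> (b q \<le> l \<longrightarrow> (Suc q, b q) \<in> R) \<and>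
     (\<forall>(u, v)\<in>R. u = Suc q \<and> v = b q \<or> Suc q < u \<and> Suc q < v)"

text \<open>The symmetric remainder. The pair (q, q + 1) is split off because it supplies the
  antisymmetry, and (i, q) because its mirror image (i, q + 1) already belongs to the ideal when row
  i ends at q + 1.\<close>

definition core_nr :: "nat \<Rightarrow> (nat \<Rightarrow> nat) \<Rightarrow> nat \<Rightarrow> (nat \<times> nat) set \<Rightarrow> (nat \<times> nat) set" where
  "core_nr l b q R = NR l b - R - {(q, Suc q)} - {(i, q) | i. 1 \<le> i \<and> b i = Suc q}"

lemma transpose_Suc: "transpose q (Suc q) i = (if i = q then Suc q else if i = Suc q then q else i)"
  by (auto simp: transpose_def)

lemma psw_core:
  assumes b: "rowfun K n b" and g: "good b q" and l: "Suc q \<le> l" and R: "clean l b q R"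
  shows "psw q (Suc q) (prod nrt (core_nr l b q R)) = prod nrt (core_nr l b q R)"
proof (rule psw_nrt_prod)
  fix u v assume uv: "(u, v) \<in> core_nr l b q R"
  have bs: "b (Suc q) = Suc (b q)" "1 \<le> q" "Suc q < b q" using g by (auto simp: good_def)
  have N: "1 \<le> u" "u < v" "v \<le> l" "v < b u" "(u, v) \<notin> R" "(u, v) \<noteq> (q, Suc q)"
    "v = q \<Longrightarrow> b u \<noteq> Suc q"
    using uv by (auto simp: core_nr_def NR_def)
  have R1: "(x, y) \<in> R \<Longrightarrow> x = Suc q \<and> y = b q \<or> Suc q < x \<and> Suc q < y" for x y
    using R by (auto simp: clean_def)
  have R2: "b q \<le> l \<Longrightarrow> (Suc q, b q) \<in> R" using R by (auto simp: clean_def)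
  consider "u = q" "v \<noteq> q" "v \<noteq> Suc q" | "u = Suc q" "v \<noteq> q" "v \<noteq> Suc q"
    | "v = q" "u \<noteq> q" "u \<noteq> Suc q" | "v = Suc q" "u \<noteq> q" "u \<noteq> Suc q"
    | "u \<noteq> q" "u \<noteq> Suc q" "v \<noteq> q" "v \<noteq> Suc q"
    using N by (metis Suc_n_not_le_n less_imp_le_nat nat_neq_iff)
  then show "(transpose q (Suc q) u, transpose q (Suc q) v) \<in> core_nr l b q R"
  proof cases
    case 1
    have "(Suc q, v) \<notin> R" using R1[of "Suc q" v] N 1 by auto
    then show ?thesis using 1 N bs by (auto simp: transpose_Suc core_nr_def NR_def)
  next
    case 2
    have "(q, v) \<notin> R" using R1[of q v] by auto
    moreover have "v \<noteq> b q" using R2 N 2 by auto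
    ultimately show ?thesis using 2 N bs by (auto simp: transpose_Suc core_nr_def NR_def)
  next
    case 3
    have "(u, Suc q) \<notin> R" using R1[of u "Suc q"] N 3 by auto
    then show ?thesis using 3 N bs l by (auto simp: transpose_Suc core_nr_def NR_def)
  next
    case 4
    have "(u, q) \<notin> R" using R1[of u q] N 4 by auto
    then show ?thesis using 4 N bs by (auto simp: transpose_Suc core_nr_def NR_def)
  next
    case 5
    then show ?thesis using uv by (simp add: transpose_Suc)
  qed
qed

lemma psw_ZM:
  assumes "good b q" "Suc q \<le> l"
  shows "psw q (Suc q) (ZM K l b) = ZM K l b"
  unfolding ZM_def psw_prod
  by (rule prod.reindex_bij_witness[of _ "transpose q (Suc q)" "transpose q (Suc q)"])
    (use assms in \<open>auto simp: transpose_Suc good_def algebra_simps\<close>)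

lemma psw_only:
  assumes "only I f" "j \<notin> I" "q \<notin> I" shows "psw j q f = f"
proof -
  have "Poly_Mapping.map_key (transpose j q) \<gamma> = \<gamma>" if "\<gamma> \<in> Poly_Mapping.keys f" for \<gamma>
  proof (rule poly_mapping_eqI)
    fix i
    have "Poly_Mapping.lookup \<gamma> j = 0" "Poly_Mapping.lookup \<gamma> q = 0"
      using that assms unfolding only_def by (metis in_keys_iff subsetD)+
    then show "Poly_Mapping.lookup (Poly_Mapping.map_key (transpose j q) \<gamma>) i = Poly_Mapping.lookup \<gamma> i"
      by (auto simp: map_key.rep_eq inj_transpose transpose_def)
  qed
  then have "psw j q f = (\<Sum>a\<in>Poly_Mapping.keys f. of_int (Poly_Mapping.lookup f a) * Poly_Mapping.single a 1)"
    unfolding psw_def lin_def by (intro sum.cong) auto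
  also have "\<dots> = (\<Sum>a\<in>Poly_Mapping.keys f. Poly_Mapping.single a (Poly_Mapping.lookup f a))"
    by (intro sum.cong) (simp_all add: single_of_int[symmetric] mult_single del: single_of_int)
  finally show ?thesis by (simp add: pm_sum_singles)
qed

text \<open>Since \<open>b\<close> is injective, at most one row i ends at q + 1, so at most one
  factor besides that of (q, q + 1) breaks the symmetry.\<close>

lemma NR_split_pair:
  assumes b: "rowfun K n b" and g: "good b q" and l: "Suc q \<le> l" and R: "clean l b q R"
  shows "(\<And>x. 1 \<le> x \<Longrightarrow> b x \<noteq> Suc q) \<Longrightarrow>
      prod nrt (NR l b - R) = nrt (q, Suc q) * prod nrt (core_nr l b q R)"
    and "1 \<le> i \<Longrightarrow> b i = Suc q \<Longrightarrow>
      prod nrt (NR l b - R) = nrt (q, Suc q) * (1 - zp i 1 * zp q (-1)) * prod nrt (core_nr l b q R)"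
    and "1 \<le> i \<Longrightarrow> b i = Suc q \<Longrightarrow> i < q"
    and "1 \<le> i \<Longrightarrow> b i = Suc q \<Longrightarrow>
      prod nrt (NR l b - insert (i, q) R) = nrt (q, Suc q) * prod nrt (core_nr l b q R)"
proof -
  have qq: "(q, Suc q) \<in> NR l b - R"
    using g l R by (auto simp: NR_def good_def clean_def)
  show "prod nrt (NR l b - R) = nrt (q, Suc q) * prod nrt (core_nr l b q R)"
    if "\<And>x. 1 \<le> x \<Longrightarrow> b x \<noteq> Suc q"
  proof -
    have "core_nr l b q R = NR l b - R - {(q, Suc q)}" using that by (auto simp: core_nr_def)
    then show ?thesis using prod_nrt_remove[OF _ qq] by simp
  qed
  assume i: "1 \<le> i" "b i = Suc q"
  show iq: "i < q"
    using rowfunD(2)[OF b i(1)] i g by (auto simp: good_def less_Suc_eq)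
  have core: "core_nr l b q R = NR l b - R - {(q, Suc q)} - {(i, q)}"
  proof -
    have "u = i" if "1 \<le> u" "b u = Suc q" for u
      using rowfun_inj[OF b i(1) that(1)] that(2) i(2) by metis
    then have "{(u, q) | u. 1 \<le> u \<and> b u = Suc q} = {(i, q)}" using i by blast
    then show ?thesis by (simp only: core_nr_def)
  qed
  have iN: "(i, q) \<in> NR l b - R - {(q, Suc q)}"
    using i iq l R by (auto simp: NR_def clean_def)
  show "prod nrt (NR l b - R) = nrt (q, Suc q) * (1 - zp i 1 * zp q (-1)) * prod nrt (core_nr l b q R)"
  proof -
    have "prod nrt (NR l b - R) = nrt (q, Suc q) * prod nrt (NR l b - R - {(q, Suc q)})"
      by (rule prod_nrt_remove[OF _ qq]) simp
    moreover have "prod nrt (NR l b - R - {(q, Suc q)}) = nrt (i, q) * prod nrt (core_nr l b q R)"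
      unfolding core by (rule prod_nrt_remove[OF _ iN]) simp
    moreover have "nrt (i, q) = 1 - zp i 1 * zp q (-1)" by (simp add: nrt_def)
    ultimately show ?thesis by (simp only: mult.assoc)
  qed
  have "(q, Suc q) \<in> NR l b - insert (i, q) R" using qq iq by auto
  moreover have "core_nr l b q R = NR l b - insert (i, q) R - {(q, Suc q)}"
    unfolding core by auto
  ultimately show "prod nrt (NR l b - insert (i, q) R) = nrt (q, Suc q) * prod nrt (core_nr l b q R)"
    using prod_nrt_remove[of "NR l b - insert (i, q) R" "(q, Suc q)"] by simp
qed

text \<open>Row x ends at q, so the ranks of q and q + 1 agree; row x + 1 ends at q + 1, so (x + 1,
  q) is the asymmetric pair, and \<open>kap_drop\<close> and \<open>kap_slide\<close> apply with X =
  z_{x+1}. The deleted pair is (x + 1, b x), exactly what \<open>clean\<close> requires of the rows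
  x and x + 1.\<close>

lemma GG_slide:
  assumes b: "rowfun K n b" and g: "good b q" and l: "Suc q \<le> l" and R: "clean l b q R"
    and x: "1 \<le> x" "b x = q" "b (Suc x) = Suc q" and P: "psw q (Suc q) P = P"
  shows "GG K l b R P = GG K l b (insert (Suc x, q) R) P"
    and "GG K l b R ((zp (Suc q) 1 - 1) * P) = GG K l b (insert (Suc x, q) R) ((zp (Suc x) 1 - 1) * P)"
    and "good b x" and "clean l b x (insert (Suc x, q) R)"
proof -
  have c: "cc b q = cc b (Suc q)" using cc_Suc[OF b, of q] x g by (auto simp: good_def)
  have sx: "Suc x < q" using NR_split_pair(3)[OF b g l R, of "Suc x"] x by simp
  define S where "S = prod nrt (core_nr l b q R) * ZM K l b * P"
  have S: "psw q (Suc q) S = S"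
    unfolding S_def using psw_core[OF b g l R] psw_ZM[OF g l] P by (simp add: psw_mult)
  have X: "psw q (Suc q) (zp (Suc x) 1) = zp (Suc x) 1" using sx by (simp add: transpose_Suc)
  have q: "q \<in> {1..l}" "Suc q \<in> {1..l}" using g l by (auto simp: good_def)
  have e1: "prod nrt (NR l b - R) * ZM K l b * P =
      nrt (q, Suc q) * (1 - zp (Suc x) 1 * zp q (-1)) * S"
    using NR_split_pair(2)[OF b g l R, of "Suc x"] x by (simp add: S_def mult_ac)
  have e2: "prod nrt (NR l b - insert (Suc x, q) R) * ZM K l b * P = nrt (q, Suc q) * S"
    using NR_split_pair(4)[OF b g l R, of "Suc x"] x by (simp add: S_def mult_ac)
  show "GG K l b R P = GG K l b (insert (Suc x, q) R) P"
    unfolding GG_def e1 e2 by (rule kap_drop[OF _ q c _ S X]) auto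
  have e3: "prod nrt (NR l b - R) * ZM K l b * ((zp (Suc q) 1 - 1) * P) =
      nrt (q, Suc q) * (1 - zp (Suc x) 1 * zp q (-1)) * ((zp (Suc q) 1 - 1) * S)"
    using e1 by (simp add: mult_ac)
  have e4: "prod nrt (NR l b - insert (Suc x, q) R) * ZM K l b * ((zp (Suc x) 1 - 1) * P) =
      nrt (q, Suc q) * ((zp (Suc x) 1 - 1) * S)"
    using e2 by (simp add: mult_ac)
  show "GG K l b R ((zp (Suc q) 1 - 1) * P) = GG K l b (insert (Suc x, q) R) ((zp (Suc x) 1 - 1) * P)"
    unfolding GG_def e3 e4 by (rule kap_slide[OF _ q c _ S X]) auto
  show "good b x" using x sx by (auto simp: good_def)
  show "clean l b x (insert (Suc x, q) R)"
    using R x sx g by (auto simp: clean_def good_def)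
qed

lemma kap_vZ:
  assumes "finite I" "j \<in> I"
  shows "kap I c ((zp j 1 - 1) * f) = kap I (c(j := c j - 1)) (zp j 1 * f)"
proof -
  have "zp j 1 - 1 = (1 - zp j (-1)) * zp j 1"
    by (simp add: left_diff_distrib)
  then show ?thesis by (simp only: mult.assoc kap_v[OF assms])
qed

text \<open>No row ends at q, so the rank of row q + 1 is larger by one. As z - 1 = (1 - 1/z) z, the
  factor lowers it; the two rows then have equal rank and \<open>kap_pair_Z\<close> applies.\<close>

lemma GG_tie:
  assumes b: "rowfun K n b" and g: "good b q" and l: "Suc q \<le> l" and R: "clean l b q R"
    and x: "\<And>x. 1 \<le> x \<Longrightarrow> b x \<noteq> q" "\<And>x. 1 \<le> x \<Longrightarrow> b x \<noteq> Suc q" and P: "psw q (Suc q) P = P"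
  shows "GG K l b R ((zp (Suc q) 1 - 1) * P) = 0"
proof -
  have c: "cc b (Suc q) = cc b q + 1" using cc_Suc[OF b, of q] x g by (auto simp: good_def)
  define S where "S = prod nrt (core_nr l b q R) * ZM K l b * P"
  have S: "psw q (Suc q) S = S"
    unfolding S_def using psw_core[OF b g l R] psw_ZM[OF g l] P by (simp add: psw_mult)
  have q: "q \<in> {1..l}" "Suc q \<in> {1..l}" using g l by (auto simp: good_def)
  have "prod nrt (NR l b - R) * ZM K l b * P = nrt (q, Suc q) * S"
    using NR_split_pair(1)[OF b g l R] x by (simp add: S_def mult_ac)
  then have e: "prod nrt (NR l b - R) * ZM K l b * ((zp (Suc q) 1 - 1) * P) =
      (zp (Suc q) 1 - 1) * (nrt (q, Suc q) * S)"
    by (simp add: mult_ac)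
  have "GG K l b R ((zp (Suc q) 1 - 1) * P) =
      kap {1..l} ((cc b)(Suc q := cc b (Suc q) - 1)) (zp (Suc q) 1 * (nrt (q, Suc q) * S))"
    unfolding GG_def e by (rule kap_vZ[OF finite_atLeastAtMost q(2)])
  also have "zp (Suc q) 1 * (nrt (q, Suc q) * S) = nrt (q, Suc q) * zp (Suc q) 1 * S"
    by (simp add: mult_ac)
  also have "kap {1..l} ((cc b)(Suc q := cc b (Suc q) - 1)) \<dots> = 0"
    by (rule kap_pair_Z[OF _ q _ _ S]) (auto simp: c)
  finally show ?thesis .
qed

text \<open>Here the ranks agree and nothing breaks the symmetry, so z_{q+1} contributes 0 and only
  -1 survives.\<close>

lemma GG_down:
  assumes b: "rowfun K n b" and g: "good b q" and l: "Suc q \<le> l" and R: "clean l b q R"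
    and x: "1 \<le> i" "b i = q" "\<And>x. 1 \<le> x \<Longrightarrow> b x \<noteq> Suc q" and P: "psw q (Suc q) P = P"
  shows "GG K l b R ((zp (Suc q) 1 - 1) * P) = - GG K l b R P"
proof -
  have c: "cc b q = cc b (Suc q)" using cc_Suc[OF b, of q] x g by (auto simp: good_def)
  define S where "S = prod nrt (core_nr l b q R) * ZM K l b * P"
  have S: "psw q (Suc q) S = S"
    unfolding S_def using psw_core[OF b g l R] psw_ZM[OF g l] P by (simp add: psw_mult)
  have q: "q \<in> {1..l}" "Suc q \<in> {1..l}" using g l by (auto simp: good_def)
  have e: "prod nrt (NR l b - R) * ZM K l b * P = nrt (q, Suc q) * S"
    using NR_split_pair(1)[OF b g l R] x by (simp add: S_def mult_ac)
  then have "prod nrt (NR l b - R) * ZM K l b * ((zp (Suc q) 1 - 1) * P) =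
      nrt (q, Suc q) * zp (Suc q) 1 * S - nrt (q, Suc q) * S"
    by (simp add: algebra_simps)
  moreover have "kap {1..l} (cc b) (nrt (q, Suc q) * zp (Suc q) 1 * S) = 0"
    by (rule kap_pair_Z[OF _ q c _ S]) auto
  ultimately show ?thesis unfolding GG_def e by (simp add: kap_diff)
qed

lemma cc_upd:
  assumes "b i = Suc q" "1 \<le> i" "i < q"
  shows "cc (b(i := q)) = (cc b)(Suc q := cc b (Suc q) - 1)"
proof
  fix j :: nat
  let ?A = "\<lambda>b. {i. 1 \<le> i \<and> i < j \<and> j \<le> b i}"
  show "cc (b(i := q)) j = ((cc b)(Suc q := cc b (Suc q) - 1)) j"
  proof (cases "j = Suc q")
    case True
    have "?A (b(i := q)) = ?A b - {i}" "i \<in> ?A b" using assms True by auto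
    moreover have "finite (?A b)" by (rule finite_subset[of _ "{..j}"]) auto
    ultimately have "card (?A b) = Suc (card (?A (b(i := q))))"
      by (metis card.remove)
    then show ?thesis using True by (simp add: cc_def)
  next
    case False
    then have "?A (b(i := q)) = ?A b" using assms by auto
    then show ?thesis using False by (simp add: cc_def)
  qed
qed

text \<open>After the rank of row q + 1 is lowered, the term z_{q+1} dies and -(z_i/z_q) z_{q+1}
  becomes z_i, a new box in row i. The lowered rank and the missing pair (i, q) are those of
  \<open>b(i := q)\<close>.\<close>

lemma GG_up:
  assumes b: "rowfun K n b" and g: "good b q" and l: "Suc q \<le> l" and R: "clean l b q R"
    and x: "1 \<le> i" "b i = Suc q" "\<And>x. 1 \<le> x \<Longrightarrow> b x \<noteq> q" and P: "psw q (Suc q) P = P"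
  shows "GG K l b R ((zp (Suc q) 1 - 1) * P) = GG K l (b(i := q)) R P"
proof -
  have c: "cc b (Suc q) = cc b q + 1" using cc_Suc[OF b, of q] x g by (auto simp: good_def)
  have iq: "i < q" using NR_split_pair(3)[OF b g l R x(1,2)] .
  define S where "S = prod nrt (core_nr l b q R) * ZM K l b * P"
  define c' where "c' = (cc b)(Suc q := cc b (Suc q) - 1)"
  have c': "c' q = c' (Suc q)" by (simp add: c'_def c)
  have S: "psw q (Suc q) S = S"
    unfolding S_def using psw_core[OF b g l R] psw_ZM[OF g l] P by (simp add: psw_mult)
  have iS: "psw q (Suc q) (zp i 1 * S) = zp i 1 * S" using iq by (simp add: psw_mult S transpose_Suc)
  have q: "q \<in> {1..l}" "Suc q \<in> {1..l}" using g l by (auto simp: good_def)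
  have "prod nrt (NR l b - R) * ZM K l b * P = nrt (q, Suc q) * (1 - zp i 1 * zp q (-1)) * S"
    using NR_split_pair(2)[OF b g l R x(1,2)] by (simp add: S_def mult_ac)
  then have e: "prod nrt (NR l b - R) * ZM K l b * ((zp (Suc q) 1 - 1) * P) =
      (zp (Suc q) 1 - 1) * (nrt (q, Suc q) * (1 - zp i 1 * zp q (-1)) * S)"
    by (simp add: mult_ac)
  have "GG K l b R ((zp (Suc q) 1 - 1) * P) =
      kap {1..l} c' (zp (Suc q) 1 * (nrt (q, Suc q) * (1 - zp i 1 * zp q (-1)) * S))"
    unfolding GG_def e c'_def by (rule kap_vZ[OF finite_atLeastAtMost q(2)])
  also have "zp (Suc q) 1 * (nrt (q, Suc q) * (1 - zp i 1 * zp q (-1)) * S) =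
      nrt (q, Suc q) * zp (Suc q) 1 * S - nrt (q, Suc q) * (zp (Suc q) 1 * zp q (-1)) * (zp i 1 * S)"
    by (simp add: algebra_simps)
  also have "kap {1..l} c' \<dots> = kap {1..l} c' (nrt (q, Suc q) * (zp i 1 * S))"
    using kap_pair_Z[where I = "{1..l}", OF _ q c' _ S] kap_pair_ratio[where I = "{1..l}", OF _ q c' _ iS]
    by (simp add: kap_diff)
  also have "nrt (q, Suc q) * (zp i 1 * S) = prod nrt (NR l (b(i := q)) - R) * ZM K l (b(i := q)) * P"
  proof -
    have "(i, q) \<notin> R" using R iq by (auto simp: clean_def)
    have "NR l (b(i := q)) - R = NR l b - insert (i, q) R"
      using x(2) by (auto simp: NR_def split: if_splits)
    then have 1: "prod nrt (NR l (b(i := q)) - R) = nrt (q, Suc q) * prod nrt (core_nr l b q R)"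
      using NR_split_pair(4)[OF b g l R x(1,2)] by simp
    have i: "i \<in> {1..l}" using x iq l by auto
    have "ZM K l (b(i := q)) = zp i (int i + int K - int q) *
        (\<Prod>j\<in>{1..l} - {i}. zp j (int j + int K - int (b j)))"
      unfolding ZM_def by (subst prod.remove[OF _ i]) (auto intro!: prod.cong)
    also have "zp i (int i + int K - int q) = zp i 1 * zp i (int i + int K - int (b i))"
      by (simp add: zp_add x(2) algebra_simps)
    finally have "ZM K l (b(i := q)) = zp i 1 * ZM K l b"
      unfolding ZM_def by (subst (2) prod.remove[OF _ i]) (auto simp: mult_ac)
    then show ?thesis by (simp add: 1 S_def mult_ac)
  qed
  finally show ?thesis unfolding GG_def c'_def cc_upd[of b i q, OF x(2,1) iq] .
qed

section \<open>Tracing a pair of adjacent rows upwards\<close>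

text \<open>The trace goes on only while both q and q + 1 are ends of rows; it stops as soon as one
  of them is not, and then \<open>GG_tie\<close>, \<open>GG_down\<close> or \<open>GG_up\<close>
  applies.\<close>

inductive reach :: "(nat \<Rightarrow> nat) \<Rightarrow> nat \<Rightarrow> (nat \<times> nat) set \<Rightarrow> nat \<Rightarrow> (nat \<times> nat) set \<Rightarrow> bool"
  for b q0 R0 where
  start: "reach b q0 R0 q0 R0"
| up: "reach b q0 R0 q R \<Longrightarrow> 1 \<le> x \<Longrightarrow> b x = q \<Longrightarrow> b (Suc x) = Suc q \<Longrightarrow>
    reach b q0 R0 x (insert (Suc x, q) R)"

lemma reach_le:
  assumes "rowfun K n b" "reach b q0 R0 q R" shows "q \<le> q0"
  using assms(2)
proof induction
  case (up q R x)
  then show ?case using rowfunD(2)[OF assms(1), of x] by simp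
qed simp

text \<open>A trace reads \<open>b\<close> only from its end point on, so a change in a higher row
  does not disturb it. This allows the comparison of a partition with the one obtained by adding a
  box.\<close>

lemma reach_upd:
  assumes "rowfun K n b" "reach b q0 R0 q R" "i < q"
  shows "reach (b(i := v)) q0 R0 q R"
  using assms(2,3)
proof induction
  case (up q R x)
  then have "x < q" using rowfunD(2)[OF assms(1), of x] by simp
  then show ?case using up by (intro reach.up) auto
qed (rule start)

lemma reach_top_ex:
  assumes b: "rowfun K n b"
  shows "\<exists>q R. reach b q0 R0 q R \<and> \<not> ((\<exists>x\<ge>1. b x = q) \<and> (\<exists>x\<ge>1. b x = Suc q))"
proof -
  have "\<exists>q' R'. reach b q0 R0 q' R' \<and> \<not> ((\<exists>x\<ge>1. b x = q') \<and> (\<exists>x\<ge>1. b x = Suc q'))"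
    if "reach b q0 R0 q R" for q R
    using that
  proof (induction q arbitrary: R rule: less_induct)
    case (less q)
    show ?case
    proof (cases "(\<exists>x\<ge>1. b x = q) \<and> (\<exists>x\<ge>1. b x = Suc q)")
      case True
      then obtain x y where xy: "1 \<le> x" "b x = q" "1 \<le> y" "b y = Suc q" by auto
      then have "x < y" using rowfun_less[OF b, of x y] by simp
      moreover have "\<not> Suc x < y" using rowfunD(4)[OF b, of "Suc x" y] rowfunD(4)[OF b, of x "Suc x"] xy by auto
      ultimately have "y = Suc x" by auto
      then have "reach b q0 R0 x (insert (Suc x, q) R)" using less.prems xy by (intro reach.up) auto
      moreover have "x < q" using rowfunD(2)[OF b, of x] xy by simp
      ultimately show ?thesis using less.IH by blast
    qed (use less.prems in blast)
  qed
  then show ?thesis using start by blast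
qed

lemma GG_reach:
  assumes b: "rowfun K n b" and r: "reach b q0 R0 q R" and g: "good b q0" and l: "Suc q0 \<le> l"
    and R: "clean l b q0 R0" and P: "\<And>q' R'. reach b q0 R0 q' R' \<Longrightarrow> psw q' (Suc q') P = P"
  shows "GG K l b R0 P = GG K l b R P \<and>
    GG K l b R0 ((zp (Suc q0) 1 - 1) * P) = GG K l b R ((zp (Suc q) 1 - 1) * P) \<and>
    good b q \<and> clean l b q R"
  using r
proof induction
  case (up q R x)
  have "Suc q \<le> l" using reach_le[OF b up(1)] l by simp
  then show ?case using GG_slide[OF b _ _ _ up(2-4) P[OF up(1)], of l R] up by metis
qed (use g R in auto)

text \<open>The number of times q can be pulled back along \<open>b\<close>. The guard
  \<open>x < q\<close> makes the recursion terminate for arbitrary \<open>b\<close>; for row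
  functions it is automatic.\<close>

function Lc :: "(nat \<Rightarrow> nat) \<Rightarrow> nat \<Rightarrow> nat" where
  "Lc b q = (if \<exists>x. 1 \<le> x \<and> x < q \<and> b x = q
             then Suc (Lc b (SOME x. 1 \<le> x \<and> x < q \<and> b x = q)) else 0)"
  by auto
termination
proof (relation "measure snd")
  fix b :: "nat \<Rightarrow> nat" and q
  assume "\<exists>x\<ge>1. x < q \<and> b x = q"
  from someI_ex[OF this] show "((b, SOME x. 1 \<le> x \<and> x < q \<and> b x = q), b, q) \<in> measure snd" by simp
qed simp

declare Lc.simps [simp del]

lemma Lc_pre:
  assumes b: "rowfun K n b" and x: "1 \<le> x"
  shows "Lc b (b x) = Suc (Lc b x)"
proof -
  have ex: "1 \<le> x \<and> x < b x \<and> b x = b x" using x rowfunD(2)[OF b x] by simp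
  have "(SOME y. 1 \<le> y \<and> y < b x \<and> b y = b x) = x"
    using ex rowfun_inj[OF b _ x] by (intro some_equality) auto
  moreover have "\<exists>y. 1 \<le> y \<and> y < b x \<and> b y = b x" using ex by blast
  ultimately show ?thesis by (subst Lc.simps) simp
qed

lemma Lc_top: "(\<And>x. 1 \<le> x \<Longrightarrow> b x \<noteq> q) \<Longrightarrow> Lc b q = 0"
  by (subst Lc.simps) auto

lemma Lc_pos:
  assumes "rowfun K n b" shows "0 < Lc b q \<longleftrightarrow> (\<exists>x\<ge>1. b x = q)"
  using Lc_pre[OF assms] Lc_top[of b q] by force

lemma reach_Lc:
  assumes b: "rowfun K n b" and r: "reach b q0 R0 q R"
  shows "\<exists>t. Lc b q0 = t + Lc b q \<and> Lc b (Suc q0) = t + Lc b (Suc q)"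
  using r
proof induction
  case (up q R x)
  then obtain t where "Lc b q0 = t + Lc b q" "Lc b (Suc q0) = t + Lc b (Suc q)" by auto
  moreover have "Lc b q = Suc (Lc b x)" "Lc b (Suc q) = Suc (Lc b (Suc x))"
    using Lc_pre[OF b, of x] Lc_pre[OF b, of "Suc x"] up by auto
  ultimately show ?case by (intro exI[of _ "Suc t"]) simp
qed simp

text \<open>Read backwards, the trace is an orbit of \<open>b\<close>, which continues through the
  zero rows in steps of \<open>K\<close>. All along it q and q + 1 move in parallel.\<close>

lemma reach_chain:
  assumes b: "rowfun K n b" and r: "reach b q0 R0 q R" and d: "n < q0"
  shows "(\<exists>s. q0 = (b ^^ s) q) \<and> (\<forall>t. b (Suc ((b ^^ t) q)) = Suc (b ((b ^^ t) q)))"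
  using r
proof induction
  case start
  have "(b ^^ t) q0 = q0 + t * K" for t
  proof (induction t)
    case (Suc t)
    then show ?case using rowfunD(5)[OF b, of "q0 + t * K"] d by simp
  qed simp
  then show ?case using rowfunD(5)[OF b] d by (auto intro!: exI[of _ 0])
next
  case (up q R x)
  then obtain s where "q0 = (b ^^ s) q" by auto
  then have "q0 = (b ^^ Suc s) x" using up by (simp add: funpow_Suc_right del: funpow.simps)
  moreover have "b (Suc ((b ^^ t) x)) = Suc (b ((b ^^ t) x))" for t
    using up by (cases t) (auto simp: funpow_Suc_right simp del: funpow.simps)
  ultimately show ?case by blast
qed

lemma funpow_ge:
  assumes "rowfun K n b" "1 \<le> q" shows "q \<le> (b ^^ t) q"
proof (induction t)
  case (Suc t)
  then show ?case using rowfunD(2)[OF assms(1), of "(b ^^ t) q"] assms(2) by simp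
qed simp

lemma rowfun_up:
  assumes b: "rowfun K n b" and x: "1 \<le> i" "b i = Suc q" "\<And>x. 1 \<le> x \<Longrightarrow> b x \<noteq> q" and iq: "i < q"
  shows "rowfun K (Suc n) (b(i := q))" "i \<le> Suc n"
proof -
  have lt: "b j < q" if "1 \<le> j" "j < i" for j
    using rowfunD(4)[OF b that] x(2) x(3)[OF that(1)] by simp
  \<comment> \<open>Otherwise row \<open>i - 1\<close> would be a zero row and would end at
    \<open>q\<close>.\<close>
  show "i \<le> Suc n"
  proof (rule ccontr)
    assume "\<not> i \<le> Suc n"
    then have "b (i - 1) = i - 1 + K" "b i = i + K" using rowfunD(5)[OF b] by auto
    moreover have "1 \<le> i - 1" using \<open>\<not> i \<le> Suc n\<close> by auto
    ultimately show False using x(2) x(3)[of "i - 1"] by auto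
  qed
  then show "rowfun K (Suc n) (b(i := q))"
    unfolding rowfun_def
  proof (intro conjI allI impI)
    show "2 \<le> K" using rowfunD(1)[OF b] .
    fix j :: nat assume "1 \<le> j"
    then show "j < (b(i := q)) j" "(b(i := q)) j \<le> j + K"
      using rowfunD(2,3)[OF b, of j] iq x(2) by auto
    fix m assume "j < m"
    then show "(b(i := q)) j < (b(i := q)) m"
      using rowfunD(4)[OF b, of j m] \<open>1 \<le> j\<close> lt[of j] x(2) by auto
  next
    fix j assume "i \<le> Suc n" "Suc n < j"
    then show "(b(i := q)) j = j + K" using rowfunD(5)[OF b, of j] by auto
  qed
qed

text \<open>Moving the end of row i from q + 1 to q only changes which of the two parallel chains
  continues through i. Hence the lengths at y and y + 1 are exchanged along the forward orbit of q,
  and nothing else changes.\<close>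

lemma Lc_up:
  assumes b: "rowfun K n b" and x: "1 \<le> i" "b i = Suc q" "\<And>x. 1 \<le> x \<Longrightarrow> b x \<noteq> q" and iq: "i < q"
    and ch: "\<And>t. b (Suc ((b ^^ t) q)) = Suc (b ((b ^^ t) q))"
  shows "(\<forall>t. y \<noteq> (b ^^ t) q \<and> y \<noteq> Suc ((b ^^ t) q)) \<Longrightarrow> Lc (b(i := q)) y = Lc b y"
    and "Lc (b(i := q)) ((b ^^ t) q) = Lc b (Suc ((b ^^ t) q))"
    and "Lc (b(i := q)) (Suc ((b ^^ t) q)) = Lc b ((b ^^ t) q)"
proof -
  define B where "B = b(i := q)"
  have B: "B i = q" "\<And>u. u \<noteq> i \<Longrightarrow> B u = b u" by (simp_all add: B_def)
  have b': "rowfun K (Suc n) B" unfolding B_def by (rule rowfun_up[OF b x iq])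
  have q1: "1 \<le> q" using iq by simp
  have ge: "i < (b ^^ t) q" for t using funpow_ge[OF b q1, of t] iq by simp
  have other: "Lc B y = Lc b y" if "\<forall>t. y \<noteq> (b ^^ t) q \<and> y \<noteq> Suc ((b ^^ t) q)" for y
    using that
  proof (induction y rule: less_induct)
    case (less y)
    have y0: "y \<noteq> q" "y \<noteq> Suc q" using less.prems[rule_format, of 0] by auto
    show ?case
    proof (cases "\<exists>u\<ge>1. b u = y")
      case True
      then obtain u where u: "1 \<le> u" "b u = y" by auto
      then have "u \<noteq> i" using x(2) y0 by auto
      then have u': "B u = y" using u B by simp
      have "\<forall>t. u \<noteq> (b ^^ t) q \<and> u \<noteq> Suc ((b ^^ t) q)"
        using less.prems[rule_format, of "Suc _"] u ch by auto
      then have "Lc B u = Lc b u" using rowfunD(2)[OF b u(1)] u by (intro less.IH) auto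
      then show ?thesis using Lc_pre[OF b u(1)] Lc_pre[OF b' u(1)] unfolding u u' by metis
    next
      case False
      then have "\<not> (\<exists>u\<ge>1. B u = y)" using y0 B by metis
      then show ?thesis using Lc_pos[OF b, of y] Lc_pos[OF b', of y] False by (metis gr0I)
    qed
  qed
  then show "(\<forall>t. y \<noteq> (b ^^ t) q \<and> y \<noteq> Suc ((b ^^ t) q)) \<Longrightarrow> Lc (b(i := q)) y = Lc b y"
    unfolding B_def .
  have iL: "Lc B i = Lc b i" using ge by (intro other) (metis less_irrefl less_SucI)
  have "Lc B ((b ^^ t) q) = Lc b (Suc ((b ^^ t) q)) \<and> Lc B (Suc ((b ^^ t) q)) = Lc b ((b ^^ t) q)"
  proof (induction t)
    case 0
    have "Lc B q = Suc (Lc b i)" using Lc_pre[OF b' x(1)] iL B by simp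
    moreover have "Lc b (Suc q) = Suc (Lc b i)" using Lc_pre[OF b x(1)] x(2) by simp
    moreover have "Lc b q = 0" using x(3) by (rule Lc_top)
    moreover have "B u \<noteq> Suc q" if "1 \<le> u" for u
      using rowfun_inj[OF b that x(1)] x(2) B by (metis n_not_Suc_n)
    then have "Lc B (Suc q) = 0" by (rule Lc_top)
    ultimately show ?case by simp
  next
    case (Suc t)
    let ?y = "(b ^^ t) q"
    have "B ?y = b ?y" "B (Suc ?y) = b (Suc ?y)" using ge[of t] B by auto
    moreover have "1 \<le> ?y" using funpow_ge[OF b q1, of t] q1 by simp
    ultimately show ?case
      using Suc Lc_pre[OF b, of ?y] Lc_pre[OF b', of ?y] Lc_pre[OF b, of "Suc ?y"] Lc_pre[OF b', of "Suc ?y"] ch[of t]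
      by simp
  qed
  then show "Lc (b(i := q)) ((b ^^ t) q) = Lc b (Suc ((b ^^ t) q))"
    "Lc (b(i := q)) (Suc ((b ^^ t) q)) = Lc b ((b ^^ t) q)"
    unfolding B_def by auto
qed

section \<open>The window at the bottom\<close>

lemma only_low: "only I f \<Longrightarrow> j \<notin> I \<Longrightarrow> low j f"
  unfolding only_def low_def by (metis in_keys_iff order_refl subsetD)

lemma low_nrt: "x \<noteq> j \<Longrightarrow> low j (nrt (x, y))"
  by (auto simp: nrt_def intro!: low_diff low_mult low_zp low_1)

lemma low_ZM: "b l = l + K \<Longrightarrow> low l (ZM K l b)"
  unfolding ZM_def by (rule low_prod) (auto intro!: low_zp)

text \<open>The pair that \<open>clean\<close> requires for the rows w - 1 and w: since
  \<open>b (w - 1) = w - 1 + K\<close>, it lies within the first l columns only for the top row of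
  the window.\<close>

definition wrap :: "nat \<Rightarrow> nat \<Rightarrow> nat \<Rightarrow> (nat \<times> nat) set" where
  "wrap K l w = (if w = Suc (l - K) then {(w, l)} else {})"

text \<open>Deleting (w, l) is free if z_l has no positive exponent elsewhere: row l is a zero row,
  so the part with z_w/z_l has negative degree in it.\<close>

lemma window_start:
  assumes b: "rowfun K n b" and l: "n + K < l" and w: "w \<in> {Suc (l - K)..l}"
  shows "good b (w - 1)" "clean l b (w - 1) (wrap K l w)"
    and "(w = Suc (l - K) \<Longrightarrow> low l P) \<Longrightarrow> GG K l b {} P = GG K l b (wrap K l w) P"
proof -
  have K: "2 \<le> K" using rowfunD(1)[OF b] .
  have w1: "n < w - 1" "Suc (w - 1) = w" using l w by auto
  have bw: "b (w - 1) = w - 1 + K" "b w = w + K" "b l = l + K"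
    using rowfunD(5)[OF b] w1 l by auto
  show "good b (w - 1)" using bw w1 K by (auto simp: good_def)
  show "clean l b (w - 1) (wrap K l w)" using bw w1 K w l by (auto simp: clean_def wrap_def)
  assume low: "w = Suc (l - K) \<Longrightarrow> low l P"
  show "GG K l b {} P = GG K l b (wrap K l w) P"
  proof (cases "w = Suc (l - K)")
    case True
    have wl: "(w, l) \<in> NR l b" using True l K bw by (auto simp: NR_def)
    define f where "f = prod nrt (NR l b - {(w, l)}) * ZM K l b * P"
    have "low l (prod nrt (NR l b - {(w, l)}))"
    proof (rule low_prod)
      fix p assume "p \<in> NR l b - {(w, l)}"
      then obtain x y where "p = (x, y)" "x < y" "y \<le> l" by (auto simp: NR_def)
      then show "low l (nrt p)" by (simp add: low_nrt)
    qed
    then have "low l (zp w 1 * f)"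
      unfolding f_def using low[OF True] low_ZM[of b l K] bw True l K
      by (intro low_mult low_zp) auto
    then have 0: "kap {1..l} (cc b) (zp l (-1) * (zp w 1 * f)) = 0"
      using l by (intro kap_low) auto
    have "prod nrt (NR l b) * ZM K l b * P = nrt (w, l) * f"
      unfolding f_def using prod_nrt_remove[OF finite_NR wl] by (simp add: mult_ac)
    also have "\<dots> = f - zp l (-1) * (zp w 1 * f)" by (simp add: nrt_def algebra_simps)
    finally show ?thesis using 0 True unfolding GG_def wrap_def f_def by (simp add: kap_diff)
  qed (simp add: wrap_def)
qed

text \<open>A zero row ending at or before l lies at least K rows above l. So the trace leaves the
  window after its first position and cannot meet the variables of the unprocessed factors.\<close>

lemma reach_window:
  assumes b: "rowfun K n b" and l: "n + K < l" and r: "reach b q0 R0 q R" and q0: "q0 < l"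
  shows "q = q0 \<or> Suc q \<le> l - K"
  using r
proof (cases rule: reach.cases)
  case (up q' R' )
  have "q' \<le> q0" using reach_le[OF b up(2)] .
  then have "b (Suc q) \<le> l" using up q0 by simp
  then show ?thesis using rowfunD(5)[OF b, of "Suc q"] l by (cases "n < Suc q") auto
qed simp

text \<open>The complete fate of one factor z_w - 1. \<open>P\<close> must avoid row w and the
  cyclically preceding row of the window: row w - 1 because it is exchanged with w, or row l because
  the pair (w, l) is deleted when w is the top row.\<close>

lemma GG_step:
  assumes b: "rowfun K n b" and l: "Suc n + K < l" and w: "w \<in> {Suc (l - K)..l}"
    and P: "only I P" "I \<subseteq> {Suc (l - K)..l}" "w \<notin> I" "(if w = Suc (l - K) then l else w - 1) \<notin> I"
  shows "\<exists>q R. reach b (w - 1) (wrap K l w) q R \<and> good b q \<and>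
    ((\<exists>i\<ge>1. b i = Suc q \<and> (\<forall>x\<ge>1. b x \<noteq> q) \<and> i < q \<and>
        GG K l b {} ((zp w 1 - 1) * P) = GG K l (b(i := q)) {} P) \<or>
     ((\<forall>x\<ge>1. b x \<noteq> q \<and> b x \<noteq> Suc q) \<and> GG K l b {} ((zp w 1 - 1) * P) = 0) \<or>
     (\<exists>i\<ge>1. b i = q \<and> (\<forall>x\<ge>1. b x \<noteq> Suc q) \<and>
        GG K l b {} ((zp w 1 - 1) * P) = - GG K l b {} P))"
proof -
  have K: "2 \<le> K" using rowfunD(1)[OF b] .
  let ?q0 = "w - 1" and ?R0 = "wrap K l w"
  have w1: "n < w - 1" "Suc (w - 1) = w" "w \<le> l" using l w by auto
  have l': "n + K < l" using l by simp
  note st = window_start[OF b l' w]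
  have lowP: "low l P" if "w = Suc (l - K)" using that P by (intro only_low[OF P(1)]) auto
  have lowz: "low l ((zp w 1 - 1) * P)" if "w = Suc (l - K)"
    using lowP[OF that] that K l by (intro low_mult low_diff low_zp low_1) auto
  have sym: "psw q' (Suc q') P = P" if r: "reach b' ?q0 ?R0 q' R'" and b': "rowfun K (Suc n) b'" for b' q' R'
  proof -
    have "q' = ?q0 \<or> Suc q' \<le> l - K"
      using reach_window[OF b' l r] w1 by auto
    then have "q' \<notin> I" "Suc q' \<notin> I" using P w1 w by (auto split: if_splits)
    then show ?thesis by (intro psw_only[OF P(1)])
  qed
  obtain q R where qR: "reach b ?q0 ?R0 q R"
    and top: "\<not> ((\<exists>x\<ge>1. b x = q) \<and> (\<exists>x\<ge>1. b x = Suc q))"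
    using reach_top_ex[OF b] by blast
  have bS: "rowfun K (Suc n) b" using rowfun_mono[OF b] by simp
  have ql: "Suc q \<le> l" using reach_le[OF b qR] w1 by simp
  have R: "GG K l b ?R0 P = GG K l b R P"
    "GG K l b ?R0 ((zp w 1 - 1) * P) = GG K l b R ((zp (Suc q) 1 - 1) * P)"
    "good b q" "clean l b q R"
    using GG_reach[OF b qR st(1) _ st(2) sym[OF _ bS]] w1 by auto
  have e1: "GG K l b {} ((zp w 1 - 1) * P) = GG K l b R ((zp (Suc q) 1 - 1) * P)"
    using st(3)[OF lowz] R(2) by simp
  have e2: "GG K l b {} P = GG K l b R P" using st(3)[OF lowP] R(1) by simp
  have sq: "psw q (Suc q) P = P" by (rule sym[OF qR bS])
  consider i where "1 \<le> i" "b i = Suc q" "\<And>x. 1 \<le> x \<Longrightarrow> b x \<noteq> q"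
    | "\<And>x. 1 \<le> x \<Longrightarrow> b x \<noteq> q" "\<And>x. 1 \<le> x \<Longrightarrow> b x \<noteq> Suc q"
    | i where "1 \<le> i" "b i = q" "\<And>x. 1 \<le> x \<Longrightarrow> b x \<noteq> Suc q"
    using top by metis
  then show ?thesis
  proof cases
    case (1 i)
    have iq: "i < q" by (rule NR_split_pair(3)[OF b R(3) ql R(4) 1(1,2)])
    define B where "B = b(i := q)"
    have b': "rowfun K (Suc n) B" unfolding B_def by (rule rowfun_up(1)[OF b 1 iq])
    have r': "reach B ?q0 ?R0 q R" unfolding B_def by (rule reach_upd[OF b qR iq])
    note st' = window_start[OF b' l w]
    \<comment> \<open>The same trace for the enlarged partition is read in the opposite direction,
      which restores the deleted pairs.\<close>
    have "GG K l B ?R0 P = GG K l B R P"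
      using GG_reach[OF b' r' st'(1) _ st'(2) sym[OF _ b']] w1 by auto
    then have "GG K l B R P = GG K l B {} P" using st'(3)[OF lowP] by simp
    moreover have "GG K l b R ((zp (Suc q) 1 - 1) * P) = GG K l B R P"
      unfolding B_def by (rule GG_up[OF b R(3) ql R(4) 1 sq])
    ultimately have "GG K l b {} ((zp w 1 - 1) * P) = GG K l (b(i := q)) {} P"
      using e1 unfolding B_def by simp
    then show ?thesis using qR R(3) 1 iq by blast
  next
    case 2
    have "GG K l b {} ((zp w 1 - 1) * P) = 0"
      unfolding e1 by (rule GG_tie[OF b R(3) ql R(4) 2 sq])
    then show ?thesis using qR R(3) 2 by blast
  next
    case (3 i)
    have "GG K l b {} ((zp w 1 - 1) * P) = - GG K l b {} P"
      unfolding e1 e2 by (rule GG_down[OF b R(3) ql R(4) 3 sq])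
    then show ?thesis using qR R(3) 3 by blast
  qed
qed

section \<open>Height functions\<close>

text \<open>The limit stabilises because \<open>Lc\<close> grows by one along every zero row.\<close>

definition hh :: "nat \<Rightarrow> (nat \<Rightarrow> nat) \<Rightarrow> int \<Rightarrow> int" where
  "hh K b x = (THE v. \<exists>T. \<forall>t\<ge>T. v = int (Lc b (nat (int K * t - x))) - t)"

lemma Lc_far:
  assumes b: "rowfun K n b" and d: "int n < int K * t - x"
  shows "int (Lc b (nat (int K * (t + int s) - x))) - (t + int s) = int (Lc b (nat (int K * t - x))) - t"
proof (induction s)
  case (Suc s)
  let ?y = "nat (int K * (t + int s) - x)"
  have y: "int ?y = int K * (t + int s) - x" "n < ?y"
  proof -
    have "int K * t - x \<le> int K * (t + int s) - x" by (simp add: distrib_left)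
    then show "int ?y = int K * (t + int s) - x" "n < ?y" using d by auto
  qed
  have "nat (int K * (t + int (Suc s)) - x) = ?y + K"
    using y by (simp add: algebra_simps nat_add_distrib nat_eq_iff)
  then have "Lc b (nat (int K * (t + int (Suc s)) - x)) = Suc (Lc b ?y)"
    using Lc_pre[OF b, of ?y] rowfunD(5)[OF b y(2)] y(2) by simp
  then show ?case using Suc by simp
qed simp

lemma hh_far:
  assumes b: "rowfun K n b" and d: "int n < int K * t - x"
  shows "hh K b x = int (Lc b (nat (int K * t - x))) - t"
  unfolding hh_def
proof (rule the_equality)
  have *: "int (Lc b (nat (int K * t' - x))) - t' = int (Lc b (nat (int K * t - x))) - t" if "t \<le> t'" for t'
    using Lc_far[OF b d, of "nat (t' - t)"] that by simp
  show "\<exists>T. \<forall>t'\<ge>T. int (Lc b (nat (int K * t - x))) - t = int (Lc b (nat (int K * t' - x))) - t'"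
  proof (intro exI[of _ t] allI impI)
    fix t' assume "t \<le> t'"
    then show "int (Lc b (nat (int K * t - x))) - t = int (Lc b (nat (int K * t' - x))) - t'"
      by (rule *[symmetric])
  qed
  fix v assume "\<exists>T. \<forall>t\<ge>T. v = int (Lc b (nat (int K * t - x))) - t"
  then obtain T where T: "\<forall>t\<ge>T. v = int (Lc b (nat (int K * t - x))) - t" by blast
  have "v = int (Lc b (nat (int K * max T t - x))) - max T t" using T by (meson max.cobounded1)
  also have "\<dots> = int (Lc b (nat (int K * t - x))) - t" by (rule *) simp
  finally show "v = int (Lc b (nat (int K * t - x))) - t" .
qed

lemma far_ex:
  assumes "2 \<le> K" obtains t where "m < int K * t - x" "t0 \<le> t"
proof -
  define t where "t = \<bar>m\<bar> + \<bar>x\<bar> + \<bar>t0\<bar> + 1"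
  have t: "m + x < t" "t0 \<le> t" "0 \<le> t" unfolding t_def by linarith+
  have "t \<le> int K * t" using mult_right_mono[of 1 "int K" t] assms t by simp
  then have "m < int K * t - x" using t by linarith
  then show ?thesis using that t by blast
qed

lemma hh_shift:
  assumes b: "rowfun K n b" shows "hh K b (x + int K) = hh K b x - 1"
proof -
  obtain t where t: "int n < int K * t - x" using far_ex[OF rowfunD(1)[OF b]] by metis
  have e: "int K * (t + 1) - (x + int K) = int K * t - x" by (simp add: algebra_simps)
  show ?thesis using hh_far[OF b t] hh_far[OF b, of "t + 1" "x + int K"] t by (simp add: e)
qed

lemma hh_row: "rowfun K n b \<Longrightarrow> n < y \<Longrightarrow> hh K b (- int y) = int (Lc b y)"
  using hh_far[of K n b 0 "- int y"] by simp

text \<open>The affine simple reflection of the integers that exchanges a - 1 and a modulo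
  \<open>K\<close>.\<close>

definition sg :: "nat \<Rightarrow> int \<Rightarrow> int \<Rightarrow> int" where
  "sg K a x = (if int K dvd x - a then x - 1 else if int K dvd x + 1 - a then x + 1 else x)"

text \<open>The far part of the orbit of q consists of the rows congruent to q0 modulo K, where
  \<open>Lc_up\<close> exchanges y and y + 1. Under x = K t - y this is the exchange of a and a -
  1.\<close>

lemma hh_up:
  assumes b: "rowfun K n b" and x: "1 \<le> i" "b i = Suc q" "\<And>x. 1 \<le> x \<Longrightarrow> b x \<noteq> q" and iq: "i < q"
    and r: "reach b q0 R0 q R" and q0: "n < q0" and a: "int K dvd a + int q0"
  shows "hh K (b(i := q)) = hh K b \<circ> sg K a"
proof
  fix x0
  have K: "2 \<le> K" using rowfunD(1)[OF b] .
  have b': "rowfun K (Suc n) (b(i := q))" by (rule rowfun_up(1)[OF b x iq])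
  obtain s where s: "q0 = (b ^^ s) q" and ch: "\<And>t. b (Suc ((b ^^ t) q)) = Suc (b ((b ^^ t) q))"
    using reach_chain[OF b r q0] by blast
  note L = Lc_up[OF b x iq ch]
  have q0t: "(b ^^ t) q0 = q0 + t * K" for t
  proof (induction t)
    case (Suc t)
    then show ?case using rowfunD(5)[OF b, of "q0 + t * K"] q0 by simp
  qed simp
  have chain: "(b ^^ (s + t)) q = q0 + t * K" for t
    using q0t[of t] s by (metis add.commute comp_apply funpow_add)
  have q1: "1 \<le> q" using iq by simp
  have chain_far: "\<exists>t'. (b ^^ t) q = q0 + t' * K" if "q0 \<le> (b ^^ t) q" for t
  proof (cases "s \<le> t")
    case True
    then show ?thesis using chain[of "t - s"] by auto
  next
    case False
    then have "s = (s - t) + t" by simp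
    then have "q0 = (b ^^ (s - t)) ((b ^^ t) q)" using s by (metis comp_apply funpow_add)
    moreover have "1 \<le> (b ^^ t) q" using funpow_ge[OF b q1, of t] q1 by simp
    ultimately have "(b ^^ t) q \<le> q0" using funpow_ge[OF b, of "(b ^^ t) q" "s - t"] by simp
    then show ?thesis using that by (intro exI[of _ 0]) simp
  qed
  \<comment> \<open>With this margin y and its neighbours lie beyond q0 and among the zero rows,
    where the orbit is explicit and \<open>hh_far\<close> applies.\<close>
  obtain t where t: "int (Suc q0 + Suc n) < int K * t - x0" using far_ex[OF K] by metis
  define y where "y = nat (int K * t - x0)"
  have y: "int y = int K * t - x0" "Suc q0 + Suc n < y" using t by (auto simp: y_def)
  have hy: "hh K (b(i := q)) x0 = int (Lc (b(i := q)) y) - t"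
    using hh_far[OF b', of t x0] t by (simp add: y_def)
  obtain m where m: "a + int q0 = int K * m" using a by (elim dvdE)
  have dv0: "int K dvd x0 - a \<longleftrightarrow> int K dvd int y - int q0"
  proof -
    have "int y - int q0 = int K * (t - m) - (x0 - a)" using y m by (simp add: right_diff_distrib)
    then show ?thesis by (simp only: dvd_diff_right_iff[OF dvd_triv_left])
  qed
  have dv1: "int K dvd x0 + 1 - a \<longleftrightarrow> int K dvd int y - int (Suc q0)"
  proof -
    have "int y - int (Suc q0) = int K * (t - m) - (x0 + 1 - a)" using y m by (simp add: right_diff_distrib)
    then show ?thesis by (simp only: dvd_diff_right_iff[OF dvd_triv_left])
  qed
  have multK: "\<exists>t'. y' = q0 + t' * K" if "int K dvd int y' - int q0" "q0 \<le> y'" for y'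
  proof -
    have "K dvd y' - q0" using that by (simp add: of_nat_diff[symmetric] del: of_nat_diff)
    then obtain t' where "y' - q0 = t' * K" by (metis dvdE mult.commute)
    then show ?thesis using that by (intro exI[of _ t']) simp
  qed
  consider "int K dvd x0 - a" | "\<not> int K dvd x0 - a" "int K dvd x0 + 1 - a"
    | "\<not> int K dvd x0 - a" "\<not> int K dvd x0 + 1 - a" by blast
  then show "hh K (b(i := q)) x0 = (hh K b \<circ> sg K a) x0"
  proof cases
    case 1
    then obtain t' where "y = q0 + t' * K" using multK[of y] dv0 y by auto
    then have "Lc (b(i := q)) y = Lc b (Suc y)" using L(2)[of "s + t'"] chain[of t'] by simp
    moreover have "hh K b (x0 - 1) = int (Lc b (Suc y)) - t"
    proof -
      have "nat (int K * t - (x0 - 1)) = Suc y" using y by (simp add: nat_eq_iff)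
      then show ?thesis using hh_far[OF b, of t "x0 - 1"] y by simp
    qed
    ultimately show ?thesis using 1 hy by (simp add: sg_def)
  next
    case 2
    have "int (y - 1) - int q0 = int y - int (Suc q0)" using y by simp
    then have "int K dvd int (y - 1) - int q0" using dv1 2 by (simp only:)
    moreover have "q0 \<le> y - 1" using y by linarith
    ultimately obtain t' where "y - 1 = q0 + t' * K" using multK by blast
    then have "y = Suc (q0 + t' * K)" using y by simp
    then have "Lc (b(i := q)) y = Lc b (y - 1)" using L(3)[of "s + t'"] chain[of t'] by simp
    moreover have "hh K b (x0 + 1) = int (Lc b (y - 1)) - t"
    proof -
      have "nat (int K * t - (x0 + 1)) = y - 1" using y by (simp add: nat_eq_iff)
      then show ?thesis using hh_far[OF b, of t "x0 + 1"] y by simp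
    qed
    ultimately show ?thesis using 2 hy by (simp add: sg_def)
  next
    case 3
    have "y \<noteq> (b ^^ t) q \<and> y \<noteq> Suc ((b ^^ t) q)" for t
    proof (intro conjI notI)
      assume e: "y = (b ^^ t) q"
      then obtain t' where "y = q0 + t' * K" using chain_far[of t] y by auto
      then show False using 3 dv0 by simp
    next
      assume e: "y = Suc ((b ^^ t) q)"
      then obtain t' where "y = Suc (q0 + t' * K)" using chain_far[of t] y by auto
      then show False using 3 dv1 by simp
    qed
    then have "Lc (b(i := q)) y = Lc b y" using L(1) by blast
    moreover have "hh K b x0 = int (Lc b y) - t" using hh_far[OF b, of t x0] y by (simp add: y_def)
    ultimately show ?thesis using 3 hy by (simp add: sg_def)
  qed
qed

lemma rowfun_down:
  assumes b: "rowfun K n b" and x: "1 \<le> i" "b i = q" "\<And>x. 1 \<le> x \<Longrightarrow> b x \<noteq> Suc q"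
  shows "rowfun K n (b(i := Suc q))" "i \<le> n" "b i < i + K"
proof -
  show n: "i \<le> n"
  proof (rule ccontr)
    assume "\<not> i \<le> n"
    then have "b i = i + K" "b (Suc i) = Suc i + K" using rowfunD(5)[OF b] by auto
    then show False using x(2) x(3)[of "Suc i"] by auto
  qed
  show iK: "b i < i + K"
  proof (rule ccontr)
    assume "\<not> b i < i + K"
    then have "b i = i + K" using rowfunD(3)[OF b x(1)] by simp
    moreover have "b i < b (Suc i)" "b (Suc i) \<le> Suc i + K"
      using rowfunD(3)[OF b, of "Suc i"] rowfunD(4)[OF b x(1), of "Suc i"] by auto
    ultimately show False using x(2) x(3)[of "Suc i"] by auto
  qed
  have gt: "Suc q < b j" if "i < j" for j
    using rowfunD(4)[OF b x(1) that] x(2) x(3)[of j] that by simp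
  show "rowfun K n (b(i := Suc q))"
    unfolding rowfun_def
  proof (intro conjI allI impI)
    show "2 \<le> K" using rowfunD(1)[OF b] .
    fix j :: nat assume "1 \<le> j"
    then show "j < (b(i := Suc q)) j" "(b(i := Suc q)) j \<le> j + K"
      using rowfunD(2,3)[OF b, of j] x(2) iK by auto
    fix m assume "j < m"
    then show "(b(i := Suc q)) j < (b(i := Suc q)) m"
      using rowfunD(4)[OF b, of j m] \<open>1 \<le> j\<close> gt[of m] x(2) by auto
  next
    fix j assume "n < j"
    then show "(b(i := Suc q)) j = j + K" using rowfunD(5)[OF b, of j] n by auto
  qed
qed

text \<open>Along the trace both chain lengths change equally, so comparing \<open>hh\<close> at a
  and a - 1 amounts to comparing \<open>Lc\<close> at q and q + 1, the end of the trace.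
  \<open>Lc\<close> is positive there exactly when some row ends at that index.\<close>

lemma trichotomy:
  assumes b: "rowfun K n b" and r: "reach b q0 R0 q R" and q0: "n < q0" and g: "good b q"
    and a: "int K dvd a + int q0"
  shows "1 \<le> i \<Longrightarrow> b i = Suc q \<Longrightarrow> (\<And>x. 1 \<le> x \<Longrightarrow> b x \<noteq> q) \<Longrightarrow> hh K b a < hh K b (a - 1)"
    and "(\<And>x. 1 \<le> x \<Longrightarrow> b x \<noteq> q \<and> b x \<noteq> Suc q) \<Longrightarrow> hh K b a = hh K b (a - 1)"
    and "1 \<le> i \<Longrightarrow> b i = q \<Longrightarrow> (\<And>x. 1 \<le> x \<Longrightarrow> b x \<noteq> Suc q) \<Longrightarrow> hh K b (a - 1) < hh K b a"
proof -
  have shift: "hh K b (x + int K * m) = hh K b x - m" for x m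
  proof -
    have nat: "hh K b (x + int K * int t) = hh K b x - int t" for x t
    proof (induction t)
      case (Suc t)
      have "x + int K * int (Suc t) = (x + int K * int t) + int K" by (simp add: algebra_simps)
      then show ?case unfolding \<open>x + int K * int (Suc t) = _\<close> hh_shift[OF b] Suc by simp
    qed simp
    show ?thesis
    proof (cases "0 \<le> m")
      case True
      then show ?thesis using nat[of x "nat m"] by simp
    next
      case False
      then show ?thesis using nat[of "x + int K * m" "nat (- m)"] by simp
    qed
  qed
  obtain m where "a + int q0 = int K * m" using a by (elim dvdE)
  then have "a = - int q0 + int K * m" "a - 1 = - int (Suc q0) + int K * m" by auto
  then have h: "hh K b a = int (Lc b q0) - m" "hh K b (a - 1) = int (Lc b (Suc q0)) - m"
    using shift hh_row[OF b] q0 by (metis, metis less_SucI)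
  obtain t where t: "Lc b q0 = t + Lc b q" "Lc b (Suc q0) = t + Lc b (Suc q)"
    using reach_Lc[OF b r] by blast
  show "hh K b a < hh K b (a - 1)" if "1 \<le> i" "b i = Suc q" "\<And>x. 1 \<le> x \<Longrightarrow> b x \<noteq> q"
  proof -
    have "Lc b q = 0" using that(3) by (rule Lc_top)
    moreover have "0 < Lc b (Suc q)" using Lc_pos[OF b] that(1,2) by blast
    ultimately show ?thesis using h t by simp
  qed
  show "hh K b a = hh K b (a - 1)" if "\<And>x. 1 \<le> x \<Longrightarrow> b x \<noteq> q \<and> b x \<noteq> Suc q"
    using h t Lc_top[of b q] Lc_top[of b "Suc q"] that by simp
  show "hh K b (a - 1) < hh K b a" if "1 \<le> i" "b i = q" "\<And>x. 1 \<le> x \<Longrightarrow> b x \<noteq> Suc q"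
  proof -
    have "Lc b (Suc q) = 0" using that(3) by (rule Lc_top)
    moreover have "0 < Lc b q" using Lc_pos[OF b] that(1,2) by blast
    ultimately show ?thesis using h t by simp
  qed
qed

section \<open>Determinants as values of the row functional\<close>

lemma monic_coeffs:
  fixes x :: "nat \<Rightarrow> 'a::comm_ring_1"
  shows "\<exists>a. \<forall>t. (\<Prod>i<n. t - x i) = t ^ n + (\<Sum>j<n. a j * t ^ j)"
proof (induction n)
  case (Suc n)
  then obtain a where a: "\<And>t. (\<Prod>i<n. t - x i) = t ^ n + (\<Sum>j<n. a j * t ^ j)" by blast
  define a' where "a' j = (case j of 0 \<Rightarrow> 0 | Suc m \<Rightarrow> a m) - (if j = n then x n else x n * a j)" for j
  have "(\<Prod>i<Suc n. t - x i) = t ^ Suc n + (\<Sum>j<Suc n. a' j * t ^ j)" for t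
  proof -
    have "(\<Sum>j<Suc n. a' j * t ^ j) =
        (\<Sum>j<Suc n. (case j of 0 \<Rightarrow> 0 | Suc m \<Rightarrow> a m) * t ^ j) -
        (\<Sum>j<Suc n. (if j = n then x n else x n * a j) * t ^ j)"
      by (simp add: a'_def left_diff_distrib sum_subtractf del: sum.lessThan_Suc)
    also have "(\<Sum>j<Suc n. (case j of 0 \<Rightarrow> 0 | Suc m \<Rightarrow> a m) * t ^ j) = (\<Sum>j<n. a j * t ^ j) * t"
      by (simp add: sum.lessThan_Suc_shift sum_distrib_left mult_ac del: sum.lessThan_Suc)
    also have "(\<Sum>j<Suc n. (if j = n then x n else x n * a j) * t ^ j) =
        x n * (\<Sum>j<n. a j * t ^ j) + x n * t ^ n"
      by (simp add: sum_distrib_left mult_ac)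
    finally show ?thesis by (simp add: a algebra_simps)
  qed
  then show ?case by blast
qed simp

text \<open>A unipotent column operation turns the last column into the values of the monic
  polynomial with roots x_0, ..., x_{n-1}, which vanish except in the last row.\<close>

lemma det_vandermonde:
  fixes x :: "nat \<Rightarrow> 'a::comm_ring_1"
  shows "det (mat n n (\<lambda>(i, j). x i ^ j)) = (\<Prod>j<n. \<Prod>i<j. x j - x i)"
proof (induction n)
  case (Suc n)
  obtain a where a: "\<And>t. (\<Prod>i<n. t - x i) = t ^ n + (\<Sum>j<n. a j * t ^ j)"
    using monic_coeffs[where n = n and x = x] by blast
  define A where "A = mat (Suc n) (Suc n) (\<lambda>(i, j). x i ^ j)"
  define U where "U = mat (Suc n) (Suc n) (\<lambda>(i, j). if i = j then 1 else if j = n then a i else 0)"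
  define B where "B = mat (Suc n) (Suc n) (\<lambda>(i, j). if j = n then (\<Prod>m<n. x i - x m) else x i ^ j)"
  have carr: "A \<in> carrier_mat (Suc n) (Suc n)" "U \<in> carrier_mat (Suc n) (Suc n)"
    "B \<in> carrier_mat (Suc n) (Suc n)" by (auto simp: A_def U_def B_def)
  have AU: "A * U = B"
  proof (rule eq_matI)
    fix i j assume "i < dim_row B" "j < dim_col B"
    then have ij: "i < Suc n" "j < Suc n" by (auto simp: B_def)
    have "(A * U) $$ (i, j) = (\<Sum>m<Suc n. x i ^ m * (if m = j then 1 else if j = n then a m else 0))"
      using ij by (simp add: A_def U_def scalar_prod_def atLeast0LessThan del: sum.lessThan_Suc)
    also have "\<dots> = B $$ (i, j)"
    proof (cases "j = n")
      case True
      have "(\<Sum>m<n. x i ^ m * (if m = j then 1 else if j = n then a m else 0)) = (\<Sum>m<n. x i ^ m * a m)"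
        by (intro sum.cong) (auto simp: True)
      then have "(\<Sum>m<Suc n. x i ^ m * (if m = j then 1 else if j = n then a m else 0)) =
          (\<Sum>m<n. x i ^ m * a m) + x i ^ n"
        by (simp only: sum.lessThan_Suc) (simp add: True)
      then show ?thesis using ij True by (simp add: B_def a mult_ac)
    next
      case False
      then have "(\<Sum>m<Suc n. x i ^ m * (if m = j then 1 else if j = n then a m else 0)) =
          (\<Sum>m<Suc n. if m = j then x i ^ m else 0)"
        by (intro sum.cong) auto
      also have "\<dots> = x i ^ j" using ij by (subst sum.delta) auto
      finally show ?thesis using ij False by (simp add: B_def)
    qed
    finally show "(A * U) $$ (i, j) = B $$ (i, j)" .
  qed (auto simp: A_def U_def B_def)
  have "upper_triangular U" by (auto simp: U_def)
  then have "det U = prod_list (diag_mat U)" using carr by (intro det_upper_triangular)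
  also have "diag_mat U = map (\<lambda>_. 1) [0..<Suc n]"
    unfolding diag_mat_def by (rule map_cong) (auto simp: U_def)
  also have "prod_list \<dots> = 1" by (simp add: map_replicate_const)
  finally have "det A = det B" using det_mult[OF carr(1,2)] AU by simp
  also have "det B = (\<Sum>i<Suc n. B $$ (i, n) * cofactor B i n)"
    using carr by (intro laplace_expansion_column) auto
  also have "\<dots> = B $$ (n, n) * cofactor B n n"
  proof -
    have "B $$ (i, n) = 0" if "i < n" for i
      using that by (simp add: B_def) (metis diff_self lessThan_iff prod_zero finite_lessThan)
    then show ?thesis by simp
  qed
  also have "cofactor B n n = det (mat n n (\<lambda>(i, j). x i ^ j))"
  proof -
    have "mat_delete B n n = mat n n (\<lambda>(i, j). x i ^ j)"
      by (rule eq_matI) (auto simp: mat_delete_def B_def)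
    then show ?thesis by (simp add: cofactor_def)
  qed
  finally show ?case using Suc by (simp add: A_def B_def mult.commute)
qed simp

text \<open>The Vandermonde product of the rows a + 1, ..., a + n divided by a monomial, see
  \<open>Vw_vandermonde\<close>.\<close>

definition Vw :: "nat \<Rightarrow> nat \<Rightarrow> laurent" where
  "Vw a n = prod nrt {(i, j). a < i \<and> i < j \<and> j \<le> a + n}"

lemma finite_Vw_pairs [simp]: "finite {(i, j). a < i \<and> i < j \<and> j \<le> a + (n::nat)}"
  by (rule finite_subset[of _ "{..a+n} \<times> {..a+n}"]) auto

lemma Vw_0: "Vw a 0 = 1"
proof -
  have "{(i, j). a < i \<and> i < j \<and> j \<le> a + 0} = {}" by auto
  then show ?thesis by (simp only: Vw_def prod.empty)
qed

lemma Vw_Suc: "Vw a (Suc n) = Vw a n * (\<Prod>i\<in>{Suc a..a + n}. nrt (i, Suc (a + n)))"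
proof -
  have "{(i, j). a < i \<and> i < j \<and> j \<le> a + Suc n} =
      {(i, j). a < i \<and> i < j \<and> j \<le> a + n} \<union> (\<lambda>i. (i, Suc (a + n))) ` {Suc a..a + n}"
    by (auto simp: le_Suc_eq)
  moreover have "prod nrt ({(i, j). a < i \<and> i < j \<and> j \<le> a + n} \<union> (\<lambda>i. (i, Suc (a + n))) ` {Suc a..a + n}) =
      Vw a n * prod nrt ((\<lambda>i. (i, Suc (a + n))) ` {Suc a..a + n})"
    unfolding Vw_def by (rule prod.union_disjoint) auto
  moreover have "prod nrt ((\<lambda>i. (i, Suc (a + n))) ` {Suc a..a + n}) = (\<Prod>i\<in>{Suc a..a + n}. nrt (i, Suc (a + n)))"
    by (subst prod.reindex) (auto simp: inj_on_def)
  ultimately show ?thesis by (simp add: Vw_def)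
qed

lemma zp_power: "zp i 1 ^ n = zp i (int n)"
  by (induction n) (simp_all add: zp_add)

lemma Vw_vandermonde:
  "(\<Prod>j<n. \<Prod>i<j. zp (a + Suc j) 1 - zp (a + Suc i) 1) = (\<Prod>j<n. zp (a + Suc j) (int j)) * Vw a n"
proof (induction n)
  case (Suc n)
  have "(\<Prod>i<n. zp (a + Suc n) 1 - zp (a + Suc i) 1) =
      (\<Prod>i<n. zp (a + Suc n) 1 * nrt (a + Suc i, a + Suc n))"
    by (intro prod.cong) (simp_all add: nrt_def algebra_simps mult.assoc[symmetric])
  also have "\<dots> = zp (a + Suc n) (int n) * (\<Prod>i<n. nrt (a + Suc i, a + Suc n))"
    by (simp add: prod.distrib zp_power)
  also have "(\<Prod>i<n. nrt (a + Suc i, a + Suc n)) = (\<Prod>i\<in>{Suc a..a + n}. nrt (i, Suc (a + n)))"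
    by (rule prod.reindex_bij_witness[of _ "\<lambda>i. i - Suc a" "\<lambda>i. a + Suc i"]) auto
  finally show ?case using Suc by (simp add: Vw_Suc mult_ac)
qed (simp add: Vw_0)

lemma kap_zp: "kap {j} c (zp j e) = kh (c j) e"
  by (simp add: kap_def zp_def lin_single)

lemma kap_monomial:
  assumes "finite J" shows "kap J c (\<Prod>j\<in>J. zp j (e j)) = (\<Prod>j\<in>J. kh (c j) (e j))"
  using assms
proof (induction J)
  case empty
  show ?case by (simp add: kap_def lin_1)
next
  case (insert j J)
  have "kap ({j} \<union> J) c (zp j (e j) * (\<Prod>j\<in>J. zp j (e j))) =
      kap {j} c (zp j (e j)) * kap J c (\<Prod>j\<in>J. zp j (e j))"
    using insert by (intro kap_union) (auto intro!: only_zp only_prod)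
  then show ?case using insert by (simp add: kap_zp)
qed

lemma kap_of_int: "kap I c (of_int z * f) = of_int z * kap I c f"
proof (cases "0 \<le> z")
  case True
  have "kap I c (of_nat m * f) = of_nat m * kap I c f" for m
    by (induction m) (simp_all add: distrib_right kap_add)
  from this[of "nat z"] True show ?thesis by simp
next
  case False
  have "kap I c (of_nat m * f) = of_nat m * kap I c f" for m
    by (induction m) (simp_all add: distrib_right kap_add)
  from this[of "nat (- z)"] False show ?thesis by (simp add: kap_uminus)
qed

text \<open>Every term of the Leibniz expansion uses each row once, so the determinant is the image
  under \<open>kap\<close> of the determinant of the monomials z_i^e, which is a monomial times a
  Vandermonde determinant. The offset \<open>a\<close> allows the rows of a window.\<close>

lemma g_fun_eq_kap:
  "g_fun r \<gamma> = kap {Suc a..a + r} (\<lambda>j. int j - int a - 1)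
     (Vw a r * (\<Prod>i<r. zp (a + Suc i) (Poly_Mapping.lookup \<gamma> (Suc i))))"
proof -
  let ?e = "\<lambda>i j. Poly_Mapping.lookup \<gamma> (Suc i) + int j - int i"
  let ?c = "\<lambda>j. int j - int a - 1"
  define D where "D = det (mat r r (\<lambda>(i, j). zp (a + Suc i) (?e i j)))"
  have re: "(\<Prod>i = 0..<r. F (a + Suc i)) = (\<Prod>i\<in>{Suc a..a + r}. F i)" for F :: "nat \<Rightarrow> 'b::comm_monoid_mult"
    by (rule prod.reindex_bij_witness[of _ "\<lambda>i. i - Suc a" "\<lambda>i. a + Suc i"]) auto
  have D: "D = (\<Sum>p | p permutes {0..<r}. signof p * (\<Prod>i = 0..<r. zp (a + Suc i) (?e i (p i))))"
    unfolding D_def by (subst det_def'[of _ r], simp, intro sum.cong refl arg_cong2[of _ _ _ _ "(*)"] prod.cong)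
      (auto dest: permutes_in_image)
  have "kap {Suc a..a + r} ?c D = (\<Sum>p | p permutes {0..<r}. signof p *
      kap {Suc a..a + r} ?c (\<Prod>i = 0..<r. zp (a + Suc i) (?e i (p i))))"
    by (simp only: D kap_sum kap_of_int)
  also have "\<dots> = (\<Sum>p | p permutes {0..<r}. signof p * (\<Prod>i = 0..<r. kh (int i) (?e i (p i))))"
  proof (intro sum.cong refl arg_cong2[of _ _ _ _ "(*)"])
    fix p
    have "kap {Suc a..a + r} ?c (\<Prod>i = 0..<r. zp (a + Suc i) (?e i (p i))) =
        kap {Suc a..a + r} ?c (\<Prod>i\<in>{Suc a..a + r}. zp i (?e (i - Suc a) (p (i - Suc a))))"
      using re[of "\<lambda>i. zp i (?e (i - Suc a) (p (i - Suc a)))"] by simp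
    also have "\<dots> = (\<Prod>i\<in>{Suc a..a + r}. kh (?c i) (?e (i - Suc a) (p (i - Suc a))))"
      by (rule kap_monomial) simp
    also have "\<dots> = (\<Prod>i = 0..<r. kh (int i) (?e i (p i)))"
      using re[of "\<lambda>i. kh (?c i) (?e (i - Suc a) (p (i - Suc a)))"] by simp
    finally show "kap {Suc a..a + r} ?c (\<Prod>i = 0..<r. zp (a + Suc i) (?e i (p i))) =
        (\<Prod>i = 0..<r. kh (int i) (?e i (p i)))" .
  qed
  also have "\<dots> = g_fun r \<gamma>"
    unfolding g_fun_def
    by (subst det_def'[of _ r], simp, intro sum.cong refl arg_cong2[of _ _ _ _ "(*)"] prod.cong)
      (auto dest: permutes_in_image)
  finally have 1: "kap {Suc a..a + r} ?c D = g_fun r \<gamma>" .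
  have "D = (\<Sum>p | p permutes {0..<r}. signof p * (\<Prod>i = 0..<r. zp (a + Suc i) (?e i 0) * zp (a + Suc i) 1 ^ p i))"
    unfolding D by (intro sum.cong refl arg_cong2[of _ _ _ _ "(*)"] prod.cong)
      (simp_all add: zp_power zp_add algebra_simps)
  also have "\<dots> = (\<Prod>i = 0..<r. zp (a + Suc i) (?e i 0)) *
      (\<Sum>p | p permutes {0..<r}. signof p * (\<Prod>i = 0..<r. zp (a + Suc i) 1 ^ p i))"
    by (simp add: prod.distrib sum_distrib_left mult_ac)
  also have "(\<Sum>p | p permutes {0..<r}. signof p * (\<Prod>i = 0..<r. zp (a + Suc i) 1 ^ p i)) =
      det (mat r r (\<lambda>(i, j). zp (a + Suc i) 1 ^ j))"
    by (subst det_def'[of _ r], simp, intro sum.cong refl arg_cong2[of _ _ _ _ "(*)"] prod.cong)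
      (auto dest: permutes_in_image)
  also have "\<dots> = (\<Prod>j<r. zp (a + Suc j) (int j)) * Vw a r"
    by (simp only: det_vandermonde Vw_vandermonde)
  also have "(\<Prod>i = 0..<r. zp (a + Suc i) (?e i 0)) * ((\<Prod>j<r. zp (a + Suc j) (int j)) * Vw a r) =
      (\<Prod>i<r. zp (a + Suc i) (?e i 0) * zp (a + Suc i) (int i)) * Vw a r"
    by (simp add: prod.distrib atLeast0LessThan mult_ac)
  also have "\<dots> = Vw a r * (\<Prod>i<r. zp (a + Suc i) (Poly_Mapping.lookup \<gamma> (Suc i)))"
    by (simp add: zp_add mult.commute)
  finally show ?thesis using 1 by simp
qed

section \<open>Multiplication through a window of zero rows\<close>

text \<open>Row j has degree 0 apart from these factors, so each part with 1/z_j dies and the row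
  contributes \<open>kh\<close> at 0, which is 1. This removes zero rows at the bottom.\<close>

lemma kap_last_row:
  assumes "finite I" "j \<notin> I" "only I f" "A \<subseteq> I"
  shows "kap (insert j I) c (f * (\<Prod>i\<in>A. nrt (i, j))) = kap I c f"
proof -
  have fA: "finite A" using assms finite_subset by blast
  have jA: "j \<notin> A" using assms by auto
  have "kap (insert j I) c (f * (\<Prod>i\<in>A. nrt (i, j))) = kap (insert j I) c f"
    using fA assms(4) jA
  proof (induction A)
    case (insert i A)
    let ?p = "\<Prod>i\<in>A. nrt (i, j)"
    have e: "f * (\<Prod>i\<in>insert i A. nrt (i, j)) = f * ?p - zp j (-1) * (zp i 1 * (f * ?p))"
      using insert by (simp add: nrt_def algebra_simps)
    have "low j (zp i 1 * (f * ?p))"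
      using insert assms by (intro low_mult low_zp low_prod only_low[OF assms(3)] low_nrt) auto
    then have "kap (insert j I) c (zp j (-1) * (zp i 1 * (f * ?p))) = 0"
      using assms by (intro kap_low) auto
    then show ?case unfolding e using insert by (simp add: kap_diff)
  qed simp
  also have "\<dots> = kap I c f"
  proof -
    have "kap (I \<union> {j}) c (f * 1) = kap I c f * kap {j} c 1"
      using assms by (intro kap_union only_1) auto
    moreover have "kap {j} c 1 = 1" by (simp add: kap_def lin_1)
    ultimately show ?thesis by simp
  qed
  finally show ?thesis .
qed

lemma only_nrt: "x \<in> I \<Longrightarrow> y \<in> I \<Longrightarrow> only I (nrt (x, y))"
  by (auto simp: nrt_def intro!: only_diff only_mult only_zp only_1)

lemma only_Vw: "only {Suc a..a + n} (Vw a n)"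
  unfolding Vw_def
proof (rule only_prod)
  fix p assume "p \<in> {(i, j). a < i \<and> i < j \<and> j \<le> a + n}"
  then obtain x y where "p = (x, y)" "a < x" "x < y" "y \<le> a + n" by auto
  then show "only {Suc a..a + n} (nrt p)" by (simp add: only_nrt)
qed

lemma only_mono: "only I f \<Longrightarrow> I \<subseteq> J \<Longrightarrow> only J f"
  unfolding only_def by blast

lemma kap_Vw_trailing:
  assumes "only {Suc a..a + r} f"
  shows "kap {Suc a..a + (r + t)} c (Vw a (r + t) * f) = kap {Suc a..a + r} c (Vw a r * f)"
proof (induction t)
  case (Suc t)
  have "{Suc a..a + (r + Suc t)} = insert (Suc (a + (r + t))) {Suc a..a + (r + t)}" by auto
  moreover have "Vw a (r + Suc t) * f = (Vw a (r + t) * f) * (\<Prod>i\<in>{Suc a..a + (r + t)}. nrt (i, Suc (a + (r + t))))"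
    using Vw_Suc[of a "r + t"] by (simp add: mult_ac)
  moreover have "only {Suc a..a + (r + t)} (Vw a (r + t) * f)"
    using only_Vw[of a "r + t"] only_mono[OF assms] by (intro only_mult) auto
  ultimately show ?case using Suc
    by (simp only:) (subst kap_last_row, auto)
qed simp

lemma psw_Vw_core:
  assumes "a < j" "Suc j \<le> a + n"
  shows "psw j (Suc j) (prod nrt ({(x, y). a < x \<and> x < y \<and> y \<le> a + n} - {(j, Suc j)})) =
    prod nrt ({(x, y). a < x \<and> x < y \<and> y \<le> a + n} - {(j, Suc j)})"
  by (rule psw_nrt_prod) (use assms in \<open>auto simp: transpose_Suc\<close>)

lemma Vw_remove:
  assumes "a < j" "Suc j \<le> a + n"
  shows "Vw a n = nrt (j, Suc j) * prod nrt ({(x, y). a < x \<and> x < y \<and> y \<le> a + n} - {(j, Suc j)})"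
  unfolding Vw_def by (rule prod_nrt_remove) (use assms in auto)

text \<open>A staircase of factors disappears one at a time: at a descent j of \<open>d\<close> all
  but one factor is symmetric in the rows j and j + 1, and \<open>kap_drop\<close> removes that one.
  It is used with X m a variable above the window, to detach the window, and with X = 1, to change
  its ranks.\<close>

lemma kap_window_drop:
  fixes X :: "nat \<Rightarrow> laurent"
  assumes I: "finite I" "{Suc a..a + n} \<subseteq> I" and c: "\<And>j. j \<in> {Suc a..a + n} \<Longrightarrow> c j = cw"
    and S: "\<And>j. a < j \<Longrightarrow> Suc j \<le> a + n \<Longrightarrow> psw j (Suc j) S = S"
    and X: "\<And>j m. a < j \<Longrightarrow> Suc j \<le> a + n \<Longrightarrow> psw j (Suc j) (X m) = X m"
    and d: "\<And>j. a < j \<Longrightarrow> Suc j \<le> a + n \<Longrightarrow> d j = d (Suc j) \<or> d j = Suc (d (Suc j))" "d (a + n) = 0"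
  shows "kap I c (Vw a n * (\<Prod>j\<in>{Suc a..a + n}. \<Prod>m<d j. 1 - X m * zp j (-1)) * S) = kap I c (Vw a n * S)"
  using d
proof (induction "\<Sum>j\<in>{Suc a..a + n}. d j" arbitrary: d rule: less_induct)
  case less
  let ?W = "{Suc a..a + n}"
  let ?F = "\<lambda>d. \<Prod>j\<in>?W. \<Prod>m<d j. 1 - X m * zp j (-1)"
  show ?case
  proof (cases "\<exists>j. a < j \<and> Suc j \<le> a + n \<and> d j = Suc (d (Suc j))")
    case False
    have "d (a + n - t) = 0" if "t < n" for t
      using that
    proof (induction t)
      case (Suc t)
      have "Suc (a + n - Suc t) = a + n - t" using Suc by simp
      moreover have x: "a < a + n - Suc t" "Suc (a + n - Suc t) \<le> a + n" using Suc by auto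
      moreover have "d (a + n - Suc t) \<noteq> Suc (d (Suc (a + n - Suc t)))" using False x by blast
      ultimately have "d (a + n - Suc t) = d (a + n - t)" using less.prems(1)[OF x] by metis
      then show ?case using Suc by simp
    qed (simp add: less.prems)
    then have "d j = 0" if "j \<in> ?W" for j using that \<open>\<And>t. t < n \<Longrightarrow> d (a + n - t) = 0\<close>[of "a + n - j"] by auto
    then show ?thesis by simp
  next
    case True
    \<comment> \<open>The least descent, so that lowering \<open>d j\<close> still leaves steps of 0
      or 1 on its left.\<close>
    define j where "j = (LEAST j. a < j \<and> Suc j \<le> a + n \<and> d j = Suc (d (Suc j)))"
    have j: "a < j" "Suc j \<le> a + n" "d j = Suc (d (Suc j))"
      using LeastI_ex[OF True] unfolding j_def by auto
    have least: "d i \<noteq> Suc (d (Suc i))" if "a < i" "i < j" for i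
      using not_less_Least[of i "\<lambda>j. a < j \<and> Suc j \<le> a + n \<and> d j = Suc (d (Suc j))"] that j
      unfolding j_def by auto
    define d' where "d' = d(j := d (Suc j))"
    have jW: "j \<in> ?W" "Suc j \<in> ?W" using j by auto
    have d'1: "d' i = d' (Suc i) \<or> d' i = Suc (d' (Suc i))" if i: "a < i" "Suc i \<le> a + n" for i
      using less.prems(1)[OF i] least[of i] j(3) i by (auto simp: d'_def)
    have d'2: "d' (a + n) = 0" using less.prems(2) j by (auto simp: d'_def)
    have "(\<Sum>i\<in>?W. d' i) < (\<Sum>i\<in>?W. d i)"
      by (rule sum_strict_mono_ex1) (use jW j in \<open>auto simp: d'_def intro!: bexI[of _ j]\<close>)
    then have IH: "kap I c (Vw a n * ?F d' * S) = kap I c (Vw a n * S)"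
      using less.hyps d'1 d'2 by blast
    have "?F d = (\<Prod>m<d j. 1 - X m * zp j (-1)) * (\<Prod>i\<in>?W - {j}. \<Prod>m<d i. 1 - X m * zp i (-1))"
      using jW by (intro prod.remove) auto
    also have "(\<Prod>m<d j. 1 - X m * zp j (-1)) =
        (1 - X (d (Suc j)) * zp j (-1)) * (\<Prod>m<d' j. 1 - X m * zp j (-1))"
      by (simp add: j(3) d'_def mult.commute)
    also have "(\<Prod>i\<in>?W - {j}. \<Prod>m<d i. 1 - X m * zp i (-1)) = (\<Prod>i\<in>?W - {j}. \<Prod>m<d' i. 1 - X m * zp i (-1))"
      by (intro prod.cong) (auto simp: d'_def)
    also have "(1 - X (d (Suc j)) * zp j (-1)) * (\<Prod>m<d' j. 1 - X m * zp j (-1)) *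
        (\<Prod>i\<in>?W - {j}. \<Prod>m<d' i. 1 - X m * zp i (-1)) = (1 - X (d (Suc j)) * zp j (-1)) * ?F d'"
      using jW by (simp add: prod.remove[of ?W j] mult.assoc)
    finally have Fd: "?F d = (1 - X (d (Suc j)) * zp j (-1)) * ?F d'" .
    have Fsym: "psw j (Suc j) (?F d') = ?F d'"
      unfolding psw_prod
    proof (rule prod.reindex_bij_witness[of _ "transpose j (Suc j)" "transpose j (Suc j)"])
      fix i assume i: "i \<in> ?W"
      have "d' (transpose j (Suc j) i) = d' i" by (simp add: d'_def transpose_Suc)
      then show "(\<Prod>m<d' (transpose j (Suc j) i). 1 - X m * zp (transpose j (Suc j) i) (- 1)) =
          (\<Prod>m<d' i. psw j (Suc j) (1 - X m * zp i (- 1)))"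
        using X[OF j(1,2)] by (simp add: psw_diff psw_mult)
    qed (use jW in \<open>auto simp: transpose_Suc\<close>)
    define S' where "S' = prod nrt ({(x, y). a < x \<and> x < y \<and> y \<le> a + n} - {(j, Suc j)}) * ?F d' * S"
    have S': "psw j (Suc j) S' = S'"
      unfolding S'_def using psw_Vw_core[OF j(1,2)] Fsym S[OF j(1,2)] by (simp only: psw_mult)
    have "Vw a n * ?F d * S = nrt (j, Suc j) * (1 - X (d (Suc j)) * zp j (-1)) * S'"
      unfolding Fd S'_def Vw_remove[OF j(1,2)] by (simp only: mult_ac)
    also have "kap I c \<dots> = kap I c (nrt (j, Suc j) * S')"
      using I jW by (intro kap_drop S' X[OF j(1,2)]) (auto simp: c)
    also have "nrt (j, Suc j) * S' = Vw a n * ?F d' * S"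
      unfolding S'_def Vw_remove[OF j(1,2)] by (simp only: mult_ac)
    finally show ?thesis using IH by simp
  qed
qed

text \<open>The elementary symmetric polynomial of degree r in the variables z_w - 1.\<close>

definition esw :: "nat \<Rightarrow> nat set \<Rightarrow> laurent" where
  "esw r W = (\<Sum>C | C \<subseteq> W \<and> card C = r. \<Prod>w\<in>C. zp w 1 - 1)"

lemma psw_esw:
  assumes "finite W" "j \<in> W" "q \<in> W" shows "psw j q (esw r W) = esw r W"
proof -
  have tW: "transpose j q ` C \<subseteq> W" if "C \<subseteq> W" for C
    using that assms by (auto simp: transpose_def)
  have tt: "transpose j q ` transpose j q ` C = C" for C by (simp add: image_image)
  have ct: "card (transpose j q ` C) = card C" for C
    by (rule card_image) (simp add: inj_on_subset[OF inj_transpose])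
  have "psw j q (esw r W) = (\<Sum>C | C \<subseteq> W \<and> card C = r. \<Prod>w\<in>C. zp (transpose j q w) 1 - 1)"
    by (simp add: esw_def psw_sum psw_prod psw_diff)
  also have "\<dots> = (\<Sum>C | C \<subseteq> W \<and> card C = r. \<Prod>w\<in>C. zp w 1 - 1)"
  proof (rule sum.reindex_bij_witness[of _ "(`) (transpose j q)" "(`) (transpose j q)"])
    fix C assume "C \<in> {C. C \<subseteq> W \<and> card C = r}"
    show "(\<Prod>w\<in>transpose j q ` C. zp w 1 - 1) = (\<Prod>w\<in>C. zp (transpose j q w) 1 - 1)"
      by (subst prod.reindex) (simp_all add: inj_on_subset[OF inj_transpose])
  qed (use tW ct tt in auto)
  finally show ?thesis by (simp add: esw_def)
qed

lemma only_esw: "finite W \<Longrightarrow> only W (esw r W)"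
  unfolding esw_def by (auto intro!: only_sum only_prod only_diff only_zp only_1)

lemma kap_v_prod:
  assumes "finite I" "finite J" "J \<subseteq> I"
  shows "kap I c ((\<Prod>j\<in>J. (1 - zp j (-1)) ^ d j) * f) = kap I (\<lambda>j. c j - (if j \<in> J then int (d j) else 0)) f"
  using assms(2,3)
proof (induction J arbitrary: c f)
  case (insert j J)
  have pow: "kap I c ((1 - zp j (-1)) ^ m * g) = kap I (c(j := c j - int m)) g" for m c g
  proof (induction m arbitrary: c)
    case (Suc m)
    have "kap I c ((1 - zp j (-1)) ^ Suc m * g) = kap I (c(j := c j - 1)) ((1 - zp j (-1)) ^ m * g)"
      using kap_v[OF assms(1), of j c "(1 - zp j (-1)) ^ m * g"] insert.prems
      by (simp only: power_Suc mult.assoc) simp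
    also have "\<dots> = kap I ((c(j := c j - 1))(j := (c(j := c j - 1)) j - int m)) g"
      by (rule Suc.IH)
    also have "\<dots> = kap I (c(j := c j - int (Suc m))) g"
      by (rule kap_cong) auto
    finally show ?case .
  qed simp
  have "kap I c ((\<Prod>j\<in>insert j J. (1 - zp j (-1)) ^ d j) * f) =
      kap I c ((\<Prod>j\<in>J. (1 - zp j (-1)) ^ d j) * ((1 - zp j (-1)) ^ d j * f))"
    using insert by (simp add: mult_ac)
  also have "\<dots> = kap I ((\<lambda>i. c i - (if i \<in> J then int (d i) else 0))(j := c j - int (d j))) f"
    using insert by (simp add: pow)
  also have "\<dots> = kap I (\<lambda>i. c i - (if i \<in> insert j J then int (d i) else 0)) f"
    using insert by (intro kap_cong) auto
  finally show ?case .
qed (simp)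

text \<open>\<open>kap_window_drop\<close> read backwards with X = 1 inserts the factors (1 -
  1/z_j)^(a+K-j), which lower the constant rank K to j - a. Each chosen z_w - 1 lowers the rank of w
  once more. A subset containing w + 1 but not w thus gives two rows of equal rank and vanishes. The
  remaining subset is the initial segment, whose ranks 0, ..., r - 1 are those of the determinant of
  g (1^r).\<close>

lemma kap_window_value:
  assumes r: "r \<le> K" and c: "\<And>j. j \<in> {Suc a..a + K} \<Longrightarrow> c j = int K"
  shows "kap {Suc a..a + K} c (Vw a K * esw r {Suc a..a + K}) = g_fun r (ones r)"
proof -
  let ?W = "{Suc a..a + K}"
  let ?d = "\<lambda>j. a + K - j"
  let ?c1 = "\<lambda>j. int j - int a"
  have "kap ?W c (Vw a K * esw r ?W) = kap ?W c (Vw a K * (\<Prod>j\<in>?W. \<Prod>m<?d j. 1 - 1 * zp j (-1)) * esw r ?W)"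
    by (rule kap_window_drop[symmetric, where cw = "int K" and X = "\<lambda>_. 1" and d = ?d]) (auto simp: c psw_esw)
  also have "(\<Prod>j\<in>?W. \<Prod>m<?d j. 1 - 1 * zp j (-1)) = (\<Prod>j\<in>?W. (1 - zp j (-1)) ^ ?d j)"
    by simp
  also have "kap ?W c (Vw a K * (\<Prod>j\<in>?W. (1 - zp j (-1)) ^ ?d j) * esw r ?W) =
      kap ?W (\<lambda>j. c j - (if j \<in> ?W then int (?d j) else 0)) (Vw a K * esw r ?W)"
    using kap_v_prod[of ?W ?W c ?d "Vw a K * esw r ?W"] by (simp add: mult_ac)
  also have "\<dots> = kap ?W ?c1 (Vw a K * esw r ?W)"
    by (rule kap_cong) (auto simp: c)
  also have "\<dots> = (\<Sum>C | C \<subseteq> ?W \<and> card C = r. kap ?W ?c1 (Vw a K * (\<Prod>w\<in>C. zp w 1 - 1)))"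
    by (simp add: esw_def sum_distrib_left kap_sum)
  also have "\<dots> = (\<Sum>C | C \<subseteq> ?W \<and> card C = r.
      kap ?W (\<lambda>j. ?c1 j - (if j \<in> C then 1 else 0)) (Vw a K * (\<Prod>w\<in>C. zp w 1)))"
  proof (intro sum.cong refl)
    fix C assume C: "C \<in> {C. C \<subseteq> ?W \<and> card C = r}"
    have "(\<Prod>w\<in>C. zp w 1 - 1) = (\<Prod>w\<in>C. (1 - zp w (-1)) ^ 1 * zp w 1)"
      by (intro prod.cong) (auto simp: left_diff_distrib)
    then have e: "Vw a K * (\<Prod>w\<in>C. zp w 1 - 1) = (\<Prod>w\<in>C. (1 - zp w (-1)) ^ 1) * (Vw a K * (\<Prod>w\<in>C. zp w 1))"
      by (simp add: prod.distrib mult_ac)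
    show "kap ?W ?c1 (Vw a K * (\<Prod>w\<in>C. zp w 1 - 1)) =
        kap ?W (\<lambda>j. ?c1 j - (if j \<in> C then 1 else 0)) (Vw a K * (\<Prod>w\<in>C. zp w 1))"
      unfolding e by (subst kap_v_prod) (use C finite_subset[of C ?W] in \<open>auto intro!: kap_cong\<close>)
  qed
  also have "\<dots> = (\<Sum>C\<in>{{Suc a..a + r}}.
      kap ?W (\<lambda>j. ?c1 j - (if j \<in> C then 1 else 0)) (Vw a K * (\<Prod>w\<in>C. zp w 1)))"
  proof (rule sum.mono_neutral_right)
    show "finite {C. C \<subseteq> ?W \<and> card C = r}" by simp
    show "{{Suc a..a + r}} \<subseteq> {C. C \<subseteq> ?W \<and> card C = r}" using r by auto
    show "\<forall>C\<in>{C. C \<subseteq> ?W \<and> card C = r} - {{Suc a..a + r}}.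
        kap ?W (\<lambda>j. ?c1 j - (if j \<in> C then 1 else 0)) (Vw a K * (\<Prod>w\<in>C. zp w 1)) = 0"
    proof
      fix C assume "C \<in> {C. C \<subseteq> ?W \<and> card C = r} - {{Suc a..a + r}}"
      then have C: "C \<subseteq> ?W" "card C = r" "C \<noteq> {Suc a..a + r}" by auto
      have "\<exists>w. a < w \<and> w \<notin> C \<and> Suc w \<in> C"
      proof (rule ccontr)
        assume no: "\<nexists>w. a < w \<and> w \<notin> C \<and> Suc w \<in> C"
        have down: "w - t \<in> C" if "w \<in> C" "a < w - t" for w t
          using that
        proof (induction t)
          case (Suc t)
          then have "Suc (w - Suc t) = w - t" "w - t \<in> C" by auto
          then show ?case using no Suc by (metis)
        qed simp
        have finC: "finite C" using C(1) finite_subset by blast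
        have "C \<subseteq> {Suc a..a + r}"
        proof
          fix w assume w: "w \<in> C"
          then have wa: "a < w" using C(1) by auto
          have "{Suc a..w} \<subseteq> C"
          proof
            fix u assume "u \<in> {Suc a..w}"
            then show "u \<in> C" using down[OF w, of "w - u"] by auto
          qed
          then have "card {Suc a..w} \<le> card C" by (rule card_mono[OF finC])
          then have "w - a \<le> r" using C(2) by simp
          then show "w \<in> {Suc a..a + r}" using wa by auto
        qed
        then show False using C(2,3) card_subset_eq[of "{Suc a..a + r}" C] by auto
      qed
      then obtain w where w: "a < w" "w \<notin> C" "Suc w \<in> C" by auto
      have wK: "Suc w \<le> a + K" using w C(1) by auto
      have finC: "finite C" using C(1) finite_subset by blast
      define S where "S = prod nrt ({(x, y). a < x \<and> x < y \<and> y \<le> a + K} - {(w, Suc w)}) * (\<Prod>v\<in>C - {Suc w}. zp v 1)"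
      have "psw w (Suc w) (\<Prod>v\<in>C - {Suc w}. zp v 1) = (\<Prod>v\<in>C - {Suc w}. zp v 1)"
        unfolding psw_prod using w by (intro prod.cong) (auto simp: transpose_Suc)
      then have S: "psw w (Suc w) S = S"
        unfolding S_def psw_mult psw_Vw_core[OF w(1) wK] by simp
      have "Vw a K * (\<Prod>w\<in>C. zp w 1) = nrt (w, Suc w) * zp (Suc w) 1 * S"
        unfolding S_def Vw_remove[OF w(1) wK] prod.remove[OF finC w(3)] by (simp only: mult_ac)
      also have "kap ?W (\<lambda>j. ?c1 j - (if j \<in> C then 1 else 0)) \<dots> = 0"
        using w wK by (intro kap_pair_Z S) auto
      finally show "kap ?W (\<lambda>j. ?c1 j - (if j \<in> C then 1 else 0)) (Vw a K * (\<Prod>w\<in>C. zp w 1)) = 0" .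
    qed
  qed
  also have "\<dots> = kap {Suc a..a + (r + (K - r))} (\<lambda>j. ?c1 j - (if j \<in> {Suc a..a + r} then 1 else 0))
      (Vw a (r + (K - r)) * (\<Prod>w\<in>{Suc a..a + r}. zp w 1))"
    using r by simp
  also have "\<dots> = kap {Suc a..a + r} (\<lambda>j. ?c1 j - (if j \<in> {Suc a..a + r} then 1 else 0))
      (Vw a r * (\<Prod>w\<in>{Suc a..a + r}. zp w 1))"
    by (rule kap_Vw_trailing) (auto intro!: only_prod only_zp)
  also have "\<dots> = kap {Suc a..a + r} (\<lambda>j. int j - int a - 1) (Vw a r * (\<Prod>w\<in>{Suc a..a + r}. zp w 1))"
    by (rule kap_cong) auto
  also have "(\<Prod>w\<in>{Suc a..a + r}. zp w 1) = (\<Prod>i<r. zp (a + Suc i) (Poly_Mapping.lookup (ones r) (Suc i)))"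
  proof (rule prod.reindex_bij_witness[of _ "\<lambda>i. a + Suc i" "\<lambda>i. i - Suc a"])
    fix w assume w: "w \<in> {Suc a..a + r}"
    have "Poly_Mapping.lookup (ones r) (Suc (w - Suc a)) = 1"
      using w by (auto simp: ones_def lookup_sum lookup_single when_def)
    then show "zp (a + Suc (w - Suc a)) (Poly_Mapping.lookup (ones r) (Suc (w - Suc a))) = zp w 1"
      using w by simp
  qed auto
  finally show ?thesis by (simp only: g_fun_eq_kap[of r "ones r" a])
qed

lemma cc_deep:
  assumes b: "rowfun K n b" and j: "n + K < j"
  shows "cc b j = int K"
proof -
  have "{i. 1 \<le> i \<and> i < j \<and> j \<le> b i} = {j - K..<j}"
  proof (rule Set.set_eqI)
    fix i
    show "i \<in> {i. 1 \<le> i \<and> i < j \<and> j \<le> b i} \<longleftrightarrow> i \<in> {j - K..<j}"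
      using rowfunD(3)[OF b, of i] rowfunD(5)[OF b, of i] j by (cases "n < i") auto
  qed
  then show ?thesis using j by (simp add: cc_def)
qed

text \<open>The pairs joining earlier rows to the window form a staircase. All window rows have rank
  K, so \<open>kap_window_drop\<close> deletes it, and the functional splits into the partition part
  and the window part.\<close>

lemma GG_window:
  assumes b: "rowfun K n b" and l: "n + K \<le> l0" and r: "r \<le> K"
  shows "GG K (l0 + K) b {} (esw r {Suc l0..l0 + K}) = g_fun r (ones r) * GG K l0 b {} 1"
proof -
  let ?W = "{Suc l0..l0 + K}" and ?l = "l0 + K"
  let ?d = "\<lambda>j. l0 + K - j"
  let ?H = "prod nrt (NR l0 b) * ZM K l0 b"
  define Xp where "Xp = {(i, j). 1 \<le> i \<and> i \<le> l0 \<and> l0 < j \<and> j \<le> ?l \<and> j < b i}"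
  have K: "2 \<le> K" using rowfunD(1)[OF b] .
  have bdeep: "b i = i + K" if "n < i" for i using rowfunD(5)[OF b that] .
  have XpNR: "Xp \<subseteq> NR ?l b" by (auto simp: Xp_def NR_def)
  have finX: "finite Xp" by (rule finite_subset[OF XpNR finite_NR])
  have "NR ?l b = NR l0 b \<union> ({(i, j). l0 < i \<and> i < j \<and> j \<le> l0 + K} \<union> Xp)"
  proof (rule Set.set_eqI)
    fix p :: "nat \<times> nat"
    obtain i j where p: "p = (i, j)" by (cases p)
    show "p \<in> NR ?l b \<longleftrightarrow> p \<in> NR l0 b \<union> ({(i, j). l0 < i \<and> i < j \<and> j \<le> l0 + K} \<union> Xp)"
      unfolding p NR_def Xp_def using bdeep[of i] l by (cases "l0 < i") auto
  qed
  moreover have "prod nrt (NR l0 b \<union> ({(i, j). l0 < i \<and> i < j \<and> j \<le> l0 + K} \<union> Xp)) =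
      prod nrt (NR l0 b) * prod nrt ({(i, j). l0 < i \<and> i < j \<and> j \<le> l0 + K} \<union> Xp)"
  proof (rule prod.union_disjoint)
    show "finite ({(i, j). l0 < i \<and> i < j \<and> j \<le> l0 + K} \<union> Xp)" using finX by simp
    show "NR l0 b \<inter> ({(i, j). l0 < i \<and> i < j \<and> j \<le> l0 + K} \<union> Xp) = {}" by (auto simp: NR_def Xp_def)
  qed simp
  moreover have "prod nrt ({(i, j). l0 < i \<and> i < j \<and> j \<le> l0 + K} \<union> Xp) = Vw l0 K * prod nrt Xp"
    unfolding Vw_def
  proof (rule prod.union_disjoint)
    show "{(i, j). l0 < i \<and> i < j \<and> j \<le> l0 + K} \<inter> Xp = {}" by (auto simp: Xp_def)
  qed (simp_all add: finX)
  moreover have "prod nrt Xp = (\<Prod>j\<in>?W. \<Prod>m<?d j. 1 - zp (l0 - m) 1 * zp j (-1))"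
  proof -
    have "(\<Prod>j\<in>?W. \<Prod>m<?d j. 1 - zp (l0 - m) 1 * zp j (-1)) =
        (\<Prod>(j, m)\<in>(SIGMA j:?W. {..<?d j}). 1 - zp (l0 - m) 1 * zp j (-1))"
      by (rule prod.Sigma) auto
    also have "\<dots> = prod nrt Xp"
    proof (rule prod.reindex_bij_witness[of _ "\<lambda>(i, j). (j, l0 - i)" "\<lambda>(j, m). (l0 - m, j)"])
      fix p assume "p \<in> Xp"
      then obtain i j where p: "p = (i, j)" "1 \<le> i" "i \<le> l0" "l0 < j" "j \<le> ?l" "j < b i"
        by (auto simp: Xp_def)
      \<comment> \<open>Rows of the partition proper end before the window since
        \<open>n + K \<le> l0\<close>; only zero rows meet it, and this gives the regular
        staircase.\<close>
      have "n < i"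
      proof (rule ccontr)
        assume "\<not> n < i"
        then have "b i \<le> n + K" using rowfunD(3)[OF b p(2)] by simp
        then show False using p l by simp
      qed
      then have "j < i + K" using bdeep p by simp
      then show "(case p of (i, j) \<Rightarrow> (j, l0 - i)) \<in> (SIGMA j:?W. {..<?d j})" using p by auto
    next
      fix p assume "p \<in> (SIGMA j:?W. {..<?d j})"
      then obtain j m where p: "p = (j, m)" "l0 < j" "j \<le> ?l" "m < ?d j" by auto
      have "m < K" "n < l0 - m" using p l by auto
      then show "(case p of (j, m) \<Rightarrow> (l0 - m, j)) \<in> Xp" using p bdeep[of "l0 - m"] by (auto simp: Xp_def)
    next
      fix p assume "p \<in> (SIGMA j:?W. {..<?d j})"
      then obtain j m where p: "p = (j, m)" "l0 < j" "j \<le> ?l" "m < ?d j" by auto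
      have "m \<le> l0" using p l by auto
      then show "(case case p of (j, m) \<Rightarrow> (l0 - m, j) of (i, j) \<Rightarrow> (j, l0 - i)) = p" using p by simp
    next
      fix p assume "p \<in> Xp"
      then show "(case case p of (i, j) \<Rightarrow> (j, l0 - i) of (j, m) \<Rightarrow> (l0 - m, j)) = p" by (auto simp: Xp_def)
    next
      fix p assume "p \<in> (SIGMA j:?W. {..<?d j})"
      show "nrt (case p of (j, m) \<Rightarrow> (l0 - m, j)) = (case p of (j, m) \<Rightarrow> 1 - zp (l0 - m) 1 * zp j (- 1))"
        by (cases p) (simp add: nrt_def)
    qed
    finally show ?thesis ..
  qed
  moreover have "ZM K ?l b = ZM K l0 b"
  proof -
    have "ZM K ?l b = (\<Prod>i\<in>{1..l0}. zp i (int i + int K - int (b i))) * (\<Prod>i\<in>?W. zp i (int i + int K - int (b i)))"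
      unfolding ZM_def by (subst prod.union_disjoint[symmetric]) (auto intro!: prod.cong)
    also have "(\<Prod>i\<in>?W. zp i (int i + int K - int (b i))) = 1"
      using bdeep l by (intro prod.neutral) auto
    finally show ?thesis by (simp add: ZM_def)
  qed
  ultimately have e: "prod nrt (NR ?l b - {}) * ZM K ?l b * esw r ?W =
      Vw l0 K * (\<Prod>j\<in>?W. \<Prod>m<?d j. 1 - zp (l0 - m) 1 * zp j (-1)) * (?H * esw r ?W)"
    by (simp add: mult_ac)
  have onlyH: "only {1..l0} ?H"
  proof (rule only_mult)
    show "only {1..l0} (prod nrt (NR l0 b))"
    proof (rule only_prod)
      fix p assume "p \<in> NR l0 b"
      then obtain x y where "p = (x, y)" "1 \<le> x" "x < y" "y \<le> l0" by (auto simp: NR_def)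
      then show "only {1..l0} (nrt p)" by (simp add: only_nrt)
    qed
    show "only {1..l0} (ZM K l0 b)" unfolding ZM_def by (auto intro!: only_prod only_zp)
  qed
  have cW: "cc b j = int K" if "j \<in> ?W" for j using cc_deep[OF b, of j] l that by simp
  have "GG K ?l b {} (esw r ?W) = kap {1..?l} (cc b) (Vw l0 K * (?H * esw r ?W))"
    unfolding GG_def e
  proof (rule kap_window_drop[where cw = "int K" and X = "\<lambda>m. zp (l0 - m) 1" and d = ?d])
    fix j assume j: "l0 < j" "Suc j \<le> l0 + K"
    show "psw j (Suc j) (?H * esw r ?W) = ?H * esw r ?W"
      using psw_only[OF onlyH, of j "Suc j"] psw_esw[of ?W j "Suc j" r] j by (simp add: psw_mult)
    show "psw j (Suc j) (zp (l0 - m) 1) = zp (l0 - m) 1" for m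
      using j by (auto simp: transpose_Suc)
  qed (auto simp: cW)
  also have "Vw l0 K * (?H * esw r ?W) = ?H * (Vw l0 K * esw r ?W)" by (simp only: mult_ac)
  also have "{1..?l} = {1..l0} \<union> ?W" by auto
  also have "kap ({1..l0} \<union> ?W) (cc b) (?H * (Vw l0 K * esw r ?W)) =
      kap {1..l0} (cc b) ?H * kap ?W (cc b) (Vw l0 K * esw r ?W)"
    by (rule kap_union[OF _ _ _ onlyH only_mult[OF only_Vw only_esw]]) auto
  also have "kap ?W (cc b) (Vw l0 K * esw r ?W) = g_fun r (ones r)"
    by (rule kap_window_value[OF r cW])
  finally show ?thesis by (simp add: GG_def mult.commute)
qed

section \<open>Katalan functions as values of the row functional\<close>

lemma zcoeff_0 [simp]: "zcoeff 0 \<beta> = 0"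
  by (simp add: zero_zseries.rep_eq)

lemma zcoeff_sum: "zcoeff (sum F A) \<beta> = (\<Sum>x\<in>A. zcoeff (F x) \<beta>)"
  by (induction A rule: infinite_finite_induct) (auto simp: plus_zseries.rep_eq)

lemma zcoeff_of_int_mult: "zcoeff (of_int z * x) \<beta> = z * zcoeff x \<beta>"
proof -
  have nat: "zcoeff (of_nat m * x) \<beta> = int m * zcoeff x \<beta>" for m x
    by (induction m) (simp_all add: plus_zseries.rep_eq distrib_right)
  show ?thesis
  proof (cases "0 \<le> z")
    case True
    then show ?thesis using nat[of "nat z" x] by simp
  next
    case False
    have "of_int z * x = - (of_nat (nat (- z)) * x)" using False by simp
    then show ?thesis using nat[of "nat (- z)" x] False by (simp only: uminus_zseries.rep_eq) simp
  qed
qed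

definition zemb :: "laurent \<Rightarrow> zseries" where "zemb = lin zmono"

lemma zemb_mult: "zemb (f * g) = zemb f * zemb g"
  unfolding zemb_def by (rule lin_mult) (simp add: zmono_mult)

lemma zemb_1: "zemb 1 = 1"
  by (simp add: zemb_def lin_1 zmono_0)

lemma zemb_diff: "zemb (f - g) = zemb f - zemb g"
  by (simp add: zemb_def lin_diff)

lemma zemb_single: "zemb (Poly_Mapping.single \<gamma> 1) = zmono \<gamma>"
  by (simp add: zemb_def lin_single)

lemma zemb_prod: "zemb (prod F A) = (\<Prod>x\<in>A. zemb (F x))"
  by (induction A rule: infinite_finite_induct) (auto simp: zemb_mult zemb_1)

lemma zcoeff_zemb_mult:
  "zcoeff (zemb p * f) \<beta> = (\<Sum>\<delta>\<in>Poly_Mapping.keys p. Poly_Mapping.lookup p \<delta> * zcoeff f (\<beta> - \<delta>))"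
  unfolding zemb_def lin_def
  by (simp add: sum_distrib_right zcoeff_sum mult.assoc zcoeff_of_int_mult zcoeff_zmono_mult)

lemma zcoeff_zemb: "zcoeff (zemb p) \<beta> = Poly_Mapping.lookup p \<beta>"
proof -
  have "zcoeff (zemb p) \<beta> = (\<Sum>\<delta>\<in>Poly_Mapping.keys p. Poly_Mapping.lookup p \<delta> * (if \<beta> - \<delta> = 0 then 1 else 0))"
    using zcoeff_zemb_mult[of p 1 \<beta>] by (simp add: one_zseries.rep_eq)
  also have "\<dots> = (\<Sum>\<delta>\<in>Poly_Mapping.keys p. if \<delta> = \<beta> then Poly_Mapping.lookup p \<delta> else 0)"
    by (intro sum.cong) auto
  also have "\<dots> = Poly_Mapping.lookup p \<beta>"
    by (auto simp: sum.delta in_keys_iff)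
  finally show ?thesis .
qed

lemma total_root_comb: "(\<Sum>i = 1..l. Poly_Mapping.lookup (root_comb l n) i) = 0"
proof (cases "l \<le> 1")
  case True
  then show ?thesis by (intro sum.neutral) (auto simp: lookup_root_comb)
next
  case False
  then obtain m where m: "l = Suc m" "1 \<le> m" by (cases l) auto
  have "(\<Sum>i = 1..l. Poly_Mapping.lookup (root_comb l n) i) =
      (\<Sum>i = 1..m. Poly_Mapping.lookup (root_comb l n) i) + Poly_Mapping.lookup (root_comb l n) l"
    using m by simp
  also have "\<dots> = 0" using psum_root_comb[of m l n] m by (simp add: lookup_root_comb)
  finally show ?thesis .
qed

text \<open>The coefficients of the simple roots are minus the tail sums of the exponent, hence
  bounded once every coordinate is bounded below. This finiteness permits the rearrangement in
  \<open>g_map_eq_kap\<close>.\<close>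

lemma A_ring_finite_above:
  assumes "f \<in> A_ring l"
  shows "finite {\<gamma>. zcoeff f \<gamma> \<noteq> 0 \<and> (\<forall>i\<in>{1..l}. Poly_Mapping.lookup \<delta> i \<le> Poly_Mapping.lookup \<gamma> i)}"
proof -
  obtain S where S: "finite S" "\<And>\<beta>. zcoeff f \<beta> \<noteq> 0 \<Longrightarrow> \<exists>\<gamma> \<in> S. \<beta> - \<gamma> \<in> Qplus l"
    using assms unfolding A_ring_def cone_supported_def by blast
  define bd where "bd \<gamma> m = nat (\<Sum>i = Suc m..l. Poly_Mapping.lookup \<gamma> i - Poly_Mapping.lookup \<delta> i)" for \<gamma> :: zvec and m
  let ?X = "\<lambda>\<gamma>. {q \<in> Qplus l. \<exists>n. q = root_comb l n \<and> (\<forall>m \<in> {1..<l}. n m \<le> bd \<gamma> m)}"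
  have "{\<gamma>. zcoeff f \<gamma> \<noteq> 0 \<and> (\<forall>i\<in>{1..l}. Poly_Mapping.lookup \<delta> i \<le> Poly_Mapping.lookup \<gamma> i)} \<subseteq>
      (\<Union>\<gamma> \<in> S. (+) \<gamma> ` ?X \<gamma>)"
  proof
    fix \<beta> assume "\<beta> \<in> {\<gamma>. zcoeff f \<gamma> \<noteq> 0 \<and> (\<forall>i\<in>{1..l}. Poly_Mapping.lookup \<delta> i \<le> Poly_Mapping.lookup \<gamma> i)}"
    then have nz: "zcoeff f \<beta> \<noteq> 0" "\<And>i. i \<in> {1..l} \<Longrightarrow> Poly_Mapping.lookup \<delta> i \<le> Poly_Mapping.lookup \<beta> i" by auto
    then obtain \<gamma> n where \<gamma>: "\<gamma> \<in> S" "\<beta> - \<gamma> = root_comb l n" using S unfolding Qplus_def by blast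
    have \<beta>: "\<beta> = \<gamma> + root_comb l n" using \<gamma>(2) by (metis add.commute diff_add_cancel)
    have "n m \<le> bd \<gamma> m" if m: "m \<in> {1..<l}" for m
    proof -
      have "(\<Sum>i = 1..m. Poly_Mapping.lookup (root_comb l n) i) + (\<Sum>i = Suc m..l. Poly_Mapping.lookup (root_comb l n) i) =
          (\<Sum>i = 1..l. Poly_Mapping.lookup (root_comb l n) i)"
        using m by (subst sum.union_disjoint[symmetric]) (auto intro!: sum.cong)
      then have "int (n m) = - (\<Sum>i = Suc m..l. Poly_Mapping.lookup (root_comb l n) i)"
        using psum_root_comb[of m l n] total_root_comb[of l n] m by simp
      also have "\<dots> = (\<Sum>i = Suc m..l. - Poly_Mapping.lookup (root_comb l n) i)"
        by (simp add: sum_negf)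
      also have "\<dots> \<le> (\<Sum>i = Suc m..l. Poly_Mapping.lookup \<gamma> i - Poly_Mapping.lookup \<delta> i)"
      proof (rule sum_mono)
        fix i assume "i \<in> {Suc m..l}"
        then have "Poly_Mapping.lookup \<delta> i \<le> Poly_Mapping.lookup \<gamma> i + Poly_Mapping.lookup (root_comb l n) i"
          using nz(2)[of i] by (simp add: \<beta> lookup_add)
        then show "- Poly_Mapping.lookup (root_comb l n) i \<le> Poly_Mapping.lookup \<gamma> i - Poly_Mapping.lookup \<delta> i"
          by simp
      qed
      finally show ?thesis by (simp add: bd_def)
    qed
    then have "root_comb l n \<in> ?X \<gamma>" by (auto simp: Qplus_def)
    then show "\<beta> \<in> (\<Union>\<gamma> \<in> S. (+) \<gamma> ` ?X \<gamma>)" using \<gamma>(1) \<beta> by blast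
  qed
  then show ?thesis
    by (rule finite_subset) (intro finite_UN_I[OF S(1)] finite_imageI finite_Qplus_bounded)
qed

lemma prod_zp_eq_single:
  assumes "\<gamma> \<in> zvecs l"
  shows "(\<Prod>i\<in>{1..l}. zp i (Poly_Mapping.lookup \<gamma> i)) = Poly_Mapping.single \<gamma> 1"
proof -
  have "(\<Prod>i\<in>A. zp i (Poly_Mapping.lookup \<gamma> i)) =
      Poly_Mapping.single (\<Sum>i\<in>A. Poly_Mapping.single i (Poly_Mapping.lookup \<gamma> i)) 1" if "finite A" for A
    using that by (induction A) (simp_all add: zp_def mult_single)
  moreover have "(\<Sum>i\<in>{1..l}. Poly_Mapping.single i (Poly_Mapping.lookup \<gamma> i)) = \<gamma>"
  proof -
    have "(\<Sum>i\<in>{1..l}. Poly_Mapping.single i (Poly_Mapping.lookup \<gamma> i)) =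
        (\<Sum>i\<in>Poly_Mapping.keys \<gamma>. Poly_Mapping.single i (Poly_Mapping.lookup \<gamma> i))"
      using assms unfolding zvecs_def by (intro sum.mono_neutral_right) (auto simp: in_keys_iff)
    then show ?thesis by (simp add: pm_sum_singles)
  qed
  ultimately show ?thesis by simp
qed

text \<open>Expand each \<open>g_fun\<close> through the Vandermonde product and regroup by the
  total exponent. Although \<open>f\<close> may be an infinite series, only finitely many of its
  terms survive after a fixed shift \<delta>, because \<open>kh\<close> vanishes in negative
  degree.\<close>

lemma g_map_eq_kap:
  assumes f: "f \<in> A_ring l" and p: "zemb (Vw 0 l) * f = zemb p"
  shows "g_map l f = kap {1..l} (\<lambda>j. int j - 1) p"
proof -
  let ?\<phi> = "\<lambda>\<gamma>::zvec. \<Prod>i\<in>{1..l}. kh (int i - 1) (Poly_Mapping.lookup \<gamma> i)"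
  let ?V = "Vw 0 l"
  have g: "g_fun l \<gamma> = (\<Sum>\<delta>\<in>Poly_Mapping.keys ?V. of_int (Poly_Mapping.lookup ?V \<delta>) * ?\<phi> (\<delta> + \<gamma>))"
    if "\<gamma> \<in> zvecs l" for \<gamma>
  proof -
    have "(\<Prod>i<l. zp (0 + Suc i) (Poly_Mapping.lookup \<gamma> (Suc i))) = (\<Prod>i\<in>{1..l}. zp i (Poly_Mapping.lookup \<gamma> i))"
      by (rule prod.reindex_bij_witness[of _ "\<lambda>i. i - 1" Suc]) auto
    then have "g_fun l \<gamma> = kap {1..l} (\<lambda>j. int j - 1) (?V * Poly_Mapping.single \<gamma> 1)"
      using g_fun_eq_kap[of l \<gamma> 0] prod_zp_eq_single[OF that] by simp
    also have "?V * Poly_Mapping.single \<gamma> 1 =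
        (\<Sum>\<delta>\<in>Poly_Mapping.keys ?V. Poly_Mapping.single (\<delta> + \<gamma>) (Poly_Mapping.lookup ?V \<delta>))"
      by (subst pm_sum_singles[of ?V, symmetric]) (simp only: sum_distrib_right mult_single mult_1_right)
    finally show ?thesis by (simp only: kap_sum kap_single)
  qed
  have fin: "finite {\<gamma>. zcoeff f \<gamma> \<noteq> 0 \<and> ?\<phi> (\<delta> + \<gamma>) \<noteq> 0}" for \<delta>
  proof (rule finite_subset[OF _ A_ring_finite_above[OF f, of "- \<delta>"]])
    show "{\<gamma>. zcoeff f \<gamma> \<noteq> 0 \<and> ?\<phi> (\<delta> + \<gamma>) \<noteq> 0} \<subseteq>
        {\<gamma>. zcoeff f \<gamma> \<noteq> 0 \<and> (\<forall>i\<in>{1..l}. Poly_Mapping.lookup (- \<delta>) i \<le> Poly_Mapping.lookup \<gamma> i)}"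
    proof safe
      fix \<gamma> i assume *: "?\<phi> (\<delta> + \<gamma>) \<noteq> 0" "i \<in> {1..l}"
      have "0 \<le> Poly_Mapping.lookup (\<delta> + \<gamma>) i"
      proof (rule ccontr)
        assume "\<not> ?thesis"
        then have "kh (int i - 1) (Poly_Mapping.lookup (\<delta> + \<gamma>) i) = 0" by (simp add: kh_neg)
        then have "?\<phi> (\<delta> + \<gamma>) = 0" using *(2) by (intro prod_zero) auto
        then show False using * by simp
      qed
      then show "Poly_Mapping.lookup (- \<delta>) i \<le> Poly_Mapping.lookup \<gamma> i" by (simp add: lookup_add)
    qed
  qed
  define A where "A = (\<Union>\<delta>\<in>Poly_Mapping.keys ?V. {\<gamma>. zcoeff f \<gamma> \<noteq> 0 \<and> ?\<phi> (\<delta> + \<gamma>) \<noteq> 0})"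
  define E where "E = (\<lambda>(\<delta>, \<gamma>). \<delta> + \<gamma>) ` (Poly_Mapping.keys ?V \<times> A) \<union> Poly_Mapping.keys p"
  have finA: "finite A" unfolding A_def using fin by auto
  have finE: "finite E" unfolding E_def using finA by auto
  have zv: "\<gamma> \<in> zvecs l" if "zcoeff f \<gamma> \<noteq> 0" for \<gamma> using f that by (auto simp: A_ring_def)
  have "g_map l f = (\<Sum>\<gamma>\<in>A. of_int (zcoeff f \<gamma>) * g_fun l \<gamma>)"
    unfolding g_map_def
  proof (rule Sum_any.expand_superset[OF finA])
    show "{\<gamma>. of_int (zcoeff f \<gamma>) * g_fun l \<gamma> \<noteq> 0} \<subseteq> A"
    proof
      fix \<gamma> assume "\<gamma> \<in> {\<gamma>. of_int (zcoeff f \<gamma>) * g_fun l \<gamma> \<noteq> 0}"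
      then have nz: "zcoeff f \<gamma> \<noteq> 0" "g_fun l \<gamma> \<noteq> 0" by auto
      then obtain \<delta> where "\<delta> \<in> Poly_Mapping.keys ?V" "?\<phi> (\<delta> + \<gamma>) \<noteq> 0"
        using g[OF zv[OF nz(1)]] by (metis (mono_tags, lifting) mult_zero_right sum.neutral)
      then show "\<gamma> \<in> A" using nz(1) unfolding A_def by blast
    qed
  qed
  also have "\<dots> = (\<Sum>\<gamma>\<in>A. \<Sum>\<delta>\<in>Poly_Mapping.keys ?V.
      of_int (Poly_Mapping.lookup ?V \<delta> * zcoeff f \<gamma>) * ?\<phi> (\<delta> + \<gamma>))"
  proof (rule sum.cong[OF refl])
    fix \<gamma> assume "\<gamma> \<in> A"
    then have "\<gamma> \<in> zvecs l" using zv unfolding A_def by blast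
    then show "of_int (zcoeff f \<gamma>) * g_fun l \<gamma> = (\<Sum>\<delta>\<in>Poly_Mapping.keys ?V.
        of_int (Poly_Mapping.lookup ?V \<delta> * zcoeff f \<gamma>) * ?\<phi> (\<delta> + \<gamma>))"
      by (simp only: g sum_distrib_left of_int_mult mult_ac)
  qed
  also have "\<dots> = (\<Sum>\<delta>\<in>Poly_Mapping.keys ?V. \<Sum>\<gamma>\<in>A.
      of_int (Poly_Mapping.lookup ?V \<delta> * zcoeff f \<gamma>) * ?\<phi> (\<delta> + \<gamma>))"
    by (rule sum.swap)
  also have "\<dots> = (\<Sum>\<delta>\<in>Poly_Mapping.keys ?V. \<Sum>\<epsilon>\<in>E.
      of_int (Poly_Mapping.lookup ?V \<delta> * zcoeff f (\<epsilon> - \<delta>)) * ?\<phi> \<epsilon>)"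
  proof (rule sum.cong[OF refl])
    fix \<delta> assume d: "\<delta> \<in> Poly_Mapping.keys ?V"
    have "(\<Sum>\<gamma>\<in>A. of_int (Poly_Mapping.lookup ?V \<delta> * zcoeff f \<gamma>) * ?\<phi> (\<delta> + \<gamma>)) =
        (\<Sum>\<epsilon>\<in>(+) \<delta> ` A. of_int (Poly_Mapping.lookup ?V \<delta> * zcoeff f (\<epsilon> - \<delta>)) * ?\<phi> \<epsilon>)"
      by (subst sum.reindex) (auto simp: inj_on_def)
    also have "\<dots> = (\<Sum>\<epsilon>\<in>E. of_int (Poly_Mapping.lookup ?V \<delta> * zcoeff f (\<epsilon> - \<delta>)) * ?\<phi> \<epsilon>)"
    proof (rule sum.mono_neutral_left[OF finE])
      show "(+) \<delta> ` A \<subseteq> E" unfolding E_def using d by force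
      show "\<forall>\<epsilon>\<in>E - (+) \<delta> ` A. of_int (Poly_Mapping.lookup ?V \<delta> * zcoeff f (\<epsilon> - \<delta>)) * ?\<phi> \<epsilon> = 0"
      proof
        fix \<epsilon> assume e: "\<epsilon> \<in> E - (+) \<delta> ` A"
        have "zcoeff f (\<epsilon> - \<delta>) = 0 \<or> ?\<phi> \<epsilon> = 0"
        proof (rule ccontr)
          assume n: "\<not> (zcoeff f (\<epsilon> - \<delta>) = 0 \<or> ?\<phi> \<epsilon> = 0)"
          have eq: "\<delta> + (\<epsilon> - \<delta>) = \<epsilon>" by simp
          have "?\<phi> (\<delta> + (\<epsilon> - \<delta>)) \<noteq> 0" unfolding eq using n by blast
          then have "\<epsilon> - \<delta> \<in> {\<gamma>. zcoeff f \<gamma> \<noteq> 0 \<and> ?\<phi> (\<delta> + \<gamma>) \<noteq> 0}"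
            using n by blast
          then have "\<epsilon> - \<delta> \<in> A" unfolding A_def using d by blast
          then have "\<delta> + (\<epsilon> - \<delta>) \<in> (+) \<delta> ` A" by blast
          then show False using e by simp
        qed
        then show "of_int (Poly_Mapping.lookup ?V \<delta> * zcoeff f (\<epsilon> - \<delta>)) * ?\<phi> \<epsilon> = 0" by auto
      qed
    qed
    finally show "(\<Sum>\<gamma>\<in>A. of_int (Poly_Mapping.lookup ?V \<delta> * zcoeff f \<gamma>) * ?\<phi> (\<delta> + \<gamma>)) =
        (\<Sum>\<epsilon>\<in>E. of_int (Poly_Mapping.lookup ?V \<delta> * zcoeff f (\<epsilon> - \<delta>)) * ?\<phi> \<epsilon>)" .
  qed
  also have "\<dots> = (\<Sum>\<epsilon>\<in>E. of_int (zcoeff (zemb ?V * f) \<epsilon>) * ?\<phi> \<epsilon>)"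
    by (subst sum.swap) (simp only: zcoeff_zemb_mult of_int_sum sum_distrib_right)
  also have "\<dots> = (\<Sum>\<epsilon>\<in>E. of_int (Poly_Mapping.lookup p \<epsilon>) * ?\<phi> \<epsilon>)"
    by (simp only: p zcoeff_zemb)
  also have "\<dots> = kap {1..l} (\<lambda>j. int j - 1) p"
    unfolding kap_def by (rule lin_superset[symmetric, OF finE]) (simp add: E_def)
  finally show ?thesis .
qed

lemma kap_v_mset:
  assumes "finite I" "set_mset M \<subseteq> I"
  shows "kap I c ((\<Prod>j\<in>#M. 1 - zp j (-1)) * f) = kap I (\<lambda>j. c j - int (count M j)) f"
  using assms(2)
proof (induction M arbitrary: f)
  case (add x M)
  have "kap I c ((\<Prod>j\<in>#add_mset x M. 1 - zp j (-1)) * f) =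
      kap I c ((\<Prod>j\<in>#M. 1 - zp j (-1)) * ((1 - zp x (-1)) * f))"
    by (simp add: mult_ac)
  also have "\<dots> = kap I (\<lambda>j. c j - int (count M j)) ((1 - zp x (-1)) * f)"
    using add by simp
  also have "\<dots> = kap I ((\<lambda>j. c j - int (count M j))(x := c x - int (count M x) - 1)) f"
    using add.prems by (intro kap_v[OF assms(1)]) simp
  also have "\<dots> = kap I (\<lambda>j. c j - int (count (add_mset x M) j)) f"
    by (rule kap_cong) auto
  finally show ?case .
qed simp

lemma finite_pos_roots: "finite (pos_roots l)"
  by (rule finite_subset[of _ "{..l} \<times> {..l}"]) (auto simp: pos_roots_def)

lemma zemb_nrt: "zemb (nrt (i, j)) = 1 - zmono (eroot i j)"
proof -
  have "zp i 1 * zp j (-1) = Poly_Mapping.single (eroot i j) 1"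
    by (simp add: zp_def mult_single eroot_def single_uminus)
  then show ?thesis by (simp add: nrt_def zemb_diff zemb_1 zemb_single)
qed

text \<open>The Vandermonde product has one factor for every positive root. It cancels the geometric
  series of the pairs in \<Psi> and leaves the factors of the pairs outside; the multiset is
  absorbed into the ranks.\<close>

theorem Katalan_eq_kap:
  assumes \<Psi>: "\<Psi> \<subseteq> pos_roots l" and M: "set_mset M \<subseteq> {1..l}" and \<gamma>: "\<gamma> \<in> zvecs l"
  shows "Katalan l \<Psi> M \<gamma> = kap {1..l} (\<lambda>j. int j - 1 - int (count M j))
    (prod nrt (pos_roots l - \<Psi>) * Poly_Mapping.single \<gamma> 1)"
proof -
  have fin\<Psi>: "finite \<Psi>" by (rule finite_subset[OF \<Psi> finite_pos_roots])
  define p where "p = (\<Prod>j\<in>#M. 1 - zp j (-1)) * (prod nrt (pos_roots l - \<Psi>) * Poly_Mapping.single \<gamma> 1)"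
  have V: "Vw 0 l = prod nrt (pos_roots l - \<Psi>) * prod nrt \<Psi>"
  proof -
    have "{(i, j). 0 < i \<and> i < j \<and> j \<le> 0 + l} = pos_roots l" by (auto simp: pos_roots_def)
    then show ?thesis unfolding Vw_def by (simp only: prod.subset_diff[OF \<Psi> finite_pos_roots])
  qed
  have inv: "zemb (prod nrt \<Psi>) * (\<Prod>(i, j)\<in>\<Psi>. zinv (1 - zmono (eroot i j))) = 1"
    unfolding zemb_prod prod.distrib[symmetric]
  proof (rule prod.neutral, rule ballI)
    fix x assume "x \<in> \<Psi>"
    then obtain i j where x: "x = (i, j)" "1 \<le> i" "i < j" "j \<le> l" using \<Psi> by (auto simp: pos_roots_def)
    then show "zemb (nrt x) * (case x of (i, j) \<Rightarrow> zinv (1 - zmono (eroot i j))) = 1"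
      using zinv_root[of i j l] by (simp add: zemb_nrt)
  qed
  have M': "zemb (\<Prod>j\<in>#M. 1 - zp j (-1)) = (\<Prod>j\<in>#M. 1 - zmono (- Poly_Mapping.single j 1))"
  proof (induction M)
    case (add x M)
    have "zemb (zp x (-1)) = zmono (- Poly_Mapping.single x 1)"
      by (simp add: zp_def zemb_single single_uminus)
    then show ?case using add by (simp add: zemb_mult zemb_diff zemb_1)
  qed (simp add: zemb_1)
  have "zemb (Vw 0 l) * Katalan_series \<Psi> M \<gamma> =
      (zemb (prod nrt \<Psi>) * (\<Prod>(i, j)\<in>\<Psi>. zinv (1 - zmono (eroot i j)))) *
      (zemb (prod nrt (pos_roots l - \<Psi>)) * (\<Prod>j\<in>#M. 1 - zmono (- Poly_Mapping.single j 1)) * zmono \<gamma>)"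
    unfolding V zemb_mult Katalan_series_def by (simp only: mult_ac)
  also have "\<dots> = zemb p"
    unfolding inv p_def zemb_mult M' zemb_single by (simp only: mult_1 mult_ac)
  finally have "Katalan l \<Psi> M \<gamma> = kap {1..l} (\<lambda>j. int j - 1) p"
    unfolding Katalan_def using assms by (intro g_map_eq_kap Katalan_series_in_A_ring)
  then show ?thesis unfolding p_def using kap_v_mset[OF _ M] by simp
qed

section \<open>Partitions and row data\<close>

definition bb :: "nat \<Rightarrow> zvec \<Rightarrow> nat \<Rightarrow> nat" where
  "bb k \<mu> i = nat (int i + int k + 1 - Poly_Mapping.lookup \<mu> i)"

lemma Par_lenD:
  assumes "\<mu> \<in> Par_len k l"
  shows "0 \<le> Poly_Mapping.lookup \<mu> i" "Poly_Mapping.lookup \<mu> i \<le> int k"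
    "1 \<le> i \<Longrightarrow> i \<le> j \<Longrightarrow> Poly_Mapping.lookup \<mu> j \<le> Poly_Mapping.lookup \<mu> i"
    "l < i \<Longrightarrow> Poly_Mapping.lookup \<mu> i = 0" "Poly_Mapping.lookup \<mu> 0 = 0"
proof -
  have out: "Poly_Mapping.lookup \<mu> i = 0" if "i \<notin> {1..l}" for i
    using assms that by (auto simp: Par_len_def zvecs_def in_keys_iff)
  then show "l < i \<Longrightarrow> Poly_Mapping.lookup \<mu> i = 0" "Poly_Mapping.lookup \<mu> 0 = 0" by auto
  have inn: "0 \<le> Poly_Mapping.lookup \<mu> i \<and> Poly_Mapping.lookup \<mu> i \<le> int k" for i
    using assms out[of i] by (cases "i \<in> {1..l}") (auto simp: Par_len_def)
  then show "0 \<le> Poly_Mapping.lookup \<mu> i" "Poly_Mapping.lookup \<mu> i \<le> int k" by auto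
  show "Poly_Mapping.lookup \<mu> j \<le> Poly_Mapping.lookup \<mu> i" if "1 \<le> i" "i \<le> j"
  proof (cases "j \<le> l")
    case True
    then show ?thesis using assms that unfolding Par_len_def by auto
  next
    case False
    then show ?thesis using out[of j] inn[of i] by simp
  qed
qed

lemma bb_int:
  assumes "\<mu> \<in> Par_len k l" shows "int (bb k \<mu> i) = int i + int k + 1 - Poly_Mapping.lookup \<mu> i"
  using Par_lenD(2)[OF assms, of i] by (simp add: bb_def)

lemma rowfun_bb:
  assumes "1 \<le> k" "\<mu> \<in> Par_len k l" shows "rowfun (k + 1) l (bb k \<mu>)"
  unfolding rowfun_def
proof (intro conjI allI impI)
  show "2 \<le> k + 1" using assms by simp
  fix i :: nat assume i: "1 \<le> i"
  show "i < bb k \<mu> i" "bb k \<mu> i \<le> i + (k + 1)"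
    using bb_int[OF assms(2), of i] Par_lenD(1,2)[OF assms(2), of i] by linarith+
  fix j assume "i < j"
  then show "bb k \<mu> i < bb k \<mu> j"
    using bb_int[OF assms(2), of i] bb_int[OF assms(2), of j] Par_lenD(3)[OF assms(2) i, of j] by linarith
next
  fix i assume "l < i"
  then show "bb k \<mu> i = i + (k + 1)"
    using bb_int[OF assms(2), of i] Par_lenD(4)[OF assms(2), of i] by linarith
qed

lemma ZM_bb:
  assumes \<mu>: "\<mu> \<in> Par_len k l" shows "ZM (k + 1) l (bb k \<mu>) = Poly_Mapping.single \<mu> 1"
proof -
  have "ZM (k + 1) l (bb k \<mu>) = (\<Prod>i\<in>{1..l}. zp i (Poly_Mapping.lookup \<mu> i))"
    unfolding ZM_def by (rule prod.cong) (auto simp: bb_int[OF \<mu>])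
  then show ?thesis using prod_zp_eq_single[of \<mu> l] \<mu> by (simp add: Par_len_def)
qed

text \<open>Outside \<open>Delta\<close> for k means j < b i, outside \<open>Delta\<close> for k + 1
  means j \<le> b i. This shift by one accounts for the different inequalities in \<open>NR\<close>
  and \<open>cc\<close>.\<close>

lemma kSchur_eq_GG:
  assumes k: "1 \<le> k" and \<mu>: "\<mu> \<in> Par_len k l"
  shows "kSchur_Katalan k l \<mu> = GG (k + 1) l (bb k \<mu>) {} 1"
proof -
  let ?b = "bb k \<mu>"
  have zv: "\<mu> \<in> zvecs l" using \<mu> by (simp add: Par_len_def)
  have D: "Delta l m \<mu> \<subseteq> pos_roots l" for m by (auto simp: Delta_def)
  have M: "set_mset (L_multiset (Delta l (int k + 1) \<mu>)) \<subseteq> {1..l}"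
    using finite_subset[OF D finite_pos_roots] by (auto simp: L_multiset_def Delta_def pos_roots_def)
  have N: "pos_roots l - Delta l (int k) \<mu> = NR l ?b"
  proof (rule Set.set_eqI)
    fix p :: "nat \<times> nat"
    obtain i j where p: "p = (i, j)" by (cases p)
    have "\<not> int k - Poly_Mapping.lookup \<mu> i + int i < int j \<longleftrightarrow> j < ?b i"
      using bb_int[OF \<mu>, of i] by linarith
    then show "p \<in> pos_roots l - Delta l (int k) \<mu> \<longleftrightarrow> p \<in> NR l ?b"
      by (auto simp: p pos_roots_def Delta_def NR_def)
  qed
  have C: "int j - 1 - int (count (L_multiset (Delta l (int k + 1) \<mu>)) j) = cc ?b j" if "j \<in> {1..l}" for j
  proof -
    let ?D = "Delta l (int k + 1) \<mu>"
    have finD: "finite ?D" by (rule finite_subset[OF D finite_pos_roots])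
    have "count (L_multiset ?D) j = (\<Sum>y\<in>snd -` {j} \<inter> ?D. count (mset_set ?D) y)"
      using finD by (simp add: L_multiset_def count_image_mset)
    also have "\<dots> = (\<Sum>y\<in>snd -` {j} \<inter> ?D. 1)"
      using finD by (intro sum.cong) auto
    also have "\<dots> = card (snd -` {j} \<inter> ?D)" by simp
    also have "snd -` {j} \<inter> ?D = {p \<in> ?D. snd p = j}" by auto
    also have "card {p \<in> ?D. snd p = j} = card {i. 1 \<le> i \<and> i < j \<and> \<not> j \<le> ?b i}"
    proof -
      let ?S = "{i. 1 \<le> i \<and> i < j \<and> \<not> j \<le> ?b i}"
      have iff: "(i, j) \<in> ?D \<longleftrightarrow> i \<in> ?S" for i
        using bb_int[OF \<mu>, of i] that by (auto simp: Delta_def pos_roots_def)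
      have "{p \<in> ?D. snd p = j} = (\<lambda>i. (i, j)) ` ?S"
      proof (intro subset_antisym subsetI)
        fix p assume "p \<in> {p \<in> ?D. snd p = j}"
        then have "p = (fst p, j)" "(fst p, j) \<in> ?D" by (cases p, simp)+
        then show "p \<in> (\<lambda>i. (i, j)) ` ?S" using iff by blast
      next
        fix p assume "p \<in> (\<lambda>i. (i, j)) ` ?S"
        then obtain i where "p = (i, j)" "i \<in> ?S" by blast
        then show "p \<in> {p \<in> ?D. snd p = j}" using iff[of i] by simp
      qed
      then show ?thesis by (simp add: card_image inj_on_def)
    qed
    finally have 1: "count (L_multiset ?D) j = card {i. 1 \<le> i \<and> i < j \<and> \<not> j \<le> ?b i}" .
    have "card {1..<j} = card ({i. 1 \<le> i \<and> i < j \<and> \<not> j \<le> ?b i} \<union> {i. 1 \<le> i \<and> i < j \<and> j \<le> ?b i})"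
      by (rule arg_cong[of _ _ card]) auto
    also have "\<dots> = card {i. 1 \<le> i \<and> i < j \<and> \<not> j \<le> ?b i} + card {i. 1 \<le> i \<and> i < j \<and> j \<le> ?b i}"
      by (rule card_Un_disjoint) (auto intro: finite_subset[of _ "{..j}"])
    finally have 2: "card {1..<j} = card {i. 1 \<le> i \<and> i < j \<and> \<not> j \<le> ?b i} + card {i. 1 \<le> i \<and> i < j \<and> j \<le> ?b i}" .
    have "int j - 1 = int (card {1..<j})" using that by simp
    then show ?thesis unfolding cc_def 1 using 2 by linarith
  qed
  have "kSchur_Katalan k l \<mu> = kap {1..l} (\<lambda>j. int j - 1 - int (count (L_multiset (Delta l (int k + 1) \<mu>)) j))
      (prod nrt (NR l ?b) * Poly_Mapping.single \<mu> 1)"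
    unfolding kSchur_Katalan_def using Katalan_eq_kap[OF D M zv] N by simp
  also have "\<dots> = kap {1..l} (cc ?b) (prod nrt (NR l ?b) * Poly_Mapping.single \<mu> 1)"
    by (rule kap_cong) (rule C)
  finally show ?thesis by (simp only: GG_def ZM_bb[OF \<mu>] Diff_empty mult_1_right)
qed

section \<open>Independence of trailing zero rows\<close>

lemma GG_stable:
  assumes b: "rowfun K n b" and l: "n \<le> l"
  shows "GG K l b {} 1 = GG K n b {} 1"
  using l
proof (induction l rule: dec_induct)
  case (step l)
  let ?A = "{i. 1 \<le> i \<and> i \<le> l \<and> Suc l < b i}"
  have "NR (Suc l) b = NR l b \<union> (\<lambda>i. (i, Suc l)) ` ?A"
    by (auto simp: NR_def le_Suc_eq)
  moreover have "prod nrt (NR l b \<union> (\<lambda>i. (i, Suc l)) ` ?A) = prod nrt (NR l b) * prod nrt ((\<lambda>i. (i, Suc l)) ` ?A)"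
  proof (rule prod.union_disjoint)
    show "finite ((\<lambda>i. (i, Suc l)) ` ?A)" by (intro finite_imageI finite_subset[of ?A "{..l}"]) auto
    show "NR l b \<inter> (\<lambda>i. (i, Suc l)) ` ?A = {}" by (auto simp: NR_def)
  qed simp
  moreover have "prod nrt ((\<lambda>i. (i, Suc l)) ` ?A) = (\<Prod>i\<in>?A. nrt (i, Suc l))"
    by (subst prod.reindex) (auto simp: inj_on_def)
  moreover have "ZM K (Suc l) b = ZM K l b"
    using rowfunD(5)[OF b, of "Suc l"] step by (simp add: ZM_def)
  ultimately have e: "prod nrt (NR (Suc l) b - {}) * ZM K (Suc l) b * 1 =
      (prod nrt (NR l b) * ZM K l b) * (\<Prod>i\<in>?A. nrt (i, Suc l))"
    by (simp add: mult_ac)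
  have I: "{1..Suc l} = insert (Suc l) {1..l}" by auto
  have "only {1..l} (prod nrt (NR l b) * ZM K l b)"
  proof (rule only_mult)
    show "only {1..l} (prod nrt (NR l b))"
    proof (rule only_prod)
      fix p assume "p \<in> NR l b"
      then obtain x y where "p = (x, y)" "1 \<le> x" "x < y" "y \<le> l" by (auto simp: NR_def)
      then show "only {1..l} (nrt p)" by (simp add: only_nrt)
    qed
    show "only {1..l} (ZM K l b)" unfolding ZM_def by (auto intro!: only_prod only_zp)
  qed
  then have "GG K (Suc l) b {} 1 = GG K l b {} 1"
    unfolding GG_def e I by (subst kap_last_row) auto
  then show ?case using step by simp
qed simp

lemma keys_Par:
  assumes "\<mu> \<in> Par_len k l"
  shows "Poly_Mapping.keys \<mu> = {1..nparts \<mu>}" "nparts \<mu> \<le> l" "\<mu> \<in> Par_len k (nparts \<mu>)"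
proof -
  have sub: "Poly_Mapping.keys \<mu> \<subseteq> {1..l}" using assms by (simp add: Par_len_def zvecs_def)
  have down: "i \<in> Poly_Mapping.keys \<mu>" if "j \<in> Poly_Mapping.keys \<mu>" "1 \<le> i" "i \<le> j" for i j
    using Par_lenD(3)[OF assms that(2,3)] Par_lenD(1)[OF assms, of j] that(1) by (auto simp: in_keys_iff)
  show keys: "Poly_Mapping.keys \<mu> = {1..nparts \<mu>}"
  proof (cases "Poly_Mapping.keys \<mu> = {}")
    case True
    then show ?thesis by (simp add: nparts_def)
  next
    case False
    let ?m = "Max (Poly_Mapping.keys \<mu>)"
    have "?m \<in> Poly_Mapping.keys \<mu>" using False by (intro Max_in) auto
    then have "Poly_Mapping.keys \<mu> = {1..?m}"
      using down sub by (auto intro: Max_ge)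
    then show ?thesis unfolding nparts_def by (metis card_atLeastAtMost diff_Suc_1)
  qed
  have "card (Poly_Mapping.keys \<mu>) \<le> card {1..l}" using sub by (intro card_mono) auto
  then show "nparts \<mu> \<le> l" by (simp add: nparts_def)
  then show "\<mu> \<in> Par_len k (nparts \<mu>)" using assms keys by (auto simp: Par_len_def zvecs_def)
qed

lemma kSchur_stable:
  assumes k: "1 \<le> k" and \<mu>: "\<mu> \<in> Par_len k l"
  shows "kSchur_Katalan k l \<mu> = kSchur_Katalan k (nparts \<mu>) \<mu>"
  unfolding kSchur_eq_GG[OF k \<mu>] kSchur_eq_GG[OF k keys_Par(3)[OF \<mu>]]
  by (rule GG_stable[OF rowfun_bb[OF k keys_Par(3)[OF \<mu>]] keys_Par(2)[OF \<mu>]])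

lemma Par_len_rowfun:
  assumes b: "rowfun (k + 1) n (bb k \<mu>)" and keys: "Poly_Mapping.keys \<mu> \<subseteq> {1..n}"
  shows "\<mu> \<in> Par_len k n"
proof -
  have eq: "Poly_Mapping.lookup \<mu> i = int i + int k + 1 - int (bb k \<mu> i)" if "1 \<le> i" for i
    using rowfunD(2)[OF b that] by (simp add: bb_def)
  have mono: "Poly_Mapping.lookup \<mu> (i + t) \<le> Poly_Mapping.lookup \<mu> i" if "1 \<le> i" for i t
  proof (induction t)
    case (Suc t)
    have "bb k \<mu> (i + t) < bb k \<mu> (i + Suc t)" using rowfunD(4)[OF b, of "i + t" "i + Suc t"] that by simp
    then show ?case using Suc eq[of "i + t"] eq[of "i + Suc t"] that by simp
  qed simp
  have "Poly_Mapping.lookup \<mu> j \<le> Poly_Mapping.lookup \<mu> i" if "1 \<le> i" "i \<le> j" for i j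
    using mono[OF that(1), of "j - i"] that by simp
  moreover have "0 \<le> Poly_Mapping.lookup \<mu> i \<and> Poly_Mapping.lookup \<mu> i \<le> int k" if "1 \<le> i" for i
    using eq[OF that] rowfunD(2,3)[OF b that] by simp
  ultimately show ?thesis using keys by (auto simp: Par_len_def zvecs_def)
qed

section \<open>The affine symmetric group acting on integers\<close>

lemma sg_down: "int K dvd x - a \<Longrightarrow> sg K a x = x - 1"
  by (simp add: sg_def)

lemma not_dvd_shift:
  assumes "int K dvd y" "0 < \<bar>c\<bar>" "\<bar>c\<bar> < int K" shows "\<not> int K dvd y + c"
proof
  assume "int K dvd y + c"
  then have "int K dvd c" using assms(1) by (simp add: dvd_add_right_iff)
  then show False using assms(2,3) zdvd_not_zless[of "\<bar>c\<bar>" "int K"] by simp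
qed

lemma sg_up:
  assumes "2 \<le> K" "int K dvd x + 1 - a" shows "sg K a x = x + 1"
  using not_dvd_shift[OF assms(2), of "-1"] assms by (simp add: sg_def)

lemma sg_fix: "\<not> int K dvd x - a \<Longrightarrow> \<not> int K dvd x + 1 - a \<Longrightarrow> sg K a x = x"
  by (simp add: sg_def)

lemma sg_invol:
  assumes "2 \<le> K" shows "sg K a (sg K a x) = x"
proof -
  consider "int K dvd x - a" | "int K dvd x + 1 - a" | "\<not> int K dvd x - a" "\<not> int K dvd x + 1 - a"
    by blast
  then show ?thesis
  proof cases
    case 1
    then show ?thesis using sg_up[OF assms, of "x - 1" a] by (simp add: sg_down)
  next
    case 2
    then show ?thesis using sg_down[of K "x + 1" a] by (simp add: sg_up[OF assms])
  qed (simp add: sg_fix)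
qed

lemma sg_cong:
  assumes "int K dvd a - a'" shows "sg K a = sg K a'"
proof
  fix x
  have "x - a = (x - a') - (a - a')" "x + 1 - a = (x + 1 - a') - (a - a')" by simp_all
  then have "int K dvd x - a \<longleftrightarrow> int K dvd x - a'" "int K dvd x + 1 - a \<longleftrightarrow> int K dvd x + 1 - a'"
    using assms by (simp_all only: dvd_diff_left_iff)
  then show "sg K a x = sg K a' x" by (simp add: sg_def)
qed

lemma sg_shift: "sg K a (x + int K) = sg K a x + int K"
proof -
  have "x + int K - a = (x - a) + int K" "x + int K + 1 - a = (x + 1 - a) + int K" by simp_all
  then have "int K dvd x + int K - a \<longleftrightarrow> int K dvd x - a" "int K dvd x + int K + 1 - a \<longleftrightarrow> int K dvd x + 1 - a"
    by (simp_all only: dvd_add_left_iff[OF dvd_refl])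
  then show ?thesis by (simp add: sg_def)
qed

text \<open>The sets of moved points are disjoint unless the residues coincide or are
  neighbours.\<close>

lemma sg_commute:
  assumes "2 \<le> K" "\<not> int K dvd a - b" "\<not> int K dvd a + 1 - b" "\<not> int K dvd a - 1 - b"
  shows "sg K a \<circ> sg K b = sg K b \<circ> sg K a"
proof
  fix x
  define A where "A c = {x. int K dvd x - c \<or> int K dvd x + 1 - c}" for c
  have AB: "x \<notin> A b" if xa: "x \<in> A a" for x
  proof
    assume "x \<in> A b"
    then consider "int K dvd x - a" "int K dvd x - b" | "int K dvd x - a" "int K dvd x + 1 - b"
      | "int K dvd x + 1 - a" "int K dvd x - b" | "int K dvd x + 1 - a" "int K dvd x + 1 - b"
      using xa by (auto simp: A_def)
    then show False
    proof cases
      case 1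
      then have "int K dvd (x - b) - (x - a)" by (rule dvd_diff[rotated])
      then show False using assms by simp
    next
      case 2
      then have "int K dvd (x + 1 - b) - (x - a)" by (rule dvd_diff[rotated])
      then show False using assms(3) by (simp add: algebra_simps)
    next
      case 3
      then have "int K dvd (x - b) - (x + 1 - a)" by (rule dvd_diff[rotated])
      then show False using assms(4) by (simp add: algebra_simps)
    next
      case 4
      then have "int K dvd (x + 1 - b) - (x + 1 - a)" by (rule dvd_diff[rotated])
      then show False using assms by simp
    qed
  qed
  have fixed: "sg K c x = x" if "x \<notin> A c" for c x using that by (simp add: A_def sg_fix)
  have stay: "sg K c x \<in> A c" if "x \<in> A c" for c x
    using that sg_up[OF assms(1), of x c] sg_down[of K x c] by (auto simp: A_def)
  consider "x \<in> A a" | "x \<in> A b" | "x \<notin> A a" "x \<notin> A b" by blast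
  then show "(sg K a \<circ> sg K b) x = (sg K b \<circ> sg K a) x"
  proof cases
    case 1
    then show ?thesis using AB[of x] AB[OF stay[OF 1]] fixed by simp
  next
    case 2
    then show ?thesis using AB[of x] AB[of "sg K b x"] stay[OF 2] fixed by fastforce
  qed (simp add: fixed)
qed

text \<open>For K \<ge> 3 the residues a - 1, a and a + 1 are distinct, and both sides exchange a -
  1 with a + 1.\<close>

lemma sg_braid:
  assumes "3 \<le> K" shows "sg K a \<circ> sg K (a + 1) \<circ> sg K a = sg K (a + 1) \<circ> sg K a \<circ> sg K (a + 1)"
proof
  fix x
  have K: "2 \<le> K" using assms by simp
  consider "int K dvd x + 1 - a" | "int K dvd x - a" | "int K dvd x - a - 1"
    | "\<not> int K dvd x + 1 - a" "\<not> int K dvd x - a" "\<not> int K dvd x - a - 1" by blast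
  then show "(sg K a \<circ> sg K (a + 1) \<circ> sg K a) x = (sg K (a + 1) \<circ> sg K a \<circ> sg K (a + 1)) x"
  proof cases
    case 1
    have 2: "\<not> int K dvd x - a" "\<not> int K dvd x - a - 1" "\<not> int K dvd x + 2 - a" "\<not> int K dvd x + 3 - a"
      using not_dvd_shift[OF 1, of "-1"] not_dvd_shift[OF 1, of "-2"] not_dvd_shift[OF 1, of 1]
        not_dvd_shift[OF 1, of 2] assms by (simp_all add: algebra_simps)
    have "sg K a x = x + 1" "sg K (a + 1) (x + 1) = x + 2" "sg K (a + 1) x = x"
      using sg_up[OF K, of x a] sg_up[OF K, of "x + 1" "a + 1"] sg_fix[of K x "a + 1"] 1 2 by (simp_all add: algebra_simps)
    moreover have "sg K a (x + 2) = x + 2" using sg_fix[of K "x + 2" a] 2 by (simp add: algebra_simps)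
    ultimately show ?thesis by simp
  next
    case 2
    have 3: "\<not> int K dvd x + 1 - a" "\<not> int K dvd x - a - 1" "\<not> int K dvd x - a - 2" "\<not> int K dvd x + 2 - a"
      using not_dvd_shift[OF 2, of "-1"] not_dvd_shift[OF 2, of "-2"] not_dvd_shift[OF 2, of 1]
        not_dvd_shift[OF 2, of 2] assms by (simp_all add: algebra_simps)
    have "sg K a x = x - 1" "sg K (a + 1) (x - 1) = x - 1" "sg K a (x - 1) = x"
      using sg_down[of K x a] sg_fix[of K "x - 1" "a + 1"] sg_up[OF K, of "x - 1" a] 2 3 by (simp_all add: algebra_simps)
    moreover have "sg K (a + 1) x = x + 1" "sg K a (x + 1) = x + 1" "sg K (a + 1) (x + 1) = x"
      using sg_up[OF K, of x "a + 1"] sg_fix[of K "x + 1" a] sg_down[of K "x + 1" "a + 1"] 2 3 by (simp_all add: algebra_simps)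
    ultimately show ?thesis by simp
  next
    case 3
    have 4: "\<not> int K dvd x + 1 - a" "\<not> int K dvd x - a" "\<not> int K dvd x - a - 2" "\<not> int K dvd x - a - 3"
      using not_dvd_shift[OF 3, of "-1"] not_dvd_shift[OF 3, of "-2"] not_dvd_shift[OF 3, of 1]
        not_dvd_shift[OF 3, of 2] assms by (simp_all add: algebra_simps)
    have "sg K a x = x" "sg K (a + 1) x = x - 1" "sg K a (x - 1) = x - 2" "sg K (a + 1) (x - 2) = x - 2"
      using sg_fix[of K x a] sg_down[of K x "a + 1"] sg_down[of K "x - 1" a] sg_fix[of K "x - 2" "a + 1"] 3 4
      by (simp_all add: algebra_simps)
    then show ?thesis by simp
  next
    case 4
    have "sg K a x = x" "sg K (a + 1) x = x"
      using sg_fix[of K x a] sg_fix[of K x "a + 1"] 4 by (simp_all add: algebra_simps)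
    then show ?thesis by simp
  qed
qed

section \<open>Adding and removing boxes by residue\<close>

definition hp :: "nat \<Rightarrow> zvec \<Rightarrow> int \<Rightarrow> int" where
  "hp k \<mu> = hh (k + 1) (bb k \<mu>)"

lemma ParE:
  assumes "\<mu> \<in> Par k" obtains n where "\<mu> \<in> Par_len k n"
  using assms by (auto simp: Par_def)

lemma Par_lenI: "\<mu> \<in> Par_len k n \<Longrightarrow> \<mu> \<in> Par k"
  by (auto simp: Par_def)

lemma Par_nparts: "\<mu> \<in> Par k \<Longrightarrow> \<mu> \<in> Par_len k (nparts \<mu>)"
  using keys_Par(3) by (auto simp: Par_def)

lemma hp_shift: "1 \<le> k \<Longrightarrow> \<mu> \<in> Par k \<Longrightarrow> hp k \<mu> (x + int (k + 1)) = hp k \<mu> x - 1"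
  unfolding hp_def by (elim ParE) (rule hh_shift[OF rowfun_bb])

text \<open>Stated through the trace, not through the diagram: a trace that starts in a zero row of
  residue class -a ends in the situation of \<open>GG_up\<close> for row i. The auxiliary data do
  not matter, see \<open>addable_unique\<close>.\<close>

definition addable :: "nat \<Rightarrow> int \<Rightarrow> zvec \<Rightarrow> nat \<Rightarrow> bool" where
  "addable k a \<mu> i \<longleftrightarrow> 1 \<le> i \<and> (\<exists>n q0 R0 q R. rowfun (k + 1) n (bb k \<mu>) \<and> n < q0 \<and>
     int (k + 1) dvd a + int q0 \<and> reach (bb k \<mu>) q0 R0 q R \<and> good (bb k \<mu>) q \<and>
     bb k \<mu> i = Suc q \<and> (\<forall>x\<ge>1. bb k \<mu> x \<noteq> q) \<and> i < q)"

lemma funpow_inj_rowfun: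
  assumes b: "rowfun K n b" and "1 \<le> x" "1 \<le> y" "(b ^^ t) x = (b ^^ t) y"
  shows "x = y"
  using assms(2-)
proof (induction t)
  case (Suc t)
  have "1 \<le> (b ^^ t) x" "1 \<le> (b ^^ t) y" using funpow_ge[OF b] Suc.prems by (metis le_trans)+
  then show ?case using Suc rowfun_inj[OF b] by simp
qed simp

lemma reach_funpow:
  assumes b: "rowfun K n b" and r: "reach b q0 R0 q R"
  shows "\<exists>t. (b ^^ t) q = q0 \<and> Lc b q0 = t + Lc b q \<and> Lc b (Suc q0) = t + Lc b (Suc q)"
  using r
proof induction
  case start
  show ?case by (rule exI[of _ 0]) simp
next
  case (up q R x)
  then obtain t where "(b ^^ t) q = q0" "Lc b q0 = t + Lc b q" "Lc b (Suc q0) = t + Lc b (Suc q)" by auto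
  moreover have "Lc b q = Suc (Lc b x)" "Lc b (Suc q) = Suc (Lc b (Suc x))"
    using Lc_pre[OF b, of x] Lc_pre[OF b, of "Suc x"] up by auto
  ultimately show ?case using up
    by (intro exI[of _ "Suc t"]) (simp add: funpow_Suc_right del: funpow.simps)
qed

text \<open>Both traces are prolonged to a common far row M. No row ends at the end point q of a
  trace, so the number of steps from q to M is the smaller of the chain lengths at M and M + 1. This
  number and the injectivity of \<open>b\<close> determine q.\<close>

lemma addable_unique:
  assumes "addable k a \<mu> i" "addable k a \<mu> j" shows "i = j"
proof -
  let ?b = "bb k \<mu>" and ?K = "k + 1"
  obtain n q0 R0 q R where 1: "rowfun ?K n ?b" "n < q0" "int ?K dvd a + int q0" "reach ?b q0 R0 q R"
    "?b i = Suc q" "\<forall>x\<ge>1. ?b x \<noteq> q" "i < q" and i: "1 \<le> i"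
    using assms(1) unfolding addable_def by blast
  obtain m p0 S0 p S where 2: "rowfun ?K m ?b" "m < p0" "int ?K dvd a + int p0" "reach ?b p0 S0 p S"
    "?b j = Suc p" "\<forall>x\<ge>1. ?b x \<noteq> p" "j < p" and j: "1 \<le> j"
    using assms(2) unfolding addable_def by blast
  have far: "(?b ^^ s) y = y + s * ?K \<and> Lc ?b (y + s * ?K) = s + Lc ?b y" if "n < y" for s y
  proof (induction s)
    case (Suc s)
    have "?b (y + s * ?K) = y + s * ?K + ?K" using rowfunD(5)[OF 1(1), of "y + s * ?K"] that by simp
    then show ?case using Suc Lc_pre[OF 1(1), of "y + s * ?K"] that by (simp add: algebra_simps)
  qed simp
  obtain M where M: "n < M" "q0 \<le> M" "p0 \<le> M" "int ?K dvd a + int M"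
  proof
    show "n < q0 + p0 * ?K" "q0 \<le> q0 + p0 * ?K" "p0 \<le> q0 + p0 * ?K" using 1(2) by auto
    have "a + int (q0 + p0 * ?K) = (a + int q0) + int ?K * int p0" by (simp add: algebra_simps)
    then show "int ?K dvd a + int (q0 + p0 * ?K)" using 1(3) by (simp only: dvd_add dvd_triv_left)
  qed
  have key: "\<exists>t. (?b ^^ t) q' = M \<and> min (Lc ?b M) (Lc ?b (Suc M)) = t"
    if th: "rowfun ?K n' ?b" "n' < q0'" "int ?K dvd a + int q0'" "reach ?b q0' R0' q' R'" "\<forall>x\<ge>1. ?b x \<noteq> q'" "q0' \<le> M"
    for n' q0' R0' q' R'
  proof -
    have far': "(?b ^^ s) y = y + s * ?K \<and> Lc ?b (y + s * ?K) = s + Lc ?b y" if "n' < y" for s y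
    proof (induction s)
      case (Suc s)
      have "?b (y + s * ?K) = y + s * ?K + ?K" using rowfunD(5)[OF \<open>rowfun ?K n' ?b\<close>, of "y + s * ?K"] that by simp
      then show ?case using Suc Lc_pre[OF 1(1), of "y + s * ?K"] that by (simp add: algebra_simps)
    qed simp
    have "int ?K dvd (a + int M) - (a + int q0')" using M(4) th(3) by (rule dvd_diff)
    then have "?K dvd M - q0'" using th(6) by (simp add: of_nat_diff[symmetric] del: of_nat_diff of_nat_Suc of_nat_add)
    then obtain s where "M - q0' = s * ?K" by (metis dvdE mult.commute)
    then have s: "M = q0' + s * ?K" using th(6) by simp
    obtain t where t: "(?b ^^ t) q' = q0'" "Lc ?b q0' = t + Lc ?b q'" "Lc ?b (Suc q0') = t + Lc ?b (Suc q')"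
      using reach_funpow[OF 1(1) th(4)] by blast
    have "Lc ?b q' = 0" using th(5) by (intro Lc_top) auto
    then have "Lc ?b M = s + t" "Lc ?b (Suc M) = s + t + Lc ?b (Suc q')"
      using far'[OF th(2), of s] far'[of "Suc q0'" s] th(2) t s by auto
    moreover have "(?b ^^ (s + t)) q' = M" using far'[OF th(2), of s] t(1) s by (simp add: funpow_add)
    ultimately show ?thesis by (intro exI[of _ "s + t"]) simp
  qed
  have "q = p"
  proof -
    obtain t where t: "(?b ^^ t) q = M" "min (Lc ?b M) (Lc ?b (Suc M)) = t"
      using key[OF 1(1,2,3,4,6)] M by blast
    obtain t' where t': "(?b ^^ t') p = M" "min (Lc ?b M) (Lc ?b (Suc M)) = t'"
      using key[OF 2(1,2,3,4,6)] M by blast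
    show ?thesis using funpow_inj_rowfun[OF 1(1), of q p t] t t' 1(7) 2(7) by simp
  qed
  then show ?thesis using rowfun_inj[OF 1(1) i j] 1(5) 2(5) by simp
qed

lemma bb_add_single:
  assumes "rowfun (k + 1) n (bb k \<mu>)" "1 \<le> i" "bb k \<mu> i = Suc q"
  shows "bb k (\<mu> + Poly_Mapping.single i 1) = (bb k \<mu>)(i := q)"
proof
  fix x
  show "bb k (\<mu> + Poly_Mapping.single i 1) x = ((bb k \<mu>)(i := q)) x"
    using assms(3) by (auto simp: bb_def lookup_add lookup_single when_def nat_eq_iff split: if_splits)
qed

lemma addableD:
  assumes k: "1 \<le> k" and \<mu>: "\<mu> \<in> Par k" and a: "addable k a \<mu> i"
  shows "\<mu> + Poly_Mapping.single i 1 \<in> Par k"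
    and "hp k (\<mu> + Poly_Mapping.single i 1) = hp k \<mu> \<circ> sg (k + 1) a"
    and "hp k \<mu> a < hp k \<mu> (a - 1)" and "i \<le> Suc (nparts \<mu>)"
proof -
  let ?b = "bb k \<mu>" and ?K = "k + 1"
  obtain n q0 R0 q R where 1: "rowfun ?K n ?b" "n < q0" "int ?K dvd a + int q0" "reach ?b q0 R0 q R"
    "good ?b q" "?b i = Suc q" "\<And>x. 1 \<le> x \<Longrightarrow> ?b x \<noteq> q" "i < q" and i: "1 \<le> i"
    using a unfolding addable_def by blast
  have \<mu>n: "\<mu> \<in> Par_len k (nparts \<mu>)" using Par_nparts[OF \<mu>] .
  have rn: "rowfun ?K (nparts \<mu>) ?b" by (rule rowfun_bb[OF k \<mu>n])
  note up = rowfun_up[OF rn i 1(6,7,8)]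
  have be: "bb k (\<mu> + Poly_Mapping.single i 1) = ?b(i := q)" by (rule bb_add_single[OF 1(1) i 1(6)])
  show "i \<le> Suc (nparts \<mu>)" by (rule up(2))
  have "Poly_Mapping.keys (\<mu> + Poly_Mapping.single i 1) \<subseteq> {1..Suc (nparts \<mu>)}"
    using Poly_Mapping.keys_add[of \<mu> "Poly_Mapping.single i 1"] keys_Par(1)[OF \<mu>n] up(2) i by auto
  then have "\<mu> + Poly_Mapping.single i 1 \<in> Par_len k (Suc (nparts \<mu>))"
    using up(1) be by (intro Par_len_rowfun) simp_all
  then show "\<mu> + Poly_Mapping.single i 1 \<in> Par k" by (rule Par_lenI)
  show "hp k (\<mu> + Poly_Mapping.single i 1) = hp k \<mu> \<circ> sg (k + 1) a"
    unfolding hp_def be by (rule hh_up[OF 1(1) i 1(6,7,8,4,2,3)])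
  show "hp k \<mu> a < hp k \<mu> (a - 1)"
    unfolding hp_def by (rule trichotomy(1)[OF 1(1,4,2,5,3) i 1(6,7)])
qed

text \<open>One letter of the 0-Hecke action, realised by multiplication with \<open>Z - 1\<close> in a window row.\<close>

lemma window_letter:
  assumes k: "1 \<le> k" and \<mu>: "\<mu> \<in> Par_len k n" and l: "Suc n + (k + 1) < l" and w: "w \<in> {Suc (l - (k + 1))..l}"
    and P: "only I P" "I \<subseteq> {Suc (l - (k + 1))..l}" "w \<notin> I" "(if w = Suc (l - (k + 1)) then l else w - 1) \<notin> I"
    and a: "int (k + 1) dvd a + int (w - 1)"
  shows "hp k \<mu> a < hp k \<mu> (a - 1) \<Longrightarrow> \<exists>i. addable k a \<mu> i \<and>
      GG (k + 1) l (bb k \<mu>) {} ((zp w 1 - 1) * P) = GG (k + 1) l (bb k (\<mu> + Poly_Mapping.single i 1)) {} P"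
    and "hp k \<mu> a = hp k \<mu> (a - 1) \<Longrightarrow> GG (k + 1) l (bb k \<mu>) {} ((zp w 1 - 1) * P) = 0"
    and "hp k \<mu> (a - 1) < hp k \<mu> a \<Longrightarrow>
      GG (k + 1) l (bb k \<mu>) {} ((zp w 1 - 1) * P) = - GG (k + 1) l (bb k \<mu>) {} P"
    and "hp k \<mu> (a - 1) < hp k \<mu> a \<Longrightarrow> \<exists>i \<nu>. \<nu> \<in> Par k \<and> \<mu> = \<nu> + Poly_Mapping.single i 1 \<and> addable k a \<nu> i"
proof -
  let ?b = "bb k \<mu>" and ?K = "k + 1"
  have b: "rowfun ?K n ?b" by (rule rowfun_bb[OF k \<mu>])
  have q0: "n < w - 1" using w l by auto
  obtain q R where qR: "reach ?b (w - 1) (wrap ?K l w) q R" "good ?b q" and cases: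
    "(\<exists>i\<ge>1. ?b i = Suc q \<and> (\<forall>x\<ge>1. ?b x \<noteq> q) \<and> i < q \<and>
        GG ?K l ?b {} ((zp w 1 - 1) * P) = GG ?K l (?b(i := q)) {} P) \<or>
     ((\<forall>x\<ge>1. ?b x \<noteq> q \<and> ?b x \<noteq> Suc q) \<and> GG ?K l ?b {} ((zp w 1 - 1) * P) = 0) \<or>
     (\<exists>i\<ge>1. ?b i = q \<and> (\<forall>x\<ge>1. ?b x \<noteq> Suc q) \<and>
        GG ?K l ?b {} ((zp w 1 - 1) * P) = - GG ?K l ?b {} P)"
    using GG_step[OF b l w P] by blast
  note tri = trichotomy[OF b qR(1) q0 qR(2) a, folded hp_def]
  from cases consider (up) i where "1 \<le> i" "?b i = Suc q" "\<And>x. 1 \<le> x \<Longrightarrow> ?b x \<noteq> q" "i < q"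
      "GG ?K l ?b {} ((zp w 1 - 1) * P) = GG ?K l (?b(i := q)) {} P"
    | (tie) "\<And>x. 1 \<le> x \<Longrightarrow> ?b x \<noteq> q \<and> ?b x \<noteq> Suc q" "GG ?K l ?b {} ((zp w 1 - 1) * P) = 0"
    | (down) i where "1 \<le> i" "?b i = q" "\<And>x. 1 \<le> x \<Longrightarrow> ?b x \<noteq> Suc q"
      "GG ?K l ?b {} ((zp w 1 - 1) * P) = - GG ?K l ?b {} P"
    by blast
  then have "(hp k \<mu> a < hp k \<mu> (a - 1) \<and> (\<exists>i. addable k a \<mu> i \<and>
      GG ?K l ?b {} ((zp w 1 - 1) * P) = GG ?K l (bb k (\<mu> + Poly_Mapping.single i 1)) {} P)) \<or>
    (hp k \<mu> a = hp k \<mu> (a - 1) \<and> GG ?K l ?b {} ((zp w 1 - 1) * P) = 0) \<or>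
    (hp k \<mu> (a - 1) < hp k \<mu> a \<and> GG ?K l ?b {} ((zp w 1 - 1) * P) = - GG ?K l ?b {} P \<and>
      (\<exists>i \<nu>. \<nu> \<in> Par k \<and> \<mu> = \<nu> + Poly_Mapping.single i 1 \<and> addable k a \<nu> i))"
  proof cases
    case (up i)
    have "addable k a \<mu> i" unfolding addable_def using up(1-4) b q0 a qR by blast
    moreover have "bb k (\<mu> + Poly_Mapping.single i 1) = ?b(i := q)" by (rule bb_add_single[OF b up(1,2)])
    ultimately show ?thesis using tri(1)[OF up(1,2,3)] up(5) by auto
  next
    case tie
    then show ?thesis using tri(2) by blast
  next
    case (down i)
    \<comment> \<open>Row i ends at q; with one box less it ends at q + 1 and no row ends at q,
      which is the situation of \<open>GG_up\<close>.\<close>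
    define \<nu> where "\<nu> = \<mu> - Poly_Mapping.single i 1"
    have \<mu>\<nu>: "\<mu> = \<nu> + Poly_Mapping.single i 1" by (simp add: \<nu>_def)
    note dn = rowfun_down[OF b down(1,2,3)]
    have iq: "i < q" using rowfunD(2)[OF b down(1)] down(2) by simp
    have be: "bb k \<nu> = ?b(i := Suc q)"
    proof
      fix x
      have "0 \<le> int i + int k + 1 - Poly_Mapping.lookup \<mu> i" using Par_lenD(2)[OF \<mu>, of i] by simp
      then show "bb k \<nu> x = (?b(i := Suc q)) x"
        using down(2) by (auto simp: \<nu>_def bb_def lookup_minus lookup_single when_def nat_eq_iff)
    qed
    have r': "reach (bb k \<nu>) (w - 1) (wrap ?K l w) q R" unfolding be by (rule reach_upd[OF b qR(1) iq])
    have g': "good (bb k \<nu>) q" using qR(2) iq unfolding be good_def by auto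
    have "bb k \<nu> x \<noteq> q" if "1 \<le> x" for x
      using rowfun_inj[OF b that down(1)] down(2) unfolding be by (metis fun_upd_apply n_not_Suc_n)
    then have "addable k a \<nu> i"
      unfolding addable_def using dn(1) q0 a r' g' iq down(1) be by (metis fun_upd_same)
    moreover have "\<nu> \<in> Par_len k n"
    proof (rule Par_len_rowfun)
      show "rowfun (k + 1) n (bb k \<nu>)" unfolding be by (rule dn(1))
      have "Poly_Mapping.keys \<mu> \<subseteq> {1..n}" using \<mu> by (simp add: Par_len_def zvecs_def)
      then show "Poly_Mapping.keys \<nu> \<subseteq> {1..n}"
        unfolding \<nu>_def using keys_diff[of \<mu> "Poly_Mapping.single i 1"] dn(2) down(1) by auto
    qed
    then have "\<nu> \<in> Par k" by (rule Par_lenI)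
    ultimately show ?thesis using tri(3)[OF down(1,2,3)] down(4) \<mu>\<nu> by blast
  qed
  note D = this
  show "\<exists>i. addable k a \<mu> i \<and>
      GG (k + 1) l (bb k \<mu>) {} ((zp w 1 - 1) * P) = GG (k + 1) l (bb k (\<mu> + Poly_Mapping.single i 1)) {} P"
    if "hp k \<mu> a < hp k \<mu> (a - 1)" using D that by (elim disjE) auto
  show "GG (k + 1) l (bb k \<mu>) {} ((zp w 1 - 1) * P) = 0"
    if "hp k \<mu> a = hp k \<mu> (a - 1)" using D that by (elim disjE) auto
  show "GG (k + 1) l (bb k \<mu>) {} ((zp w 1 - 1) * P) = - GG (k + 1) l (bb k \<mu>) {} P"
    if "hp k \<mu> (a - 1) < hp k \<mu> a" using D that by (elim disjE) auto
  show "\<exists>i \<nu>. \<nu> \<in> Par k \<and> \<mu> = \<nu> + Poly_Mapping.single i 1 \<and> addable k a \<nu> i"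
    if "hp k \<mu> (a - 1) < hp k \<mu> a" using D that by (elim disjE) auto
qed

lemma window_row_ex:
  fixes a :: int
  assumes "K \<le> l" "1 \<le> K" obtains w where "w \<in> {Suc (l - K)..l}" "int K dvd a + int (w - 1)"
proof -
  define w where "w = l - nat ((a + int l - 1) mod int K)"
  have r: "0 \<le> (a + int l - 1) mod int K" "(a + int l - 1) mod int K < int K" using assms by auto
  then have n: "nat ((a + int l - 1) mod int K) < K" by linarith
  have w: "w \<in> {Suc (l - K)..l}" using n assms by (auto simp: w_def)
  have "int w = int l - (a + int l - 1) mod int K" using n r assms by (simp add: w_def)
  then have "a + int (w - 1) = (a + int l - 1) - (a + int l - 1) mod int K" using w by simp
  then have "int K dvd a + int (w - 1)" by (simp only: dvd_minus_mod)
  then show ?thesis using w that by blast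
qed

text \<open>The combinatorial part of \<open>window_letter\<close>; the choice of an empty
  \<open>I\<close> and of P = 1 satisfies its conditions on the unprocessed factors.\<close>

lemma addable_ex:
  assumes k: "1 \<le> k" and \<mu>: "\<mu> \<in> Par k" and h: "hp k \<mu> a < hp k \<mu> (a - 1)"
  shows "\<exists>i. addable k a \<mu> i"
proof -
  obtain n where n: "\<mu> \<in> Par_len k n" using \<mu> by (rule ParE)
  obtain w where w: "w \<in> {Suc ((n + k + 3) - (k + 1))..n + k + 3}" "int (k + 1) dvd a + int (w - 1)"
    by (rule window_row_ex[of "k + 1" "n + k + 3" a]) auto
  show ?thesis using window_letter(1)[OF k n _ w(1) only_1[of "{}"] _ _ _ w(2) h] by auto
qed

lemma removable_ex:
  assumes k: "1 \<le> k" and \<mu>: "\<mu> \<in> Par k" and h: "hp k \<mu> (a - 1) < hp k \<mu> a"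
  shows "\<exists>i \<nu>. \<nu> \<in> Par k \<and> \<mu> = \<nu> + Poly_Mapping.single i 1 \<and> addable k a \<nu> i"
proof -
  obtain n where n: "\<mu> \<in> Par_len k n" using \<mu> by (rule ParE)
  obtain w where w: "w \<in> {Suc ((n + k + 3) - (k + 1))..n + k + 3}" "int (k + 1) dvd a + int (w - 1)"
    by (rule window_row_ex[of "k + 1" "n + k + 3" a]) auto
  show ?thesis by (rule window_letter(4)[OF k n _ w(1) only_1[of "{}"] _ _ _ w(2) h]) auto
qed

text \<open>A trace of length zero suffices: the end q of the last nonzero row is itself a zero row.
  The residue is the one of the first letter of \<open>par_word\<close>.\<close>

lemma addable_last_box:
  assumes k: "1 \<le> k" and \<mu>: "\<mu> \<in> Par k" and n: "n = nparts \<mu>" "1 \<le> n"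
  shows "\<mu> - Poly_Mapping.single n 1 \<in> Par k"
    "addable k (Poly_Mapping.lookup \<mu> n - int n) (\<mu> - Poly_Mapping.single n 1) n"
proof -
  define \<nu> where "\<nu> = \<mu> - Poly_Mapping.single n 1"
  have \<mu>n: "\<mu> \<in> Par_len k n" using Par_nparts[OF \<mu>] n by simp
  have "n \<in> Poly_Mapping.keys \<mu>" using keys_Par(1)[OF \<mu>n] n by auto
  then have pos: "1 \<le> Poly_Mapping.lookup \<mu> n" using Par_lenD(1)[OF \<mu>n, of n] by (simp add: in_keys_iff)
  have lk: "Poly_Mapping.lookup \<nu> i = Poly_Mapping.lookup \<mu> i - (if i = n then 1 else 0)" for i
    by (simp add: \<nu>_def lookup_minus lookup_single when_def)
  have "Poly_Mapping.keys \<nu> \<subseteq> {1..n}"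
    using keys_diff[of \<mu> "Poly_Mapping.single n 1"] keys_Par(1)[OF \<mu>n] n unfolding \<nu>_def by auto
  moreover have "0 \<le> Poly_Mapping.lookup \<nu> i \<and> Poly_Mapping.lookup \<nu> i \<le> int k" for i
    using Par_lenD(1,2)[OF \<mu>n, of i] pos by (auto simp: lk)
  moreover have "Poly_Mapping.lookup \<nu> j \<le> Poly_Mapping.lookup \<nu> i" if "1 \<le> i" "i \<le> j" "j \<le> n" for i j
    using Par_lenD(3)[OF \<mu>n that(1,2)] that by (auto simp: lk)
  ultimately have \<nu>: "\<nu> \<in> Par_len k n" by (auto simp: Par_len_def zvecs_def)
  then show "\<mu> - Poly_Mapping.single n 1 \<in> Par k" unfolding \<nu>_def by (rule Par_lenI)
  have b: "rowfun (k + 1) n (bb k \<nu>)" by (rule rowfun_bb[OF k \<nu>])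
  define q where "q = bb k \<mu> n"
  have q: "int q = int n + int k + 1 - Poly_Mapping.lookup \<mu> n" using bb_int[OF \<mu>n, of n] by (simp add: q_def)
  have nq: "n < q" using q Par_lenD(2)[OF \<mu>n, of n] by linarith
  have bn: "bb k \<nu> n = Suc q" using q bb_int[OF \<nu>, of n] by (simp add: lk)
  have bq: "bb k \<nu> q = q + (k + 1)" "bb k \<nu> (Suc q) = Suc q + (k + 1)" using rowfunD(5)[OF b] nq by auto
  have "bb k \<nu> x \<noteq> q" if x: "1 \<le> x" for x
  proof
    assume e: "bb k \<nu> x = q"
    then have "x < n" using rowfun_less[OF b x, of n] bn n by simp
    then show False using bb_int[OF \<nu>, of x] Par_lenD(3)[OF \<mu>n x, of n] e q by (simp add: lk)
  qed
  moreover have "int (k + 1) dvd (Poly_Mapping.lookup \<mu> n - int n) + int q"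
  proof -
    have "(Poly_Mapping.lookup \<mu> n - int n) + int q = int (k + 1)" using q by simp
    then show ?thesis by (simp only: dvd_refl)
  qed
  moreover have "good (bb k \<nu>) q" using bq nq k by (simp add: good_def)
  ultimately show "addable k (Poly_Mapping.lookup \<mu> n - int n) (\<mu> - Poly_Mapping.single n 1) n"
    unfolding addable_def \<nu>_def[symmetric] using b nq bn n(2) reach.start[of "bb k \<nu>" q "{}"] by blast
qed

section \<open>Size, and injectivity of the height function\<close>

definition psz :: "zvec \<Rightarrow> nat" where
  "psz \<mu> = nat (\<Sum>i\<in>Poly_Mapping.keys \<mu>. Poly_Mapping.lookup \<mu> i)"

lemma psz_add_single:
  assumes "\<mu> \<in> Par k" shows "psz (\<mu> + Poly_Mapping.single i 1) = Suc (psz \<mu>)"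
proof -
  obtain n where n: "\<mu> \<in> Par_len k n" using assms by (rule ParE)
  let ?A = "insert i (Poly_Mapping.keys \<mu>)"
  have "(\<Sum>j\<in>Poly_Mapping.keys (\<mu> + Poly_Mapping.single i 1). Poly_Mapping.lookup (\<mu> + Poly_Mapping.single i 1) j) =
      (\<Sum>j\<in>?A. Poly_Mapping.lookup (\<mu> + Poly_Mapping.single i 1) j)"
    using Poly_Mapping.keys_add[of \<mu> "Poly_Mapping.single i 1"]
    by (intro sum.mono_neutral_left) (auto simp: in_keys_iff)
  also have "\<dots> = (\<Sum>j\<in>?A. Poly_Mapping.lookup \<mu> j) + (\<Sum>j\<in>?A. Poly_Mapping.lookup (Poly_Mapping.single i 1) j)"
    by (simp only: lookup_add sum.distrib)
  also have "(\<Sum>j\<in>?A. Poly_Mapping.lookup (Poly_Mapping.single i (1::int)) j) = 1"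
    by (simp add: lookup_single when_def)
  also have "(\<Sum>j\<in>?A. Poly_Mapping.lookup \<mu> j) = (\<Sum>j\<in>Poly_Mapping.keys \<mu>. Poly_Mapping.lookup \<mu> j)"
    by (intro sum.mono_neutral_right) (auto simp: in_keys_iff)
  finally show ?thesis unfolding psz_def
    using sum_nonneg[of "Poly_Mapping.keys \<mu>" "Poly_Mapping.lookup \<mu>"] Par_lenD(1)[OF n] by (simp add: nat_add_distrib)
qed

lemma psz_0_iff:
  assumes "\<mu> \<in> Par k" shows "psz \<mu> = 0 \<longleftrightarrow> \<mu> = 0"
proof
  assume z: "psz \<mu> = 0"
  obtain n where n: "\<mu> \<in> Par_len k n" using assms by (rule ParE)
  have "(\<Sum>i\<in>Poly_Mapping.keys \<mu>. Poly_Mapping.lookup \<mu> i) = 0"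
    using z sum_nonneg[of "Poly_Mapping.keys \<mu>" "Poly_Mapping.lookup \<mu>"] Par_lenD(1)[OF n] by (simp add: psz_def)
  then have "\<forall>i\<in>Poly_Mapping.keys \<mu>. Poly_Mapping.lookup \<mu> i = 0"
    using sum_nonneg_eq_0_iff[of "Poly_Mapping.keys \<mu>" "Poly_Mapping.lookup \<mu>"] Par_lenD(1)[OF n] by simp
  then have "Poly_Mapping.keys \<mu> = {}" by (metis in_keys_iff equals0I)
  then show "\<mu> = 0" by simp
qed (simp add: psz_def)

lemma zero_Par: "0 \<in> Par k"
  by (auto simp: Par_def Par_len_def zvecs_def)

text \<open>A nonzero partition has a removable box, visible in \<open>hp\<close> as an ascent from
  a - 1 to a. Removing residue a from both partitions keeps the height functions equal, and
  \<open>addable_unique\<close> tells where to put the box back.\<close>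

lemma hp_inj:
  assumes k: "1 \<le> k"
  shows "\<mu> \<in> Par k \<Longrightarrow> \<nu> \<in> Par k \<Longrightarrow> hp k \<mu> = hp k \<nu> \<Longrightarrow> \<mu> = \<nu>"
proof (induction "psz \<mu>" arbitrary: \<mu> \<nu> rule: less_induct)
  case less
  have ex: "\<exists>a. hp k \<kappa> (a - 1) < hp k \<kappa> a" if \<kappa>: "\<kappa> \<in> Par k" "\<kappa> \<noteq> 0" for \<kappa>
  proof -
    have n: "1 \<le> nparts \<kappa>" using keys_Par(1)[OF Par_nparts[OF \<kappa>(1)]] \<kappa>(2) by (metis atLeastatMost_empty_iff2 keys_eq_empty)
    let ?\<nu> = "\<kappa> - Poly_Mapping.single (nparts \<kappa>) 1" and ?a = "Poly_Mapping.lookup \<kappa> (nparts \<kappa>) - int (nparts \<kappa>)"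
    note l = addable_last_box[OF k \<kappa>(1) refl n]
    have "hp k \<kappa> = hp k ?\<nu> \<circ> sg (k + 1) ?a" using addableD(2)[OF k l] by simp
    moreover have "hp k ?\<nu> ?a < hp k ?\<nu> (?a - 1)" by (rule addableD(3)[OF k l])
    moreover have "sg (k + 1) ?a ?a = ?a - 1" "sg (k + 1) ?a (?a - 1) = ?a"
      using sg_down[of "k + 1" ?a ?a] sg_up[of "k + 1" "?a - 1" ?a] k by auto
    ultimately show ?thesis by (intro exI[of _ ?a]) simp
  qed
  show ?case
  proof (cases "\<mu> = 0")
    case True
    show ?thesis
    proof (rule ccontr)
      assume "\<mu> \<noteq> \<nu>"
      then obtain a where "hp k \<mu> (a - 1) < hp k \<mu> a" using ex[OF less.prems(2)] True less.prems(3) by auto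
      then obtain i \<kappa> where "\<kappa> \<in> Par k" "\<mu> = \<kappa> + Poly_Mapping.single i 1"
        using removable_ex[OF k less.prems(1)] by blast
      then have "psz \<mu> = Suc (psz \<kappa>)" using psz_add_single by simp
      then show False using True by (simp add: psz_def)
    qed
  next
    case False
    then obtain a where a: "hp k \<mu> (a - 1) < hp k \<mu> a" using ex[OF less.prems(1)] by blast
    obtain i \<mu>' where 1: "\<mu>' \<in> Par k" "\<mu> = \<mu>' + Poly_Mapping.single i 1" "addable k a \<mu>' i"
      using removable_ex[OF k less.prems(1) a] by blast
    obtain j \<nu>' where 2: "\<nu>' \<in> Par k" "\<nu> = \<nu>' + Poly_Mapping.single j 1" "addable k a \<nu>' j"
      using removable_ex[OF k less.prems(2)] a less.prems(3) by metis
    have inv: "(f \<circ> sg (k + 1) a) \<circ> sg (k + 1) a = f" for f :: "int \<Rightarrow> int"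
      using sg_invol[of "k + 1" a] k by auto
    have "hp k \<mu>' = hp k \<mu> \<circ> sg (k + 1) a" using addableD(2)[OF k 1(1,3)] 1(2) inv by simp
    moreover have "hp k \<nu>' = hp k \<nu> \<circ> sg (k + 1) a" using addableD(2)[OF k 2(1,3)] 2(2) inv by simp
    ultimately have "hp k \<mu>' = hp k \<nu>'" using less.prems(3) by simp
    moreover have "psz \<mu>' < psz \<mu>" using psz_add_single[OF 1(1)] 1(2) by simp
    ultimately have "\<mu>' = \<nu>'" using less.hyps 1(1) 2(1) by blast
    then show ?thesis using addable_unique 1 2 by blast
  qed
qed

lemma hp_0:
  assumes "1 \<le> k" shows "hp k 0 x = (- x - 1) div int (k + 1)"
proof -
  let ?K = "k + 1" and ?b = "bb k 0"
  have b: "rowfun ?K 0 ?b" using rowfun_bb[OF assms, of 0 0] by (simp add: Par_len_def zvecs_def)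
  have L: "1 \<le> y \<Longrightarrow> Lc ?b y = (y - 1) div ?K" for y
  proof (induction y rule: less_induct)
    case (less y)
    show ?case
    proof (cases "y \<le> ?K")
      case True
      have "?b x \<noteq> y" if "1 \<le> x" for x using rowfunD(5)[OF b, of x] that True by simp
      then have "Lc ?b y = 0" by (rule Lc_top)
      then show ?thesis using True less.prems by simp
    next
      case False
      have "?b (y - ?K) = y" using rowfunD(5)[OF b, of "y - ?K"] False by simp
      then have "Lc ?b y = Suc (Lc ?b (y - ?K))" using Lc_pre[OF b, of "y - ?K"] False by simp
      also have "Lc ?b (y - ?K) = (y - ?K - 1) div ?K" using False by (intro less.IH) auto
      also have "Suc ((y - ?K - 1) div ?K) = (y - ?K - 1 + ?K) div ?K"
        by (metis Suc_eq_plus1 add_is_0 div_add_self2 one_neq_zero)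
      also have "y - ?K - 1 + ?K = y - 1" using False by simp
      finally show ?thesis .
    qed
  qed
  obtain t where t: "int 0 < int ?K * t - x" using far_ex[of ?K] assms by (metis add_leD2 one_add_one add_mono le_refl)
  have "hp k 0 x = int (Lc ?b (nat (int ?K * t - x))) - t" unfolding hp_def by (rule hh_far[OF b t])
  also have "Lc ?b (nat (int ?K * t - x)) = (nat (int ?K * t - x) - 1) div ?K" using t by (intro L) simp
  also have "int \<dots> = (int ?K * t - x - 1) div int ?K" using t by (simp add: zdiv_int of_nat_diff)
  also have "int ?K * t - x - 1 = (- x - 1) + t * int ?K" by simp
  also have "((- x - 1) + t * int ?K) div int ?K = (- x - 1) div int ?K + t" by simp
  finally show ?thesis by simp
qed

section \<open>Words acting on partitions\<close>

definition qp :: "nat \<Rightarrow> (int \<Rightarrow> int) \<Rightarrow> bool" where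
  "qp K H \<longleftrightarrow> (\<forall>x. H (x + int K) = H x - 1)"

text \<open>Negative, zero or positive according to whether the residue c is addable, neutral or
  removable; see \<open>trichotomy\<close>.\<close>

definition dh :: "(int \<Rightarrow> int) \<Rightarrow> int \<Rightarrow> int" where
  "dh H c = H c - H (c - 1)"

lemma qp_mult:
  assumes "qp K H" shows "H (x + int K * m) = H x - m"
proof -
  have nat: "H (x + int K * int t) = H x - int t" for x t
  proof (induction t)
    case (Suc t)
    have "x + int K * int (Suc t) = (x + int K * int t) + int K" by (simp add: algebra_simps)
    then have "H (x + int K * int (Suc t)) = H (x + int K * int t) - 1"
      using assms unfolding qp_def by metis
    then show ?case using Suc by simp
  qed simp
  show ?thesis
  proof (cases "0 \<le> m")
    case True
    then show ?thesis using nat[of x "nat m"] by simp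
  next
    case False
    then show ?thesis using nat[of "x + int K * m" "nat (- m)"] by simp
  qed
qed

lemma dh_cong:
  assumes "qp K H" "int K dvd c - c'" shows "dh H c = dh H c'"
proof -
  obtain m where "c - c' = int K * m" using assms(2) by (elim dvdE)
  then have "c = c' + int K * m" "c - 1 = (c' - 1) + int K * m" by auto
  then show ?thesis unfolding dh_def using qp_mult[OF assms(1)] by (metis diff_diff_eq2 diff_add_cancel add_diff_cancel_right diff_diff_add)
qed

lemma qp_sg: "qp K H \<Longrightarrow> qp K (H \<circ> sg K a)"
  by (simp add: qp_def sg_shift)

lemma qp_hp: "1 \<le> k \<Longrightarrow> \<mu> \<in> Par k \<Longrightarrow> qp (k + 1) (hp k \<mu>)"
  unfolding qp_def using hp_shift by blast

lemma dh_sg_self: "2 \<le> K \<Longrightarrow> dh (H \<circ> sg K a) a = - dh H a"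
  using sg_down[of K a a] sg_up[of K "a - 1" a] by (simp add: dh_def)

definition nbr :: "nat \<Rightarrow> int \<Rightarrow> int \<Rightarrow> bool" where
  "nbr K a c \<longleftrightarrow> int K dvd c - a - 1 \<or> int K dvd a - c - 1"

text \<open>With \<open>dh_sg_self\<close> and \<open>dh_sg_far\<close> this is the reflection
  formula for the pairing with simple roots, with the Cartan integers 2, -1 and 0 of affine type
  A.\<close>

lemma dh_sg_nbr:
  assumes K: "3 \<le> K" and H: "qp K H" and n: "nbr K a c"
  shows "dh (H \<circ> sg K a) c = dh H c + dh H a"
proof -
  have K2: "2 \<le> K" using K by simp
  have fx: "sg K a (a + 1) = a + 1" "sg K a (a - 2) = a - 2"
    using not_dvd_shift[of K 0 1] not_dvd_shift[of K 0 2] not_dvd_shift[of K 0 "-1"] not_dvd_shift[of K 0 "-2"] K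
    by (auto intro!: sg_fix)
  have mv: "sg K a a = a - 1" "sg K a (a - 1) = a" using sg_down[of K a a] sg_up[OF K2, of "a - 1" a] by auto
  from n consider "int K dvd c - (a + 1)" | "int K dvd c - (a - 1)"
    unfolding nbr_def using dvd_minus_iff[of "int K" "a - c - 1"] by (auto simp: algebra_simps)
  then show ?thesis
  proof cases
    case 1
    show ?thesis unfolding dh_cong[OF H 1] dh_cong[OF qp_sg[OF H] 1] by (simp add: dh_def fx mv)
  next
    case 2
    show ?thesis unfolding dh_cong[OF H 2] dh_cong[OF qp_sg[OF H] 2] by (simp add: dh_def fx mv)
  qed
qed

lemma dh_sg_far:
  assumes "\<not> int K dvd c - a" "\<not> nbr K a c" shows "dh (H \<circ> sg K a) c = dh H c"
proof -
  have "sg K a c = c" using assms by (intro sg_fix) (auto simp: nbr_def dvd_minus_iff[of "int K" "c + 1 - a", symmetric] algebra_simps)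
  moreover have "sg K a (c - 1) = c - 1" using assms by (intro sg_fix) (auto simp: nbr_def algebra_simps)
  ultimately show ?thesis by (simp add: dh_def)
qed

lemma sg_commute_far:
  assumes "2 \<le> K" "\<not> int K dvd a - c" "\<not> nbr K a c"
  shows "sg K a \<circ> sg K c = sg K c \<circ> sg K a"
proof (rule sg_commute[OF assms(1,2)])
  have "a + 1 - c = - (c - a - 1)" by simp
  then show "\<not> int K dvd a + 1 - c" using assms(3) by (simp only: nbr_def dvd_minus_iff) blast
  have "a - 1 - c = a - c - 1" by simp
  then show "\<not> int K dvd a - 1 - c" using assms(3) by (simp only: nbr_def) blast
qed

text \<open>For K = 2 the two differences add up to -1 by quasi-periodicity, so both cannot be
  positive. This is why the absence of a braid relation for k = 1 does no harm.\<close>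

lemma dh_two:
  assumes "qp 2 H" "nbr 2 a c" shows "dh H c = - 1 - dh H a"
proof -
  have "int 2 dvd c - (a + 1)"
    using assms(2) unfolding nbr_def by (auto simp: algebra_simps)
  then have "dh H c = dh H (a + 1)" by (rule dh_cong[OF assms(1)])
  moreover have "H (a + 1) = H (a - 1) - 1"
    using assms(1)[unfolded qp_def, rule_format, of "a - 1"] by (simp add: algebra_simps)
  ultimately show ?thesis by (simp add: dh_def)
qed

lemma add_box:
  assumes "1 \<le> k" "\<mu> \<in> Par k" "dh (hp k \<mu>) a < 0"
  obtains i where "addable k a \<mu> i"
  using addable_ex[of k \<mu> a] assms by (auto simp: dh_def)

lemma remove_box:
  assumes k: "1 \<le> k" and \<mu>: "\<mu> \<in> Par k" and d: "0 < dh (hp k \<mu>) a"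
  obtains i \<nu> where "\<nu> \<in> Par k" "\<mu> = \<nu> + Poly_Mapping.single i 1" "addable k a \<nu> i"
    "hp k \<nu> = hp k \<mu> \<circ> sg (k + 1) a" "psz \<mu> = Suc (psz \<nu>)"
proof -
  obtain i \<nu> where 1: "\<nu> \<in> Par k" "\<mu> = \<nu> + Poly_Mapping.single i 1" "addable k a \<nu> i"
    using removable_ex[OF k \<mu>, of a] d by (auto simp: dh_def)
  have "hp k \<mu> \<circ> sg (k + 1) a = hp k \<nu>"
    using addableD(2)[OF k 1(1,3)] 1(2) sg_invol[of "k + 1" a] k by (auto simp: fun_eq_iff)
  then show ?thesis using that[OF 1] psz_add_single[OF 1(1)] 1(2) by simp
qed

lemma addable_dh: "1 \<le> k \<Longrightarrow> \<mu> \<in> Par k \<Longrightarrow> addable k a \<mu> i \<Longrightarrow> dh (hp k \<mu>) a < 0"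
  using addableD(3)[of k \<mu> a i] by (simp add: dh_def)

lemma addable_dh': 
  assumes "1 \<le> k" "\<mu> \<in> Par k" "addable k a \<mu> i"
  shows "0 < dh (hp k (\<mu> + Poly_Mapping.single i 1)) a"
  using addable_dh[OF assms] dh_sg_self[of "k + 1" "hp k \<mu>" a] assms(1) by (simp add: addableD(2)[OF assms])

lemma tie_sg:
  assumes K: "2 \<le> K" and H: "qp K H" and d: "dh H a = 0" shows "H \<circ> sg K a = H"
proof
  fix x
  consider "int K dvd x - a" | "int K dvd x + 1 - a" | "\<not> int K dvd x - a" "\<not> int K dvd x + 1 - a" by blast
  then show "(H \<circ> sg K a) x = H x"
  proof cases
    case 1
    then show ?thesis using dh_cong[OF H 1] d by (simp add: sg_down dh_def)
  next
    case 2
    then show ?thesis using dh_cong[OF H 2] d by (simp add: sg_up[OF K] dh_def)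
  qed (simp add: sg_fix)
qed

lemma addable_cong:
  assumes "int (k + 1) dvd a - a'" shows "addable k a \<mu> i \<longleftrightarrow> addable k a' \<mu> i"
proof -
  have "int (k + 1) dvd a + int q \<longleftrightarrow> int (k + 1) dvd a' + int q" for q
  proof -
    have "a + int q = (a - a') + (a' + int q)" by simp
    then show ?thesis by (simp only: dvd_add_right_iff[OF assms])
  qed
  then show ?thesis by (simp only: addable_def)
qed

text \<open>Composed in reverse order, so that \<open>H \<circ> sgw K as\<close> is a left action of
  words on height functions: the last letter acts first.\<close>

primrec sgw :: "nat \<Rightarrow> nat list \<Rightarrow> int \<Rightarrow> int" where
  "sgw K [] = id"
| "sgw K (a # as) = sgw K as \<circ> sg K (int a)"

lemma sgw_append: "sgw K (u @ v) = sgw K v \<circ> sgw K u"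
  by (induction u) (auto simp: comp_assoc)

lemma dvd_mod_letter: "int (k + 1) dvd int (x mod (k + 1)) - int x"
proof -
  have "int (k + 1) dvd int x mod int (k + 1) - int x" by (metis dvd_minus_iff dvd_minus_mod minus_diff_eq)
  then show ?thesis by (simp only: of_nat_mod)
qed

lemma letters_nbr:
  assumes "i \<le> k" "j \<le> k"
  shows "int (k + 1) dvd int j - int i \<longleftrightarrow> i = j"
    and "nbr (k + 1) (int i) (int j) \<longleftrightarrow> j = (i + 1) mod (k + 1) \<or> i = (j + 1) mod (k + 1)"
proof -
  show "int (k + 1) dvd int j - int i \<longleftrightarrow> i = j"
    using assms by (auto simp: mod_eq_dvd_iff[symmetric])
  have *: "int (k + 1) dvd int j - int i - 1 \<longleftrightarrow> j = (i + 1) mod (k + 1)" if "j \<le> k" for i j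
  proof -
    have "int (k + 1) dvd int j - int i - 1 \<longleftrightarrow> int j mod int (k + 1) = int (i + 1) mod int (k + 1)"
      by (simp add: mod_eq_dvd_iff algebra_simps)
    also have "\<dots> \<longleftrightarrow> j mod (k + 1) = (i + 1) mod (k + 1)" by (simp only: of_nat_mod[symmetric] of_nat_eq_iff)
    finally show ?thesis using that by simp
  qed
  show "nbr (k + 1) (int i) (int j) \<longleftrightarrow> j = (i + 1) mod (k + 1) \<or> i = (j + 1) mod (k + 1)"
    unfolding nbr_def using *[OF assms(2), of i] *[OF assms(1), of j] by simp
qed

lemma cox_step_sgw:
  assumes "cox_step k u v" "1 \<le> k" shows "sgw (k + 1) u = sgw (k + 1) v"
  using assms(1)
proof cases
  case (square i x y)
  have "sg (k + 1) (int i) \<circ> sg (k + 1) (int i) = id" using sg_invol[of "k + 1" "int i"] assms(2) by auto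
  then have "sgw (k + 1) [i, i] = id" by simp
  then show ?thesis unfolding square(1,2) sgw_append by (simp only: comp_assoc id_comp)
next
  case (braid i j x y)
  have "sg (k + 1) (int j) = sg (k + 1) (int i + 1)"
    unfolding braid(5) by (rule sg_cong) (use dvd_mod_letter[of k "i + 1"] in \<open>simp add: algebra_simps\<close>)
  moreover have "sg (k + 1) (int i) \<circ> sg (k + 1) (int i + 1) \<circ> sg (k + 1) (int i) =
      sg (k + 1) (int i + 1) \<circ> sg (k + 1) (int i) \<circ> sg (k + 1) (int i + 1)"
    using braid(3) by (intro sg_braid) simp
  ultimately have "sgw (k + 1) [i, j, i] = sgw (k + 1) [j, i, j]" by (simp add: comp_assoc)
  then show ?thesis unfolding braid(1,2) sgw_append by simp
next
  case (commute i j x y)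
  have "\<not> nbr (k + 1) (int i) (int j)" using letters_nbr(2)[OF commute(3,4)] commute by simp
  moreover have "\<not> int (k + 1) dvd int j - int i" using letters_nbr(1)[OF commute(3,4)] commute by simp
  ultimately have "sg (k + 1) (int j) \<circ> sg (k + 1) (int i) = sg (k + 1) (int i) \<circ> sg (k + 1) (int j)"
    using assms(2) by (intro sg_commute_far) (auto simp: nbr_def)
  then have "sgw (k + 1) [i, j] = sgw (k + 1) [j, i]" by simp
  then show ?thesis unfolding commute(1,2) sgw_append by simp
qed

section \<open>Equivalence of words\<close>

definition weq :: "nat \<Rightarrow> nat list \<Rightarrow> nat list \<Rightarrow> bool" where
  "weq k = equivclp (cox_step k)"

text \<open>Equivalence of words by braid and commutation moves only: these preserve the length.\<close>

definition beq :: "nat \<Rightarrow> nat list \<Rightarrow> nat list \<Rightarrow> bool" where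
  "beq k = equivclp (\<lambda>u v. cox_step k u v \<and> length u = length v)"

lemma weq_refl [simp]: "weq k a a" and beq_refl [simp]: "beq k a a"
  by (simp_all add: weq_def beq_def)

lemma weq_sym: "weq k a b \<Longrightarrow> weq k b a" and beq_sym: "beq k a b \<Longrightarrow> beq k b a"
  by (simp_all add: weq_def beq_def equivclp_sym)

lemma weq_trans [trans]: "weq k a b \<Longrightarrow> weq k b c \<Longrightarrow> weq k a c"
  and beq_trans [trans]: "beq k a b \<Longrightarrow> beq k b c \<Longrightarrow> beq k a c"
  unfolding weq_def beq_def by (rule equivclp_trans; assumption)+

lemma weq_induct [consumes 1, case_names refl fwd bwd]:
  assumes "weq k a b" "P a" "\<And>u v. weq k a u \<Longrightarrow> cox_step k u v \<Longrightarrow> P u \<Longrightarrow> P v"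
    "\<And>u v. weq k a u \<Longrightarrow> cox_step k v u \<Longrightarrow> P u \<Longrightarrow> P v"
  shows "P b"
  using assms(1) unfolding weq_def
  by (induction rule: equivclp_induct) (use assms in \<open>auto simp: weq_def\<close>)

lemma beq_induct [consumes 1, case_names refl fwd bwd]:
  assumes "beq k a b" "P a" "\<And>u v. beq k a u \<Longrightarrow> cox_step k u v \<Longrightarrow> length u = length v \<Longrightarrow> P u \<Longrightarrow> P v"
    "\<And>u v. beq k a u \<Longrightarrow> cox_step k v u \<Longrightarrow> length u = length v \<Longrightarrow> P u \<Longrightarrow> P v"
  shows "P b"
  using assms(1) unfolding beq_def
  by (induction rule: equivclp_induct) (use assms in \<open>auto simp: beq_def\<close>)

lemma weq_step: "cox_step k u v \<Longrightarrow> weq k u v"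
  unfolding weq_def by (rule r_into_equivclp)

lemma beq_step: "cox_step k u v \<Longrightarrow> length u = length v \<Longrightarrow> beq k u v"
  unfolding beq_def by (rule r_into_equivclp) simp

lemma beq_weq: "beq k a b \<Longrightarrow> weq k a b"
  by (induction rule: beq_induct) (meson weq_refl weq_trans weq_step weq_sym)+

lemma cox_step_context: "cox_step k u v \<Longrightarrow> cox_step k (x @ u @ y) (x @ v @ y)"
proof (induction rule: cox_step.induct)
  case (square i u v)
  then show ?case using cox_step.square[of i k "x @ u" "v @ y"] by simp
next
  case (braid i j u v)
  then show ?case using cox_step.braid[of k i j "x @ u" "v @ y"] by simp
next
  case (commute i j u v)
  then show ?case using cox_step.commute[of i k j "x @ u" "v @ y"] by simp
qed

lemma weq_context: "weq k a b \<Longrightarrow> weq k (x @ a @ y) (x @ b @ y)"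
  by (induction rule: weq_induct) (meson weq_refl weq_trans weq_step cox_step_context weq_sym)+

lemma beq_context: "beq k a b \<Longrightarrow> beq k (x @ a @ y) (x @ b @ y)"
proof (induction rule: beq_induct)
  case (fwd u v)
  have "beq k (x @ u @ y) (x @ v @ y)"
    by (rule beq_step[OF cox_step_context[OF fwd(2)]]) (use fwd in simp)
  then show ?case using fwd beq_trans by blast
next
  case (bwd u v)
  have "beq k (x @ v @ y) (x @ u @ y)"
    by (rule beq_step[OF cox_step_context[OF bwd(2)]]) (use bwd in simp)
  then show ?case using bwd beq_trans beq_sym by blast
qed simp

lemma beq_Cons: "beq k a b \<Longrightarrow> beq k (x # a) (x # b)"
  using beq_context[of k a b "[x]" "[]"] by simp

lemma weq_Cons: "weq k a b \<Longrightarrow> weq k (x # a) (x # b)"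
  using weq_context[of k a b "[x]" "[]"] by simp

lemma weq_sgw: "weq k a b \<Longrightarrow> 1 \<le> k \<Longrightarrow> sgw (k + 1) a = sgw (k + 1) b"
  by (induction rule: weq_induct) (auto dest: cox_step_sgw)

lemma cox_step_letters: "cox_step k u v \<Longrightarrow> set u \<subseteq> {..k} \<longleftrightarrow> set v \<subseteq> {..k}"
proof (induction rule: cox_step.induct)
  case (braid i j u v)
  then have "j \<le> k" by (simp add: less_Suc_eq_le[symmetric])
  then show ?case using braid by auto
qed auto

lemma weq_letters: "weq k a b \<Longrightarrow> set a \<subseteq> {..k} \<longleftrightarrow> set b \<subseteq> {..k}"
  by (induction rule: weq_induct) (auto dest: cox_step_letters)

lemma mem_word_class: "b \<in> word_class k a \<longleftrightarrow> weq k a b"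
  by (simp add: word_class_def weq_def)

lemma word_class_eq_iff: "word_class k a = word_class k b \<longleftrightarrow> weq k a b"
  using weq_refl weq_sym weq_trans unfolding set_eq_iff mem_word_class by metis

lemma beq_braid3:
  assumes k: "2 \<le> k" and ab: "a \<le> k" "b \<le> k" and n: "nbr (k + 1) (int a) (int b)"
  shows "beq k ([a, b, a] @ v) ([b, a, b] @ v)"
proof -
  from n letters_nbr(2)[OF ab] consider "b = (a + 1) mod (k + 1)" | "a = (b + 1) mod (k + 1)" by blast
  then show ?thesis
  proof cases
    case 1
    then show ?thesis using cox_step.braid[OF k ab(1) 1, of "[]" v] by (intro beq_step) auto
  next
    case 2
    then show ?thesis using cox_step.braid[OF k ab(2) 2, of "[]" v] by (intro beq_sym[OF beq_step]) auto
  qed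
qed

lemma beq_swap2:
  assumes ab: "a \<le> k" "b \<le> k" and n: "\<not> nbr (k + 1) (int a) (int b)"
  shows "beq k ([a, b] @ v) ([b, a] @ v)"
proof (cases "a = b")
  case False
  then show ?thesis using cox_step.commute[OF ab, of "[]" v] n letters_nbr(2)[OF ab] by (intro beq_step) auto
qed simp

section \<open>Reduced words of partitions\<close>

lemma par_word_0: "par_word k 0 = []"
  by (simp add: par_word_def nparts_def)

lemma par_word_rec:
  assumes \<mu>: "\<mu> \<in> Par k" and n: "n = nparts \<mu>" "1 \<le> n"
  shows "par_word k \<mu> = nat ((Poly_Mapping.lookup \<mu> n - int n) mod (int k + 1)) #
    par_word k (\<mu> - Poly_Mapping.single n 1)"
proof -
  define \<nu> where "\<nu> = \<mu> - Poly_Mapping.single n 1"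
  define F where "F \<mu> r = map (\<lambda>c. nat ((c - int r) mod (int k + 1))) (rev [1..Poly_Mapping.lookup \<mu> r])" for \<mu> :: zvec and r
  have \<mu>n: "\<mu> \<in> Par_len k n" using Par_nparts[OF \<mu>] n by simp
  have kmu: "Poly_Mapping.keys \<mu> = {1..n}" using keys_Par(1)[OF \<mu>n] n by simp
  have pos: "1 \<le> Poly_Mapping.lookup \<mu> n"
  proof -
    have "n \<in> Poly_Mapping.keys \<mu>" using kmu n by simp
    then show ?thesis using Par_lenD(1)[OF \<mu>n, of n] by (simp add: in_keys_iff)
  qed
  have lk: "Poly_Mapping.lookup \<nu> i = Poly_Mapping.lookup \<mu> i - (if i = n then 1 else 0)" for i
    by (simp add: \<nu>_def lookup_minus lookup_single when_def)
  have rows: "rev [1..<n + 1] = n # rev [1..<n]" using n by simp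
  have Feq: "concat (map (F \<nu>) (rev [1..<n])) = concat (map (F \<mu>) (rev [1..<n]))"
    by (rule arg_cong[of _ _ concat], rule map_cong) (auto simp: F_def lk)
  have up: "[1..Poly_Mapping.lookup \<mu> n] = [1..Poly_Mapping.lookup \<mu> n - 1] @ [Poly_Mapping.lookup \<mu> n]"
    using pos by (rule upto_rec2)
  have "par_word k \<mu> = concat (map (F \<mu>) (rev [1..<n + 1]))"
    by (simp add: par_word_def F_def[abs_def] n)
  also have "\<dots> = F \<mu> n @ concat (map (F \<mu>) (rev [1..<n]))" unfolding rows by simp
  also have "F \<mu> n = nat ((Poly_Mapping.lookup \<mu> n - int n) mod (int k + 1)) # F \<nu> n"
    unfolding F_def up lk by simp
  also have "(nat ((Poly_Mapping.lookup \<mu> n - int n) mod (int k + 1)) # F \<nu> n) @ concat (map (F \<mu>) (rev [1..<n])) =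
      nat ((Poly_Mapping.lookup \<mu> n - int n) mod (int k + 1)) # concat (map (F \<nu>) (rev [1..<n + 1]))"
    unfolding rows Feq[symmetric] by simp
  also have "concat (map (F \<nu>) (rev [1..<n + 1])) = par_word k \<nu>"
  proof (cases "Poly_Mapping.lookup \<mu> n = 1")
    case False
    then have "i \<in> Poly_Mapping.keys \<nu> \<longleftrightarrow> i \<in> Poly_Mapping.keys \<mu>" for i
      using pos by (cases "i = n") (simp_all add: in_keys_iff lk)
    then have "Poly_Mapping.keys \<nu> = Poly_Mapping.keys \<mu>" by blast
    then have "nparts \<nu> = n" using n by (simp add: nparts_def)
    then show ?thesis by (simp add: par_word_def F_def[abs_def])
  next
    case True
    have "i \<in> Poly_Mapping.keys \<nu> \<longleftrightarrow> i \<in> {1..n - 1}" for i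
    proof -
      have "i \<in> Poly_Mapping.keys \<nu> \<longleftrightarrow> i \<noteq> n \<and> i \<in> Poly_Mapping.keys \<mu>" using True by (simp add: in_keys_iff lk)
      then show ?thesis unfolding kmu using n by auto
    qed
    then have "Poly_Mapping.keys \<nu> = {1..n - 1}" by blast
    then have "nparts \<nu> = n - 1" by (simp add: nparts_def)
    moreover have "F \<nu> n = []" using True by (simp add: F_def lk)
    ultimately show ?thesis unfolding rows using n by (simp add: par_word_def F_def[abs_def])
  qed
  finally show ?thesis by (simp add: \<nu>_def)
qed

lemma par_word_last:
  assumes k: "1 \<le> k" and \<mu>: "\<mu> \<in> Par k" "\<mu> \<noteq> 0"
  obtains a \<nu> i where "a \<le> k" "\<nu> \<in> Par k" "\<mu> = \<nu> + Poly_Mapping.single i 1" "addable k (int a) \<nu> i"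
    "par_word k \<mu> = a # par_word k \<nu>" "0 < dh (hp k \<mu>) (int a)" "psz \<mu> = Suc (psz \<nu>)"
    "hp k \<nu> = hp k \<mu> \<circ> sg (k + 1) (int a)"
proof -
  define n where "n = nparts \<mu>"
  have n1: "1 \<le> n" using keys_Par(1)[OF Par_nparts[OF \<mu>(1)]] \<mu>(2) unfolding n_def by (metis atLeastatMost_empty_iff2 keys_eq_empty)
  define c where "c = Poly_Mapping.lookup \<mu> n - int n"
  define a where "a = nat (c mod (int k + 1))"
  define \<nu> where "\<nu> = \<mu> - Poly_Mapping.single n 1"
  have ai: "int a = c mod (int k + 1)" unfolding a_def by simp
  have ak: "a \<le> k"
  proof -
    have "c mod (int k + 1) < int k + 1" by (rule pos_mod_bound) simp
    then show ?thesis using ai by linarith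
  qed
  have "int (k + 1) dvd int a - c"
  proof -
    have "int (k + 1) = int k + 1" by simp
    then have "int (k + 1) dvd c - c mod (int k + 1)" by (simp only: dvd_minus_mod)
    then show ?thesis unfolding ai by (metis dvd_minus_iff minus_diff_eq)
  qed
  moreover have \<nu>: "\<nu> \<in> Par k" "addable k c \<nu> n"
    using addable_last_box[OF k \<mu>(1) n_def n1] by (simp_all add: \<nu>_def c_def)
  ultimately have add: "addable k (int a) \<nu> n" using addable_cong by blast
  have m: "\<mu> = \<nu> + Poly_Mapping.single n 1" by (simp add: \<nu>_def)
  have inv: "hp k \<nu> = hp k \<mu> \<circ> sg (k + 1) (int a)"
    using addableD(2)[OF k \<nu>(1) add] m sg_invol[of "k + 1" "int a"] k by (auto simp: fun_eq_iff)
  show ?thesis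
  proof (rule that[OF ak \<nu>(1) m add _ _ _ inv])
    show "par_word k \<mu> = a # par_word k \<nu>"
      using par_word_rec[OF \<mu>(1) n_def n1] unfolding a_def c_def \<nu>_def .
    show "0 < dh (hp k \<mu>) (int a)" using addable_dh'[OF k \<nu>(1) add] unfolding m[symmetric] .
    show "psz \<mu> = Suc (psz \<nu>)" using psz_add_single[OF \<nu>(1), of n] unfolding m[symmetric] .
  qed
qed

text \<open>The inductive step of the only instance of Matsumoto's theorem that is needed, \<open>reduced_word\<close>.\<close>

lemma beq_par_word:
  assumes k: "1 \<le> k"
  shows "\<mu> \<in> Par k \<Longrightarrow> a \<le> k \<Longrightarrow> addable k (int a) \<mu> i \<Longrightarrow>
    beq k (a # par_word k \<mu>) (par_word k (\<mu> + Poly_Mapping.single i 1))"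
proof (induction "psz \<mu>" arbitrary: \<mu> a i rule: less_induct)
  case less
  let ?K = "k + 1"
  define \<nu> where "\<nu> = \<mu> + Poly_Mapping.single i 1"
  have \<nu>: "\<nu> \<in> Par k" unfolding \<nu>_def by (rule addableD(1)[OF k less.prems(1,3)])
  have s\<nu>: "psz \<nu> = Suc (psz \<mu>)" unfolding \<nu>_def by (rule psz_add_single[OF less.prems(1)])
  then have "\<nu> \<noteq> 0" by (auto simp: psz_def)
  then obtain b \<nu>' j where b: "b \<le> k" "\<nu>' \<in> Par k" "\<nu> = \<nu>' + Poly_Mapping.single j 1" "addable k (int b) \<nu>' j"
    "par_word k \<nu> = b # par_word k \<nu>'" "0 < dh (hp k \<nu>) (int b)" "psz \<nu> = Suc (psz \<nu>')"
    "hp k \<nu>' = hp k \<nu> \<circ> sg ?K (int b)"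
    using par_word_last[OF k \<nu>] by blast
  have da: "0 < dh (hp k \<nu>) (int a)" unfolding \<nu>_def by (rule addable_dh'[OF k less.prems(1,3)])
  have H\<mu>: "hp k \<mu> = hp k \<nu> \<circ> sg ?K (int a)"
    unfolding \<nu>_def addableD(2)[OF k less.prems(1,3)] using sg_invol[of ?K "int a"] k by (auto simp: fun_eq_iff)
  have K2: "2 \<le> ?K" using k by simp
  note q\<nu> = qp_hp[OF k \<nu>] and q\<mu> = qp_hp[OF k less.prems(1)] and q\<nu>' = qp_hp[OF k b(2)]
  have IH: "beq k (c # par_word k \<kappa>) (par_word k \<rho>)"
    if "\<kappa> \<in> Par k" "\<rho> = \<kappa> + Poly_Mapping.single m 1" "addable k (int c) \<kappa> m" "psz \<kappa> < psz \<mu>" "c \<le> k" for c \<kappa> \<rho> m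
    using less.hyps[OF that(4,1,5,3)] that(2) by simp
  show ?case unfolding \<nu>_def[symmetric]
  proof (cases "a = b")
    case True
    have "hp k \<mu> = hp k \<nu>'" using H\<mu> b(8) True by simp
    then have "\<mu> = \<nu>'" using hp_inj[OF k less.prems(1) b(2)] by simp
    then show "beq k (a # par_word k \<mu>) (par_word k \<nu>)" using b(5) True by simp
  next
    case False
    have nd: "\<not> int ?K dvd int b - int a" "\<not> int ?K dvd int a - int b"
      using letters_nbr(1)[OF less.prems(2) b(1)] letters_nbr(1)[OF b(1) less.prems(2)] False by auto
    have sym: "nbr ?K (int b) (int a) \<longleftrightarrow> nbr ?K (int a) (int b)" by (auto simp: nbr_def)
    show "beq k (a # par_word k \<mu>) (par_word k \<nu>)"
    proof (cases "nbr ?K (int a) (int b)")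
      \<comment> \<open>The residues commute: the two boxes can be removed in either order, and by
        \<open>hp_inj\<close> both orders lead to the same \<kappa>.\<close>
      case far: False
      have "dh (hp k \<nu>') (int a) = dh (hp k \<nu>) (int a)"
        unfolding b(8) using nd far sym by (intro dh_sg_far) auto
      then obtain m \<kappa> where 1: "\<kappa> \<in> Par k" "\<nu>' = \<kappa> + Poly_Mapping.single m 1" "addable k (int a) \<kappa> m"
        "hp k \<kappa> = hp k \<nu>' \<circ> sg ?K (int a)" "psz \<nu>' = Suc (psz \<kappa>)"
        using remove_box[OF k b(2), of "int a"] da by metis
      have "dh (hp k \<mu>) (int b) = dh (hp k \<nu>) (int b)"
        unfolding H\<mu> using nd far by (intro dh_sg_far) auto
      then obtain m' \<kappa>' where 2: "\<kappa>' \<in> Par k" "\<mu> = \<kappa>' + Poly_Mapping.single m' 1" "addable k (int b) \<kappa>' m'"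
        "hp k \<kappa>' = hp k \<mu> \<circ> sg ?K (int b)" "psz \<mu> = Suc (psz \<kappa>')"
        using remove_box[OF k less.prems(1), of "int b"] b(6) by metis
      have "sg ?K (int a) \<circ> sg ?K (int b) = sg ?K (int b) \<circ> sg ?K (int a)"
        by (rule sg_commute_far[OF K2 nd(2) far])
      then have "hp k \<kappa> = hp k \<kappa>'" unfolding 1(4) 2(4) b(8) H\<mu> by (simp only: comp_assoc)
      then have \<kappa>: "\<kappa>' = \<kappa>" using hp_inj[OF k 1(1) 2(1)] by simp
      have i2: "beq k (b # par_word k \<kappa>) (par_word k \<mu>)"
        using IH[OF 2(1,2,3) _ b(1)] 2(5) unfolding \<kappa> by simp
      have i1: "beq k (a # par_word k \<kappa>) (par_word k \<nu>')"
        using IH[OF 1(1,2,3) _ less.prems(2)] 2(5) unfolding \<kappa> by simp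
      have "beq k (a # par_word k \<mu>) (a # b # par_word k \<kappa>)"
        by (rule beq_Cons[OF beq_sym[OF i2]])
      also have "beq k (a # b # par_word k \<kappa>) (b # a # par_word k \<kappa>)"
        using beq_swap2[OF less.prems(2) b(1) far, of "par_word k \<kappa>"] by simp
      also have "beq k (b # a # par_word k \<kappa>) (b # par_word k \<nu>')"
        by (rule beq_Cons[OF i1])
      finally show ?thesis using b(5) by simp
    next
      \<comment> \<open>Both a and b are removable from \<nu>, hence so are the three boxes b, a, b
        and the three boxes a, b, a in succession. The braid relation for \<open>sgw\<close> and
        \<open>hp_inj\<close> show that both descents end at the same \<kappa>.\<close>
      case near: True
      have k2: "2 \<le> k"
      proof (rule ccontr)
        assume "\<not> 2 \<le> k"
        then have "?K = 2" using k by simp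
        then have "dh (hp k \<nu>) (int b) = - 1 - dh (hp k \<nu>) (int a)"
          using dh_two q\<nu> near by metis
        then show False using da b(6) by simp
      qed
      then have K3: "3 \<le> ?K" by simp
      let ?da = "dh (hp k \<nu>) (int a)" and ?db = "dh (hp k \<nu>) (int b)"
      have near': "nbr ?K (int b) (int a)" using near sym by simp
      have "dh (hp k \<nu>') (int a) = ?da + ?db"
        unfolding b(8) by (rule dh_sg_nbr[OF K3 q\<nu> near'])
      moreover have e1: "dh (hp k \<nu>') (int b) = - ?db" unfolding b(8) by (rule dh_sg_self[OF K2])
      ultimately obtain m1 \<nu>2 where 1: "\<nu>2 \<in> Par k" "\<nu>' = \<nu>2 + Poly_Mapping.single m1 1" "addable k (int a) \<nu>2 m1"
        "hp k \<nu>2 = hp k \<nu>' \<circ> sg ?K (int a)" "psz \<nu>' = Suc (psz \<nu>2)"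
        using remove_box[OF k b(2), of "int a"] da b(6) by (metis add_pos_pos)
      have "dh (hp k \<nu>2) (int b) = ?da"
        unfolding 1(4) dh_sg_nbr[OF K3 q\<nu>' near] e1 \<open>dh (hp k \<nu>') (int a) = _\<close> by simp
      then obtain m2 \<kappa> where 2: "\<kappa> \<in> Par k" "\<nu>2 = \<kappa> + Poly_Mapping.single m2 1" "addable k (int b) \<kappa> m2"
        "hp k \<kappa> = hp k \<nu>2 \<circ> sg ?K (int b)" "psz \<nu>2 = Suc (psz \<kappa>)"
        using remove_box[OF k 1(1), of "int b"] da by metis
      have f1: "dh (hp k \<mu>) (int b) = ?db + ?da" unfolding H\<mu> by (rule dh_sg_nbr[OF K3 q\<nu> near])
      have f2: "dh (hp k \<mu>) (int a) = - ?da" unfolding H\<mu> by (rule dh_sg_self[OF K2])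
      obtain m3 \<mu>' where 3: "\<mu>' \<in> Par k" "\<mu> = \<mu>' + Poly_Mapping.single m3 1" "addable k (int b) \<mu>' m3"
        "hp k \<mu>' = hp k \<mu> \<circ> sg ?K (int b)" "psz \<mu> = Suc (psz \<mu>')"
        using remove_box[OF k less.prems(1), of "int b"] da b(6) f1 by (metis add_pos_pos)
      have "dh (hp k \<mu>') (int a) = ?db"
        unfolding 3(4) dh_sg_nbr[OF K3 q\<mu> near'] f1 f2 by simp
      then obtain m4 \<kappa>' where 4: "\<kappa>' \<in> Par k" "\<mu>' = \<kappa>' + Poly_Mapping.single m4 1" "addable k (int a) \<kappa>' m4"
        "hp k \<kappa>' = hp k \<mu>' \<circ> sg ?K (int a)" "psz \<mu>' = Suc (psz \<kappa>')"
        using remove_box[OF k 3(1), of "int a"] b(6) by metis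
      have "sgw ?K [a, b, a] = sgw ?K [b, a, b]"
        using weq_sgw[OF beq_weq[OF beq_braid3[OF k2 less.prems(2) b(1) near, of "[]"]] k] by simp
      then have "hp k \<kappa> = hp k \<kappa>'"
        unfolding 2(4) 1(4) b(8) 4(4) 3(4) H\<mu> by (simp add: comp_assoc)
      then have \<kappa>: "\<kappa>' = \<kappa>" using hp_inj[OF k 2(1) 4(1)] by simp
      have i3: "beq k (b # par_word k \<mu>') (par_word k \<mu>)"
        using IH[OF 3(1,2,3) _ b(1)] 3(5) by simp
      have i4: "beq k (a # par_word k \<kappa>) (par_word k \<mu>')"
        using IH[OF 4(1,2,3) _ less.prems(2)] 3(5) 4(5) unfolding \<kappa> by simp
      have i2: "beq k (b # par_word k \<kappa>) (par_word k \<nu>2)"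
        using IH[OF 2(1,2,3) _ b(1)] 3(5) 4(5) unfolding \<kappa> by simp
      have i1: "beq k (a # par_word k \<nu>2) (par_word k \<nu>')"
        using IH[OF 1(1,2,3) _ less.prems(2)] 1(5) b(7) s\<nu> by simp
      have "beq k (a # par_word k \<mu>) (a # b # par_word k \<mu>')"
        by (rule beq_Cons[OF beq_sym[OF i3]])
      also have "beq k (a # b # par_word k \<mu>') (a # b # a # par_word k \<kappa>)"
        by (rule beq_Cons[OF beq_Cons[OF beq_sym[OF i4]]])
      also have "beq k (a # b # a # par_word k \<kappa>) (b # a # b # par_word k \<kappa>)"
        using beq_braid3[OF k2 less.prems(2) b(1) near, of "par_word k \<kappa>"] by simp
      also have "beq k (b # a # b # par_word k \<kappa>) (b # a # par_word k \<nu>2)"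
        by (rule beq_Cons[OF beq_Cons[OF i2]])
      also have "beq k (b # a # par_word k \<nu>2) (b # par_word k \<nu>')"
        by (rule beq_Cons[OF i1])
      finally show ?thesis using b(5) by simp
    qed
  qed
qed

lemma par_word_letters:
  assumes k: "1 \<le> k" shows "\<mu> \<in> Par k \<Longrightarrow> set (par_word k \<mu>) \<subseteq> {..k} \<and> length (par_word k \<mu>) = psz \<mu>"
proof (induction "psz \<mu>" arbitrary: \<mu> rule: less_induct)
  case less
  show ?case
  proof (cases "\<mu> = 0")
    case True
    then show ?thesis by (simp add: par_word_0 psz_def)
  next
    case False
    then obtain a \<nu> i where "a \<le> k" "\<nu> \<in> Par k" "par_word k \<mu> = a # par_word k \<nu>" "psz \<mu> = Suc (psz \<nu>)"
      using par_word_last[OF k less.prems] by metis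
    then show ?thesis using less.hyps[of \<nu>] by auto
  qed
qed

lemma hp_par_word:
  assumes k: "1 \<le> k" shows "\<mu> \<in> Par k \<Longrightarrow> hp k \<mu> = hp k 0 \<circ> sgw (k + 1) (par_word k \<mu>)"
proof (induction "psz \<mu>" arbitrary: \<mu> rule: less_induct)
  case less
  show ?case
  proof (cases "\<mu> = 0")
    case True
    then show ?thesis by (simp add: par_word_0)
  next
    case False
    then obtain a \<nu> i where a: "a \<le> k" "\<nu> \<in> Par k" "par_word k \<mu> = a # par_word k \<nu>" "psz \<mu> = Suc (psz \<nu>)"
      "\<mu> = \<nu> + Poly_Mapping.single i 1" "addable k (int a) \<nu> i"
      using par_word_last[OF k less.prems] by metis
    have "hp k \<mu> = hp k \<nu> \<circ> sg (k + 1) (int a)" using addableD(2)[OF k a(2,6)] a(5) by simp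
    also have "hp k \<nu> = hp k 0 \<circ> sgw (k + 1) (par_word k \<nu>)" using less.hyps[of \<nu>] a by simp
    finally have e: "hp k \<mu> = hp k 0 \<circ> sgw (k + 1) (par_word k \<nu>) \<circ> sg (k + 1) (int a)" .
    show ?thesis unfolding a(3) sgw.simps e by (simp only: comp_assoc)
  qed
qed

lemma dh_0:
  assumes k: "1 \<le> k" and a: "a \<le> k"
  shows "dh (hp k 0) (int a) = (if a = 0 then -1 else 0)"
proof (cases "a = 0")
  case True
  have "(- 1::int) div (1 + int k) = - 1" using k by (intro div_eq_minus1) auto
  then show ?thesis using True k by (simp add: dh_def hp_0[OF k])
next
  case False
  have "(- int a - 1) div int (k + 1) = - 1" "(- (int a - 1) - 1) div int (k + 1) = - 1"
    using False a int_div_pos_eq[of "- int a - 1" "int (k + 1)" "-1" "int k - int a"]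
      int_div_pos_eq[of "- int a" "int (k + 1)" "-1" "int (k + 1) - int a"] by auto
  then show ?thesis using False by (simp add: dh_def hp_0[OF k])
qed

text \<open>A neutral letter commutes with the first letter of the word, or forms a braid with it
  and the next removable box, and so moves to the right. At the empty partition the neutral letters
  are 1, ..., k, the generators of the finite group.\<close>

lemma tie_word:
  assumes k: "1 \<le> k"
  shows "\<mu> \<in> Par k \<Longrightarrow> a \<le> k \<Longrightarrow> dh (hp k \<mu>) (int a) = 0 \<Longrightarrow>
    \<exists>b\<in>{1..k}. weq k (a # par_word k \<mu>) (par_word k \<mu> @ [b])"
proof (induction "psz \<mu>" arbitrary: \<mu> a rule: less_induct)
  case less
  let ?K = "k + 1"
  show ?case
  proof (cases "\<mu> = 0")
    case True
    then have "a \<in> {1..k}" using less.prems dh_0[OF k less.prems(2)] by (auto split: if_splits)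
    then show ?thesis using True by (intro bexI[of _ a]) (simp_all add: par_word_0)
  next
    case False
    then obtain b \<nu> i where b: "b \<le> k" "\<nu> \<in> Par k" "\<mu> = \<nu> + Poly_Mapping.single i 1" "addable k (int b) \<nu> i"
      "par_word k \<mu> = b # par_word k \<nu>" "0 < dh (hp k \<mu>) (int b)" "psz \<mu> = Suc (psz \<nu>)"
      "hp k \<nu> = hp k \<mu> \<circ> sg ?K (int b)"
      using par_word_last[OF k less.prems(1)] by blast
    have K2: "2 \<le> ?K" using k by simp
    have ab: "a \<noteq> b" using b(6) less.prems(3) by auto
    have nd: "\<not> int ?K dvd int a - int b" using letters_nbr(1)[OF b(1) less.prems(2)] ab by auto
    have sym: "nbr ?K (int b) (int a) \<longleftrightarrow> nbr ?K (int a) (int b)" by (auto simp: nbr_def)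
    note q\<mu> = qp_hp[OF k less.prems(1)] and q\<nu> = qp_hp[OF k b(2)]
    show ?thesis
    proof (cases "nbr ?K (int a) (int b)")
      case far: False
      have "dh (hp k \<nu>) (int a) = dh (hp k \<mu>) (int a)"
        unfolding b(8) using nd far sym by (intro dh_sg_far) auto
      then obtain c where c: "c \<in> {1..k}" "weq k (a # par_word k \<nu>) (par_word k \<nu> @ [c])"
        using less.hyps[of \<nu> a] b less.prems by auto
      have "weq k (a # par_word k \<mu>) (b # a # par_word k \<nu>)"
        unfolding b(5) using beq_weq[OF beq_swap2[OF less.prems(2) b(1) far, of "par_word k \<nu>"]] by simp
      also have "weq k (b # a # par_word k \<nu>) (b # par_word k \<nu> @ [c])" using weq_Cons[OF c(2)] .
      finally show ?thesis using c(1) b(5) by (intro bexI[of _ c]) simp_all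
    next
      case near: True
      have k2: "2 \<le> k"
      proof (rule ccontr)
        assume "\<not> 2 \<le> k"
        then have "?K = 2" using k by simp
        then have "dh (hp k \<mu>) (int b) = - 1 - dh (hp k \<mu>) (int a)"
          using dh_two q\<mu> near by metis
        then show False using less.prems(3) b(6) by simp
      qed
      then have K3: "3 \<le> ?K" by simp
      have near': "nbr ?K (int b) (int a)" using near sym by simp
      have d1: "dh (hp k \<nu>) (int a) = dh (hp k \<mu>) (int b)"
        unfolding b(8) using dh_sg_nbr[OF K3 q\<mu> near'] less.prems(3) by simp
      have d2: "dh (hp k \<nu>) (int b) = - dh (hp k \<mu>) (int b)" unfolding b(8) by (rule dh_sg_self[OF K2])
      obtain m \<kappa> where 1: "\<kappa> \<in> Par k" "\<nu> = \<kappa> + Poly_Mapping.single m 1" "addable k (int a) \<kappa> m"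
        "hp k \<kappa> = hp k \<nu> \<circ> sg ?K (int a)" "psz \<nu> = Suc (psz \<kappa>)"
        using remove_box[OF k b(2), of "int a"] d1 b(6) by metis
      have "dh (hp k \<kappa>) (int b) = 0" unfolding 1(4) dh_sg_nbr[OF K3 q\<nu> near] d1 d2 by simp
      then obtain c where c: "c \<in> {1..k}" "weq k (b # par_word k \<kappa>) (par_word k \<kappa> @ [c])"
        using less.hyps[of \<kappa> b] b 1 by auto
      have e: "weq k (a # par_word k \<kappa>) (par_word k \<nu>)"
        using beq_weq[OF beq_par_word[OF k 1(1) less.prems(2) 1(3)]] 1(2) by simp
      have "weq k (a # par_word k \<mu>) (a # b # a # par_word k \<kappa>)"
        unfolding b(5) by (rule weq_Cons[OF weq_Cons[OF weq_sym[OF e]]])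
      also have "weq k (a # b # a # par_word k \<kappa>) (b # a # b # par_word k \<kappa>)"
        using beq_weq[OF beq_braid3[OF k2 less.prems(2) b(1) near, of "par_word k \<kappa>"]] by simp
      also have "weq k (b # a # b # par_word k \<kappa>) (b # a # par_word k \<kappa> @ [c])"
        using weq_Cons[OF weq_Cons[OF c(2)]] by simp
      also have "weq k (b # a # par_word k \<kappa> @ [c]) (b # par_word k \<nu> @ [c])"
        using weq_context[OF e, of "[b]" "[c]"] by simp
      finally show ?thesis using c(1) b(5) by (intro bexI[of _ c]) simp_all
    qed
  qed
qed

section \<open>Grassmannian elements and partitions\<close>

lemma letter_act:
  assumes k: "1 \<le> k" and \<mu>: "\<mu> \<in> Par k"
  shows "\<exists>\<nu>\<in>Par k. hp k \<nu> = hp k \<mu> \<circ> sg (k + 1) a \<and> psz \<nu> \<le> Suc (psz \<mu>)"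
proof -
  consider "dh (hp k \<mu>) a < 0" | "dh (hp k \<mu>) a = 0" | "0 < dh (hp k \<mu>) a" by linarith
  then show ?thesis
  proof cases
    case 1
    then obtain i where i: "addable k a \<mu> i" using add_box[OF k \<mu>] by blast
    show ?thesis
      by (intro bexI[of _ "\<mu> + Poly_Mapping.single i 1"])
        (simp_all only: addableD(1,2)[OF k \<mu> i] psz_add_single[OF \<mu>] order_refl simp_thms)
  next
    case 2
    then have "hp k \<mu> \<circ> sg (k + 1) a = hp k \<mu>" using k by (intro tie_sg qp_hp[OF k \<mu>]) auto
    then show ?thesis using \<mu> by (intro bexI[of _ \<mu>]) auto
  next
    case 3
    then obtain i \<nu> where "\<nu> \<in> Par k" "hp k \<nu> = hp k \<mu> \<circ> sg (k + 1) a" "psz \<mu> = Suc (psz \<nu>)"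
      using remove_box[OF k \<mu>] by metis
    then show ?thesis by (intro bexI[of _ \<nu>]) auto
  qed
qed

lemma word_act:
  assumes k: "1 \<le> k" and \<mu>: "\<mu> \<in> Par k"
  shows "\<exists>\<nu>\<in>Par k. hp k \<nu> = hp k \<mu> \<circ> sgw (k + 1) as \<and> psz \<nu> \<le> psz \<mu> + length as"
proof (induction as)
  case Nil
  show ?case using \<mu> by (intro bexI[of _ \<mu>]) auto
next
  case (Cons a as)
  then obtain \<nu> where 1: "\<nu> \<in> Par k" "hp k \<nu> = hp k \<mu> \<circ> sgw (k + 1) as" "psz \<nu> \<le> psz \<mu> + length as" by blast
  obtain \<rho> where 2: "\<rho> \<in> Par k" "hp k \<rho> = hp k \<nu> \<circ> sg (k + 1) (int a)" "psz \<rho> \<le> Suc (psz \<nu>)"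
    using letter_act[OF k 1(1)] by blast
  have "hp k \<rho> = hp k \<mu> \<circ> sgw (k + 1) (a # as)" unfolding 2(2) 1(2) sgw.simps by (simp only: comp_assoc)
  then show ?case using 1(3) 2(1,3) by (intro bexI[of _ \<rho>]) auto
qed

text \<open>A letter raises the size by at most one, and by \<open>hp_inj\<close> the partition
  reached is \<nu>.\<close>

lemma psz_le_length:
  assumes k: "1 \<le> k" and \<nu>: "\<nu> \<in> Par k" "hp k \<nu> = hp k 0 \<circ> sgw (k + 1) as"
  shows "psz \<nu> \<le> length as"
proof -
  obtain \<rho> where "\<rho> \<in> Par k" "hp k \<rho> = hp k 0 \<circ> sgw (k + 1) as" "psz \<rho> \<le> psz 0 + length as"
    using word_act[OF k zero_Par] by blast
  then show ?thesis using hp_inj[OF k \<nu>(1), of \<rho>] \<nu>(2) by (simp add: psz_def)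
qed

text \<open>Up to sign, the 0-Hecke generators act as Demazure operators: on height functions of partitions
  they add a box, kill the partition, or fix it.\<close>

definition dem1 :: "nat \<Rightarrow> int \<Rightarrow> (int \<Rightarrow> int) \<Rightarrow> (int \<Rightarrow> int) option" where
  "dem1 K a H = (if dh H a < 0 then Some (H \<circ> sg K a) else if 0 < dh H a then Some H else None)"

primrec demw :: "nat \<Rightarrow> nat list \<Rightarrow> (int \<Rightarrow> int) \<Rightarrow> (int \<Rightarrow> int) option" where
  "demw K [] H = Some H"
| "demw K (a # as) H = Option.bind (demw K as H) (dem1 K (int a))"

text \<open>If the length equals the size, every letter must add a box: a tie or a removal would
  waste a letter. Then \<open>beq_par_word\<close> rebuilds the word from the right, and the
  Demazure action agrees with the group action.\<close>

lemma reduced_word: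
  assumes k: "1 \<le> k"
  shows "set as \<subseteq> {..k} \<Longrightarrow> \<nu> \<in> Par k \<Longrightarrow> hp k \<nu> = hp k 0 \<circ> sgw (k + 1) as \<Longrightarrow> length as = psz \<nu> \<Longrightarrow>
    beq k as (par_word k \<nu>) \<and> demw (k + 1) as (hp k 0) = Some (hp k \<nu>)"
proof (induction as arbitrary: \<nu>)
  case Nil
  then have "\<nu> = 0" using psz_0_iff[of \<nu> k] by simp
  then show ?case by (simp add: par_word_0)
next
  case (Cons a as)
  obtain \<kappa> where \<kappa>: "\<kappa> \<in> Par k" "hp k \<kappa> = hp k 0 \<circ> sgw (k + 1) as" "psz \<kappa> \<le> length as"
    using word_act[OF k zero_Par, of as] by (auto simp: psz_def)
  have h\<nu>: "hp k \<nu> = hp k \<kappa> \<circ> sg (k + 1) (int a)"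
    unfolding Cons.prems(3) \<kappa>(2) sgw.simps by (simp only: comp_assoc)
  have K2: "2 \<le> k + 1" using k by simp
  consider "dh (hp k \<kappa>) (int a) < 0" | "dh (hp k \<kappa>) (int a) = 0" | "0 < dh (hp k \<kappa>) (int a)" by linarith
  then show ?case
  proof cases
    case 1
    then obtain i where i: "addable k (int a) \<kappa> i" using add_box[OF k \<kappa>(1)] by blast
    have e: "\<nu> = \<kappa> + Poly_Mapping.single i 1"
      using addableD(1,2)[OF k \<kappa>(1) i] h\<nu> by (intro hp_inj[OF k Cons.prems(2)]) auto
    have "length as = psz \<kappa>" using psz_add_single[OF \<kappa>(1), of i] e Cons.prems(4) by simp
    then have IH: "beq k as (par_word k \<kappa>)" "demw (k + 1) as (hp k 0) = Some (hp k \<kappa>)"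
      using Cons.IH[OF _ \<kappa>(1,2)] Cons.prems(1) by simp_all
    have "beq k (a # as) (a # par_word k \<kappa>)" by (rule beq_Cons[OF IH(1)])
    also have "beq k (a # par_word k \<kappa>) (par_word k \<nu>)"
      unfolding e using Cons.prems(1) by (intro beq_par_word[OF k \<kappa>(1) _ i]) simp
    finally have "beq k (a # as) (par_word k \<nu>)" .
    moreover have "demw (k + 1) (a # as) (hp k 0) = Some (hp k \<nu>)"
      unfolding demw.simps IH(2) Option.bind.simps dem1_def h\<nu> using 1 by simp
    ultimately show ?thesis by simp
  next
    case 2
    then have "hp k \<nu> = hp k \<kappa>" unfolding h\<nu> by (rule tie_sg[OF K2 qp_hp[OF k \<kappa>(1)]])
    then have "\<nu> = \<kappa>" by (rule hp_inj[OF k Cons.prems(2) \<kappa>(1)])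
    then show ?thesis using \<kappa>(3) Cons.prems(4) by simp
  next
    case 3
    then obtain i \<rho> where "\<rho> \<in> Par k" "hp k \<rho> = hp k \<kappa> \<circ> sg (k + 1) (int a)" "psz \<kappa> = Suc (psz \<rho>)"
      using remove_box[OF k \<kappa>(1)] by metis
    then have "\<nu> = \<rho>" "psz \<kappa> = Suc (psz \<rho>)" using hp_inj[OF k Cons.prems(2), of \<rho>] h\<nu> by auto
    then show ?thesis using \<kappa>(3) Cons.prems(4) by simp
  qed
qed

section \<open>Lengths and minimal coset representatives\<close>

lemma aff_length_attained: "\<exists>c\<in>word_class k a. length c = aff_length (word_class k a)"
proof -
  have "\<exists>n. \<exists>c\<in>word_class k a. length c = n"
    by (intro exI[of _ "length a"] bexI[of _ a] refl) (unfold mem_word_class, rule weq_refl)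
  then show ?thesis unfolding aff_length_def by (rule LeastI_ex)
qed

lemma aff_length_le: "c \<in> word_class k a \<Longrightarrow> aff_length (word_class k a) \<le> length c"
  unfolding aff_length_def by (rule Least_le) auto

lemma aff_length_par_elt:
  assumes k: "1 \<le> k" and \<mu>: "\<mu> \<in> Par k" shows "aff_length (par_elt k \<mu>) = psz \<mu>"
proof (rule antisym)
  show "aff_length (par_elt k \<mu>) \<le> psz \<mu>"
    using aff_length_le[of "par_word k \<mu>" k "par_word k \<mu>"] par_word_letters[OF k \<mu>]
    by (simp add: par_elt_def mem_word_class)
  obtain c where c: "weq k (par_word k \<mu>) c" "length c = aff_length (par_elt k \<mu>)"
    using aff_length_attained[of k "par_word k \<mu>"] by (auto simp: par_elt_def mem_word_class)
  have "hp k \<mu> = hp k 0 \<circ> sgw (k + 1) c" using hp_par_word[OF k \<mu>] weq_sgw[OF c(1) k] by simp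
  then show "psz \<mu> \<le> aff_length (par_elt k \<mu>)" using psz_le_length[OF k \<mu>, of c] c(2) by simp
qed

lemma hp_0_fixed:
  assumes k: "1 \<le> k" shows "set b \<subseteq> {1..k} \<Longrightarrow> hp k 0 \<circ> sgw (k + 1) b = hp k 0"
proof (induction b rule: rev_induct)
  case (snoc x b)
  have "hp k 0 \<circ> sg (k + 1) (int x) = hp k 0"
    using dh_0[OF k, of x] snoc.prems k by (intro tie_sg qp_hp[OF k zero_Par]) auto
  then have "hp k 0 \<circ> sgw (k + 1) [x] = hp k 0" by simp
  then show ?case using snoc unfolding sgw_append by (metis comp_assoc le_sup_iff set_append)
qed simp

text \<open>The letters 1, ..., k fix \<open>hp k 0\<close>, so every word for an element of the
  coset sends it to \<open>hp k \<mu>\<close> and has length at least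
  \<open>psz \<mu>\<close>.\<close>

lemma par_elt_grass:
  assumes k: "1 \<le> k" and \<mu>: "\<mu> \<in> Par k" shows "par_elt k \<mu> \<in> aff_grass k"
  unfolding aff_grass_def
proof (intro CollectI conjI ballI)
  show "par_elt k \<mu> \<in> aff_sym k"
    unfolding aff_sym_def par_elt_def using par_word_letters[OF k \<mu>] by (intro imageI) auto
  fix v assume "v \<in> fin_coset k (par_elt k \<mu>)"
  then obtain a b where v: "v = word_class k (a @ b)" "weq k (par_word k \<mu>) a" "set b \<subseteq> {1..k}"
    by (auto simp: fin_coset_def par_elt_def mem_word_class in_lists_conv_set subset_iff)
  obtain c where c: "weq k (a @ b) c" "length c = aff_length v"
    using aff_length_attained[of k "a @ b"] v(1) by (auto simp: mem_word_class)
  have "hp k 0 \<circ> sgw (k + 1) c = hp k 0 \<circ> sgw (k + 1) b \<circ> sgw (k + 1) a"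
    unfolding weq_sgw[OF c(1) k, symmetric] sgw_append by (simp only: comp_assoc)
  also have "\<dots> = hp k \<mu>"
    unfolding hp_0_fixed[OF k v(3)] hp_par_word[OF k \<mu>] weq_sgw[OF v(2) k] by simp
  finally have "psz \<mu> \<le> length c" using psz_le_length[OF k \<mu>, of c] by simp
  then show "aff_length (par_elt k \<mu>) \<le> aff_length v" using c(2) aff_length_par_elt[OF k \<mu>] by simp
qed

lemma weq_cancel: "set v \<subseteq> {..k} \<Longrightarrow> weq k (v @ rev v) []"
proof (induction v)
  case (Cons x v)
  have "weq k ([x] @ (v @ rev v) @ [x]) ([x] @ [] @ [x])" using Cons by (intro weq_context) simp
  also have "weq k ([x] @ [] @ [x]) []"
    using cox_step.square[of x k "[]" "[]"] Cons.prems by (intro weq_step) simp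
  finally show ?case by simp
qed simp

text \<open>Reading from the right, a letter adds a box, cancels one, or passes through by
  \<open>tie_word\<close> and joins the finite part.\<close>

lemma word_normal_form:
  assumes k: "1 \<le> k"
  shows "set as \<subseteq> {..k} \<Longrightarrow> \<exists>\<nu>\<in>Par k. \<exists>v. set v \<subseteq> {1..k} \<and> weq k as (par_word k \<nu> @ v)"
proof (induction as)
  case Nil
  show ?case by (intro bexI[of _ 0] exI[of _ "[]"]) (simp_all add: par_word_0 zero_Par)
next
  case (Cons a as)
  then obtain \<nu> v where 1: "\<nu> \<in> Par k" "set v \<subseteq> {1..k}" "weq k as (par_word k \<nu> @ v)" by auto
  have a: "a \<le> k" using Cons.prems by simp
  have w: "weq k (a # as) ((a # par_word k \<nu>) @ v)" using weq_Cons[OF 1(3)] by simp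
  have ctx: "weq k (x @ v) (y @ v)" if "weq k x y" for x y using weq_context[OF that, of "[]" v] by simp
  consider "dh (hp k \<nu>) (int a) < 0" | "dh (hp k \<nu>) (int a) = 0" | "0 < dh (hp k \<nu>) (int a)" by linarith
  then show ?case
  proof cases
    case 1
    then obtain i where i: "addable k (int a) \<nu> i" using add_box[OF k \<open>\<nu> \<in> Par k\<close>] by blast
    have "weq k (a # par_word k \<nu>) (par_word k (\<nu> + Poly_Mapping.single i 1))"
      by (rule beq_weq[OF beq_par_word[OF k \<open>\<nu> \<in> Par k\<close> a i]])
    then have "weq k (a # as) (par_word k (\<nu> + Poly_Mapping.single i 1) @ v)" using w ctx weq_trans by blast
    then show ?thesis using addableD(1)[OF k \<open>\<nu> \<in> Par k\<close> i] \<open>set v \<subseteq> {1..k}\<close> by blast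
  next
    case 2
    then obtain b where b: "b \<in> {1..k}" "weq k (a # par_word k \<nu>) (par_word k \<nu> @ [b])"
      using tie_word[OF k \<open>\<nu> \<in> Par k\<close> a] by blast
    have "weq k (a # as) ((par_word k \<nu> @ [b]) @ v)" using w ctx[OF b(2)] weq_trans by blast
    then have "weq k (a # as) (par_word k \<nu> @ (b # v))" by simp
    moreover have "set (b # v) \<subseteq> {1..k}" using b(1) \<open>set v \<subseteq> {1..k}\<close> by simp
    ultimately show ?thesis using \<open>\<nu> \<in> Par k\<close> by blast
  next
    case 3
    then obtain i \<rho> where \<rho>: "\<rho> \<in> Par k" "\<nu> = \<rho> + Poly_Mapping.single i 1" "addable k (int a) \<rho> i"
      using remove_box[OF k \<open>\<nu> \<in> Par k\<close>] by metis
    have "weq k (a # par_word k \<rho>) (par_word k \<nu>)"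
      using beq_weq[OF beq_par_word[OF k \<rho>(1) a \<rho>(3)]] \<rho>(2) by simp
    then have "weq k (a # par_word k \<nu>) (a # a # par_word k \<rho>)" by (intro weq_Cons) (rule weq_sym)
    also have "weq k (a # a # par_word k \<rho>) (par_word k \<rho>)"
      using cox_step.square[OF a, of "[]" "par_word k \<rho>"] by (intro weq_step) simp
    finally have "weq k (a # as) (par_word k \<rho> @ v)" using w ctx weq_trans by blast
    then show ?thesis using \<rho>(1) \<open>set v \<subseteq> {1..k}\<close> by blast
  qed
qed

text \<open>\<open>w\<close> lies in the coset of some \<open>par_elt k \<nu>\<close>. Minimality
  gives \<open>aff_length w \<le> psz \<nu>\<close>, and \<open>psz_le_length\<close> gives the
  converse. So a shortest word for \<open>w\<close> satisfies the hypotheses of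
  \<open>reduced_word\<close>.\<close>

lemma aff_grass_par_elt:
  assumes k: "1 \<le> k" and w: "w \<in> aff_grass k" shows "\<exists>\<nu>\<in>Par k. w = par_elt k \<nu>"
proof -
  obtain a0 where a0: "set a0 \<subseteq> {..k}" "w = word_class k a0"
    using w by (auto simp: aff_grass_def aff_sym_def)
  obtain \<nu> v where \<nu>: "\<nu> \<in> Par k" "set v \<subseteq> {1..k}" "weq k a0 (par_word k \<nu> @ v)"
    using word_normal_form[OF k a0(1)] by blast
  have "weq k (a0 @ rev v) (par_word k \<nu> @ v @ rev v)" using weq_context[OF \<nu>(3), of "[]" "rev v"] by simp
  also have "weq k (par_word k \<nu> @ v @ rev v) (par_word k \<nu>)"
    using weq_context[OF weq_cancel, of v k "par_word k \<nu>" "[]"] \<nu>(2) by fastforce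
  finally have "par_elt k \<nu> = word_class k (a0 @ rev v)"
    unfolding par_elt_def word_class_eq_iff by (rule weq_sym)
  moreover have "word_class k (a0 @ rev v) \<in> fin_coset k w"
    unfolding fin_coset_def using a0(2) \<nu>(2)
    by (intro CollectI exI[of _ a0] exI[of _ "rev v"]) (auto simp: mem_word_class in_lists_conv_set subset_iff)
  ultimately have le: "aff_length w \<le> psz \<nu>"
    using w aff_length_par_elt[OF k \<nu>(1)] unfolding aff_grass_def by auto
  obtain c where c: "weq k a0 c" "length c = aff_length w"
    using aff_length_attained[of k a0] a0(2) by (auto simp: mem_word_class)
  have "hp k 0 \<circ> sgw (k + 1) c = hp k 0 \<circ> sgw (k + 1) v \<circ> sgw (k + 1) (par_word k \<nu>)"
    unfolding weq_sgw[OF c(1) k, symmetric] weq_sgw[OF \<nu>(3) k] sgw_append by (simp only: comp_assoc)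
  also have "\<dots> = hp k \<nu>" unfolding hp_0_fixed[OF k \<nu>(2)] using hp_par_word[OF k \<nu>(1)] by simp
  finally have hc: "hp k \<nu> = hp k 0 \<circ> sgw (k + 1) c" by simp
  have "length c = psz \<nu>" using psz_le_length[OF k \<nu>(1) hc] le c(2) by simp
  moreover have "set c \<subseteq> {..k}" using weq_letters[OF c(1)] a0(1) by simp
  ultimately have "beq k c (par_word k \<nu>)" using reduced_word[OF k _ \<nu>(1) hc] by blast
  then have "weq k a0 (par_word k \<nu>)" using c(1) beq_weq weq_trans by blast
  then have "w = par_elt k \<nu>" using a0(2) by (simp add: par_elt_def word_class_eq_iff)
  then show ?thesis using \<nu>(1) by blast
qed

lemma par_elt_inj:
  assumes k: "1 \<le> k" shows "inj_on (par_elt k) (Par k)"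
proof (rule inj_onI)
  fix \<mu> \<nu> assume 1: "\<mu> \<in> Par k" "\<nu> \<in> Par k" "par_elt k \<mu> = par_elt k \<nu>"
  then have "weq k (par_word k \<mu>) (par_word k \<nu>)" by (simp add: par_elt_def word_class_eq_iff)
  then have "hp k \<mu> = hp k \<nu>" using hp_par_word[OF k] 1 weq_sgw[OF _ k] by metis
  then show "\<mu> = \<nu>" by (rule hp_inj[OF k 1(1,2)])
qed

section \<open>Cyclically increasing words\<close>

definition cycw :: "nat \<Rightarrow> nat list \<Rightarrow> bool" where
  "cycw k as \<longleftrightarrow> distinct as \<and> sorted_wrt (\<lambda>x y. x \<noteq> (y + 1) mod (k + 1)) as \<and> set as \<subseteq> {..k}"

text \<open>The reflection crosses only the boundaries below the integers congruent to a. The blocks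
  of length K starting at the integers congruent to i are therefore preserved.\<close>

lemma sg_level:
  assumes K: "2 \<le> K" and a: "\<not> int K dvd a - i"
  shows "(sg K a x - i) div int K = (x - i) div int K"
proof -
  have *: "(y - 1 - i) div int K = (y - i) div int K" if "\<not> int K dvd y - i" for y
  proof -
    define z where "z = y - i"
    have m: "0 < z mod int K" "z mod int K < int K"
      using that K pos_mod_sign[of "int K" z] pos_mod_bound[of "int K" z]
      unfolding z_def dvd_eq_mod_eq_0 by linarith+
    have "z - 1 = int K * (z div int K) + (z mod int K - 1)" by simp
    then have "(z - 1) div int K = z div int K" by (rule int_div_pos_eq) (use m in linarith)+
    then show ?thesis by (simp add: z_def algebra_simps)
  qed
  consider "int K dvd x - a" | "int K dvd x + 1 - a" | "\<not> int K dvd x - a" "\<not> int K dvd x + 1 - a" by blast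
  then show ?thesis
  proof cases
    case 1
    have "x - i = (x - a) + (a - i)" by simp
    then have "\<not> int K dvd x - i" using a dvd_add_right_iff[OF 1, of "a - i"] by simp
    then show ?thesis using 1 *[of x] by (simp add: sg_down)
  next
    case 2
    have "x + 1 - i = (x + 1 - a) + (a - i)" by simp
    then have "\<not> int K dvd x + 1 - i" using a dvd_add_right_iff[OF 2, of "a - i"] by (simp only: simp_thms)
    then show ?thesis using 2 *[of "x + 1"] by (simp add: sg_up[OF K])
  qed (simp add: sg_fix)
qed

lemma sgw_level:
  assumes K: "2 \<le> K" shows "(\<And>a. a \<in> set as \<Longrightarrow> \<not> int K dvd int a - i) \<Longrightarrow>
    (sgw K as x - i) div int K = (x - i) div int K"
  by (induction as arbitrary: x) (simp_all add: sg_level[OF K])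

lemma sgw_surj:
  assumes K: "2 \<le> K" shows "\<exists>x. sgw K as x = y"
proof (induction as)
  case (Cons a as)
  then obtain x where "sgw K as x = y" by blast
  then show ?case using sg_invol[OF K, of "int a" x] by (intro exI[of _ "sg K (int a) x"]) simp
qed simp

text \<open>A word containing i exactly once moves some point across a boundary of residue i; a word
  without i preserves the blocks between these boundaries.\<close>

lemma distinct_support:
  assumes k: "1 \<le> k" and a: "distinct a" "set a \<subseteq> {..k}" and w: "weq k a b"
  shows "set a \<subseteq> set b"
proof
  fix i assume "i \<in> set a"
  then obtain u v where uv: "a = u @ i # v" by (meson split_list)
  have iu: "i \<notin> set u" "i \<notin> set v" using a(1) uv by auto
  have K: "2 \<le> k + 1" using k by simp
  have nd: "\<not> int (k + 1) dvd int x - int i" if "x \<noteq> i" "x \<le> k" for x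
    using letters_nbr(1)[of i k x] a(2) uv that by auto
  have b: "set b \<subseteq> {..k}" using weq_letters[OF w] a(2) by simp
  show "i \<in> set b"
  proof (rule ccontr)
    assume "i \<notin> set b"
    \<comment> \<open>The point that the prefix carries exactly to i, so that the letter i pushes it
      to i - 1.\<close>
    obtain x where x: "sgw (k + 1) u x = int i" using sgw_surj[OF K] by blast
    have lu: "(sgw (k + 1) u x - int i) div int (k + 1) = (x - int i) div int (k + 1)"
    proof (rule sgw_level[OF K])
      fix c assume "c \<in> set u"
      then have "c \<noteq> i" "c \<le> k" using iu a(2) uv by auto
      then show "\<not> int (k + 1) dvd int c - int i" by (rule nd)
    qed
    have "sgw (k + 1) a x = sgw (k + 1) v (int i - 1)"
      using x sg_down[of "k + 1" "int i" "int i"] by (simp add: uv sgw_append)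
    moreover have "(sgw (k + 1) v (int i - 1) - int i) div int (k + 1) = (int i - 1 - int i) div int (k + 1)"
    proof (rule sgw_level[OF K])
      fix c assume "c \<in> set v"
      then have "c \<noteq> i" "c \<le> k" using iu a(2) uv by auto
      then show "\<not> int (k + 1) dvd int c - int i" by (rule nd)
    qed
    moreover have "(sgw (k + 1) b x - int i) div int (k + 1) = (x - int i) div int (k + 1)"
    proof (rule sgw_level[OF K])
      fix c assume "c \<in> set b"
      then have "c \<noteq> i" "c \<le> k" using \<open>i \<notin> set b\<close> b by auto
      then show "\<not> int (k + 1) dvd int c - int i" by (rule nd)
    qed
    moreover have "(-1::int) div int (k + 1) = -1" using k by (intro div_eq_minus1) simp
    ultimately show False using lu x weq_sgw[OF w k] by simp
  qed
qed

lemma distinct_length: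
  assumes k: "1 \<le> k" and a: "distinct a" "set a \<subseteq> {..k}"
  shows "aff_length (word_class k a) = length a"
proof (rule antisym)
  show "aff_length (word_class k a) \<le> length a" by (rule aff_length_le) (simp add: mem_word_class)
  obtain c where c: "weq k a c" "length c = aff_length (word_class k a)"
    using aff_length_attained[of k a] by (auto simp: mem_word_class)
  have "length a = card (set a)" using a(1) by (simp add: distinct_card)
  also have "\<dots> \<le> card (set c)" using distinct_support[OF k a c(1)] by (intro card_mono) auto
  also have "\<dots> \<le> length c" by (rule card_length)
  finally show "length a \<le> aff_length (word_class k a)" using c(2) by simp
qed

lemma distinct_reduced:
  assumes k: "1 \<le> k" and a: "distinct a" "set a \<subseteq> {..k}" and b: "weq k a b" "length b = length a"
  shows "distinct b" "set b = set a"
proof -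
  have sub: "set a \<subseteq> set b" by (rule distinct_support[OF k a b(1)])
  have ca: "card (set a) = length b" using a(1) b(2) by (simp add: distinct_card)
  have "card (set a) \<le> card (set b)" using sub by (intro card_mono) auto
  moreover have "card (set b) \<le> length b" by (rule card_length)
  ultimately have cb: "card (set b) = length b" using ca by simp
  then show "distinct b" by (rule card_distinct)
  show "set b = set a" using card_subset_eq[OF _ sub] ca cb by simp
qed

text \<open>A word in which \<open>j = i + 1\<close> precedes \<open>i\<close> moves some point of \<open>[i + 1, i + K)\<close> below \<open>i\<close>;
  one in which \<open>i\<close> precedes \<open>j\<close> does not. So the order of \<open>i\<close> and \<open>j\<close> is visible in the group element.\<close>

lemma order_visible:
  assumes k: "2 \<le> k" and i: "i \<le> k" and j: "j = (i + 1) mod (k + 1)"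
    and a: "distinct a" "set a \<subseteq> {..k}" "a = u @ i # v @ j # w"
    and b: "distinct b" "set b \<subseteq> {..k}" "b = u' @ j # v' @ i # w'"
  shows "sgw (k + 1) a \<noteq> sgw (k + 1) b"
proof
  let ?K = "k + 1"
  assume eq: "sgw ?K a = sgw ?K b"
  have K: "2 \<le> ?K" using k by simp
  have jk: "j \<le> k" unfolding j by (simp add: less_Suc_eq_le[symmetric])
  have dj: "int ?K dvd int j - (int i + 1)" unfolding j using dvd_mod_letter[of k "i + 1"] by (simp add: algebra_simps)
  have ndi: "\<not> int ?K dvd int x - int i" if "x \<noteq> i" "x \<le> k" for x
    using letters_nbr(1)[of i k x] i that by auto
  have ndj: "\<not> int ?K dvd int x - (int i + 1)" if "x \<noteq> j" "x \<le> k" for x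
  proof -
    have "int x - int j = (int x - (int i + 1)) - (int j - (int i + 1))" by simp
    then have "int ?K dvd int x - (int i + 1) \<longleftrightarrow> int ?K dvd int x - int j" using dj by (simp only: dvd_diff_left_iff)
    then show ?thesis using letters_nbr(1)[of j k x] jk that by auto
  qed
  have levi: "(sgw ?K s x - int i) div int ?K = (x - int i) div int ?K"
    if s: "i \<notin> set s" "set s \<subseteq> {..k}" for s x
  proof (rule sgw_level[OF K])
    fix c assume "c \<in> set s"
    then have "c \<noteq> i" "c \<le> k" using s by auto
    then show "\<not> int ?K dvd int c - int i" by (rule ndi)
  qed
  have levj: "(sgw ?K s x - (int i + 1)) div int ?K = (x - (int i + 1)) div int ?K"
    if s: "j \<notin> set s" "set s \<subseteq> {..k}" for s x
  proof (rule sgw_level[OF K])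
    fix c assume "c \<in> set s"
    then have "c \<noteq> j" "c \<le> k" using s by auto
    then show "\<not> int ?K dvd int c - (int i + 1)" by (rule ndj)
  qed
  have d0: "0 \<le> z \<and> z < int ?K" if "z div int ?K = 0" for z using that k by (auto simp: zdiv_eq_0_iff)
  have dm: "z < 0" if "z div int ?K = - 1" for z using that pos_imp_zdiv_neg_iff[of "int ?K" z] by linarith
  have sgj: "sg ?K (int j) = sg ?K (int i + 1)" by (rule sg_cong[OF dj])
  have iv: "i \<notin> set u" "i \<notin> set v" "i \<notin> set w" "j \<notin> set u" "j \<notin> set v" "j \<notin> set w" "i \<noteq> j"
    "set u \<subseteq> {..k}" "set v \<subseteq> {..k}" "set w \<subseteq> {..k}"
    using a by auto
  have iv': "i \<notin> set u'" "i \<notin> set v'" "i \<notin> set w'" "j \<notin> set u'" "j \<notin> set v'" "j \<notin> set w'"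
    "set u' \<subseteq> {..k}" "set v' \<subseteq> {..k}" "set w' \<subseteq> {..k}"
    using b by auto
  \<comment> \<open>The point that meets the letter j of \<open>b\<close> at i + 1: it moves to i,
    stays there during v', and is then pushed below i.\<close>
  obtain x where x: "sgw ?K u' x = int i + 1" using sgw_surj[OF K] by blast
  have "(int i + 1 - int i) div int ?K = 0" using k by (simp add: zdiv_eq_0_iff)
  then have "(x - int i) div int ?K = 0" "(x - (int i + 1)) div int ?K = 0"
    using levi[OF iv'(1,7), of x] levj[OF iv'(4,7), of x] x by auto
  then have xr: "int i + 1 \<le> x" "x < int i + int ?K" using d0[of "x - int i"] d0[of "x - (int i + 1)"] by linarith+
  have m1: "(-1::int) div int ?K = -1" using k by (intro div_eq_minus1) simp
  \<comment> \<open>Without the letters i and j the boundaries below i and below i + 1 are both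
    respected, and i is the only integer between them.\<close>
  have fixv': "sgw ?K v' (int i) = int i"
  proof -
    have "(sgw ?K v' (int i) - int i) div int ?K = 0" using levi[OF iv'(2,8), of "int i"] by simp
    moreover have "(sgw ?K v' (int i) - (int i + 1)) div int ?K = -1" using levj[OF iv'(5,8), of "int i"] m1 by simp
    ultimately show ?thesis using d0 dm by (metis diff_ge_0_iff_ge diff_less_0_iff_less order_antisym zle_add1_eq_le)
  qed
  have "sgw ?K b x = sgw ?K w' (sg ?K (int i) (sgw ?K v' (sg ?K (int i + 1) (int i + 1))))"
    by (simp only: b(3) sgw_append sgw.simps comp_apply sgj x)
  also have "sg ?K (int i + 1) (int i + 1) = int i" using sg_down[of ?K "int i + 1" "int i + 1"] by simp
  also have "sg ?K (int i) (sgw ?K v' (int i)) = int i - 1" unfolding fixv' using sg_down[of ?K "int i" "int i"] by simp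
  finally have "(sgw ?K b x - int i) div int ?K = (int i - 1 - int i) div int ?K"
    using levi[OF iv'(3,9), of "int i - 1"] by simp
  also have "int i - 1 - int i = -1" by simp
  also note m1
  finally have B: "(sgw ?K b x - int i) div int ?K = -1" .
  define y where "y = sgw ?K u x"
  have "(y - (int i + 1)) div int ?K = 0"
    unfolding y_def levj[OF iv(4,8), of x] using xr by (auto simp: zdiv_eq_0_iff)
  then have yr: "int i + 1 \<le> y" using d0[of "y - (int i + 1)"] by linarith
  \<comment> \<open>In \<open>a\<close> the same point is still at i + 1 or above when the letter i
    comes, so it cannot fall below i; no later letter crosses that boundary.\<close>
  have "int i \<le> sg ?K (int i) y"
    using yr by (auto simp: sg_def)
  then have n0: "0 \<le> (sg ?K (int i) y - int i) div int ?K" by (intro pos_imp_zdiv_nonneg_iff[THEN iffD2]) auto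
  have "(sgw ?K a x - int i) div int ?K = (sgw ?K (v @ j # w) (sg ?K (int i) y) - int i) div int ?K"
    by (simp add: a(3) sgw_append y_def)
  also have "\<dots> = (sg ?K (int i) y - int i) div int ?K"
    by (rule levi) (use iv jk in auto)
  finally show False using B n0 eq by simp
qed

text \<open>The set of letters is forced by \<open>distinct_reduced\<close>, the relative order of
  cyclic neighbours by \<open>order_visible\<close>. So the choice of a reduced word hidden in
  \<open>T_elt\<close> is harmless for these elements.\<close>

lemma cycw_reduced:
  assumes k: "1 \<le> k" and a: "cycw k a" "length a \<le> k" and b: "weq k a b" "length b = length a"
  shows "cycw k b" "set b = set a"
proof -
  have a': "distinct a" "set a \<subseteq> {..k}" using a by (auto simp: cycw_def)
  note d = distinct_reduced[OF k a' b]
  show "set b = set a" by (rule d(2))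
  have "sorted_wrt (\<lambda>x y. x \<noteq> (y + 1) mod (k + 1)) b"
  proof (rule ccontr)
    assume "\<not> ?thesis"
    then obtain p q where pq: "p < q" "q < length b" "b ! p = (b ! q + 1) mod (k + 1)"
      by (auto simp: sorted_wrt_iff_nth_less)
    define i where "i = b ! q"
    define j where "j = b ! p"
    have j: "j = (i + 1) mod (k + 1)" using pq by (simp add: i_def j_def)
    have "b = take p b @ b ! p # drop (Suc p) b" using pq by (intro id_take_nth_drop) simp
    moreover have "drop (Suc p) b = take (q - Suc p) (drop (Suc p) b) @ b ! q # drop (Suc q) b"
      using id_take_nth_drop[of "q - Suc p" "drop (Suc p) b"] pq by simp
    ultimately have bs: "b = take p b @ j # take (q - Suc p) (drop (Suc p) b) @ i # drop (Suc q) b"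
      by (simp add: i_def j_def)
    have ij: "i \<in> set a" "j \<in> set a" "i \<noteq> j"
      using pq nth_mem[of q b] nth_mem[of p b] d(2) nth_eq_iff_index_eq[OF d(1), of p q]
      unfolding i_def j_def by auto
    have ik: "i \<le> k" using ij a' by auto
    have k2: "2 \<le> k"
    proof -
      have "card {i, j} \<le> card (set a)" using ij by (intro card_mono) auto
      then show ?thesis using ij a(2) a' by (simp add: distinct_card)
    qed
    obtain s where s: "s < length a" "a ! s = i" using ij(1) by (auto simp: in_set_conv_nth)
    obtain t where t: "t < length a" "a ! t = j" using ij(2) by (auto simp: in_set_conv_nth)
    have "\<not> t < s" using a(1) s t j unfolding cycw_def sorted_wrt_iff_nth_less by metis
    moreover have "s \<noteq> t" using s t ij by auto
    ultimately have st: "s < t" by simp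
    have "a = take s a @ a ! s # drop (Suc s) a" using s by (intro id_take_nth_drop) simp
    moreover have "drop (Suc s) a = take (t - Suc s) (drop (Suc s) a) @ a ! t # drop (Suc t) a"
      using id_take_nth_drop[of "t - Suc s" "drop (Suc s) a"] st t by simp
    ultimately have as: "a = take s a @ i # take (t - Suc s) (drop (Suc s) a) @ j # drop (Suc t) a"
      using s t by simp
    have "set b \<subseteq> {..k}" using d a' by simp
    then have "sgw (k + 1) a \<noteq> sgw (k + 1) b" using order_visible[OF k2 ik j a' as d(1) _ bs] by blast
    then show False using weq_sgw[OF b(1) k] by simp
  qed
  then show "cycw k b" using d a' by (simp add: cycw_def)
qed

text \<open>The first letter of \<open>a\<close> commutes with everything before it in
  \<open>b\<close>, because a cyclic neighbour there would violate the order in one of the two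
  words.\<close>

lemma cycw_beq:
  assumes "cycw k a" "cycw k b" "set a = set b" shows "beq k a b"
  using assms
proof (induction a arbitrary: b)
  case (Cons x a)
  then obtain u v where b: "b = u @ x # v" by (metis list.set_intros(1) split_list)
  have cb: "cycw k (u @ v)" using Cons.prems(2) unfolding b by (auto simp: cycw_def sorted_wrt_append)
  have ca: "cycw k a" using Cons.prems(1) by (auto simp: cycw_def)
  have xa: "x \<notin> set a" "x \<notin> set u" "x \<notin> set v" using Cons.prems b by (auto simp: cycw_def)
  then have "set a = set (u @ v)" using Cons.prems(3) b by auto
  then have IH: "beq k a (u @ v)" by (rule Cons.IH[OF ca cb])
  have "beq k (x # u @ v) (u @ x # v)"
  proof -
    have "beq k (x # s @ v) (s @ x # v)" if "set s \<subseteq> set u" for s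
      using that
    proof (induction s)
      case (Cons y s)
      have y: "y \<in> set u" using Cons.prems by simp
      then have "y \<in> set a" using \<open>set a = set (u @ v)\<close> by auto
      then have "x \<noteq> (y + 1) mod (k + 1)" using Cons.prems \<open>cycw k (x # a)\<close> by (auto simp: cycw_def)
      moreover have "y \<noteq> (x + 1) mod (k + 1)"
        using \<open>cycw k b\<close> y unfolding b by (auto simp: cycw_def sorted_wrt_append)
      moreover have "x \<le> k" "y \<le> k" using \<open>cycw k b\<close> y unfolding b by (auto simp: cycw_def)
      ultimately have "\<not> nbr (k + 1) (int x) (int y)" using letters_nbr(2) by blast
      then have "beq k (x # y # s @ v) (y # x # s @ v)"
        using beq_swap2[OF \<open>x \<le> k\<close> \<open>y \<le> k\<close>, of "s @ v"] by simp
      also have "beq k (y # x # s @ v) (y # s @ x # v)" using Cons by (intro beq_Cons) auto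
      finally show ?case by simp
    qed simp
    then show ?thesis by blast
  qed
  then show ?case using beq_Cons[OF IH, of x] b beq_trans by metis
qed simp

text \<open>Cut the circle of residues at a missing residue c and list the elements of
  \<open>A\<close> in the order c + 1, c + 2, and so on.\<close>

lemma cycw_ex:
  assumes A: "A \<subseteq> {..k}" "card A \<le> k" shows "\<exists>as. cycw k as \<and> set as = A"
proof -
  have "A \<noteq> {..k}" using A(2) by auto
  then obtain c where c: "c \<le> k" "c \<notin> A" using A(1) by auto
  define L where "L = map (\<lambda>s. (c + s) mod (k + 1)) [1..<k + 1]"
  have inj: "s = t" if "(c + s) mod (k + 1) = (c + t) mod (k + 1)" "s < k + 1" "t < k + 1" for s t
  proof -
    have "int (c + s) mod int (k + 1) = int (c + t) mod int (k + 1)" using that(1) by (metis of_nat_mod)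
    then have "int (k + 1) dvd int s - int t" by (simp add: mod_eq_dvd_iff)
    then show ?thesis using letters_nbr(1)[of t k s] that(2,3) by simp
  qed
  have dL: "distinct L" unfolding L_def distinct_map
  proof (intro conjI inj_onI)
    fix s t assume "s \<in> set [1..<k + 1]" "t \<in> set [1..<k + 1]" "(c + s) mod (k + 1) = (c + t) mod (k + 1)"
    then show "s = t" using inj[of s t] by (simp only: set_upt atLeastLessThan_iff simp_thms)
  qed simp
  have "sorted_wrt (\<lambda>x y. x \<noteq> (y + 1) mod (k + 1)) L"
    unfolding L_def sorted_wrt_map
  proof (rule sorted_wrt_mono_rel[of _ "(<)"])
    fix s t assume st: "s \<in> set [1..<k + 1]" "t \<in> set [1..<k + 1]" "s < t"
    have st': "1 \<le> s" "s < k + 1" "t < k + 1" using st by (simp_all only: set_upt atLeastLessThan_iff)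
    show "(c + s) mod (k + 1) \<noteq> ((c + t) mod (k + 1) + 1) mod (k + 1)"
    proof
      assume "(c + s) mod (k + 1) = ((c + t) mod (k + 1) + 1) mod (k + 1)"
      then have e: "(c + s) mod (k + 1) = (c + (t + 1)) mod (k + 1)" by (simp add: mod_simps)
      show False
      proof (cases "t = k")
        case True
        then have "(c + s) mod (k + 1) = (c + 0) mod (k + 1)" using e by (simp only: mod_add_self2 add_0_right)
        then show False using inj[of s 0] st' by simp
      next
        case False
        then show False using inj[OF e] st' st(3) by simp
      qed
    qed
  qed (simp only: sorted_wrt_upt)
  then have sL: "sorted_wrt (\<lambda>x y. x \<noteq> (y + 1) mod (k + 1)) (filter (\<lambda>x. x \<in> A) L)"
    by (rule sorted_wrt_filter)
  have "A \<subseteq> set L"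
  proof
    fix x assume x: "x \<in> A"
    then have xk: "x \<le> k" "x \<noteq> c" using A(1) c(2) by auto
    define s where "s = (x + (k + 1) - c) mod (k + 1)"
    have "(c + s) mod (k + 1) = (c + (x + (k + 1) - c)) mod (k + 1)" unfolding s_def by (simp add: mod_simps)
    also have "c + (x + (k + 1) - c) = x + (k + 1)" using c(1) by simp
    also have "(x + (k + 1)) mod (k + 1) = x" using xk(1) unfolding mod_add_self2 by (intro mod_less) simp
    finally have "(c + s) mod (k + 1) = x" .
    moreover have "s \<noteq> 0" using calculation xk c(1) by (intro notI) simp
    moreover have "s < k + 1" unfolding s_def by simp
    ultimately show "x \<in> set L" unfolding L_def set_map by (intro image_eqI[of _ _ s]) (simp_all only: set_upt atLeastLessThan_iff, simp)
  qed
  then have "set (filter (\<lambda>x. x \<in> A) L) = A" by auto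
  moreover have "cycw k (filter (\<lambda>x. x \<in> A) L)"
    unfolding cycw_def using dL sL A(1) by auto
  ultimately show ?thesis by blast
qed

section \<open>The 0-Hecke algebra\<close>

lemma demw_append: "demw K (u @ v) H = Option.bind (demw K v H) (demw K u)"
proof (induction u)
  case Nil
  show ?case by (cases "demw K v H") auto
next
  case (Cons a u)
  then show ?case by (cases "demw K v H") auto
qed

lemma qp_demw: "qp K H \<Longrightarrow> demw K as H = Some H' \<Longrightarrow> qp K H'"
proof (induction as arbitrary: H')
  case (Cons a as)
  then obtain H1 where "demw K as H = Some H1" "dem1 K (int a) H1 = Some H'" by (auto simp: bind_eq_Some_conv)
  then show ?case using Cons qp_sg[of K H1 "int a"] by (auto simp: dem1_def split: if_splits)
qed simp

lemma dem_square: "2 \<le> K \<Longrightarrow> Option.bind (dem1 K a H) (dem1 K a) = dem1 K a H"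
  by (auto simp: dem1_def dh_sg_self)

lemma dem_commute:
  assumes K: "2 \<le> K" and n: "\<not> int K dvd a - c" "\<not> nbr K a c"
  shows "Option.bind (dem1 K a H) (dem1 K c) = Option.bind (dem1 K c H) (dem1 K a)"
proof -
  have n': "\<not> int K dvd c - a" using n(1) dvd_minus_iff[of "int K" "a - c"] by simp
  have nb: "\<not> nbr K c a" using n(2) by (auto simp: nbr_def)
  have "dh (H \<circ> sg K a) c = dh H c" by (rule dh_sg_far[OF n' n(2)])
  moreover have "dh (H \<circ> sg K c) a = dh H a" by (rule dh_sg_far[OF n(1) nb])
  moreover have "H \<circ> sg K a \<circ> sg K c = H \<circ> sg K c \<circ> sg K a"
    unfolding comp_assoc sg_commute_far[OF K n] ..
  ultimately show ?thesis by (auto simp: dem1_def)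
qed

text \<open>On each side only H and the images of H under reflections occur, and their differences
  at a and c are those of H and their sum up to sign. The signs of \<open>dh H a\<close> and
  \<open>dh H c\<close> then decide everything, with the sum deciding in the mixed cases.\<close>

lemma dem_braid:
  assumes K: "3 \<le> K" and H: "qp K H" and n: "nbr K a c" and br: "sg K a \<circ> sg K c \<circ> sg K a = sg K c \<circ> sg K a \<circ> sg K c"
  shows "Option.bind (Option.bind (dem1 K a H) (dem1 K c)) (dem1 K a) =
    Option.bind (Option.bind (dem1 K c H) (dem1 K a)) (dem1 K c)"
proof -
  have K2: "2 \<le> K" using K by simp
  have n': "nbr K c a" using n by (auto simp: nbr_def)
  define A where "A = H \<circ> sg K a"
  define C where "C = H \<circ> sg K c"
  define AC where "AC = A \<circ> sg K c"
  define CA where "CA = C \<circ> sg K a"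
  define B where "B = AC \<circ> sg K a"
  have qA: "qp K A" and qC: "qp K C" unfolding A_def C_def by (rule qp_sg[OF H])+
  have B': "CA \<circ> sg K c = B" unfolding B_def AC_def CA_def A_def C_def using br by (metis comp_assoc)
  have dA: "dh A a = - dh H a" "dh A c = dh H c + dh H a"
    unfolding A_def using dh_sg_self[OF K2] dh_sg_nbr[OF K H n] by auto
  have dC: "dh C c = - dh H c" "dh C a = dh H a + dh H c"
    unfolding C_def using dh_sg_self[OF K2] dh_sg_nbr[OF K H n'] by auto
  have dAC: "dh AC a = dh H c" unfolding AC_def using dh_sg_nbr[OF K qA n'] dA by simp
  have dCA: "dh CA c = dh H a" unfolding CA_def using dh_sg_nbr[OF K qC n] dC by simp
  have D: "dem1 K a H = (if dh H a < 0 then Some A else if 0 < dh H a then Some H else None)"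
    "dem1 K c H = (if dh H c < 0 then Some C else if 0 < dh H c then Some H else None)"
    "dem1 K a C = (if dh H a + dh H c < 0 then Some CA else if 0 < dh H a + dh H c then Some C else None)"
    "dem1 K c A = (if dh H a + dh H c < 0 then Some AC else if 0 < dh H a + dh H c then Some A else None)"
    "dem1 K a A = (if 0 < dh H a then Some (A \<circ> sg K a) else if dh H a < 0 then Some A else None)"
    "dem1 K c C = (if 0 < dh H c then Some (C \<circ> sg K c) else if dh H c < 0 then Some C else None)"
    "dem1 K a AC = (if dh H c < 0 then Some B else if 0 < dh H c then Some AC else None)"
    "dem1 K c CA = (if dh H a < 0 then Some B else if 0 < dh H a then Some CA else None)"
    unfolding dem1_def dA dC dAC dCA B' by (simp_all add: A_def C_def AC_def CA_def B_def add.commute)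
  consider "dh H a < 0" | "dh H a = 0" | "0 < dh H a" by linarith
  then show ?thesis
  proof cases
    case 1
    note a = this
    consider "dh H c < 0" | "dh H c = 0" | "0 < dh H c" by linarith
    then show ?thesis by cases (use a in \<open>simp_all add: D\<close>)
  next
    case 2
    note a = this
    consider "dh H c < 0" | "dh H c = 0" | "0 < dh H c" by linarith
    then show ?thesis by cases (use a in \<open>simp_all add: D\<close>)
  next
    case 3
    note a = this
    consider "dh H c < 0" | "dh H c = 0" | "0 < dh H c" by linarith
    then show ?thesis by cases (use a in \<open>simp_all add: D\<close>)
  qed
qed

lemma demw_square:
  assumes "1 \<le> k" shows "demw (k + 1) (u @ [i, i] @ v) H = demw (k + 1) (u @ [i] @ v) H"
proof -
  have "demw (k + 1) [i, i] H' = demw (k + 1) [i] H'" for H' using dem_square[of "k + 1" "int i" H'] assms by simp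
  then show ?thesis unfolding demw_append by simp
qed

lemma demw_cox_step:
  assumes k: "1 \<le> k" and H: "qp (k + 1) H" and s: "cox_step k a b" "length a = length b"
  shows "demw (k + 1) a H = demw (k + 1) b H"
  using s(1)
proof cases
  case (square i u v)
  then show ?thesis using s(2) by simp
next
  case (braid i j u v)
  have "sg (k + 1) (int j) = sg (k + 1) (int i + 1)"
    unfolding braid(5) by (rule sg_cong) (use dvd_mod_letter[of k "i + 1"] in \<open>simp add: algebra_simps\<close>)
  moreover have "sg (k + 1) (int i) \<circ> sg (k + 1) (int i + 1) \<circ> sg (k + 1) (int i) =
      sg (k + 1) (int i + 1) \<circ> sg (k + 1) (int i) \<circ> sg (k + 1) (int i + 1)"
    using braid(3) by (intro sg_braid) simp
  ultimately have br: "sg (k + 1) (int i) \<circ> sg (k + 1) (int j) \<circ> sg (k + 1) (int i) =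
      sg (k + 1) (int j) \<circ> sg (k + 1) (int i) \<circ> sg (k + 1) (int j)" by simp
  have jk: "j \<le> k" unfolding braid(5) by (simp add: less_Suc_eq_le[symmetric])
  have n: "nbr (k + 1) (int i) (int j)" using letters_nbr(2)[OF braid(4) jk] braid(5) by simp
  have K3: "3 \<le> k + 1" using braid(3) by simp
  have *: "demw (k + 1) [i, j, i] H' = demw (k + 1) [j, i, j] H'" if "qp (k + 1) H'" for H'
    unfolding demw.simps Option.bind.simps by (rule dem_braid[OF K3 that n br])
  show ?thesis
  proof (cases "demw (k + 1) v H")
    case None
    then show ?thesis unfolding braid(1,2) demw_append by simp
  next
    case (Some H')
    then show ?thesis unfolding braid(1,2) demw_append[of _ u] demw_append[of _ _ v]
      using *[OF qp_demw[OF H Some]] by (simp only: Option.bind.simps)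
  qed
next
  case (commute i j u v)
  have n: "\<not> nbr (k + 1) (int i) (int j)" using letters_nbr(2)[OF commute(3,4)] commute by simp
  have d: "\<not> int (k + 1) dvd int i - int j" using letters_nbr(1)[OF commute(4,3)] commute by simp
  have K2: "2 \<le> k + 1" using k by simp
  have "demw (k + 1) [i, j] = demw (k + 1) [j, i]"
    unfolding fun_eq_iff demw.simps Option.bind.simps by (intro allI dem_commute[OF K2 d n, symmetric])
  then show ?thesis unfolding commute(1,2) demw_append by simp
qed

lemma demw_beq:
  assumes "beq k a b" "1 \<le> k" "qp (k + 1) H" shows "demw (k + 1) a H = demw (k + 1) b H"
  using assms(1)
proof (induction rule: beq_induct)
  case (fwd u v)
  then show ?case using demw_cox_step[OF assms(2,3) fwd(2)] by simp
next
  case (bwd u v)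
  then show ?case using demw_cox_step[OF assms(2,3) bwd(2)] by simp
qed simp

section \<open>Words modulo the Hecke ideal\<close>

definition Tw :: "nat list \<Rightarrow> (word \<Rightarrow>\<^sub>0 int)" where
  "Tw a = Poly_Mapping.single (Word a) 1"

lemma Tw_append: "Tw (a @ b) = Tw a * Tw b"
  by (simp add: Tw_def mult_single plus_word_def)

lemma Tw_Cons: "Tw (a # b) = Tw [a] * Tw b"
  using Tw_append[of "[a]" b] by simp

lemma Tw_Nil: "Tw [] = 1"
  by (simp add: Tw_def flip: zero_word_def)

lemma Tw_prod: "prod_list (map T_gen a) = Tw a"
proof (induction a)
  case (Cons x a)
  then show ?case unfolding Tw_Cons[of x a] by (simp add: T_gen_def Tw_def[of "[x]"])
qed (simp add: Tw_Nil)

lemma hecke_rels_cases: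
  assumes "x \<in> hecke_rels k"
  obtains (square) i where "i \<le> k" "x = Tw [i, i] + Tw [i]"
  | (braid) a b where "cox_step k a b" "length a = length b" "x = Tw a - Tw b"
proof -
  have T: "T_gen i = Tw [i]" for i by (simp add: T_gen_def Tw_def)
  have T2: "T_gen i * T_gen j = Tw [i, j]" for i j using Tw_append[of "[i]" "[j]"] by (simp add: T)
  have T3: "T_gen i * T_gen j * T_gen m = Tw [i, j, m]" for i j m unfolding T2 using Tw_append[of "[i, j]" "[m]"] by (simp add: T)
  from assms consider i where "i \<le> k" "x = Tw [i, i] + Tw [i]"
    | i j where "2 \<le> k" "i \<le> k" "j = (i + 1) mod (k + 1)" "x = Tw [i, j, i] - Tw [j, i, j]"
    | i j where "i \<le> k" "j \<le> k" "i \<noteq> j" "j \<noteq> (i + 1) mod (k + 1)" "i \<noteq> (j + 1) mod (k + 1)" "x = Tw [i, j] - Tw [j, i]"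
    unfolding hecke_rels_def T3 unfolding T2 unfolding T by blast
  then show ?thesis
  proof cases
    case 1 then show ?thesis by (rule square)
  next
    case (2 i j) then show ?thesis using cox_step.braid[OF 2(1,2,3), of "[]" "[]"] by (intro braid) auto
  next
    case (3 i j) then show ?thesis using cox_step.commute[OF 3(1-5), of "[]" "[]"] by (intro braid) auto
  qed
qed

lemma hecke_ideal_uminus: "x \<in> hecke_ideal k \<Longrightarrow> - x \<in> hecke_ideal k"
proof (induction rule: hecke_ideal.induct)
  case (gen x a b)
  then show ?case using hecke_ideal.gen[OF gen, of "- a" b] by simp
next
  case (add x y)
  then show ?case using hecke_ideal.add by fastforce
qed (simp add: hecke_ideal.zero)

lemma hecke_ideal_mult: "x \<in> hecke_ideal k \<Longrightarrow> c * x * d \<in> hecke_ideal k"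
proof (induction rule: hecke_ideal.induct)
  case (gen x a b)
  then show ?case using hecke_ideal.gen[OF gen, of "c * a" "b * d"] by (simp add: mult.assoc)
next
  case (add x y)
  then show ?case using hecke_ideal.add by (simp add: distrib_left distrib_right)
qed (simp add: hecke_ideal.zero)

lemma hecke_eq_refl: "hecke_eq k x x"
  by (simp add: hecke_eq_def hecke_ideal.zero)

lemma hecke_eq_sym: "hecke_eq k x y \<Longrightarrow> hecke_eq k y x"
  unfolding hecke_eq_def using hecke_ideal_uminus[of "x - y" k] by simp

lemma hecke_eq_trans [trans]: "hecke_eq k x y \<Longrightarrow> hecke_eq k y z \<Longrightarrow> hecke_eq k x z"
  unfolding hecke_eq_def using hecke_ideal.add[of "x - y" k "y - z"] by simp

lemma hecke_eq_uminus: "hecke_eq k x y \<Longrightarrow> hecke_eq k (- x) (- y)"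
  unfolding hecke_eq_def using hecke_ideal_uminus[of "x - y" k] by simp

lemma hecke_eq_mult:
  assumes "hecke_eq k x y" "hecke_eq k x' y'" shows "hecke_eq k (x * x') (y * y')"
proof -
  have "(x - y) * x' \<in> hecke_ideal k" using hecke_ideal_mult[of "x - y" k 1 x'] assms by (simp add: hecke_eq_def)
  moreover have "y * (x' - y') \<in> hecke_ideal k" using hecke_ideal_mult[of "x' - y'" k y 1] assms by (simp add: hecke_eq_def)
  ultimately have "(x - y) * x' + y * (x' - y') \<in> hecke_ideal k" by (rule hecke_ideal.add)
  then show ?thesis by (simp add: hecke_eq_def algebra_simps)
qed

lemma hecke_eq_square: "i \<le> k \<Longrightarrow> hecke_eq k (Tw (i # i # v)) (- Tw (i # v))"
proof -
  assume i: "i \<le> k"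
  have "T_gen i * T_gen i + T_gen i \<in> hecke_rels k" using i by (auto simp: hecke_rels_def)
  then have "1 * (T_gen i * T_gen i + T_gen i) * Tw v \<in> hecke_ideal k" by (rule hecke_ideal.gen)
  moreover have "1 * (T_gen i * T_gen i + T_gen i) * Tw v = Tw (i # i # v) - (- Tw (i # v))"
    unfolding Tw_Cons[of i "i # v"] Tw_Cons[of i v] by (simp add: T_gen_def Tw_def[of "[i]"] distrib_right mult.assoc)
  ultimately show ?thesis by (simp add: hecke_eq_def)
qed

lemma hecke_eq_cox_step:
  assumes "cox_step k a b" "length a = length b" shows "hecke_eq k (Tw a) (Tw b)"
  using assms(1)
proof cases
  case (square i u v)
  then show ?thesis using assms(2) by simp
next
  case (braid i j u v)
  have "T_gen i * T_gen j * T_gen i - T_gen j * T_gen i * T_gen j \<in> hecke_rels k"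
    using braid by (auto simp: hecke_rels_def)
  then have "Tw u * (T_gen i * T_gen j * T_gen i - T_gen j * T_gen i * T_gen j) * Tw v \<in> hecke_ideal k"
    by (rule hecke_ideal.gen)
  moreover have "Tw [i, j, i] = T_gen i * T_gen j * T_gen i" for i j
    by (simp add: T_gen_def Tw_def mult_single plus_word_def)
  ultimately show ?thesis unfolding hecke_eq_def braid(1,2) Tw_append by (simp add: algebra_simps)
next
  case (commute i j u v)
  have "T_gen i * T_gen j - T_gen j * T_gen i \<in> hecke_rels k"
    using commute by (auto simp: hecke_rels_def)
  then have "Tw u * (T_gen i * T_gen j - T_gen j * T_gen i) * Tw v \<in> hecke_ideal k"
    by (rule hecke_ideal.gen)
  moreover have "Tw [i, j] = T_gen i * T_gen j" for i j
    by (simp add: T_gen_def Tw_def mult_single plus_word_def)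
  ultimately show ?thesis unfolding hecke_eq_def commute(1,2) Tw_append by (simp add: algebra_simps)
qed

lemma hecke_eq_beq: "beq k a b \<Longrightarrow> hecke_eq k (Tw a) (Tw b)"
proof (induction rule: beq_induct)
  case (fwd u v)
  then show ?case using hecke_eq_cox_step hecke_eq_trans by blast
next
  case (bwd u v)
  then show ?case using hecke_eq_cox_step[OF bwd(2)] hecke_eq_trans hecke_eq_sym by metis
qed (rule hecke_eq_refl)

text \<open>A matrix coefficient of the 0-Hecke action in which T_i is minus the Demazure operator
  and \<open>None\<close> plays the role of 0. It detects basis elements without a proof that the
  T_w are linearly independent.\<close>

definition theta :: "nat \<Rightarrow> (int \<Rightarrow> int) \<Rightarrow> (int \<Rightarrow> int) \<Rightarrow> word \<Rightarrow> int" where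
  "theta k H H' w = (- 1) ^ length (letters w) * of_bool (demw (k + 1) (letters w) H = Some H')"

lemma lin_theta_Tw: "lin (theta k H H') (Tw a) = (- 1) ^ length a * of_bool (demw (k + 1) a H = Some H')"
  by (simp add: Tw_def lin_single theta_def)

lemma theta_ideal:
  assumes k: "1 \<le> k" and H: "qp (k + 1) H" and x: "x \<in> hecke_ideal k"
  shows "lin (theta k H H') x = 0"
  using x
proof (induction rule: hecke_ideal.induct)
  case (gen x a b)
  have word: "lin (theta k H H') (Tw u * x * Tw v) = 0" for u v
    using gen
  proof (cases rule: hecke_rels_cases)
    case (square i)
    \<comment> \<open>The two words act alike and their lengths differ by one, so the signs
      cancel.\<close>
    have "Tw u * x * Tw v = Tw (u @ [i, i] @ v) + Tw (u @ [i] @ v)"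
      unfolding square(2) Tw_append[of u] Tw_append[of _ v] by (simp add: algebra_simps)
    then show ?thesis by (simp only: lin_add lin_theta_Tw demw_square[OF k]) simp
  next
    case (braid p q)
    have "Tw u * x * Tw v = Tw (u @ p @ v) - Tw (u @ q @ v)"
      unfolding braid(3) Tw_append[of u] Tw_append[of _ v] by (simp add: algebra_simps)
    moreover have "demw (k + 1) (u @ p @ v) H = demw (k + 1) (u @ q @ v) H"
      by (rule demw_cox_step[OF k H cox_step_context[OF braid(1)]]) (simp add: braid(2))
    ultimately show ?thesis using braid(2) by (simp add: lin_diff lin_theta_Tw)
  qed
  have sgl: "Poly_Mapping.single w c = of_int c * Tw (letters w)" for w c
    using mult_single[of "0 :: word" c w 1] by (simp add: Tw_def flip: single_of_int)
  have scale: "lin (theta k H H') (of_int c * y) = c * lin (theta k H H') y" for c y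
  proof (induction y rule: pm_induct)
    case (single w d)
    show ?case by (simp add: mult_single lin_single flip: single_of_int)
  qed (simp_all add: lin_add distrib_left)
  have comm: "of_int c * y = y * of_int c" for c and y :: "word \<Rightarrow>\<^sub>0 int"
    by (rule mult_of_int_commute)
  show ?case
  proof (induction a rule: pm_induct)
    case (single w c)
    show ?case
    proof (induction b rule: pm_induct)
      case (single w' d)
      have "Poly_Mapping.single w c * x * Poly_Mapping.single w' d =
          of_int c * (Tw (letters w) * x * (of_int d * Tw (letters w')))"
        unfolding sgl by (simp only: mult.assoc)
      also have "Tw (letters w) * x * (of_int d * Tw (letters w')) =
          of_int d * (Tw (letters w) * x * Tw (letters w'))"
        by (metis comm mult.assoc)
      finally show ?case by (simp only: scale word mult_zero_right)
    qed (simp_all add: lin_add distrib_left)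
  qed (simp_all add: lin_add distrib_right)
qed (simp_all add: lin_add)

lemma demw_Par:
  assumes k: "1 \<le> k" and \<mu>: "\<mu> \<in> Par k"
  shows "demw (k + 1) as (hp k \<mu>) = Some H \<Longrightarrow> \<exists>\<nu>\<in>Par k. H = hp k \<nu> \<and> psz \<nu> \<le> psz \<mu> + length as"
proof (induction as arbitrary: H)
  case Nil
  then show ?case using \<mu> by auto
next
  case (Cons a as)
  then obtain H1 where 1: "demw (k + 1) as (hp k \<mu>) = Some H1" "dem1 (k + 1) (int a) H1 = Some H" by (auto simp: bind_eq_Some_conv)
  obtain \<nu> where \<nu>: "\<nu> \<in> Par k" "H1 = hp k \<nu>" "psz \<nu> \<le> psz \<mu> + length as" using Cons.IH[OF 1(1)] by blast
  show ?case
  proof (cases "dh H1 (int a) < 0")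
    case True
    then obtain \<rho> where "\<rho> \<in> Par k" "hp k \<rho> = hp k \<nu> \<circ> sg (k + 1) (int a)" "psz \<rho> \<le> Suc (psz \<nu>)"
      using letter_act[OF k \<nu>(1)] by blast
    moreover have "H = hp k \<nu> \<circ> sg (k + 1) (int a)" using 1(2) True \<nu>(2) by (simp add: dem1_def)
    ultimately show ?thesis using \<nu>(3) by (intro bexI[of _ \<rho>]) auto
  next
    case False
    then have "H = hp k \<nu>" using 1(2) \<nu>(2) by (auto simp: dem1_def split: if_splits)
    then show ?thesis using \<nu> by (intro bexI[of _ \<nu>]) auto
  qed
qed

text \<open>A letter that adds a box prolongs the word of the partition by
  \<open>beq_par_word\<close>. A letter that fixes it meets a copy of itself at the front, and the
  quadratic relation contributes a sign.\<close>

lemma hecke_act: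
  assumes k: "1 \<le> k" and \<mu>: "\<mu> \<in> Par k"
  shows "set as \<subseteq> {..k} \<Longrightarrow> \<nu> \<in> Par k \<Longrightarrow> demw (k + 1) as (hp k \<mu>) = Some (hp k \<nu>) \<Longrightarrow>
    hecke_eq k (Tw (as @ par_word k \<mu>)) (Tw (par_word k \<nu>)) \<or>
    hecke_eq k (Tw (as @ par_word k \<mu>)) (- Tw (par_word k \<nu>))"
proof (induction as arbitrary: \<nu>)
  case Nil
  then have "\<mu> = \<nu>" using hp_inj[OF k \<mu>] by simp
  then show ?case by (simp add: hecke_eq_refl)
next
  case (Cons a as)
  then obtain H1 where 1: "demw (k + 1) as (hp k \<mu>) = Some H1" "dem1 (k + 1) (int a) H1 = Some (hp k \<nu>)"
    by (auto simp: bind_eq_Some_conv)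
  obtain \<kappa> where \<kappa>: "\<kappa> \<in> Par k" "H1 = hp k \<kappa>" using demw_Par[OF k \<mu> 1(1)] by blast
  have IH: "hecke_eq k (Tw (as @ par_word k \<mu>)) (Tw (par_word k \<kappa>)) \<or>
    hecke_eq k (Tw (as @ par_word k \<mu>)) (- Tw (par_word k \<kappa>))"
    using Cons.IH[OF _ \<kappa>(1)] Cons.prems(1) 1(1) \<kappa>(2) by simp
  have a: "a \<le> k" using Cons.prems(1) by simp
  have step: "hecke_eq k (Tw (a # as @ par_word k \<mu>)) (Tw (a # par_word k \<kappa>)) \<or>
    hecke_eq k (Tw (a # as @ par_word k \<mu>)) (- Tw (a # par_word k \<kappa>))"
    using IH hecke_eq_mult[OF hecke_eq_refl[of k "Tw [a]"], of "Tw (as @ par_word k \<mu>)" "Tw (par_word k \<kappa>)"]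
      hecke_eq_mult[OF hecke_eq_refl[of k "Tw [a]"], of "Tw (as @ par_word k \<mu>)" "- Tw (par_word k \<kappa>)"]
    unfolding Tw_Cons[of a "as @ par_word k \<mu>"] Tw_Cons[of a "par_word k \<kappa>"] by auto
  have last: "hecke_eq k (Tw (a # par_word k \<kappa>)) (Tw (par_word k \<nu>)) \<or>
    hecke_eq k (Tw (a # par_word k \<kappa>)) (- Tw (par_word k \<nu>))"
  proof (cases "dh H1 (int a) < 0")
    case True
    then obtain i where i: "addable k (int a) \<kappa> i" using add_box[OF k \<kappa>(1)] \<kappa>(2) by blast
    have "hp k \<nu> = hp k (\<kappa> + Poly_Mapping.single i 1)"
      using 1(2) True \<kappa>(2) addableD(2)[OF k \<kappa>(1) i] by (simp add: dem1_def)
    then have "\<nu> = \<kappa> + Poly_Mapping.single i 1" by (rule hp_inj[OF k Cons.prems(2) addableD(1)[OF k \<kappa>(1) i]])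
    then show ?thesis using hecke_eq_beq[OF beq_par_word[OF k \<kappa>(1) a i]] by simp
  next
    case False
    then have d: "0 < dh (hp k \<kappa>) (int a)" and "hp k \<nu> = hp k \<kappa>"
      using 1(2) \<kappa>(2) by (auto simp: dem1_def split: if_splits)
    then have e: "\<nu> = \<kappa>" using hp_inj[OF k Cons.prems(2) \<kappa>(1)] by simp
    obtain i \<rho> where \<rho>: "\<rho> \<in> Par k" "\<kappa> = \<rho> + Poly_Mapping.single i 1" "addable k (int a) \<rho> i"
      using remove_box[OF k \<kappa>(1) d] by metis
    have b: "hecke_eq k (Tw (a # par_word k \<rho>)) (Tw (par_word k \<kappa>))"
      unfolding \<rho>(2) by (rule hecke_eq_beq[OF beq_par_word[OF k \<rho>(1) a \<rho>(3)]])
    have "hecke_eq k (Tw (a # par_word k \<kappa>)) (Tw (a # a # par_word k \<rho>))"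
      unfolding Tw_Cons[of a "par_word k \<kappa>"] Tw_Cons[of a "a # par_word k \<rho>"]
      by (rule hecke_eq_mult[OF hecke_eq_refl hecke_eq_sym[OF b]])
    also have "hecke_eq k (Tw (a # a # par_word k \<rho>)) (- Tw (a # par_word k \<rho>))" by (rule hecke_eq_square[OF a])
    also have "hecke_eq k (- Tw (a # par_word k \<rho>)) (- Tw (par_word k \<kappa>))" by (rule hecke_eq_uminus[OF b])
    finally show ?thesis unfolding e by blast
  qed
  define X Y Z where "X = Tw (a # as @ par_word k \<mu>)" and "Y = Tw (a # par_word k \<kappa>)" and "Z = Tw (par_word k \<nu>)"
  have u: "hecke_eq k Y Z \<Longrightarrow> hecke_eq k (- Y) (- Z)" "hecke_eq k Y (- Z) \<Longrightarrow> hecke_eq k (- Y) Z"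
    using hecke_eq_uminus[of k Y Z] hecke_eq_uminus[of k Y "- Z"] by simp_all
  have "hecke_eq k X Y \<or> hecke_eq k X (- Y)" "hecke_eq k Y Z \<or> hecke_eq k Y (- Z)"
    using step last unfolding X_def Y_def Z_def .
  then have "hecke_eq k X Z \<or> hecke_eq k X (- Z)" using u hecke_eq_trans[of k X] by blast
  then show ?case unfolding X_def Z_def by simp
qed

section \<open>The index set of the Pieri rule\<close>

lemma T_elt_word_class: "\<exists>c. weq k a c \<and> length c = aff_length (word_class k a) \<and> T_elt (word_class k a) = Tw c"
proof -
  define c where "c = (SOME c. c \<in> word_class k a \<and> length c = aff_length (word_class k a))"
  have "\<exists>c. c \<in> word_class k a \<and> length c = aff_length (word_class k a)" using aff_length_attained[of k a] by blast
  then have "c \<in> word_class k a \<and> length c = aff_length (word_class k a)" unfolding c_def by (rule someI_ex)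
  then show ?thesis unfolding T_elt_def Tw_prod c_def[symmetric] by (auto simp: mem_word_class)
qed

lemma T_elt_par_elt:
  assumes k: "1 \<le> k" and \<mu>: "\<mu> \<in> Par k"
  obtains c where "T_elt (par_elt k \<mu>) = Tw c" "beq k c (par_word k \<mu>)" "demw (k + 1) c (hp k 0) = Some (hp k \<mu>)"
proof -
  obtain c where c: "weq k (par_word k \<mu>) c" "length c = psz \<mu>" "T_elt (par_elt k \<mu>) = Tw c"
    using T_elt_word_class[of k "par_word k \<mu>"] aff_length_par_elt[OF k \<mu>] unfolding par_elt_def by auto
  have "set c \<subseteq> {..k}" using weq_letters[OF c(1)] par_word_letters[OF k \<mu>] by simp
  moreover have "hp k \<mu> = hp k 0 \<circ> sgw (k + 1) c" using hp_par_word[OF k \<mu>] weq_sgw[OF c(1) k] by simp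
  ultimately show ?thesis using reduced_word[OF k _ \<mu>, of c] c(2,3) that by blast
qed

lemma T_elt_cycw:
  assumes k: "1 \<le> k" and a: "cycw k a" "length a \<le> k"
  obtains c where "T_elt (word_class k a) = Tw c" "cycw k c" "set c = set a" "beq k c a"
proof -
  have d: "distinct a" "set a \<subseteq> {..k}" using a by (auto simp: cycw_def)
  obtain c where c: "weq k a c" "length c = length a" "T_elt (word_class k a) = Tw c"
    using T_elt_word_class[of k a] distinct_length[OF k d] by auto
  note cc = cycw_reduced[OF k a c(1,2)]
  show ?thesis using that[OF c(3) cc cycw_beq[OF cc(1) a(1) cc(2)]] .
qed

lemma cyc_increasing_iff:
  assumes "u \<in> aff_sym k" shows "cyc_increasing k u \<longleftrightarrow> (\<exists>a. cycw k a \<and> u = word_class k a)"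
proof -
  obtain a0 where a0: "set a0 \<subseteq> {..k}" "u = word_class k a0" using assms by (auto simp: aff_sym_def)
  have *: "(\<forall>p q. p < q \<and> q < length a \<longrightarrow> a ! p \<noteq> (a ! q + 1) mod (k + 1)) \<longleftrightarrow>
      sorted_wrt (\<lambda>x y. x \<noteq> (y + 1) mod (k + 1)) a" for a by (auto simp: sorted_wrt_iff_nth_less)
  have "set a \<subseteq> {..k}" if "weq k a0 a" for a using weq_letters[OF that] a0(1) by simp
  then show ?thesis
    unfolding cyc_increasing_def * cycw_def a0(2) Bex_def mem_word_class word_class_eq_iff by blast
qed

text \<open>From left to right, the functional \<open>theta\<close> for \<nu> takes a value
  \<plusminus>1 on T_w, so it cannot vanish on the product. From right to left, the product is
  computed by \<open>hecke_act\<close>.\<close>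

lemma hecke_eq_iff_demw:
  assumes k: "1 \<le> k" and a: "cycw k a" "length a \<le> k" and \<mu>: "\<mu> \<in> Par k" and \<nu>: "\<nu> \<in> Par k"
  shows "hecke_eq k (T_elt (word_class k a) * T_elt (par_elt k \<mu>)) (T_elt (par_elt k \<nu>)) \<or>
    hecke_eq k (T_elt (word_class k a) * T_elt (par_elt k \<mu>)) (- T_elt (par_elt k \<nu>)) \<longleftrightarrow>
    demw (k + 1) a (hp k \<mu>) = Some (hp k \<nu>)"
proof -
  obtain c where c: "T_elt (word_class k a) = Tw c" "cycw k c" "set c = set a" "beq k c a" by (rule T_elt_cycw[OF k a])
  obtain m where m: "T_elt (par_elt k \<mu>) = Tw m" "beq k m (par_word k \<mu>)" "demw (k + 1) m (hp k 0) = Some (hp k \<mu>)"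
    by (rule T_elt_par_elt[OF k \<mu>])
  obtain n where n: "T_elt (par_elt k \<nu>) = Tw n" "beq k n (par_word k \<nu>)" "demw (k + 1) n (hp k 0) = Some (hp k \<nu>)"
    by (rule T_elt_par_elt[OF k \<nu>])
  have q0: "qp (k + 1) (hp k 0)" by (rule qp_hp[OF k zero_Par])
  have T: "Tw c * Tw m = Tw (c @ m)" by (simp add: Tw_append)
  let ?L = "lin (theta k (hp k 0) (hp k \<nu>))"
  show ?thesis
  proof
    assume "hecke_eq k (T_elt (word_class k a) * T_elt (par_elt k \<mu>)) (T_elt (par_elt k \<nu>)) \<or>
      hecke_eq k (T_elt (word_class k a) * T_elt (par_elt k \<mu>)) (- T_elt (par_elt k \<nu>))"
    then have "Tw (c @ m) - Tw n \<in> hecke_ideal k \<or> Tw (c @ m) - (- Tw n) \<in> hecke_ideal k"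
      unfolding c(1) m(1) n(1) T hecke_eq_def .
    then have "?L (Tw (c @ m) - Tw n) = 0 \<or> ?L (Tw (c @ m) - (- Tw n)) = 0"
      using theta_ideal[OF k q0] by blast
    then have "?L (Tw (c @ m)) = ?L (Tw n) \<or> ?L (Tw (c @ m)) = - ?L (Tw n)"
      by (simp add: lin_diff lin_uminus lin_add eq_neg_iff_add_eq_0)
    then have "demw (k + 1) (c @ m) (hp k 0) = Some (hp k \<nu>)"
      unfolding lin_theta_Tw n(3) by (auto split: if_splits simp: of_bool_def)
    then have "demw (k + 1) c (hp k \<mu>) = Some (hp k \<nu>)" unfolding demw_append m(3) by simp
    then show "demw (k + 1) a (hp k \<mu>) = Some (hp k \<nu>)" using demw_beq[OF c(4) k qp_hp[OF k \<mu>]] by simp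
  next
    assume d: "demw (k + 1) a (hp k \<mu>) = Some (hp k \<nu>)"
    have as: "set a \<subseteq> {..k}" using a by (simp add: cycw_def)
    have "beq k (c @ m) (a @ m)" using beq_context[OF c(4), of "[]" m] by simp
    also have "beq k (a @ m) (a @ par_word k \<mu>)" using beq_context[OF m(2), of a "[]"] by simp
    finally have 1: "hecke_eq k (Tw c * Tw m) (Tw (a @ par_word k \<mu>))" unfolding T by (rule hecke_eq_beq)
    have 2: "hecke_eq k (Tw (par_word k \<nu>)) (Tw n)" by (rule hecke_eq_sym[OF hecke_eq_beq[OF n(2)]])
    show "hecke_eq k (T_elt (word_class k a) * T_elt (par_elt k \<mu>)) (T_elt (par_elt k \<nu>)) \<or>
      hecke_eq k (T_elt (word_class k a) * T_elt (par_elt k \<mu>)) (- T_elt (par_elt k \<nu>))"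
      unfolding c(1) m(1) n(1)
      using hecke_act[OF k \<mu> as \<nu> d] 1 2 hecke_eq_uminus[OF 2] hecke_eq_trans by blast
  qed
qed

lemma pieri_pairs_eq:
  assumes k: "1 \<le> k" and r: "r \<le> k" and \<mu>: "\<mu> \<in> Par k"
  shows "pieri_pairs k r \<mu> = {(word_class k a, par_elt k \<nu>) | a \<nu>. cycw k a \<and> length a = r \<and> \<nu> \<in> Par k \<and>
    demw (k + 1) a (hp k \<mu>) = Some (hp k \<nu>)}" (is "_ = ?R")
proof (intro Set.set_eqI iffI)
  fix x assume "x \<in> pieri_pairs k r \<mu>"
  then obtain u w where x: "x = (u, w)" "u \<in> aff_sym k" "cyc_increasing k u" "aff_length u = r" "w \<in> aff_grass k"
    "hecke_eq k (T_elt u * T_elt (par_elt k \<mu>)) (T_elt w) \<or> hecke_eq k (T_elt u * T_elt (par_elt k \<mu>)) (- T_elt w)"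
    by (auto simp: pieri_pairs_def)
  obtain a where a: "cycw k a" "u = word_class k a" using cyc_increasing_iff[OF x(2)] x(3) by blast
  obtain \<nu> where \<nu>: "\<nu> \<in> Par k" "w = par_elt k \<nu>" using aff_grass_par_elt[OF k x(5)] by blast
  have la: "length a = r" using distinct_length[OF k, of a] a x(4) by (simp add: cycw_def)
  have "demw (k + 1) a (hp k \<mu>) = Some (hp k \<nu>)"
    using hecke_eq_iff_demw[OF k a(1) _ \<mu> \<nu>(1)] x(6) la r unfolding a(2) \<nu>(2) by blast
  then show "x \<in> ?R" using x(1) a \<nu> la by blast
next
  fix x assume "x \<in> ?R"
  then obtain a \<nu> where x: "x = (word_class k a, par_elt k \<nu>)" "cycw k a" "length a = r" "\<nu> \<in> Par k"
    "demw (k + 1) a (hp k \<mu>) = Some (hp k \<nu>)" by blast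
  have d: "distinct a" "set a \<subseteq> {..k}" using x(2) by (auto simp: cycw_def)
  have u: "word_class k a \<in> aff_sym k" unfolding aff_sym_def using d(2) by (intro imageI) auto
  have "cyc_increasing k (word_class k a)" using cyc_increasing_iff[OF u] x(2) by blast
  moreover have "aff_length (word_class k a) = r" using distinct_length[OF k d] x(3) by simp
  moreover have "par_elt k \<nu> \<in> aff_grass k" by (rule par_elt_grass[OF k x(4)])
  moreover have "length a \<le> k" using x(3) r by simp
  ultimately show "x \<in> pieri_pairs k r \<mu>"
    using hecke_eq_iff_demw[OF k x(2) _ \<mu> x(4)] x(5) u unfolding pieri_pairs_def x(1) by blast
qed

definition cyc_word :: "nat \<Rightarrow> nat set \<Rightarrow> nat list" where
  "cyc_word k A = (SOME as. cycw k as \<and> set as = A)"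

lemma cyc_word:
  assumes "A \<subseteq> {..k}" "card A \<le> k"
  shows "cycw k (cyc_word k A)" "set (cyc_word k A) = A" "length (cyc_word k A) = card A"
proof -
  have 1: "cycw k (cyc_word k A) \<and> set (cyc_word k A) = A"
    unfolding cyc_word_def by (rule someI_ex[OF cycw_ex[OF assms]])
  then show "cycw k (cyc_word k A)" "set (cyc_word k A) = A" by auto
  show "length (cyc_word k A) = card A" using 1 distinct_card[of "cyc_word k A"] by (auto simp: cycw_def)
qed

text \<open>\<open>inv_into\<close> recovers the partition from its height function; a word that
  kills \<mu> contributes 0.\<close>

definition pterm :: "nat \<Rightarrow> (zvec \<Rightarrow> symf) \<Rightarrow> zvec \<Rightarrow> nat list \<Rightarrow> symf" where
  "pterm k G \<mu> as = (case demw (k + 1) as (hp k \<mu>) of None \<Rightarrow> 0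
     | Some H \<Rightarrow> (- 1) ^ (psz \<mu> + length as - psz (inv_into (Par k) (hp k) H)) * G (inv_into (Par k) (hp k) H))"

lemma hp_inj_on: "1 \<le> k \<Longrightarrow> inj_on (hp k) (Par k)"
  by (rule inj_onI) (rule hp_inj)

lemma pterm_Some:
  assumes "1 \<le> k" "\<nu> \<in> Par k" "demw (k + 1) as (hp k \<mu>) = Some (hp k \<nu>)"
  shows "pterm k G \<mu> as = (- 1) ^ (psz \<mu> + length as - psz \<nu>) * G \<nu>"
  using assms by (simp add: pterm_def inv_into_f_f[OF hp_inj_on])

text \<open>A cyclically increasing element of length r is determined by its set of letters, by
  \<open>distinct_support\<close> and \<open>cycw_beq\<close>. So the pairs (u, w) correspond to
  those r-element sets of residues that do not kill \<mu>.\<close>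

lemma pieri_sum:
  assumes k: "1 \<le> k" and r: "r \<le> k" and \<mu>: "\<mu> \<in> Par k"
  shows "(\<Sum>(u, w) \<in> pieri_pairs k r \<mu>.
      (- 1) ^ (aff_length (par_elt k \<mu>) + r - aff_length w) * G (inv_into (Par k) (par_elt k) w)) =
    (\<Sum>A | A \<subseteq> {..k} \<and> card A = r. pterm k G \<mu> (cyc_word k A))"
proof -
  define S where "S = {A. A \<subseteq> {..k} \<and> card A = r}"
  define S' where "S' = {A \<in> S. demw (k + 1) (cyc_word k A) (hp k \<mu>) \<noteq> None}"
  define nu where "nu A = inv_into (Par k) (hp k) (the (demw (k + 1) (cyc_word k A) (hp k \<mu>)))" for A
  have finS: "finite S" unfolding S_def by (rule finite_subset[of _ "Pow {..k}"]) auto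
  have cw: "cycw k (cyc_word k A)" "set (cyc_word k A) = A" "length (cyc_word k A) = r" if "A \<in> S" for A
    using cyc_word[of A k] that r by (auto simp: S_def)
  have nu: "nu A \<in> Par k" "demw (k + 1) (cyc_word k A) (hp k \<mu>) = Some (hp k (nu A))" if A: "A \<in> S'" for A
  proof -
    obtain H where H: "demw (k + 1) (cyc_word k A) (hp k \<mu>) = Some H" using A by (auto simp: S'_def)
    obtain \<nu> where "\<nu> \<in> Par k" "H = hp k \<nu>" using demw_Par[OF k \<mu> H] by blast
    then show "nu A \<in> Par k" "demw (k + 1) (cyc_word k A) (hp k \<mu>) = Some (hp k (nu A))"
      using H inv_into_f_f[OF hp_inj_on[OF k], of \<nu>] by (simp_all add: nu_def)
  qed
  let ?f = "\<lambda>A. (word_class k (cyc_word k A), par_elt k (nu A))"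
  have inj: "inj_on ?f S'"
  proof (rule inj_onI)
    fix A B assume AB: "A \<in> S'" "B \<in> S'" "?f A = ?f B"
    then have S: "A \<in> S" "B \<in> S" by (auto simp: S'_def)
    have w: "weq k (cyc_word k A) (cyc_word k B)" using AB(3) by (simp add: word_class_eq_iff)
    have d: "distinct (cyc_word k A)" "set (cyc_word k A) \<subseteq> {..k}" "distinct (cyc_word k B)" "set (cyc_word k B) \<subseteq> {..k}"
      using cw S unfolding cycw_def by blast+
    show "A = B"
      using distinct_support[OF k d(1,2) w] distinct_support[OF k d(3,4) weq_sym[OF w]] cw(2) S by blast
  qed
  have img: "pieri_pairs k r \<mu> = ?f ` S'"
    unfolding pieri_pairs_eq[OF k r \<mu>]
  proof (intro Set.set_eqI iffI)
    fix x assume "x \<in> {(word_class k a, par_elt k \<nu>) | a \<nu>. cycw k a \<and> length a = r \<and> \<nu> \<in> Par k \<and>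
      demw (k + 1) a (hp k \<mu>) = Some (hp k \<nu>)}"
    then obtain a \<nu> where x: "x = (word_class k a, par_elt k \<nu>)" "cycw k a" "length a = r" "\<nu> \<in> Par k"
      "demw (k + 1) a (hp k \<mu>) = Some (hp k \<nu>)" by blast
    have A: "set a \<in> S" using x(2,3) by (auto simp: S_def cycw_def distinct_card)
    have b: "beq k (cyc_word k (set a)) a" by (rule cycw_beq[OF cw(1)[OF A] x(2) cw(2)[OF A]])
    have dm: "demw (k + 1) (cyc_word k (set a)) (hp k \<mu>) = Some (hp k \<nu>)"
      using demw_beq[OF b k qp_hp[OF k \<mu>]] x(5) by simp
    then have A': "set a \<in> S'" using A by (simp add: S'_def)
    have "nu (set a) = \<nu>" using dm inv_into_f_f[OF hp_inj_on[OF k] x(4)] by (simp add: nu_def)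
    moreover have "word_class k (cyc_word k (set a)) = word_class k a" using beq_weq[OF b] by (simp add: word_class_eq_iff)
    ultimately show "x \<in> ?f ` S'" using A' x(1) by (intro image_eqI[of _ _ "set a"]) auto
  next
    fix x assume "x \<in> ?f ` S'"
    then obtain A where A: "A \<in> S'" "x = ?f A" by blast
    then have "A \<in> S" by (simp add: S'_def)
    then show "x \<in> {(word_class k a, par_elt k \<nu>) | a \<nu>. cycw k a \<and> length a = r \<and> \<nu> \<in> Par k \<and>
      demw (k + 1) a (hp k \<mu>) = Some (hp k \<nu>)}" using A nu[OF A(1)] cw by blast
  qed
  have "(\<Sum>(u, w) \<in> pieri_pairs k r \<mu>.
      (- 1) ^ (aff_length (par_elt k \<mu>) + r - aff_length w) * G (inv_into (Par k) (par_elt k) w)) =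
    (\<Sum>A\<in>S'. (- 1) ^ (aff_length (par_elt k \<mu>) + r - aff_length (par_elt k (nu A))) *
      G (inv_into (Par k) (par_elt k) (par_elt k (nu A))))"
    unfolding img by (subst sum.reindex[OF inj]) simp
  also have "\<dots> = (\<Sum>A\<in>S'. pterm k G \<mu> (cyc_word k A))"
  proof (rule sum.cong[OF refl])
    fix A assume A: "A \<in> S'"
    then have "A \<in> S" by (simp add: S'_def)
    then show "(- 1) ^ (aff_length (par_elt k \<mu>) + r - aff_length (par_elt k (nu A))) *
      G (inv_into (Par k) (par_elt k) (par_elt k (nu A))) = pterm k G \<mu> (cyc_word k A)"
      unfolding pterm_Some[OF k nu[OF A]] aff_length_par_elt[OF k \<mu>] aff_length_par_elt[OF k nu(1)[OF A]]
        inv_into_f_f[OF par_elt_inj[OF k] nu(1)[OF A]] using cw(3) by simp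
  qed
  also have "\<dots> = (\<Sum>A\<in>S. pterm k G \<mu> (cyc_word k A))"
    by (rule sum.mono_neutral_left) (use finS in \<open>auto simp: S'_def pterm_def\<close>)
  finally show ?thesis unfolding S_def .
qed

section \<open>The Pieri rule for the k-Schur Katalan functions\<close>

text \<open>Residues and rows run in opposite directions: raising the residue by one moves up one
  row, cyclically in the window; see \<open>wrow_next\<close>.\<close>

definition wrow :: "nat \<Rightarrow> nat \<Rightarrow> nat \<Rightarrow> nat" where
  "wrow K l a = (SOME w. w \<in> {Suc (l - K)..l} \<and> int K dvd int a + int (w - 1))"

lemma wrow:
  assumes "1 \<le> K" "K \<le> l" shows "wrow K l a \<in> {Suc (l - K)..l}" "int K dvd int a + int (wrow K l a - 1)"
proof -
  have "\<exists>w. w \<in> {Suc (l - K)..l} \<and> int K dvd int a + int (w - 1)"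
    using window_row_ex[of K l "int a"] assms by blast
  then have "wrow K l a \<in> {Suc (l - K)..l} \<and> int K dvd int a + int (wrow K l a - 1)"
    unfolding wrow_def by (rule someI_ex)
  then show "wrow K l a \<in> {Suc (l - K)..l}" "int K dvd int a + int (wrow K l a - 1)" by auto
qed

lemma dvd_abs_less: "int K dvd x \<Longrightarrow> \<bar>x\<bar> < int K \<Longrightarrow> x = 0"
  using zdvd_not_zless[of "\<bar>x\<bar>" "int K"] by auto

lemma wrow_unique:
  assumes K: "1 \<le> K" "K \<le> l" and w: "w \<in> {Suc (l - K)..l}" "int K dvd c + int (w - 1)" and c: "int K dvd c - int a"
  shows "w = wrow K l a"
proof -
  note W = wrow[OF K, of a]
  have "int w - int (wrow K l a) = (c + int (w - 1)) - (int a + int (wrow K l a - 1)) - (c - int a)"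
    using w(1) W(1) by simp
  then have "int K dvd int w - int (wrow K l a)" using w(2) W(2) c by (simp only: dvd_diff)
  then show ?thesis using dvd_abs_less[of K "int w - int (wrow K l a)"] w(1) W(1) K by auto
qed

lemma wrow_inj:
  assumes K: "1 \<le> K" "K \<le> l" shows "inj_on (wrow K l) {..<K}"
proof (rule inj_onI)
  fix a b assume ab: "a \<in> {..<K}" "b \<in> {..<K}" "wrow K l a = wrow K l b"
  have "int a - int b = (int a + int (wrow K l a - 1)) - (int b + int (wrow K l b - 1))" using ab(3) by simp
  then have "int K dvd int a - int b" using wrow(2)[OF K] by (simp only: dvd_diff)
  then show "a = b" using dvd_abs_less[of K "int a - int b"] ab by auto
qed

lemma wrow_bij:
  assumes K: "1 \<le> K" "K \<le> l" shows "bij_betw (wrow K l) {..<K} {Suc (l - K)..l}"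
proof -
  have "wrow K l ` {..<K} = {Suc (l - K)..l}"
    using wrow(1)[OF K] card_image[OF wrow_inj[OF K]] K by (intro card_subset_eq) auto
  then show ?thesis using wrow_inj[OF K] by (simp add: bij_betw_def)
qed

lemma wrow_next:
  assumes K: "1 \<le> K" "K \<le> l" and c: "int K dvd int c - (int a + 1)"
  shows "(if wrow K l a = Suc (l - K) then l else wrow K l a - 1) = wrow K l c"
proof (rule wrow_unique[OF K, of _ "int a + 1"])
  note W = wrow[OF K, of a]
  show "(if wrow K l a = Suc (l - K) then l else wrow K l a - 1) \<in> {Suc (l - K)..l}" using W(1) K by auto
  show "int K dvd int a + 1 - int c" using c dvd_minus_iff[of "int K" "int c - (int a + 1)"] by simp
  show "int K dvd int a + 1 + int ((if wrow K l a = Suc (l - K) then l else wrow K l a - 1) - 1)"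
  proof (cases "wrow K l a = Suc (l - K)")
    case True
    then have "int a + 1 + int (l - 1) = (int a + int (wrow K l a - 1)) + int K" using K by simp
    then have "int K dvd int a + 1 + int (l - 1)" using W(2) by (simp only: dvd_add_triv_right_iff)
    then show ?thesis using True by simp
  next
    case False
    then have e: "int a + 1 + int (wrow K l a - 1 - 1) = int a + int (wrow K l a - 1)" using W(1) by auto
    show ?thesis unfolding if_not_P[OF False] e by (rule W(2))
  qed
qed

lemma Par_len_mono: "\<mu> \<in> Par_len k n \<Longrightarrow> n \<le> m \<Longrightarrow> \<mu> \<in> Par_len k m"
proof -
  assume \<mu>: "\<mu> \<in> Par_len k n" and n: "n \<le> m"
  have "Poly_Mapping.keys \<mu> \<subseteq> {1..m}" using \<mu> n by (fastforce simp: Par_len_def zvecs_def)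
  then show ?thesis unfolding Par_len_def zvecs_def
    using Par_lenD(1,2,3)[OF \<mu>] by (intro CollectI conjI ballI impI) simp_all
qed

lemma Par_len_psz:
  assumes "\<mu> \<in> Par k" "psz \<mu> \<le> m" shows "\<mu> \<in> Par_len k m"
proof -
  note n = Par_nparts[OF assms(1)]
  have "int (nparts \<mu>) = (\<Sum>i\<in>Poly_Mapping.keys \<mu>. 1)" by (simp add: nparts_def)
  also have "\<dots> \<le> (\<Sum>i\<in>Poly_Mapping.keys \<mu>. Poly_Mapping.lookup \<mu> i)"
  proof (rule sum_mono)
    fix i assume "i \<in> Poly_Mapping.keys \<mu>"
    then have "Poly_Mapping.lookup \<mu> i \<noteq> 0" by (simp add: in_keys_iff)
    then show "1 \<le> Poly_Mapping.lookup \<mu> i" using Par_lenD(1)[OF n, of i] by linarith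
  qed
  finally have "nparts \<mu> \<le> psz \<mu>" unfolding psz_def by linarith
  then show ?thesis using Par_len_mono[OF n] assms(2) by simp
qed

lemma pterm_None: "demw (k + 1) as (hp k \<mu>) = None \<Longrightarrow> pterm k G \<mu> as = 0"
  by (simp add: pterm_def)

lemma pterm_cong:
  assumes k: "1 \<le> k" and \<mu>: "\<mu> \<in> Par k"
    and G: "\<And>\<nu>. \<nu> \<in> Par k \<Longrightarrow> psz \<nu> \<le> psz \<mu> + length as \<Longrightarrow> G \<nu> = G' \<nu>"
  shows "pterm k G \<mu> as = pterm k G' \<mu> as"
proof (cases "demw (k + 1) as (hp k \<mu>)")
  case (Some H)
  then obtain \<nu> where "\<nu> \<in> Par k" "H = hp k \<nu>" "psz \<nu> \<le> psz \<mu> + length as" using demw_Par[OF k \<mu> Some] by blast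
  then show ?thesis using pterm_Some[OF k, of \<nu> as \<mu>] Some G by simp
qed (simp add: pterm_None)

text \<open>The induction takes letters from the right because the last letter acts first. The
  remaining factors avoid the row of a since the letters are distinct, and the cyclically preceding
  row, that of a + 1, since a + 1 may not stand to the left of a.\<close>

lemma GG_word:
  assumes k: "1 \<le> k"
  shows "cycw k as \<Longrightarrow> \<mu> \<in> Par k \<Longrightarrow> psz \<mu> + length as + k + 5 < l \<Longrightarrow>
    GG (k + 1) l (bb k \<mu>) {} (\<Prod>a\<in>set as. zp (wrow (k + 1) l a) 1 - 1) =
    pterm k (\<lambda>\<nu>. GG (k + 1) l (bb k \<nu>) {} 1) \<mu> as"
proof (induction as arbitrary: \<mu> rule: rev_induct)
  case Nil
  then show ?case using pterm_Some[OF k Nil(2), of "[]" \<mu>] by simp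
next
  case (snoc a as)
  let ?G = "\<lambda>\<nu>. GG (k + 1) l (bb k \<nu>) {} 1" and ?K = "k + 1"
  define P where "P = (\<Prod>a\<in>set as. zp (wrow ?K l a) 1 - 1)"
  define I where "I = wrow ?K l ` set as"
  have K: "1 \<le> ?K" "?K \<le> l" using snoc.prems(3) by auto
  have c: "cycw k as" "a \<notin> set as" "a \<le> k" "set as \<subseteq> {..k}" and srt: "(a + 1) mod (k + 1) \<notin> set as"
    using snoc.prems(1) by (auto simp: cycw_def sorted_wrt_append)
  have P: "(\<Prod>a\<in>set (as @ [a]). zp (wrow ?K l a) 1 - 1) = (zp (wrow ?K l a) 1 - 1) * P"
    using c(2) by (simp add: P_def)
  have o: "only I P" unfolding P_def I_def by (intro only_prod only_diff only_zp only_1) auto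
  have IW: "I \<subseteq> {Suc (l - ?K)..l}" unfolding I_def using wrow(1)[OF K] by blast
  have inI: "wrow ?K l x \<notin> I" if "x \<notin> set as" "x \<le> k" for x
  proof
    assume "wrow ?K l x \<in> I"
    then obtain y where y: "y \<in> set as" "wrow ?K l x = wrow ?K l y" by (auto simp: I_def)
    then have "x = y" using that c(4) by (intro inj_onD[OF wrow_inj[OF K] y(2)]) auto
    then show False using y(1) that by simp
  qed
  have ak: "(a + 1) mod (k + 1) \<le> k" by (simp add: less_Suc_eq_le[symmetric])
  have dv: "int ?K dvd int ((a + 1) mod (k + 1)) - (int a + 1)"
    using dvd_mod_letter[of k "a + 1"] by (simp add: algebra_simps)
  have pw: "(if wrow ?K l a = Suc (l - ?K) then l else wrow ?K l a - 1) \<notin> I"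
    unfolding wrow_next[OF K dv] by (rule inI[OF srt ak])
  have wI: "wrow ?K l a \<notin> I" by (rule inI[OF c(2,3)])
  have pl: "\<mu> \<in> Par_len k (psz \<mu>)" by (rule Par_len_psz[OF snoc.prems(2) order_refl])
  have ll: "Suc (psz \<mu>) + (k + 1) < l" using snoc.prems(3) by simp
  note L = window_letter[OF k pl ll wrow(1)[OF K] o IW wI pw wrow(2)[OF K]]
  let ?H = "hp k \<mu>"
  have dw: "demw ?K (as @ [a]) ?H = Option.bind (dem1 ?K (int a) ?H) (demw ?K as)" by (simp add: demw_append)
  consider "dh ?H (int a) < 0" | "dh ?H (int a) = 0" | "0 < dh ?H (int a)" by linarith
  then show ?case unfolding P
  proof cases
    case 1
    then have "?H (int a) < ?H (int a - 1)" by (simp add: dh_def)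
    then obtain i where i: "addable k (int a) \<mu> i"
      "GG ?K l (bb k \<mu>) {} ((zp (wrow ?K l a) 1 - 1) * P) = GG ?K l (bb k (\<mu> + Poly_Mapping.single i 1)) {} P"
      using L(1) by blast
    define \<nu> where "\<nu> = \<mu> + Poly_Mapping.single i 1"
    have \<nu>: "\<nu> \<in> Par k" "hp k \<nu> = ?H \<circ> sg ?K (int a)" "psz \<nu> = Suc (psz \<mu>)"
      unfolding \<nu>_def using addableD(1,2)[OF k snoc.prems(2) i(1)] psz_add_single[OF snoc.prems(2)] by auto
    have e: "demw ?K (as @ [a]) ?H = demw ?K as (hp k \<nu>)" unfolding dw \<nu>(2) using 1 by (simp add: dem1_def)
    have "GG ?K l (bb k \<nu>) {} P = pterm k ?G \<nu> as"
      unfolding P_def by (rule snoc.IH[OF c(1) \<nu>(1)]) (use \<nu>(3) snoc.prems(3) in simp)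
    \<comment> \<open>The size has grown by one and the word is shorter by one, so the exponent of
      the sign is unchanged.\<close>
    moreover have "pterm k ?G \<nu> as = pterm k ?G \<mu> (as @ [a])"
    proof -
      have "Suc (psz \<mu>) + length as = psz \<mu> + length (as @ [a])" by simp
      then show ?thesis unfolding pterm_def e \<nu>(3) by (simp only:)
    qed
    ultimately show "GG ?K l (bb k \<mu>) {} ((zp (wrow ?K l a) 1 - 1) * P) = pterm k ?G \<mu> (as @ [a])"
      using i(2) unfolding \<nu>_def by simp
  next
    case 2
    then have "?H (int a) = ?H (int a - 1)" by (simp add: dh_def)
    then have "GG ?K l (bb k \<mu>) {} ((zp (wrow ?K l a) 1 - 1) * P) = 0" by (rule L(2))
    moreover have "demw ?K (as @ [a]) ?H = None" unfolding dw using 2 by (simp add: dem1_def)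
    ultimately show "GG ?K l (bb k \<mu>) {} ((zp (wrow ?K l a) 1 - 1) * P) = pterm k ?G \<mu> (as @ [a])"
      using pterm_None by simp
  next
    case 3
    then have "?H (int a - 1) < ?H (int a)" by (simp add: dh_def)
    then have "GG ?K l (bb k \<mu>) {} ((zp (wrow ?K l a) 1 - 1) * P) = - GG ?K l (bb k \<mu>) {} P" by (rule L(3))
    also have "GG ?K l (bb k \<mu>) {} P = pterm k ?G \<mu> as"
      unfolding P_def by (rule snoc.IH[OF c(1) snoc.prems(2)]) (use snoc.prems(3) in simp)
    \<comment> \<open>A letter that fixes the partition counts in the length but not in the size;
      this is the origin of the sign in the Pieri rule.\<close>
    also have "- pterm k ?G \<mu> as = pterm k ?G \<mu> (as @ [a])"
    proof -
      have e: "demw ?K (as @ [a]) ?H = demw ?K as ?H" unfolding dw using 3 by (simp add: dem1_def)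
      show ?thesis
      proof (cases "demw ?K as ?H")
        case None
        then show ?thesis using e pterm_None by simp
      next
        case (Some H)
        then obtain \<nu> where \<nu>: "\<nu> \<in> Par k" "H = hp k \<nu>" "psz \<nu> \<le> psz \<mu> + length as"
          using demw_Par[OF k snoc.prems(2) Some] by blast
        have "psz \<mu> + length (as @ [a]) - psz \<nu> = Suc (psz \<mu> + length as - psz \<nu>)" using \<nu>(3) by simp
        then show ?thesis
          using pterm_Some[OF k \<nu>(1), of as \<mu>] pterm_Some[OF k \<nu>(1), of "as @ [a]" \<mu>] Some e \<nu>(2) by simp
      qed
    qed
    finally show "GG ?K l (bb k \<mu>) {} ((zp (wrow ?K l a) 1 - 1) * P) = pterm k ?G \<mu> (as @ [a])" .
  qed
qed

definition kS :: "nat \<Rightarrow> zvec \<Rightarrow> symf" where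
  "kS k \<mu> = kSchur_Katalan k (nparts \<mu>) \<mu>"

lemma GG_kS:
  assumes "1 \<le> k" "\<mu> \<in> Par_len k l" shows "GG (k + 1) l (bb k \<mu>) {} 1 = kS k \<mu>"
  unfolding kS_def using kSchur_eq_GG[OF assms] kSchur_stable[OF assms] by simp

lemma kS_pieri:
  assumes k: "1 \<le> k" and r: "r \<le> k" and \<mu>: "\<mu> \<in> Par k"
  shows "g_fun r (ones r) * kS k \<mu> = (\<Sum>A | A \<subseteq> {..k} \<and> card A = r. pterm k (kS k) \<mu> (cyc_word k A))"
proof -
  let ?K = "k + 1"
  \<comment> \<open>Large enough for \<open>GG_window\<close>, for \<open>GG_word\<close> with r
    letters, and for all the partitions that can arise.\<close>
  define l0 where "l0 = psz \<mu> + r + k + 5"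
  let ?l = "l0 + ?K" and ?G = "\<lambda>\<nu>. GG ?K (l0 + ?K) (bb k \<nu>) {} 1"
  have K: "1 \<le> ?K" "?K \<le> ?l" by auto
  have \<mu>0: "\<mu> \<in> Par_len k l0" by (rule Par_len_psz[OF \<mu>]) (simp add: l0_def)
  have rf: "rowfun ?K (psz \<mu>) (bb k \<mu>)" by (rule rowfun_bb[OF k Par_len_psz[OF \<mu> order_refl]])
  have W: "{Suc l0..?l} = {Suc (?l - ?K)..?l}" by simp
  have bij: "bij_betw (wrow ?K ?l) {..k} {Suc l0..?l}"
    using wrow_bij[OF K] unfolding W by (simp add: lessThan_Suc_atMost)
  then have inj: "inj_on (wrow ?K ?l) {..k}" and img: "wrow ?K ?l ` {..k} = {Suc l0..?l}" by (auto simp: bij_betw_def)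
  have bijP: "bij_betw ((`) (wrow ?K ?l)) {A. A \<subseteq> {..k} \<and> card A = r} {C. C \<subseteq> {Suc l0..?l} \<and> card C = r}"
    unfolding bij_betw_def
  proof (rule conjI, rule inj_onI)
    fix A B assume "A \<in> {A. A \<subseteq> {..k} \<and> card A = r}" "B \<in> {A. A \<subseteq> {..k} \<and> card A = r}"
      "wrow ?K ?l ` A = wrow ?K ?l ` B"
    then show "A = B" using inj_on_image_eq_iff[OF inj] by blast
  next
    show "(`) (wrow ?K ?l) ` {A. A \<subseteq> {..k} \<and> card A = r} = {C. C \<subseteq> {Suc l0..?l} \<and> card C = r}"
    proof (intro Set.set_eqI iffI)
    fix C assume "C \<in> (`) (wrow ?K ?l) ` {A. A \<subseteq> {..k} \<and> card A = r}"
    then obtain A where A: "A \<subseteq> {..k}" "card A = r" "C = wrow ?K ?l ` A" by blast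
    then show "C \<in> {C. C \<subseteq> {Suc l0..?l} \<and> card C = r}"
      using card_image[OF inj_on_subset[OF inj A(1)]] img by blast
  next
    fix C assume "C \<in> {C. C \<subseteq> {Suc l0..?l} \<and> card C = r}"
    then have C: "C \<subseteq> wrow ?K ?l ` {..k}" "card C = r" using img by auto
    then obtain A where A: "A \<subseteq> {..k}" "C = wrow ?K ?l ` A" by (auto simp: subset_image_iff)
    then have "card A = r" using card_image[OF inj_on_subset[OF inj A(1)]] C(2) by simp
    then show "C \<in> (`) (wrow ?K ?l) ` {A. A \<subseteq> {..k} \<and> card A = r}" using A by blast
    qed
  qed
  have "g_fun r (ones r) * kS k \<mu> = g_fun r (ones r) * GG ?K l0 (bb k \<mu>) {} 1"
    using GG_kS[OF k \<mu>0] by simp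
  also have "\<dots> = GG ?K ?l (bb k \<mu>) {} (esw r {Suc l0..?l})"
    by (rule GG_window[OF rf, symmetric]) (use r in \<open>simp_all add: l0_def\<close>)
  also have "\<dots> = (\<Sum>C | C \<subseteq> {Suc l0..?l} \<and> card C = r. GG ?K ?l (bb k \<mu>) {} (\<Prod>w\<in>C. zp w 1 - 1))"
    unfolding GG_def esw_def sum_distrib_left kap_sum ..
  also have "\<dots> = (\<Sum>A | A \<subseteq> {..k} \<and> card A = r. GG ?K ?l (bb k \<mu>) {} (\<Prod>w\<in>wrow ?K ?l ` A. zp w 1 - 1))"
    by (rule sum.reindex_bij_betw[OF bijP, symmetric])
  also have "\<dots> = (\<Sum>A | A \<subseteq> {..k} \<and> card A = r. pterm k (kS k) \<mu> (cyc_word k A))"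
  proof (rule sum.cong[OF refl])
    fix A assume "A \<in> {A. A \<subseteq> {..k} \<and> card A = r}"
    then have A: "A \<subseteq> {..k}" "card A = r" by auto
    note cw = cyc_word[OF A(1), unfolded A(2), OF r]
    have "(\<Prod>w\<in>wrow ?K ?l ` A. zp w 1 - 1) = (\<Prod>a\<in>set (cyc_word k A). zp (wrow ?K ?l a) 1 - 1)"
      unfolding cw(2) by (rule prod.reindex_cong[OF inj_on_subset[OF inj A(1)]]) auto
    then have "GG ?K ?l (bb k \<mu>) {} (\<Prod>w\<in>wrow ?K ?l ` A. zp w 1 - 1) = pterm k ?G \<mu> (cyc_word k A)"
      using GG_word[OF k cw(1) \<mu>, of ?l] cw(3) by (simp add: l0_def)
    also have "\<dots> = pterm k (kS k) \<mu> (cyc_word k A)"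
    proof (rule pterm_cong[OF k \<mu>])
      fix \<nu> assume "\<nu> \<in> Par k" "psz \<nu> \<le> psz \<mu> + length (cyc_word k A)"
      then show "?G \<nu> = kS k \<nu>" using cw(3) by (intro GG_kS[OF k] Par_len_psz) (auto simp: l0_def)
    qed
    finally show "GG ?K ?l (bb k \<mu>) {} (\<Prod>w\<in>wrow ?K ?l ` A. zp w 1 - 1) = pterm k (kS k) \<mu> (cyc_word k A)" .
  qed
  finally show ?thesis .
qed

section \<open>The subring generated by the first complete homogeneous functions\<close>

lemma Lambda_sub_add: "f \<in> Lambda_sub k \<Longrightarrow> g \<in> Lambda_sub k \<Longrightarrow> f + g \<in> Lambda_sub k"
  unfolding Lambda_sub_def using Poly_Mapping.keys_add[of f g] by blast

lemma Lambda_sub_mult: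
  assumes "f \<in> Lambda_sub k" "g \<in> Lambda_sub k" shows "f * g \<in> Lambda_sub k"
  unfolding Lambda_sub_def
proof (intro CollectI ballI)
  fix m assume "m \<in> Poly_Mapping.keys (f * g)"
  then obtain a b where ab: "a \<in> Poly_Mapping.keys f" "b \<in> Poly_Mapping.keys g" "m = a + b"
    using Poly_Mapping.keys_mult[of f g] by auto
  have "Poly_Mapping.keys m \<subseteq> Poly_Mapping.keys a \<union> Poly_Mapping.keys b" unfolding ab(3) by (rule Poly_Mapping.keys_add)
  also have "\<dots> \<subseteq> {..<k}" using ab assms by (auto simp: Lambda_sub_def)
  finally show "Poly_Mapping.keys m \<subseteq> {..<k}" .
qed

lemma Lambda_sub_of_int: "of_int n \<in> Lambda_sub k"
  by (auto simp: Lambda_sub_def split: if_splits simp flip: single_of_int)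

lemma Lambda_sub_0: "0 \<in> Lambda_sub k" and Lambda_sub_1: "1 \<in> Lambda_sub k"
  using Lambda_sub_of_int[of 0 k] Lambda_sub_of_int[of 1 k] by simp_all

lemma Lambda_sub_sum: "(\<And>x. x \<in> A \<Longrightarrow> F x \<in> Lambda_sub k) \<Longrightarrow> sum F A \<in> Lambda_sub k"
  by (induction A rule: infinite_finite_induct) (auto simp: Lambda_sub_0 Lambda_sub_add)

lemma Lambda_sub_prod: "(\<And>x. x \<in> A \<Longrightarrow> F x \<in> Lambda_sub k) \<Longrightarrow> prod F A \<in> Lambda_sub k"
  by (induction A rule: infinite_finite_induct) (auto simp: Lambda_sub_1 Lambda_sub_mult)

lemma Lambda_sub_h: "d \<le> int k \<Longrightarrow> h d \<in> Lambda_sub k"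
  using Lambda_sub_0 Lambda_sub_1 by (auto simp: h_def Lambda_sub_def)

lemma Lambda_sub_kh: "m \<le> int k \<Longrightarrow> kh c m \<in> Lambda_sub k"
  unfolding kh_def by (auto simp: Lambda_sub_0 intro!: Lambda_sub_sum Lambda_sub_mult Lambda_sub_of_int Lambda_sub_h)

lemma Lambda_sub_det:
  assumes "A \<in> carrier_mat n n" "\<And>i j. i < n \<Longrightarrow> j < n \<Longrightarrow> A $$ (i, j) \<in> Lambda_sub k"
  shows "det A \<in> Lambda_sub k"
  unfolding det_def'[OF assms(1)]
proof (intro Lambda_sub_sum Lambda_sub_mult Lambda_sub_prod)
  fix p assume p: "p \<in> {p. p permutes {0..<n}}"
  have "signof p = (of_int (sign p) :: symf)" by simp
  then show "(signof p :: symf) \<in> Lambda_sub k" by (simp only: Lambda_sub_of_int)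
  fix i assume "i \<in> {0..<n}"
  then show "A $$ (i, p i) \<in> Lambda_sub k" using p permutes_in_image[of p "{0..<n}" i] by (intro assms(2)) auto
qed

lemma Lambda_sub_least:
  assumes of_int: "\<And>n. of_int n \<in> T" and add: "\<And>x y. x \<in> T \<Longrightarrow> y \<in> T \<Longrightarrow> x + y \<in> T"
    and mult: "\<And>x y. x \<in> T \<Longrightarrow> y \<in> T \<Longrightarrow> x * y \<in> T" and gen: "\<And>r. 1 \<le> r \<Longrightarrow> r \<le> k \<Longrightarrow> h (int r) \<in> T"
  shows "Lambda_sub k \<subseteq> T"
proof
  fix f assume f: "f \<in> Lambda_sub k"
  have var: "Poly_Mapping.single (Poly_Mapping.single i e) 1 \<in> T" if "i < k" for i e
  proof (induction e)
    case 0
    then show ?case using of_int[of 1] by simp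
  next
    case (Suc e)
    have "Poly_Mapping.single (Poly_Mapping.single i (Suc e)) (1::int) =
        Poly_Mapping.single (Poly_Mapping.single i 1) 1 * Poly_Mapping.single (Poly_Mapping.single i e) 1"
      by (simp add: mult_single single_add[symmetric])
    moreover have "Poly_Mapping.single (Poly_Mapping.single i 1) (1::int) = h (int (Suc i))" by (simp add: h_def del: of_nat_Suc)
    ultimately show ?case using mult[OF gen[of "Suc i"] Suc] that by simp
  qed
  have mon: "Poly_Mapping.keys m \<subseteq> {..<k} \<Longrightarrow> Poly_Mapping.single m 1 \<in> T" for m :: "nat \<Rightarrow>\<^sub>0 nat"
  proof (induction m rule: pm_induct)
    case zero
    show ?case using of_int[of 1] by simp
  next
    case (single a c)
    show ?case
    proof (cases "c = 0")
      case True
      then show ?thesis using of_int[of 1] by simp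
    next
      case False
      then show ?thesis using single by (intro var) simp
    qed
  next
    case (add a b)
    have "Poly_Mapping.keys a \<subseteq> Poly_Mapping.keys (a + b)" "Poly_Mapping.keys b \<subseteq> Poly_Mapping.keys (a + b)"
      by (auto simp: in_keys_iff lookup_add)
    then have "Poly_Mapping.single a 1 * Poly_Mapping.single b 1 \<in> T" using add by (intro mult) auto
    then show ?case by (simp add: mult_single)
  qed
  have sc: "Poly_Mapping.single m c \<in> T" if "Poly_Mapping.keys m \<subseteq> {..<k}" for m :: "nat \<Rightarrow>\<^sub>0 nat" and c :: int
  proof -
    have "Poly_Mapping.single 0 c = (of_int c :: symf)" by (simp flip: single_of_int)
    then show ?thesis
      using mult[OF of_int[of c] mon[OF that]] mult_single[of "0 :: nat \<Rightarrow>\<^sub>0 nat" c m 1] by simp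
  qed
  have "(\<Sum>m\<in>A. Poly_Mapping.single m (Poly_Mapping.lookup f m)) \<in> T" if "A \<subseteq> Poly_Mapping.keys f" for A
    using that
  proof (induction A rule: infinite_finite_induct)
    case (insert m A)
    have "Poly_Mapping.keys m \<subseteq> {..<k}" using f insert by (auto simp: Lambda_sub_def)
    then show ?case using insert by (simp add: add sc)
  qed (use of_int[of 0] in auto)
  then show "f \<in> T" using pm_sum_singles[of f] by (metis order_refl)
qed

lemma kh_rank_0: "0 \<le> m \<Longrightarrow> kh 0 m = h m"
proof -
  assume m: "0 \<le> m"
  have z: "ibinom (0 + int i - 1) i = 0" if "i \<noteq> 0" for i
  proof -
    have "(\<Prod>t<i. 0 + int i - 1 - int t) = 0" using that by (intro prod_zero) (auto intro!: bexI[of _ "i - 1"])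
    then show ?thesis by (simp only: ibinom_def div_0)
  qed
  have "of_int (ibinom (0 + int i - 1) i) * h (m - int i) = (if i = 0 then h m else 0)" for i
  proof (cases "i = 0")
    case True
    then show ?thesis by (simp add: ibinom_def)
  next
    case False
    then show ?thesis unfolding z[OF False] by simp
  qed
  then show ?thesis unfolding kh_def using m by simp
qed

text \<open>Expand along the first row, whose entries are h_1, ..., h_r. The minor of h_r is
  unitriangular, and no entry outside the first row involves h_r, since the degrees drop by one per
  row.\<close>

lemma g_ones_leading:
  assumes r: "1 \<le> r"
  shows "\<exists>q\<in>Lambda_sub (r - 1). g_fun r (ones r) = (- 1) ^ (r - 1) * h (int r) + q"
proof -
  define M :: "symf mat" where "M = mat r r (\<lambda>(i, j). kh (int i) (1 + int j - int i))"
  have M: "M \<in> carrier_mat r r" by (simp add: M_def)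
  have on: "Poly_Mapping.lookup (ones r) (Suc i) = 1" if "i < r" for i
    using that by (auto simp: ones_def lookup_sum lookup_single when_def)
  have g: "g_fun r (ones r) = det M" unfolding g_fun_def M_def
    by (rule arg_cong[of _ _ det]) (auto intro!: eq_matI simp: on)
  have ent: "M $$ (i, j) = kh (int i) (1 + int j - int i)" if "i < r" "j < r" for i j using that by (simp add: M_def)
  have del: "mat_delete M 0 j $$ (i, j') = M $$ (Suc i, if j' < j then j' else Suc j')"
    if "i < r - 1" "j' < r - 1" for i j j'
    using that by (simp add: mat_delete_def M_def)
  have dc: "mat_delete M 0 j \<in> carrier_mat (r - 1) (r - 1)" for j by (rule mat_delete_carrier[OF M])
  have lam: "det (mat_delete M 0 j) \<in> Lambda_sub (r - 1)" for j
    by (rule Lambda_sub_det[OF dc]) (auto simp: del ent intro!: Lambda_sub_kh)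
  have last: "det (mat_delete M 0 (r - 1)) = 1"
  proof -
    have "upper_triangular (mat_delete M 0 (r - 1))"
    proof (rule upper_triangularI)
      fix i j assume ij: "j < i" "i < dim_row (mat_delete M 0 (r - 1))"
      then have "i < r - 1" using dc[of "r - 1"] by auto
      then show "mat_delete M 0 (r - 1) $$ (i, j) = 0" using ij(1) by (simp add: del ent kh_def)
    qed
    then have "det (mat_delete M 0 (r - 1)) = prod_list (diag_mat (mat_delete M 0 (r - 1)))"
      by (rule det_upper_triangular[OF _ dc])
    also have "diag_mat (mat_delete M 0 (r - 1)) = map (\<lambda>_. 1) [0..<r - 1]"
      unfolding diag_mat_def using dc[of "r - 1"] by (auto simp: del ent)
    finally show ?thesis by (simp add: map_replicate_const)
  qed
  have "det M = (\<Sum>j<r. M $$ (0, j) * cofactor M 0 j)" using r by (intro laplace_expansion_row[OF M]) simp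
  also have "\<dots> = (\<Sum>j<Suc (r - 1). M $$ (0, j) * cofactor M 0 j)" using r by simp
  also have "\<dots> = (\<Sum>j<r - 1. M $$ (0, j) * cofactor M 0 j) + M $$ (0, r - 1) * cofactor M 0 (r - 1)" by simp
  also have "M $$ (0, r - 1) * cofactor M 0 (r - 1) = (- 1) ^ (r - 1) * h (int r)"
  proof -
    have "M $$ (0, r - 1) = h (int r)" using r by (simp add: ent kh_rank_0)
    then show ?thesis unfolding cofactor_def last by simp
  qed
  finally have "g_fun r (ones r) = (- 1) ^ (r - 1) * h (int r) + (\<Sum>j<r - 1. M $$ (0, j) * cofactor M 0 j)"
    unfolding g by simp
  moreover have "(\<Sum>j<r - 1. M $$ (0, j) * cofactor M 0 j) \<in> Lambda_sub (r - 1)"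
  proof (intro Lambda_sub_sum Lambda_sub_mult)
    fix j assume j: "j \<in> {..<r - 1}"
    then show "M $$ (0, j) \<in> Lambda_sub (r - 1)" by (simp add: ent Lambda_sub_kh)
    have "((- 1) ^ j :: symf) = of_int ((- 1) ^ j)" by simp
    then show "cofactor M 0 j \<in> Lambda_sub (r - 1)"
      unfolding cofactor_def using lam[of j] by (simp only: add_0 Lambda_sub_mult Lambda_sub_of_int)
  qed
  ultimately show ?thesis by blast
qed

text \<open>The multipliers that preserve \<open>S\<close> form a subring. It contains the functions
  g (1^r), hence by \<open>g_ones_leading\<close> and induction all h_r with r \<le> k. Only closure
  of \<open>S\<close> under these multiplications is assumed, which is what a Pieri rule
  provides.\<close>

lemma g_ones_generate:
  assumes one: "1 \<in> S" and diff: "\<And>x y. x \<in> S \<Longrightarrow> y \<in> S \<Longrightarrow> x - y \<in> S"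
    and gen: "\<And>r x. 1 \<le> r \<Longrightarrow> r \<le> k \<Longrightarrow> x \<in> S \<Longrightarrow> g_fun r (ones r) * x \<in> S"
  shows "Lambda_sub k \<subseteq> S"
proof -
  define T where "T = {f. \<forall>x\<in>S. f * x \<in> S}"
  have zero: "0 \<in> S" using diff[OF one one] by simp
  have neg: "- x \<in> S" if "x \<in> S" for x using diff[OF zero that] by simp
  have plus: "x + y \<in> S" if "x \<in> S" "y \<in> S" for x y using diff[OF that(1) neg[OF that(2)]] by simp
  have nat: "of_nat n * x \<in> S" if "x \<in> S" for n x
    by (induction n) (use zero plus that in \<open>auto simp: distrib_right\<close>)
  have int: "of_int n \<in> T" for n
    unfolding T_def
  proof (intro CollectI ballI)
    fix x assume x: "x \<in> S"
    show "of_int n * x \<in> S"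
    proof (cases n)
      case (nonneg m)
      then show ?thesis using nat[OF x, of m] by simp
    next
      case (neg m)
      have e: "of_int n * x = - (of_nat (Suc m) * x)" unfolding neg(1) by (simp only: of_int_minus of_int_of_nat_eq mult_minus_left)
      show ?thesis unfolding e by (rule \<open>\<And>x. x \<in> S \<Longrightarrow> - x \<in> S\<close>[OF nat[OF x]])
    qed
  qed
  have add: "x + y \<in> T" if "x \<in> T" "y \<in> T" for x y using that plus by (auto simp: T_def distrib_right)
  have mult: "x * y \<in> T" if "x \<in> T" "y \<in> T" for x y using that by (auto simp: T_def mult.assoc)
  have "1 \<le> r \<Longrightarrow> r \<le> k \<Longrightarrow> h (int r) \<in> T" for r
  proof (induction r rule: less_induct)
    case (less r)
    obtain q where q: "q \<in> Lambda_sub (r - 1)" "g_fun r (ones r) = (- 1) ^ (r - 1) * h (int r) + q"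
      using g_ones_leading[OF less.prems(1)] by blast
    have "Lambda_sub (r - 1) \<subseteq> T"
      by (rule Lambda_sub_least[OF int add mult]) (use less in auto)
    then have qT: "q \<in> T" using q(1) by blast
    have gT: "g_fun r (ones r) \<in> T" using gen less.prems by (auto simp: T_def)
    have "((- 1) ^ (r - 1) * (- 1) ^ (r - 1) :: symf) = 1" by (simp flip: power_mult_distrib)
    then have "h (int r) = (- 1) ^ (r - 1) * (g_fun r (ones r) - q)"
      unfolding q(2) by (simp add: mult.assoc[symmetric])
    also have "\<dots> = of_int ((- 1) ^ (r - 1)) * (g_fun r (ones r) + of_int (- 1) * q)" by simp
    finally have e: "h (int r) = of_int ((- 1) ^ (r - 1)) * (g_fun r (ones r) + of_int (- 1) * q)" .
    show ?case unfolding e by (rule mult[OF int add[OF gT mult[OF int qT]]])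
  qed
  note hT = this
  have "Lambda_sub k \<subseteq> T" by (rule Lambda_sub_least[OF int add mult]) (use hT in auto)
  then have "f * 1 \<in> S" if "f \<in> Lambda_sub k" for f using one that unfolding T_def by blast
  then show ?thesis by auto
qed

section \<open>Leading monomials\<close>

text \<open>Any function of the exponents that is concave and increasing on \<open>[0, k]\<close> could serve as the weight.
  Raising operators spread the exponents apart and so decrease the total weight.\<close>

definition Wt :: "nat \<Rightarrow> int \<Rightarrow> int" where
  "Wt k p = p * (2 * int k - p)"

definition mwt :: "nat \<Rightarrow> (nat \<Rightarrow>\<^sub>0 nat) \<Rightarrow> int" where
  "mwt k m = (\<Sum>i<k. int (Poly_Mapping.lookup m i) * Wt k (int i + 1))"

definition Fw :: "nat \<Rightarrow> int \<Rightarrow> symf set" where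
  "Fw k w = {f. \<forall>m\<in>Poly_Mapping.keys f. mwt k m \<le> w}"

lemma mwt_add: "mwt k (a + b) = mwt k a + mwt k b"
  by (simp add: mwt_def lookup_add distrib_right sum.distrib)

lemma mwt_0: "mwt k 0 = 0"
  by (simp add: mwt_def)

lemma Wt_less:
  assumes "p < q" "q \<le> int k" shows "Wt k p \<le> Wt k q - 1"
proof -
  have "Wt k q - Wt k p = (q - p) * (2 * int k - p - q)" by (simp add: Wt_def algebra_simps)
  moreover have "0 < (q - p) * (2 * int k - p - q)" using assms by (intro mult_pos_pos) linarith+
  ultimately show ?thesis by linarith
qed

lemma Fw_0: "0 \<in> Fw k w"
  by (simp add: Fw_def)

lemma Fw_mono: "f \<in> Fw k w \<Longrightarrow> w \<le> w' \<Longrightarrow> f \<in> Fw k w'"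
  by (force simp: Fw_def)

lemma Fw_add: "f \<in> Fw k w \<Longrightarrow> g \<in> Fw k w \<Longrightarrow> f + g \<in> Fw k w"
  unfolding Fw_def using Poly_Mapping.keys_add[of f g] by blast

lemma Fw_mult:
  assumes "f \<in> Fw k w" "g \<in> Fw k w'" "v = w + w'" shows "f * g \<in> Fw k v"
  unfolding Fw_def
proof (intro CollectI ballI)
  fix m assume "m \<in> Poly_Mapping.keys (f * g)"
  then obtain a b where ab: "a \<in> Poly_Mapping.keys f" "b \<in> Poly_Mapping.keys g" "m = a + b"
    using Poly_Mapping.keys_mult[of f g] by auto
  then have "mwt k a \<le> w" "mwt k b \<le> w'" using assms by (auto simp: Fw_def)
  then show "mwt k m \<le> v" using ab(3) assms(3) by (simp add: mwt_add)
qed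

lemma Fw_of_int: "of_int n \<in> Fw k 0"
  by (auto simp: Fw_def mwt_0 split: if_splits simp flip: single_of_int)

lemma Fw_scale: "f \<in> Fw k w \<Longrightarrow> of_int n * f \<in> Fw k w"
  by (rule Fw_mult[OF Fw_of_int]) auto

lemma Fw_sum: "(\<And>x. x \<in> A \<Longrightarrow> F x \<in> Fw k w) \<Longrightarrow> sum F A \<in> Fw k w"
  by (induction A rule: infinite_finite_induct) (auto simp: Fw_0 Fw_add)

lemma Fw_h:
  assumes "0 \<le> p" "p \<le> int k" shows "h p \<in> Fw k (Wt k p)"
proof (cases "p = 0")
  case True
  then show ?thesis using Fw_of_int[of 1 k] by (simp add: h_def Wt_def)
next
  case False
  then have "int (nat p - 1) + 1 = p" "nat p - 1 < k" using assms by auto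
  then have "mwt k (Poly_Mapping.single (nat p - 1) 1) = Wt k p"
    by (simp add: mwt_def lookup_single when_def if_distrib[of int] if_distrib[of "\<lambda>x. x * _"] cong: if_cong)
  then show ?thesis using False assms by (simp add: h_def Fw_def)
qed

text \<open>The other terms are multiples of h_d with d < p, and the weight increases on
  [0, k].\<close>

lemma Fw_kh:
  assumes "0 \<le> p" "p \<le> int k" shows "kh c p - h p \<in> Fw k (Wt k p - 1)" "kh c p \<in> Fw k (Wt k p)"
proof -
  have "kh c p = (\<Sum>i\<le>nat p. of_int (ibinom (c + int i - 1) i) * h (p - int i))" using assms by (simp add: kh_def)
  also have "\<dots> = of_int (ibinom (c - 1) 0) * h p + (\<Sum>i\<in>{..nat p} - {0}. of_int (ibinom (c + int i - 1) i) * h (p - int i))"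
    by (subst sum.remove[of _ 0]) auto
  finally have e: "kh c p - h p = (\<Sum>i\<in>{..nat p} - {0}. of_int (ibinom (c + int i - 1) i) * h (p - int i))"
    by (simp add: ibinom_def)
  show 1: "kh c p - h p \<in> Fw k (Wt k p - 1)"
    unfolding e
  proof (intro Fw_sum Fw_scale)
    fix i assume i: "i \<in> {..nat p} - {0}"
    then have ip: "0 \<le> p - int i" "p - int i \<le> int k" "p - int i < p" using assms by auto
    show "h (p - int i) \<in> Fw k (Wt k p - 1)"
      by (rule Fw_mono[OF Fw_h[OF ip(1,2)] Wt_less[OF ip(3) assms(2)]])
  qed
  have "kh c p = h p + (kh c p - h p)" by simp
  then show "kh c p \<in> Fw k (Wt k p)" using Fw_add[OF Fw_h[OF assms] Fw_mono[OF 1]] by simp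
qed

lemma Fw_prod:
  assumes "finite I" "\<And>i. i \<in> I \<Longrightarrow> A i \<in> Fw k (w i)" "\<And>i. i \<in> I \<Longrightarrow> B i \<in> Fw k (w i)"
    "\<And>i. i \<in> I \<Longrightarrow> A i - B i \<in> Fw k (w i - 1)"
  shows "prod A I \<in> Fw k (sum w I) \<and> prod A I - prod B I \<in> Fw k (sum w I - 1)"
  using assms
proof (induction I rule: finite_induct)
  case empty
  then show ?case using Fw_of_int[of 1 k] Fw_0 by simp
next
  case (insert x I)
  then have IH: "prod A I \<in> Fw k (sum w I)" "prod A I - prod B I \<in> Fw k (sum w I - 1)" by auto
  have x: "A x \<in> Fw k (w x)" "B x \<in> Fw k (w x)" "A x - B x \<in> Fw k (w x - 1)" using insert.prems by auto
  have "A x * prod A I \<in> Fw k (w x + sum w I)" by (rule Fw_mult[OF x(1) IH(1)]) simp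
  moreover have "A x * prod A I - B x * prod B I = (A x - B x) * prod A I + B x * (prod A I - prod B I)"
    by (simp add: algebra_simps)
  moreover have "(A x - B x) * prod A I \<in> Fw k (w x + sum w I - 1)" by (rule Fw_mult[OF x(3) IH(1)]) simp
  moreover have "B x * (prod A I - prod B I) \<in> Fw k (w x + sum w I - 1)" by (rule Fw_mult[OF x(2) IH(2)]) simp
  ultimately show ?case using insert.hyps Fw_add by simp
qed

section \<open>Exponents produced by raising operators\<close>

definition expo :: "nat \<Rightarrow> (nat \<Rightarrow> int) \<Rightarrow> zvec \<Rightarrow> int" where
  "expo l c \<gamma> = (\<Sum>i\<in>{1..l}. c i * Poly_Mapping.lookup \<gamma> i)"

lemma expo_add: "expo l c (\<alpha> + \<beta>) = expo l c \<alpha> + expo l c \<beta>"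
  by (simp add: expo_def lookup_add distrib_left sum.distrib)

lemma expo_root:
  assumes "i \<in> {1..l}" "j \<in> {1..l}"
  shows "expo l c (Poly_Mapping.single i 1 + Poly_Mapping.single j (- 1)) = c i - c j"
proof -
  have "expo l c (Poly_Mapping.single x a) = c x * a" if "x \<in> {1..l}" for x a
    unfolding expo_def by (subst sum.remove[OF _ that]) (auto simp: lookup_single when_def intro!: sum.neutral)
  then show ?thesis using assms by (simp add: expo_add)
qed

text \<open>Linear conditions satisfied by every nonempty sum of the roots \<epsilon>_i -
  \<epsilon>_j with i < j and stable under addition. The last one excludes 0, the second uses that
  \<mu> is decreasing.\<close>

definition posc :: "nat \<Rightarrow> zvec \<Rightarrow> zvec set" where
  "posc l \<mu> = {\<gamma>. expo l (\<lambda>_. 1) \<gamma> = 0 \<and> 0 \<le> expo l (Poly_Mapping.lookup \<mu>) \<gamma> \<and> expo l int \<gamma> < 0}"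

lemma posc_add: "\<alpha> \<in> posc l \<mu> \<Longrightarrow> \<beta> \<in> posc l \<mu> \<Longrightarrow> \<alpha> + \<beta> \<in> posc l \<mu>"
  by (simp add: posc_def expo_add)

lemma prod_nrt_posc:
  assumes \<mu>: "\<mu> \<in> Par_len k l" and B: "finite B" "B \<subseteq> {(i, j). 1 \<le> i \<and> i < j \<and> j \<le> l}"
  shows "Poly_Mapping.keys (prod nrt B - 1) \<subseteq> posc l \<mu>"
  using B
proof (induction B rule: finite_induct)
  case (insert p B)
  obtain i j where p: "p = (i, j)" by (cases p)
  have ij: "1 \<le> i" "i < j" "j \<le> l" using insert.prems p by auto
  define \<alpha> :: zvec where "\<alpha> = Poly_Mapping.single i 1 + Poly_Mapping.single j (- 1)"
  define f where "f = prod nrt B - 1"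
  have \<alpha>: "\<alpha> \<in> posc l \<mu>"
    unfolding posc_def \<alpha>_def using ij Par_lenD(3)[OF \<mu>, of i j] by (simp add: expo_root)
  have f: "Poly_Mapping.keys f \<subseteq> posc l \<mu>" using insert unfolding f_def by auto
  have n: "nrt p = 1 - Poly_Mapping.single \<alpha> 1" by (simp add: p nrt_def zp_def mult_single \<alpha>_def)
  have "prod nrt (insert p B) = nrt p * (f + 1)" using insert.hyps by (simp add: f_def)
  then have "prod nrt (insert p B) - 1 = f - (Poly_Mapping.single \<alpha> 1 + Poly_Mapping.single \<alpha> 1 * f)"
    unfolding n by (simp add: algebra_simps)
  also have "Poly_Mapping.keys \<dots> \<subseteq> posc l \<mu>"
  proof
    fix \<gamma> assume "\<gamma> \<in> Poly_Mapping.keys (f - (Poly_Mapping.single \<alpha> 1 + Poly_Mapping.single \<alpha> 1 * f))"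
    then have "\<gamma> \<in> Poly_Mapping.keys f \<or> \<gamma> = \<alpha> \<or> \<gamma> \<in> Poly_Mapping.keys (Poly_Mapping.single \<alpha> 1 * f)"
      using keys_diff[of f "Poly_Mapping.single \<alpha> 1 + Poly_Mapping.single \<alpha> 1 * f"]
        Poly_Mapping.keys_add[of "Poly_Mapping.single \<alpha> 1" "Poly_Mapping.single \<alpha> 1 * f"] by auto
    moreover have "\<exists>\<beta>\<in>Poly_Mapping.keys f. \<gamma> = \<alpha> + \<beta>" if "\<gamma> \<in> Poly_Mapping.keys (Poly_Mapping.single \<alpha> 1 * f)"
      using that Poly_Mapping.keys_mult[of "Poly_Mapping.single \<alpha> 1" f] by auto
    ultimately show "\<gamma> \<in> posc l \<mu>" using f \<alpha> posc_add by blast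
  qed
  finally show ?case .
qed simp

text \<open>Each pair raises its first row at most once. For the ideal of \<mu> row i has at most
  \<open>b i - i - 1 = k - \<mu> i\<close> pairs, so its exponent never exceeds k; this is why the
  Katalan functions involve only h_1, ..., h_k.\<close>

lemma prod_nrt_bound:
  assumes "finite B" "\<gamma> \<in> Poly_Mapping.keys (prod nrt B)"
  shows "Poly_Mapping.lookup \<gamma> i \<le> int (card {j. (i, j) \<in> B})"
  using assms
proof (induction B arbitrary: \<gamma> rule: finite_induct)
  case empty
  then show ?case by simp
next
  case (insert p B)
  obtain x y where p: "p = (x, y)" by (cases p)
  define \<alpha> :: zvec where "\<alpha> = Poly_Mapping.single x 1 + Poly_Mapping.single y (- 1)"
  have n: "nrt p = 1 - Poly_Mapping.single \<alpha> 1" by (simp add: p nrt_def zp_def mult_single \<alpha>_def)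
  obtain a \<beta> where ab: "a \<in> Poly_Mapping.keys (nrt p)" "\<beta> \<in> Poly_Mapping.keys (prod nrt B)" "\<gamma> = a + \<beta>"
    using insert Poly_Mapping.keys_mult[of "nrt p" "prod nrt B"] by auto
  have "a = 0 \<or> a = \<alpha>" using ab(1) keys_diff[of 1 "Poly_Mapping.single \<alpha> (1::int)"] unfolding n by auto
  then have a: "Poly_Mapping.lookup a i \<le> (if i = x then 1 else 0)"
    by (auto simp: \<alpha>_def lookup_add lookup_single when_def)
  have fin: "finite {j. (i, j) \<in> B}" using finite_subset[of "{j. (i, j) \<in> B}" "snd ` B"] insert.hyps by force
  have "int (card {j. (i, j) \<in> insert p B}) = int (card {j. (i, j) \<in> B}) + (if i = x then 1 else 0)"
  proof (cases "i = x")
    case True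
    then have "{j. (i, j) \<in> insert p B} = insert y {j. (i, j) \<in> B}" "y \<notin> {j. (i, j) \<in> B}" using p insert.hyps by auto
    then show ?thesis using True fin by simp
  next
    case False
    then have "{j. (i, j) \<in> insert p B} = {j. (i, j) \<in> B}" using p by auto
    then show ?thesis using False by simp
  qed
  then show ?case using a insert.IH[OF ab(2)] ab(3) by (simp add: lookup_add)
qed

lemma kS_expand:
  assumes k: "1 \<le> k" and \<mu>: "\<mu> \<in> Par k"
  defines "l \<equiv> nparts \<mu>"
  obtains f where "kS k \<mu> = kap {1..l} (cc (bb k \<mu>)) (Poly_Mapping.single \<mu> 1) + kap {1..l} (cc (bb k \<mu>)) f"
    and "\<And>\<gamma>. \<gamma> \<in> Poly_Mapping.keys f \<Longrightarrow> \<gamma> - \<mu> \<in> posc l \<mu>"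
    and "\<And>\<gamma> i. \<gamma> \<in> Poly_Mapping.keys f \<Longrightarrow> i \<in> {1..l} \<Longrightarrow> Poly_Mapping.lookup \<gamma> i \<le> int k"
proof -
  let ?b = "bb k \<mu>"
  have \<mu>l: "\<mu> \<in> Par_len k l" unfolding l_def by (rule Par_nparts[OF \<mu>])
  define g where "g = prod nrt (NR l ?b) - 1"
  define f where "f = g * Poly_Mapping.single \<mu> 1"
  have gp: "Poly_Mapping.keys g \<subseteq> posc l \<mu>"
    unfolding g_def by (rule prod_nrt_posc[OF \<mu>l finite_NR]) (auto simp: NR_def)
  have keysf: "\<exists>\<beta>\<in>Poly_Mapping.keys g. \<gamma> = \<beta> + \<mu>" if "\<gamma> \<in> Poly_Mapping.keys f" for \<gamma>
    using that Poly_Mapping.keys_mult[of g "Poly_Mapping.single \<mu> 1"] unfolding f_def by auto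
  show ?thesis
  proof
    have "kS k \<mu> = GG (k + 1) l ?b {} 1" by (rule GG_kS[OF k \<mu>l, symmetric])
    also have "\<dots> = kap {1..l} (cc ?b) (prod nrt (NR l ?b) * Poly_Mapping.single \<mu> 1)"
      by (simp only: GG_def ZM_bb[OF \<mu>l] Diff_empty mult_1_right)
    also have "prod nrt (NR l ?b) * Poly_Mapping.single \<mu> 1 = Poly_Mapping.single \<mu> 1 + f"
      by (simp add: f_def g_def algebra_simps)
    finally show "kS k \<mu> = kap {1..l} (cc ?b) (Poly_Mapping.single \<mu> 1) + kap {1..l} (cc ?b) f" by (simp add: kap_add)
  next
    fix \<gamma> assume "\<gamma> \<in> Poly_Mapping.keys f"
    then show "\<gamma> - \<mu> \<in> posc l \<mu>" using keysf gp by fastforce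
  next
    fix \<gamma> i assume \<gamma>: "\<gamma> \<in> Poly_Mapping.keys f" and i: "i \<in> {1..l}"
    obtain \<beta> where \<beta>: "\<beta> \<in> Poly_Mapping.keys g" "\<gamma> = \<beta> + \<mu>" using keysf[OF \<gamma>] by blast
    have "\<beta> \<in> Poly_Mapping.keys (prod nrt (NR l ?b)) \<or> \<beta> = 0"
      using \<beta>(1) keys_diff[of "prod nrt (NR l ?b)" 1] unfolding g_def by auto
    moreover have "int (card {j. (i, j) \<in> NR l ?b}) \<le> int k - Poly_Mapping.lookup \<mu> i"
    proof -
      have "card {j. (i, j) \<in> NR l ?b} \<le> card {i<..<?b i}" by (rule card_mono) (auto simp: NR_def)
      then show ?thesis using bb_int[OF \<mu>l, of i] Par_lenD(2)[OF \<mu>l, of i] by simp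
    qed
    ultimately have "Poly_Mapping.lookup \<beta> i \<le> int k - Poly_Mapping.lookup \<mu> i"
      using prod_nrt_bound[OF finite_NR, of \<beta> l ?b i] Par_lenD(2)[OF \<mu>l, of i] by fastforce
    then show "Poly_Mapping.lookup \<gamma> i \<le> int k" using \<beta>(2) by (simp add: lookup_add)
  qed
qed

lemma kS_Lambda_sub:
  assumes k: "1 \<le> k" and \<mu>: "\<mu> \<in> Par k" shows "kS k \<mu> \<in> Lambda_sub k"
proof -
  obtain f where f: "kS k \<mu> = kap {1..nparts \<mu>} (cc (bb k \<mu>)) (Poly_Mapping.single \<mu> 1) + kap {1..nparts \<mu>} (cc (bb k \<mu>)) f"
    "\<And>\<gamma> i. \<gamma> \<in> Poly_Mapping.keys f \<Longrightarrow> i \<in> {1..nparts \<mu>} \<Longrightarrow> Poly_Mapping.lookup \<gamma> i \<le> int k"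
    using kS_expand[OF k \<mu>] by metis
  have "kap {1..nparts \<mu>} (cc (bb k \<mu>)) f \<in> Lambda_sub k"
    unfolding kap_def lin_def
    by (intro Lambda_sub_sum Lambda_sub_mult Lambda_sub_of_int Lambda_sub_prod Lambda_sub_kh f(2))
  moreover have "kap {1..nparts \<mu>} (cc (bb k \<mu>)) (Poly_Mapping.single \<mu> 1) \<in> Lambda_sub k"
    unfolding kap_single of_int_1 mult_1_left by (intro Lambda_sub_prod Lambda_sub_kh Par_lenD(2)[OF Par_nparts[OF \<mu>]])
  ultimately show ?thesis unfolding f(1) by (intro Lambda_sub_add)
qed

definition pmon :: "zvec \<Rightarrow> (nat \<Rightarrow>\<^sub>0 nat)" where
  "pmon \<mu> = (\<Sum>i\<in>Poly_Mapping.keys \<mu>. Poly_Mapping.single (nat (Poly_Mapping.lookup \<mu> i) - 1) 1)"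

lemma part_pos: "\<mu> \<in> Par k \<Longrightarrow> i \<in> Poly_Mapping.keys \<mu> \<Longrightarrow> 1 \<le> Poly_Mapping.lookup \<mu> i"
  using Par_lenD(1)[OF Par_nparts, of \<mu> k i] by (auto simp: in_keys_iff order_le_less)

text \<open>For an exponent \<mu> + \<delta> the weight changes by 2 k \<Sum> \<delta>_i - 2 \<Sum>
  \<mu>_i \<delta>_i - \<Sum> \<delta>_i^2. The first sum vanishes, the second is nonnegative, and
  the squares make the change strictly negative.\<close>

lemma kS_leading:
  assumes k: "1 \<le> k" and \<mu>: "\<mu> \<in> Par k"
  shows "kS k \<mu> - Poly_Mapping.single (pmon \<mu>) 1 \<in> Fw k (mwt k (pmon \<mu>) - 1)"
proof -
  define l where "l = nparts \<mu>"
  let ?c = "cc (bb k \<mu>)" and ?m = "Poly_Mapping.lookup \<mu>"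
  have \<mu>l: "\<mu> \<in> Par_len k l" unfolding l_def by (rule Par_nparts[OF \<mu>])
  have keys: "Poly_Mapping.keys \<mu> = {1..l}" unfolding l_def by (rule keys_Par(1)[OF Par_nparts[OF \<mu>]])
  obtain f where f: "kS k \<mu> = kap {1..l} ?c (Poly_Mapping.single \<mu> 1) + kap {1..l} ?c f"
    "\<And>\<gamma>. \<gamma> \<in> Poly_Mapping.keys f \<Longrightarrow> \<gamma> - \<mu> \<in> posc l \<mu>"
    "\<And>\<gamma> i. \<gamma> \<in> Poly_Mapping.keys f \<Longrightarrow> i \<in> {1..l} \<Longrightarrow> Poly_Mapping.lookup \<gamma> i \<le> int k"
    using kS_expand[OF k \<mu>] unfolding l_def by metis
  define w where "w = (\<Sum>i\<in>{1..l}. Wt k (?m i))"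
  have H: "(\<Prod>i\<in>A. h (?m i)) = Poly_Mapping.single (\<Sum>i\<in>A. Poly_Mapping.single (nat (?m i) - 1) 1) 1"
    if "A \<subseteq> Poly_Mapping.keys \<mu>" for A
    using that
  proof (induction A rule: infinite_finite_induct)
    case (insert x A)
    have "1 \<le> ?m x" using part_pos[OF \<mu>] insert.prems by simp
    then show ?case using insert by (simp add: h_def mult_single)
  qed (simp_all)
  have mw: "mwt k (\<Sum>i\<in>A. Poly_Mapping.single (nat (?m i) - 1) 1) = (\<Sum>i\<in>A. Wt k (?m i))"
    if "A \<subseteq> Poly_Mapping.keys \<mu>" for A
    using that
  proof (induction A rule: infinite_finite_induct)
    case (insert x A)
    have "1 \<le> ?m x" "?m x \<le> int k" using part_pos[OF \<mu>] insert.prems Par_lenD(2)[OF \<mu>l] by auto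
    then have "int (nat (?m x) - 1) + 1 = ?m x" "nat (?m x) - 1 < k" by auto
    then have "mwt k (Poly_Mapping.single (nat (?m x) - 1) 1) = Wt k (?m x)"
      by (simp add: mwt_def lookup_single when_def if_distrib[of int] if_distrib[of "\<lambda>x. x * _"] cong: if_cong)
    then show ?case using insert by (simp add: mwt_add)
  qed (simp_all add: mwt_0)
  have wm: "mwt k (pmon \<mu>) = w" unfolding pmon_def w_def using mw[OF order_refl] keys by simp
  have "kap {1..l} ?c (Poly_Mapping.single \<mu> 1) - (\<Prod>i\<in>{1..l}. h (?m i)) \<in> Fw k (w - 1)"
    unfolding kap_single of_int_1 mult_1_left w_def
    by (rule Fw_prod[THEN conjunct2]) (auto intro!: Fw_kh Fw_h Par_lenD(1,2)[OF \<mu>l])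
  moreover have "kap {1..l} ?c f \<in> Fw k (w - 1)"
    unfolding kap_def lin_def
  proof (intro Fw_sum Fw_scale)
    fix \<gamma> assume \<gamma>: "\<gamma> \<in> Poly_Mapping.keys f"
    define \<delta> where "\<delta> = \<gamma> - \<mu>"
    have g: "Poly_Mapping.lookup \<gamma> i = ?m i + Poly_Mapping.lookup \<delta> i" for i by (simp add: \<delta>_def lookup_minus)
    show "(\<Prod>i\<in>{1..l}. kh (?c i) (Poly_Mapping.lookup \<gamma> i)) \<in> Fw k (w - 1)"
    proof (cases "\<exists>i\<in>{1..l}. Poly_Mapping.lookup \<gamma> i < 0")
      case True
      then have "(\<Prod>i\<in>{1..l}. kh (?c i) (Poly_Mapping.lookup \<gamma> i)) = 0"
        by (intro prod_zero) (auto simp: kh_def)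
      then show ?thesis by (simp only: Fw_0)
    next
      case False
      \<comment> \<open>All exponents now lie in [0, k], the range in which the row functions have
        leading term h and the weight is monotone.\<close>
      then have nn: "0 \<le> Poly_Mapping.lookup \<gamma> i" "Poly_Mapping.lookup \<gamma> i \<le> int k" if "i \<in> {1..l}" for i
        using that f(3)[OF \<gamma>] by (auto simp: not_less)
      have P: "(\<Prod>i\<in>{1..l}. kh (?c i) (Poly_Mapping.lookup \<gamma> i)) \<in> Fw k (\<Sum>i\<in>{1..l}. Wt k (Poly_Mapping.lookup \<gamma> i))"
        by (rule Fw_prod[where B = "\<lambda>i. h (Poly_Mapping.lookup \<gamma> i)", THEN conjunct1]) (auto intro!: Fw_kh Fw_h nn)
      have pc: "expo l (\<lambda>_. 1) \<delta> = 0" "0 \<le> expo l ?m \<delta>" "expo l int \<delta> < 0"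
        using f(2)[OF \<gamma>] by (auto simp: \<delta>_def posc_def)
      have "\<exists>i\<in>{1..l}. Poly_Mapping.lookup \<delta> i \<noteq> 0"
        using pc(3) unfolding expo_def by (metis (mono_tags, lifting) less_irrefl mult_zero_right sum.neutral)
      then have "0 < (\<Sum>i\<in>{1..l}. (Poly_Mapping.lookup \<delta> i)\<^sup>2)" by (auto intro!: sum_pos2)
      moreover have "(\<Sum>i\<in>{1..l}. Wt k (Poly_Mapping.lookup \<gamma> i)) =
          w + 2 * int k * expo l (\<lambda>_. 1) \<delta> - 2 * expo l ?m \<delta> - (\<Sum>i\<in>{1..l}. (Poly_Mapping.lookup \<delta> i)\<^sup>2)"
        unfolding g w_def expo_def sum_distrib_left sum.distrib[symmetric] sum_subtractf[symmetric]
        by (rule sum.cong) (auto simp: Wt_def algebra_simps power2_eq_square)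
      ultimately have "(\<Sum>i\<in>{1..l}. Wt k (Poly_Mapping.lookup \<gamma> i)) \<le> w - 1" using pc by simp
      then show ?thesis by (rule Fw_mono[OF P])
    qed
  qed
  ultimately have "kap {1..l} ?c (Poly_Mapping.single \<mu> 1) - (\<Prod>i\<in>{1..l}. h (?m i)) + kap {1..l} ?c f \<in> Fw k (w - 1)"
    by (rule Fw_add)
  moreover have "(\<Prod>i\<in>{1..l}. h (?m i)) = Poly_Mapping.single (pmon \<mu>) 1"
    using H[OF order_refl] unfolding pmon_def keys .
  ultimately show ?thesis unfolding f(1) wm by (simp add: algebra_simps)
qed

text \<open>The monomial records the multiplicities of the parts, hence the size of each set of rows
  with part at least q. These sets are initial segments, so their sizes determine them.\<close>

lemma pmon_inj:
  assumes \<mu>: "\<mu> \<in> Par k" and \<nu>: "\<nu> \<in> Par k" and eq: "pmon \<mu> = pmon \<nu>"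
  shows "\<mu> = \<nu>"
proof -
  define D where "D \<kappa> q = {i \<in> Poly_Mapping.keys \<kappa>. int q \<le> Poly_Mapping.lookup \<kappa> i}" for \<kappa> :: zvec and q
  have cd: "card (D \<kappa> q) = (\<Sum>p\<in>{q - 1..<k}. Poly_Mapping.lookup (pmon \<kappa>) p)" if \<kappa>: "\<kappa> \<in> Par k" and q: "1 \<le> q" for \<kappa> q
  proof -
    have "Poly_Mapping.lookup (pmon \<kappa>) p = card {i \<in> Poly_Mapping.keys \<kappa>. nat (Poly_Mapping.lookup \<kappa> i) - 1 = p}" for p
    proof -
      have "Poly_Mapping.lookup (pmon \<kappa>) p =
          (\<Sum>i\<in>Poly_Mapping.keys \<kappa>. if nat (Poly_Mapping.lookup \<kappa> i) - 1 = p then 1 else 0)"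
        unfolding pmon_def lookup_sum lookup_single when_def ..
      also have "\<dots> = card (Poly_Mapping.keys \<kappa> \<inter> {i. nat (Poly_Mapping.lookup \<kappa> i) - 1 = p})"
        by (simp add: sum.If_cases)
      finally show ?thesis by (simp add: Int_def)
    qed
    then have "(\<Sum>p\<in>{q - 1..<k}. Poly_Mapping.lookup (pmon \<kappa>) p) =
        card (\<Union>p\<in>{q - 1..<k}. {i \<in> Poly_Mapping.keys \<kappa>. nat (Poly_Mapping.lookup \<kappa> i) - 1 = p})"
      by (subst card_UN_disjoint) auto
    also have "(\<Union>p\<in>{q - 1..<k}. {i \<in> Poly_Mapping.keys \<kappa>. nat (Poly_Mapping.lookup \<kappa> i) - 1 = p}) = D \<kappa> q"
    proof (intro Set.set_eqI iffI)
      fix i assume "i \<in> D \<kappa> q"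
      then have i: "i \<in> Poly_Mapping.keys \<kappa>" "int q \<le> Poly_Mapping.lookup \<kappa> i" by (auto simp: D_def)
      have "Poly_Mapping.lookup \<kappa> i \<le> int k" by (rule Par_lenD(2)[OF Par_nparts[OF \<kappa>]])
      then have "nat (Poly_Mapping.lookup \<kappa> i) - 1 \<in> {q - 1..<k}" using i(2) q by auto
      then show "i \<in> (\<Union>p\<in>{q - 1..<k}. {i \<in> Poly_Mapping.keys \<kappa>. nat (Poly_Mapping.lookup \<kappa> i) - 1 = p})" using i(1) by blast
    next
      fix i assume "i \<in> (\<Union>p\<in>{q - 1..<k}. {i \<in> Poly_Mapping.keys \<kappa>. nat (Poly_Mapping.lookup \<kappa> i) - 1 = p})"
      then have "i \<in> Poly_Mapping.keys \<kappa>" "q - 1 \<le> nat (Poly_Mapping.lookup \<kappa> i) - 1" by auto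
      then show "i \<in> D \<kappa> q" using part_pos[OF \<kappa>, of i] q by (auto simp: D_def)
    qed
    finally show ?thesis by simp
  qed
  have down: "j \<in> D \<kappa> q" if \<kappa>: "\<kappa> \<in> Par k" and i: "i \<in> D \<kappa> q" "1 \<le> j" "j \<le> i" "1 \<le> q" for \<kappa> q i j
  proof -
    have "Poly_Mapping.lookup \<kappa> i \<le> Poly_Mapping.lookup \<kappa> j" by (rule Par_lenD(3)[OF Par_nparts[OF \<kappa>] i(2,3)])
    then show ?thesis using i by (auto simp: D_def in_keys_iff)
  qed
  have D1: "1 \<le> i" if "\<kappa> \<in> Par k" "i \<in> D \<kappa> q" for \<kappa> q i
    using that keys_Par(1)[OF Par_nparts[OF that(1)]] by (auto simp: D_def)
  have DD: "D \<mu> q = D \<nu> q" if q: "1 \<le> q" for q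
  proof -
    have c: "card (D \<mu> q) = card (D \<nu> q)" using cd[OF \<mu> q] cd[OF \<nu> q] eq by simp
    have fin: "finite (D \<kappa> q)" for \<kappa> by (simp add: D_def)
    have "D \<mu> q \<subseteq> D \<nu> q \<or> D \<nu> q \<subseteq> D \<mu> q"
    proof (rule ccontr)
      assume "\<not> ?thesis"
      then obtain x y where xy: "x \<in> D \<mu> q" "x \<notin> D \<nu> q" "y \<in> D \<nu> q" "y \<notin> D \<mu> q" by blast
      show False using down[OF \<mu> xy(1), of y] down[OF \<nu> xy(3), of x] D1[OF \<mu> xy(1)] D1[OF \<nu> xy(3)] xy q
        by (meson nat_le_linear)
    qed
    then show ?thesis using card_subset_eq[OF fin _ c] card_subset_eq[OF fin _ c[symmetric]] by blast
  qed
  have le: "Poly_Mapping.lookup \<kappa> i \<le> Poly_Mapping.lookup \<kappa>' i"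
    if \<kappa>: "\<kappa> \<in> Par k" "\<kappa>' \<in> Par k" and e: "\<And>q. 1 \<le> q \<Longrightarrow> D \<kappa> q = D \<kappa>' q" for \<kappa> \<kappa>' i
  proof (cases "i \<in> Poly_Mapping.keys \<kappa>")
    case True
    then have "i \<in> D \<kappa> (nat (Poly_Mapping.lookup \<kappa> i))" "1 \<le> nat (Poly_Mapping.lookup \<kappa> i)"
      using part_pos[OF \<kappa>(1) True] by (auto simp: D_def)
    then have "i \<in> D \<kappa>' (nat (Poly_Mapping.lookup \<kappa> i))" using e by blast
    then show ?thesis using part_pos[OF \<kappa>(1) True] by (auto simp: D_def)
  next
    case False
    then show ?thesis using Par_lenD(1)[OF Par_nparts[OF \<kappa>(2)], of i] by (simp add: in_keys_iff)
  qed
  show ?thesis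
  proof (rule poly_mapping_eqI)
    fix i
    show "Poly_Mapping.lookup \<mu> i = Poly_Mapping.lookup \<nu> i"
      using le[OF \<mu> \<nu> DD, of i] le[OF \<nu> \<mu> DD[symmetric], of i] by simp
  qed
qed

text \<open>Choose \<mu> of maximal weight in the support. Its leading monomial has coefficient 0 in
  all the other Katalan functions that occur: it is too heavy for their lower terms, and
  \<open>pmon_inj\<close> separates it from their leading monomials.\<close>

lemma kS_independent:
  assumes k: "1 \<le> k" and c: "Poly_Mapping.keys c \<subseteq> Par k" "lin (kS k) c = 0"
  shows "c = 0"
proof (rule ccontr)
  assume "c \<noteq> 0"
  then have ne: "Poly_Mapping.keys c \<noteq> {}" by simp
  let ?X = "(\<lambda>\<nu>. mwt k (pmon \<nu>)) ` Poly_Mapping.keys c"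
  have "Max ?X \<in> ?X" using ne by (intro Max_in) auto
  then obtain \<mu> where \<mu>: "\<mu> \<in> Poly_Mapping.keys c" "mwt k (pmon \<mu>) = Max ?X" by auto
  have mx: "mwt k (pmon \<nu>) \<le> mwt k (pmon \<mu>)" if "\<nu> \<in> Poly_Mapping.keys c" for \<nu>
    unfolding \<mu>(2) using that by (intro Max_ge) auto
  have co: "Poly_Mapping.lookup (kS k \<nu>) (pmon \<mu>) = (if \<nu> = \<mu> then 1 else 0)" if \<nu>: "\<nu> \<in> Poly_Mapping.keys c" for \<nu>
  proof -
    have P: "\<nu> \<in> Par k" "\<mu> \<in> Par k" using \<nu> \<mu>(1) c(1) by auto
    have "\<not> mwt k (pmon \<mu>) \<le> mwt k (pmon \<nu>) - 1" using mx[OF \<nu>] by simp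
    then have "pmon \<mu> \<notin> Poly_Mapping.keys (kS k \<nu> - Poly_Mapping.single (pmon \<nu>) 1)"
      using kS_leading[OF k P(1)] unfolding Fw_def by blast
    then have "Poly_Mapping.lookup (kS k \<nu>) (pmon \<mu>) = Poly_Mapping.lookup (Poly_Mapping.single (pmon \<nu>) (1::int)) (pmon \<mu>)"
      by (simp add: in_keys_iff lookup_minus)
    then show ?thesis using pmon_inj[OF P] by (auto simp: lookup_single when_def)
  qed
  have sc: "Poly_Mapping.lookup (of_int n * f) m = n * Poly_Mapping.lookup f m" for n and f :: symf and m
  proof (induction f rule: pm_induct)
    case (single a d)
    show ?case by (simp add: mult_single lookup_single when_def flip: single_of_int)
  qed (simp_all add: distrib_left lookup_add)
  have "Poly_Mapping.lookup (lin (kS k) c) (pmon \<mu>) =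
      (\<Sum>\<nu>\<in>Poly_Mapping.keys c. Poly_Mapping.lookup c \<nu> * Poly_Mapping.lookup (kS k \<nu>) (pmon \<mu>))"
    by (simp add: lin_def lookup_sum sc)
  also have "\<dots> = (\<Sum>\<nu>\<in>Poly_Mapping.keys c. if \<nu> = \<mu> then Poly_Mapping.lookup c \<nu> else 0)"
    by (rule sum.cong) (auto simp: co)
  also have "\<dots> = Poly_Mapping.lookup c \<mu>" using \<mu>(1) by simp
  finally show False using c(2) \<mu>(1) by (simp add: in_keys_iff)
qed

section \<open>Bases and the characterisation by the Pieri rule\<close>

text \<open>The right-hand side of the Pieri rule as a formal combination, so that the same
  coefficients can be evaluated in any family.\<close>

definition pvec :: "nat \<Rightarrow> nat \<Rightarrow> zvec \<Rightarrow> (zvec \<Rightarrow>\<^sub>0 int)" where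
  "pvec k r \<mu> = (\<Sum>A | A \<subseteq> {..k} \<and> card A = r. case demw (k + 1) (cyc_word k A) (hp k \<mu>) of None \<Rightarrow> 0
     | Some H \<Rightarrow> Poly_Mapping.single (inv_into (Par k) (hp k) H)
         ((- 1) ^ (psz \<mu> + length (cyc_word k A) - psz (inv_into (Par k) (hp k) H))))"

lemma lin_pvec: "lin G (pvec k r \<mu>) = (\<Sum>A | A \<subseteq> {..k} \<and> card A = r. pterm k G \<mu> (cyc_word k A))"
  unfolding pvec_def lin_sum pterm_def by (rule sum.cong) (auto simp: lin_single split: option.split)

lemma keys_pvec:
  assumes k: "1 \<le> k" and \<mu>: "\<mu> \<in> Par k" shows "Poly_Mapping.keys (pvec k r \<mu>) \<subseteq> Par k"
  unfolding pvec_def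
proof (rule order_trans[OF keys_sum], intro UN_least)
  fix A
  show "Poly_Mapping.keys (case demw (k + 1) (cyc_word k A) (hp k \<mu>) of None \<Rightarrow> 0
     | Some H \<Rightarrow> Poly_Mapping.single (inv_into (Par k) (hp k) H)
         ((- 1) ^ (psz \<mu> + length (cyc_word k A) - psz (inv_into (Par k) (hp k) H)))) \<subseteq> Par k"
  proof (cases "demw (k + 1) (cyc_word k A) (hp k \<mu>)")
    case (Some H)
    obtain \<nu> where "\<nu> \<in> Par k" "H = hp k \<nu>" using demw_Par[OF k \<mu> Some] by blast
    then have "inv_into (Par k) (hp k) H \<in> Par k" by (simp add: inv_into_into)
    then show ?thesis using Some by (simp split: if_splits)
  qed simp
qed

lemma lin_scale: "lin G (of_int n * p) = of_int n * lin G (p :: 'a::monoid_add \<Rightarrow>\<^sub>0 int)"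
proof (induction p rule: pm_induct)
  case (single a d)
  show ?case by (simp add: mult_single lin_single mult.assoc flip: single_of_int)
qed (simp_all add: distrib_left lin_add)

lemma kS_0: assumes k: "1 \<le> k" shows "kS k 0 = 1"
proof -
  have "kS k 0 = kap {} (cc (bb k 0)) (prod nrt (NR 0 (bb k 0)) * ZM (k + 1) 0 (bb k 0) * 1)"
    using GG_kS[OF k, of 0 0] by (simp add: GG_def Par_len_def zvecs_def)
  also have "NR 0 (bb k 0) = {}" by (auto simp: NR_def)
  finally show ?thesis by (simp add: ZM_def kap_def lin_1)
qed

text \<open>Both families start at 1 and obey the same rule, so one and the same coefficient vector
  expresses \<open>f\<close> in both. For \<open>G = kS k\<close> this is the spanning property; for
  general \<open>G\<close> it compares the two families.\<close>

lemma pieri_span: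
  assumes k: "1 \<le> k" and G0: "G 0 = 1"
    and G: "\<And>r \<mu>. 1 \<le> r \<Longrightarrow> r \<le> k \<Longrightarrow> \<mu> \<in> Par k \<Longrightarrow> g_fun r (ones r) * G \<mu> = lin G (pvec k r \<mu>)"
  shows "Lambda_sub k \<subseteq> {f. \<exists>c. Poly_Mapping.keys c \<subseteq> Par k \<and> f = lin (kS k) c \<and> f = lin G c}" (is "_ \<subseteq> ?S")
proof (rule g_ones_generate)
  show "1 \<in> ?S"
    by (intro CollectI exI[of _ "Poly_Mapping.single 0 1"]) (auto simp: lin_single lin_1 kS_0[OF k] G0 zero_Par)
next
  fix x y assume "x \<in> ?S" "y \<in> ?S"
  then obtain c d where "Poly_Mapping.keys c \<subseteq> Par k" "x = lin (kS k) c" "x = lin G c"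
    "Poly_Mapping.keys d \<subseteq> Par k" "y = lin (kS k) d" "y = lin G d" by blast
  then show "x - y \<in> ?S"
    using keys_diff[of c d] by (intro CollectI exI[of _ "c - d"]) (auto simp: lin_diff)
next
  fix r x assume r: "1 \<le> r" "r \<le> k" and "x \<in> ?S"
  then obtain c where c: "Poly_Mapping.keys c \<subseteq> Par k" "x = lin (kS k) c" "x = lin G c" by blast
  define d where "d = lin (pvec k r) c"
  have act: "lin G' d = g_fun r (ones r) * lin G' c"
    if G': "\<And>\<mu>. \<mu> \<in> Par k \<Longrightarrow> g_fun r (ones r) * G' \<mu> = lin G' (pvec k r \<mu>)" for G'
  proof -
    have "lin G' d = (\<Sum>\<mu>\<in>Poly_Mapping.keys c. of_int (Poly_Mapping.lookup c \<mu>) * lin G' (pvec k r \<mu>))"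
      unfolding d_def lin_def[of "pvec k r"] lin_sum lin_scale ..
    also have "\<dots> = (\<Sum>\<mu>\<in>Poly_Mapping.keys c. g_fun r (ones r) * (of_int (Poly_Mapping.lookup c \<mu>) * G' \<mu>))"
    proof (rule sum.cong[OF refl])
      fix \<mu> assume "\<mu> \<in> Poly_Mapping.keys c"
      then have "lin G' (pvec k r \<mu>) = g_fun r (ones r) * G' \<mu>" using G' c(1) by auto
      then show "of_int (Poly_Mapping.lookup c \<mu>) * lin G' (pvec k r \<mu>) =
          g_fun r (ones r) * (of_int (Poly_Mapping.lookup c \<mu>) * G' \<mu>)" by (simp only: mult.left_commute)
    qed
    finally show ?thesis by (simp add: lin_def sum_distrib_left)
  qed
  have "Poly_Mapping.keys d \<subseteq> Par k"
    unfolding d_def lin_def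
  proof (rule order_trans[OF keys_sum], intro UN_least)
    fix \<mu> assume "\<mu> \<in> Poly_Mapping.keys c"
    then have "Poly_Mapping.keys (pvec k r \<mu>) \<subseteq> Par k" using c(1) by (intro keys_pvec[OF k]) auto
    moreover have "Poly_Mapping.keys (of_int n * p) \<subseteq> Poly_Mapping.keys p" for n and p :: "zvec \<Rightarrow>\<^sub>0 int"
      using Poly_Mapping.keys_mult[of "of_int n" p] by (auto split: if_splits simp flip: single_of_int)
    ultimately show "Poly_Mapping.keys (of_int (Poly_Mapping.lookup c \<mu>) * pvec k r \<mu>) \<subseteq> Par k" by blast
  qed
  moreover have "g_fun r (ones r) * x = lin (kS k) d"
    unfolding c(2) by (rule act[symmetric]) (simp add: kS_pieri[OF k r(2)] lin_pvec)
  moreover have "g_fun r (ones r) * x = lin G d"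
    unfolding c(3) by (rule act[symmetric]) (rule G[OF r])
  ultimately show "g_fun r (ones r) * x \<in> ?S" by blast
qed

lemma kS_span:
  assumes k: "1 \<le> k" and f: "f \<in> Lambda_sub k"
  obtains c where "Poly_Mapping.keys c \<subseteq> Par k" "f = lin (kS k) c"
proof -
  have "Lambda_sub k \<subseteq> {f. \<exists>c. Poly_Mapping.keys c \<subseteq> Par k \<and> f = lin (kS k) c \<and> f = lin (kS k) c}"
  proof (rule pieri_span[OF k])
    show "kS k 0 = 1" by (rule kS_0[OF k])
    fix r \<mu> assume "r \<le> k" "\<mu> \<in> Par k"
    then show "g_fun r (ones r) * kS k \<mu> = lin (kS k) (pvec k r \<mu>)" unfolding lin_pvec by (rule kS_pieri[OF k])
  qed
  then show ?thesis using f that by blast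
qed

lemma K_k_Schur_family_iff:
  assumes k: "1 \<le> k"
  shows "K_k_Schur_family k G \<longleftrightarrow> G \<in> Par k \<rightarrow>\<^sub>E Lambda_sub k \<and> G 0 = 1 \<and>
    (\<forall>r\<in>{1..k}. \<forall>\<mu>\<in>Par k. g_fun r (ones r) * G \<mu> = lin G (pvec k r \<mu>))"
  unfolding K_k_Schur_family_def lin_pvec using pieri_sum[OF k, where G = G] by auto

lemma kS_family:
  assumes k: "1 \<le> k" shows "K_k_Schur_family k (\<lambda>\<mu>\<in>Par k. kS k \<mu>)"
  unfolding K_k_Schur_family_iff[OF k] lin_pvec
proof (intro conjI ballI)
  show "(\<lambda>\<mu>\<in>Par k. kS k \<mu>) \<in> Par k \<rightarrow>\<^sub>E Lambda_sub k" using kS_Lambda_sub[OF k] by auto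
  show "(\<lambda>\<mu>\<in>Par k. kS k \<mu>) 0 = 1" using kS_0[OF k] zero_Par by simp
  fix r \<mu> assume r: "r \<in> {1..k}" and \<mu>: "\<mu> \<in> Par k"
  have "g_fun r (ones r) * (\<lambda>\<mu>\<in>Par k. kS k \<mu>) \<mu> = (\<Sum>A | A \<subseteq> {..k} \<and> card A = r. pterm k (kS k) \<mu> (cyc_word k A))"
    using kS_pieri[OF k _ \<mu>, of r] r \<mu> by simp
  also have "\<dots> = (\<Sum>A | A \<subseteq> {..k} \<and> card A = r. pterm k (\<lambda>\<mu>\<in>Par k. kS k \<mu>) \<mu> (cyc_word k A))"
    by (intro sum.cong[OF refl] pterm_cong[OF k \<mu>]) simp
  finally show "g_fun r (ones r) * (\<lambda>\<mu>\<in>Par k. kS k \<mu>) \<mu> =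
    (\<Sum>A | A \<subseteq> {..k} \<and> card A = r. pterm k (\<lambda>\<mu>\<in>Par k. kS k \<mu>) \<mu> (cyc_word k A))" .
qed

lemma kS_coeff_unique:
  assumes k: "1 \<le> k" and c: "Poly_Mapping.keys c \<subseteq> Par k" "Poly_Mapping.keys d \<subseteq> Par k" "lin (kS k) c = lin (kS k) d"
  shows "c = d"
proof -
  have "c - d = 0"
    using keys_diff[of c d] c by (intro kS_independent[OF k]) (auto simp: lin_diff)
  then show ?thesis by simp
qed

lemma K_k_Schur_eq:
  assumes k: "1 \<le> k" shows "K_k_Schur k = (\<lambda>\<mu>\<in>Par k. kS k \<mu>)"
  unfolding K_k_Schur_def
proof (rule the_equality)
  show "K_k_Schur_family k (\<lambda>\<mu>\<in>Par k. kS k \<mu>)" by (rule kS_family[OF k])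
  fix G assume "K_k_Schur_family k G"
  then have G: "G \<in> Par k \<rightarrow>\<^sub>E Lambda_sub k" "G 0 = 1"
    "\<And>r \<mu>. 1 \<le> r \<Longrightarrow> r \<le> k \<Longrightarrow> \<mu> \<in> Par k \<Longrightarrow> g_fun r (ones r) * G \<mu> = lin G (pvec k r \<mu>)"
    unfolding K_k_Schur_family_iff[OF k] by auto
  have "G \<mu> = kS k \<mu>" if \<mu>: "\<mu> \<in> Par k" for \<mu>
  proof -
    obtain c where c: "Poly_Mapping.keys c \<subseteq> Par k" "kS k \<mu> = lin (kS k) c" "kS k \<mu> = lin G c"
      using pieri_span[OF k G(2,3)] kS_Lambda_sub[OF k \<mu>] by blast
    \<comment> \<open>Independence leaves only the trivial expansion of \<open>kS k \<mu>\<close>;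
      the same coefficients evaluated in \<open>G\<close> give \<open>G \<mu>\<close>.\<close>
    have "c = Poly_Mapping.single \<mu> 1"
      by (rule kS_coeff_unique[OF k c(1)]) (use \<mu> c(2) in \<open>auto simp: lin_single\<close>)
    then show ?thesis using c(3) by (simp add: lin_single)
  qed
  moreover have "G \<mu> = undefined" if "\<mu> \<notin> Par k" for \<mu> using G(1) that by (rule PiE_arb)
  ultimately show "G = (\<lambda>\<mu>\<in>Par k. kS k \<mu>)" by (auto simp: fun_eq_iff restrict_def)
qed

theorem theorem2p6:
  fixes k :: nat
  assumes "1 \<le> k"
  shows "(\<forall>l. \<forall>\<mu> \<in> Par_len k l. kSchur_Katalan k l \<mu> = K_k_Schur k \<mu>) \<and>
    K_k_Schur_family k (\<lambda>\<mu> \<in> Par k. kSchur_Katalan k (nparts \<mu>) \<mu>) \<and>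
    Z_basis (Par k) (\<lambda>\<mu>. kSchur_Katalan k (nparts \<mu>) \<mu>) (Lambda_sub k)"
proof (intro conjI allI ballI)
  fix l \<mu> assume \<mu>: "\<mu> \<in> Par_len k l"
  show "kSchur_Katalan k l \<mu> = K_k_Schur k \<mu>"
    using kSchur_stable[OF assms \<mu>] Par_lenI[OF \<mu>] unfolding K_k_Schur_eq[OF assms] kS_def by simp
next
  show "K_k_Schur_family k (\<lambda>\<mu> \<in> Par k. kSchur_Katalan k (nparts \<mu>) \<mu>)"
    using kS_family[OF assms] unfolding kS_def .
next
  have "\<exists>!c. Poly_Mapping.keys c \<subseteq> Par k \<and> f = lin (kS k) c" if f: "f \<in> Lambda_sub k" for f
  proof -
    obtain c where "Poly_Mapping.keys c \<subseteq> Par k" "f = lin (kS k) c" by (rule kS_span[OF assms f])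
    then show ?thesis using kS_coeff_unique[OF assms] by metis
  qed
  then show "Z_basis (Par k) (\<lambda>\<mu>. kSchur_Katalan k (nparts \<mu>) \<mu>) (Lambda_sub k)"
    unfolding Z_basis_def lin_def kS_def using kS_Lambda_sub[OF assms, unfolded kS_def] by blast
qed

end
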